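(* Let $H\in(0,1)$ and $T>0$. The linear transformation $U:\mathcal{K}_T\to\mathcal{L}_T$ determined by $Ux_t=e_t$ for $t\in[0,T]$ is a Hilbert space isometry (of $\mathcal{K}_T$ onto $\mathcal{L}_T$). For every $f\in\mathcal{K}_T$ it holds that $$Uf(\lambda)=\int_0^T f(u)\varphi(u\lambda)\,dV_u$$ for $\mu$-almost all $\lambda\in\mathbb{R}$. The class of functions $$\mathcal{L}_T'=\Big\{\psi\in\mathcal{L}_T:\int_{\mathbb{R}}\|\varphi(\cdot\,\lambda)\|_V\,|\psi(\lambda)|\,\mu(d\lambda)<\infty\Big\}$$ is dense in $\mathcal{L}_T$, and for every $\psi\in\mathcal{L}_T'$ we have $$U^*\psi(u)=U^{-1}\psi(u)=\int_{\mathbb{R}}\psi(\lambda)\overline{\varphi(u\lambda)}\,\mu(d\lambda)$$ for $V$-almost every $u\in[0,T]$, where $U^*$ denotes the adjoint of $U$.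
   Context: $\Gamma$ is Euler's gamma function and $J_\nu$ the Bessel function of the first kind of order $\nu$. Spectral measure: $\mu(d\lambda)=(2\pi)^{-1}\sin(\pi H)\Gamma(1+2H)|\lambda|^{1-2H}\,d\lambda$ on $\mathbb{R}$; $\langle f,g\rangle_\mu=\int_{\mathbb{R}} f\overline{g}\,d\mu$. For $t\ge 0$, $e_t(\lambda)=(e^{i\lambda t}-1)/(i\lambda)$ (with $e_t(0)=t$). $\mathcal{L}_T$ is the closure in $L^2(\mu)$ of the complex linear span of $\{e_t:t\in[0,T]\}$. Variance function: $V_t=d_H^2\,t^{2-2H}$ with $d_H^2=\dfrac{\Gamma(3/2-H)}{2H\,\Gamma(H+1/2)\,\Gamma(3-2H)}$; $L^2([0,T],V)$ is the complex $L^2$-space on $[0,T]$ with respect to the measure $dV_u$, with inner product $\langle f,g\rangle_V=\int_0^T f\overline{g}\,dV$ and norm $\|\cdot\|_V$; $\|\varphi(\cdot\,\lambda)\|_V$ is the norm of $u\mapsto\varphi(u\lambda)$. For $t\in[0,T]$ and $u>0$, $$x_t(u)=2H\Big(t^{H-1/2}(t-u)^{H-1/2}-\int_u^t (v-u)^{H-1/2}\,d(v^{H-1/2})\Big)\mathbb{1}_{(0,t)}(u),$$ where $d(v^{H-1/2})=(H-\tfrac12)v^{H-3/2}\,dv$. $\mathcal{K}_T$ is the closure in $L^2([0,T],V)$ of the complex linear span of $\{x_t:t\in[0,T]\}$; in fact $\mathcal{K}_T=L^2([0,T],V)$. One has $\langle x_s,x_t\rangle_V=\langle e_s,e_t\rangle_\mu=\tfrac12(s^{2H}+t^{2H}-|s-t|^{2H})$,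 the covariance function of the fractional Brownian motion with Hurst index $H$. The map $U$ is the composition of the isometries $\mathcal{K}_T\to\mathcal{H}_T\to\mathcal{L}_T$, $x_t\mapsto X_t\mapsto e_t$, where $\mathcal{H}_T$ is the closed linear span in $L^2(\mathbb{P})$ of the fractional Brownian motion $(X_t)_{t\in[0,T]}$. Equivalently, $U$ is the isometry determined by $U\mathbb{1}_{(0,t)}=\hat m_t$ for $t\in[0,T]$, where $\hat m_t(\lambda)=\int_0^t m_t(u)e^{i\lambda u}\,du$ and $m_t(u)=\dfrac{u^{1/2-H}(t-u)^{1/2-H}}{2H\,\Gamma(H+1/2)\Gamma(3/2-H)}\mathbb{1}_{(0,t)}(u)$. The function $\varphi:\mathbb{R}\to\mathbb{C}$ is $$\varphi(z)=\Gamma(1-H)\Big(\frac z4\Big)^H e^{iz/2}\Big(J_{-H}\Big(\frac z2\Big)+iJ_{1-H}\Big(\frac z2\Big)\Big)\ (z\ne0),\qquad \varphi(0)=1.$$ Here $z^{-\nu}J_\nu(z)$ is always understood as the entire even function $\sum_{k\ge0}\frac{(-1)^k 2^{-\nu}(z/2)^{2k}}{k!\,\Gamma(k+\nu+1)}$, so $z^HJ_{-H}(z)$ and $z^HJ_{1-H}(z)=z\cdot z^{-(1-H)}J_{1-H}(z)$ are entire and $\varphi$ is entire. *)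

theory Defs
  imports "HOL-Analysis.Analysis"
begin

section \<open>Complex $L^2$-spaces\<close>

text \<open>
  Elements of \<open>L\<^sup>2(M)\<close> are represented by square-integrable functions; two representatives are the
  same element iff they agree \<open>M\<close>-almost everywhere. All notions below respect this identification.
\<close>

definition L2_space :: "'a measure \<Rightarrow> ('a \<Rightarrow> complex) set" where
  "L2_space M = {f \<in> borel_measurable M. integrable M (\<lambda>x. (cmod (f x))\<^sup>2)}"

definition L2_inner :: "'a measure \<Rightarrow> ('a \<Rightarrow> complex) \<Rightarrow> ('a \<Rightarrow> complex) \<Rightarrow> complex" where
  "L2_inner M f g = (\<integral>x. f x * cnj (g x) \<partial>M)"

definition L2_norm :: "'a measure \<Rightarrow> ('a \<Rightarrow> complex) \<Rightarrow> real" where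
  "L2_norm M f = sqrt (\<integral>x. (cmod (f x))\<^sup>2 \<partial>M)"

definition complex_span :: "('a \<Rightarrow> complex) set \<Rightarrow> ('a \<Rightarrow> complex) set" where
  "complex_span S = {\<lambda>x. \<Sum>g\<in>A. c g * g x | A c. finite A \<and> A \<subseteq> S}"

definition L2_closure :: "'a measure \<Rightarrow> ('a \<Rightarrow> complex) set \<Rightarrow> ('a \<Rightarrow> complex) set" where
  "L2_closure M S =
    {f \<in> L2_space M. \<forall>\<epsilon>>0. \<exists>g \<in> S \<inter> L2_space M. L2_norm M (\<lambda>x. f x - g x) < \<epsilon>}"

text \<open>
  Operators between subspaces \<open>K\<close> of \<open>L\<^sup>2(M)\<close> and \<open>L\<close> of \<open>L\<^sup>2(N)\<close> act on representatives. The second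
  clause makes them well defined on equivalence classes.
\<close>

definition L2_bounded_linear ::
  "'a measure \<Rightarrow> ('a \<Rightarrow> complex) set \<Rightarrow> 'b measure \<Rightarrow> ('b \<Rightarrow> complex) set \<Rightarrow>
    (('a \<Rightarrow> complex) \<Rightarrow> ('b \<Rightarrow> complex)) \<Rightarrow> bool" where
  "L2_bounded_linear M K N L U \<longleftrightarrow>
    (\<forall>f\<in>K. U f \<in> L) \<and>
    (\<forall>f\<in>K. \<forall>g\<in>K. (AE x in M. f x = g x) \<longrightarrow> (AE y in N. U f y = U g y)) \<and>
    (\<forall>f\<in>K. \<forall>g\<in>K. \<forall>a b. AE y in N. U (\<lambda>x. a * f x + b * g x) y = a * U f y + b * U g y) \<and>
    (\<exists>C. \<forall>f\<in>K. L2_norm N (U f) \<le> C * L2_norm M f)"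

definition L2_isometry_onto ::
  "'a measure \<Rightarrow> ('a \<Rightarrow> complex) set \<Rightarrow> 'b measure \<Rightarrow> ('b \<Rightarrow> complex) set \<Rightarrow>
    (('a \<Rightarrow> complex) \<Rightarrow> ('b \<Rightarrow> complex)) \<Rightarrow> bool" where
  "L2_isometry_onto M K N L U \<longleftrightarrow>
    L2_bounded_linear M K N L U \<and>
    (\<forall>f\<in>K. \<forall>g\<in>K. L2_inner N (U f) (U g) = L2_inner M f g) \<and>
    (\<forall>\<psi>\<in>L. \<exists>f\<in>K. AE y in N. U f y = \<psi> y)"

definition L2_adjoint ::
  "'a measure \<Rightarrow> ('a \<Rightarrow> complex) set \<Rightarrow> 'b measure \<Rightarrow> ('b \<Rightarrow> complex) set \<Rightarrow>
    (('a \<Rightarrow> complex) \<Rightarrow> ('b \<Rightarrow> complex)) \<Rightarrow> (('b \<Rightarrow> complex) \<Rightarrow> ('a \<Rightarrow> complex)) \<Rightarrow> bool" where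
  "L2_adjoint M K N L U W \<longleftrightarrow>
    (\<forall>\<psi>\<in>L. W \<psi> \<in> K) \<and>
    (\<forall>f\<in>K. \<forall>\<psi>\<in>L. L2_inner N (U f) \<psi> = L2_inner M f (W \<psi>))"

definition L2_inverse ::
  "'a measure \<Rightarrow> ('a \<Rightarrow> complex) set \<Rightarrow> 'b measure \<Rightarrow> ('b \<Rightarrow> complex) set \<Rightarrow>
    (('a \<Rightarrow> complex) \<Rightarrow> ('b \<Rightarrow> complex)) \<Rightarrow> (('b \<Rightarrow> complex) \<Rightarrow> ('a \<Rightarrow> complex)) \<Rightarrow> bool" where
  "L2_inverse M K N L U W \<longleftrightarrow>
    (\<forall>\<psi>\<in>L. W \<psi> \<in> K) \<and>
    (\<forall>f\<in>K. AE x in M. W (U f) x = f x) \<and>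
    (\<forall>\<psi>\<in>L. AE y in N. U (W \<psi>) y = \<psi> y)"

section \<open>The spectral side\<close>

definition spectral_measure :: "real \<Rightarrow> real measure" where
  "spectral_measure H = density lborel
    (\<lambda>l. ennreal (sin (pi * H) * Gamma (1 + 2 * H) / (2 * pi) * \<bar>l\<bar> powr (1 - 2 * H)))"

definition e_fun :: "real \<Rightarrow> real \<Rightarrow> complex" where
  "e_fun t l = (if l = 0 then of_real t
     else (exp (\<i> * of_real l * of_real t) - 1) / (\<i> * of_real l))"

definition L_space :: "real \<Rightarrow> real \<Rightarrow> (real \<Rightarrow> complex) set" where
  "L_space H T = L2_closure (spectral_measure H) (complex_span (e_fun ` {0..T}))"

section \<open>The time side\<close>

definition d_sq :: "real \<Rightarrow> real" where
  "d_sq H = Gamma (3/2 - H) / (2 * H * Gamma (H + 1/2) * Gamma (3 - 2 * H))"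

text \<open>The variance function is extended by \<open>0\<close> to the negative half-line.\<close>

definition V_fun :: "real \<Rightarrow> real \<Rightarrow> real" where
  "V_fun H t = (if t \<le> 0 then 0 else d_sq H * t powr (2 - 2 * H))"

definition V_measure :: "real \<Rightarrow> real \<Rightarrow> real measure" where
  "V_measure H T = restrict_space (interval_measure (V_fun H)) {0..T}"

definition x_fun :: "real \<Rightarrow> real \<Rightarrow> real \<Rightarrow> complex" where
  "x_fun H t u = (if 0 < u \<and> u < t
     then of_real (2 * H * (t powr (H - 1/2) * (t - u) powr (H - 1/2)
       - (LINT v:{u..t}|lborel. (v - u) powr (H - 1/2) * ((H - 1/2) * v powr (H - 3/2)))))
     else 0)"

definition K_space :: "real \<Rightarrow> real \<Rightarrow> (real \<Rightarrow> complex) set" where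
  "K_space H T = L2_closure (V_measure H T) (complex_span (x_fun H ` {0..T}))"

section \<open>The kernel\<close>

definition bessel_J :: "real \<Rightarrow> complex \<Rightarrow> complex" where
  "bessel_J \<nu> z = (z / 2) powr of_real \<nu> *
     (\<Sum>k. (-1) ^ k / (fact k * of_real (Gamma (of_nat k + \<nu> + 1))) * (z / 2) ^ (2 * k))"

text \<open>
  All powers below are principal. The branches cancel, also for negative \<open>z\<close>, so that the kernel is
  the restriction to the real line of an entire function; see \<open>phi_entire_form\<close>.
\<close>

definition phi :: "real \<Rightarrow> real \<Rightarrow> complex" where
  "phi H z = (if z = 0 then 1 else
     of_real (Gamma (1 - H)) * (of_real z / 4) powr of_real H * exp (\<i> * of_real z / 2) *
       (bessel_J (- H) (of_real z / 2) + \<i> * bessel_J (1 - H) (of_real z / 2)))"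

text \<open>The entire even function \<open>z\<^bsup>-\<nu>\<^esup> J\<^bsub>\<nu>\<^esub>(z)\<close>.\<close>

definition bessel_red :: "real \<Rightarrow> complex \<Rightarrow> complex" where
  "bessel_red \<nu> z = of_real (2 powr (- \<nu>)) *
     (\<Sum>k. (-1) ^ k / (fact k * of_real (Gamma (of_nat k + \<nu> + 1))) * (z / 2) ^ (2 * k))"

lemma bessel_J_eq_bessel_red: "bessel_J \<nu> z = z powr of_real \<nu> * bessel_red \<nu> z"
proof -
  have "(z / 2) powr of_real \<nu> = (of_real (1/2) * z) powr of_real \<nu>" by simp
  also have "\<dots> = of_real (1/2) powr of_real \<nu> * z powr of_real \<nu>"
    by (rule powr_times_real_left) auto
  also have "of_real (1/2) powr of_real \<nu> = complex_of_real ((1/2) powr \<nu>)"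
    by (rule powr_of_real) auto
  also have "(1/2::real) powr \<nu> = 2 powr (-\<nu>)"
    by (simp add: powr_minus powr_divide inverse_eq_divide)
  finally show ?thesis
    unfolding bessel_J_def bessel_red_def by (simp add: mult_ac)
qed

lemma phi_entire_form:
  assumes "0 < H" "H < 1"
  shows "phi H z = of_real (Gamma (1 - H)) * of_real (2 powr (- H)) * exp (\<i> * of_real z / 2) *
    (bessel_red (- H) (of_real z / 2) + \<i> * (of_real z / 2) * bessel_red (1 - H) (of_real z / 2))"
proof (cases "z = 0")
  case True
  have "(\<Sum>k. (-1) ^ k / (fact k * complex_of_real (Gamma (of_nat k + (- H) + 1))) * 0 ^ (2 * k))
      = (\<Sum>k\<in>{0}. (-1) ^ k / (fact k * complex_of_real (Gamma (of_nat k + (- H) + 1))) * 0 ^ (2 * k))"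
    by (rule suminf_finite) auto
  then have "bessel_red (- H) 0 = of_real (2 powr H) / of_real (Gamma (1 - H))"
    unfolding bessel_red_def by simp
  moreover have "Gamma (1 - H) > 0"
    by (rule Gamma_real_pos) (use assms in simp)
  moreover have "(2::real) powr (- H) * 2 powr H = 1"
    by (simp flip: powr_add)
  then have "complex_of_real (2 powr (- H)) * complex_of_real (2 powr H) = 1"
    by (metis of_real_1 of_real_mult)
  ultimately show ?thesis
    using True by (simp add: phi_def)
next
  case False
  define w where "w = complex_of_real z / 2"
  have w: "w \<noteq> 0" using False by (simp add: w_def)
  have "(complex_of_real z / 4) powr of_real H = (of_real (1/2) * w) powr of_real H"
    by (simp add: w_def)
  also have "\<dots> = of_real (1/2) powr of_real H * w powr of_real H"
    by (rule powr_times_real_left) auto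
  also have "of_real (1/2) powr of_real H = complex_of_real ((1/2) powr H)"
    by (rule powr_of_real) auto
  also have "(1/2::real) powr H = 2 powr (-H)"
    by (simp add: powr_minus powr_divide inverse_eq_divide)
  finally have p: "(complex_of_real z / 4) powr of_real H = of_real (2 powr (-H)) * w powr of_real H" .
  have c1: "w powr of_real H * w powr of_real (- H) = 1"
    using w by (simp flip: powr_add)
  have c2: "w powr of_real H * w powr of_real (1 - H) = w"
    using w by (simp flip: powr_add)
  have "w powr of_real H * (bessel_J (- H) w + \<i> * bessel_J (1 - H) w) =
      (w powr of_real H * w powr of_real (- H)) * bessel_red (- H) w +
      \<i> * (w powr of_real H * w powr of_real (1 - H)) * bessel_red (1 - H) w"
    unfolding bessel_J_eq_bessel_red by (simp add: algebra_simps)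
  also have "\<dots> = bessel_red (- H) w + \<i> * w * bessel_red (1 - H) w"
    by (simp only: c1 c2) simp
  finally have q: "w powr of_real H * (bessel_J (- H) w + \<i> * bessel_J (1 - H) w) =
      bessel_red (- H) w + \<i> * w * bessel_red (1 - H) w" .
  have "phi H z = of_real (Gamma (1 - H)) * of_real (2 powr (- H)) * exp (\<i> * of_real z / 2) *
      (w powr of_real H * (bessel_J (- H) w + \<i> * bessel_J (1 - H) w))"
    unfolding phi_def p using False by (simp add: w_def mult_ac)
  then show ?thesis unfolding q by (simp add: w_def)
qed

section \<open>The transformation $U$\<close>

text \<open>
  \<open>U\<close> is the bounded linear operator with \<open>U x\<^sub>t = e\<^sub>t\<close>. Boundedness is what makes it determined by
  its values on the \<open>x\<^sub>t\<close>, whose linear span is only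
  dense in \<open>K_space H T\<close>.
\<close>

definition is_U :: "real \<Rightarrow> real \<Rightarrow> ((real \<Rightarrow> complex) \<Rightarrow> (real \<Rightarrow> complex)) \<Rightarrow> bool" where
  "is_U H T U \<longleftrightarrow>
    L2_bounded_linear (V_measure H T) (K_space H T) (spectral_measure H) (L_space H T) U \<and>
    (\<forall>t\<in>{0..T}. AE l in spectral_measure H. U (x_fun H t) l = e_fun t l)"

definition L'_space :: "real \<Rightarrow> real \<Rightarrow> (real \<Rightarrow> complex) set" where
  "L'_space H T = {\<psi> \<in> L_space H T.
     (\<integral>\<^sup>+l. ennreal (L2_norm (V_measure H T) (\<lambda>u. phi H (u * l)) * cmod (\<psi> l))
        \<partial>spectral_measure H) < \<infinity>}"

end

theory Submission
  imports Defs
begin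

text \<open>
  The candidate \<open>\<Phi> f \<lambda> = \<integral> f(u) \<phi>(u \<lambda>) dV\<^sub>u\<close> maps \<open>x\<^sub>t\<close> to \<open>e\<^sub>t\<close>: the power moments of \<open>x\<^sub>t dV\<close> are
  Beta integrals, and they match the coefficients of \<open>\<phi>\<close> against those of \<open>e\<^sub>t\<close>. The Gram matrices of
  \<open>x\<^sub>t\<close> and \<open>e\<^sub>t\<close> are both the covariance of fractional Brownian motion, so \<open>\<Phi>\<close> is isometric on the span
  of the \<open>x\<^sub>t\<close>. Since \<open>\<phi>(\<sqdot> \<lambda>)\<close> lies in \<open>L\<^sup>2(V)\<close>, \<open>\<Phi> f \<lambda>\<close> depends continuously on \<open>f\<close> for each fixed \<open>\<lambda>\<close>,
  so every isometry with \<open>x\<^sub>t \<mapsto> e\<^sub>t\<close> is given by \<open>\<Phi>\<close>; completeness of \<open>L\<^sup>2(V)\<close> makes it onto.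

  As \<open>\<phi>\<close> grows at most linearly, the functions \<open>e\<^sub>t\<close> smoothed by two factors \<open>e\<^sub>\<epsilon> / \<epsilon>\<close> belong to \<open>L'\<close>,
  which is therefore dense. For \<open>\<psi>\<close> in \<open>L'\<close>, Fubini's theorem shows that \<open>U\<^sup>* \<psi>\<close> and the claimed integral
  have the same inner products with all \<open>x\<^sub>t\<close>. They agree because suitable superpositions of the \<open>x\<^sub>t\<close>
  are the polynomials \<open>(T - u)\<^sup>n\<close>.
\<close>

section \<open>Complex $L^2$-spaces\<close>

text \<open>With \<open>a = H - 1/2\<close>, the function \<open>phi\<close> is the confluent
  hypergeometric series with parameters \<open>1 - a\<close> and \<open>1 - 2 * a\<close>, evaluated
  at \<open>i z\<close>. The n-th moment of \<open>x_t dV\<close> carries the reciprocal Pochhammer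
  quotient times \<open>t ^ (n + 1) / (n + 1)\<close>, so transforming \<open>x_t\<close> leaves the
  Taylor series of \<open>e_t\<close>. The same moments give the Gram matrix: for
  \<open>u < t\<close> the kernel \<open>x_t\<close> is, up to the factor
  \<open>t powr (2 * a)\<close>, a power series in \<open>u / t\<close> plus a multiple of
  \<open>(u / t) powr (2 * a)\<close>, and the singular term, integrated against \<open>x_s\<close>,
  yields \<open>s powr (2 * H) / 2\<close>. Termwise integration rests on \<open>x_t\<close> being
  nonnegative, which its definition hides for \<open>a > 0\<close>. The adjoint formula has its own
  obstacle. The integral of \<open>psi\<close> against the conjugate kernel is at first only known
  to be integrable for \<open>dV\<close>, so density of the \<open>x_t\<close> in L2 cannot identify
  it. What is known is a bound of order \<open>t powr H\<close> on its pairing with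
  \<open>x_t\<close>; against a superposition weight of order \<open>t powr (- a - 1)\<close> near 0
  this leaves \<open>t powr (- 1/2)\<close>, and Fubini's theorem applies.\<close>

lemma borel_measurable_cnj [measurable (raw)]:
  assumes "f \<in> borel_measurable M"
  shows "(\<lambda>x. cnj (f x)) \<in> borel_measurable M"
  using assms by (intro borel_measurable_continuous_on[of cnj]) (auto intro: continuous_intros)

lemma L2_space_measurable [measurable_dest]: "f \<in> L2_space M \<Longrightarrow> f \<in> borel_measurable M"
  by (simp add: L2_space_def)

lemma L2_space_integrable: "f \<in> L2_space M \<Longrightarrow> integrable M (\<lambda>x. (cmod (f x))\<^sup>2)"
  by (simp add: L2_space_def)

lemma L2_space_dominated:
  assumes "g \<in> L2_space M" "f \<in> borel_measurable M" "AE x in M. cmod (f x) \<le> C * cmod (g x)"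
  shows "f \<in> L2_space M"
proof -
  have [measurable]: "f \<in> borel_measurable M" "g \<in> borel_measurable M"
    using assms by (auto simp: L2_space_def)
  have "integrable M (\<lambda>x. (cmod (f x))\<^sup>2)"
  proof (rule Bochner_Integration.integrable_bound)
    show "integrable M (\<lambda>x. C\<^sup>2 * (cmod (g x))\<^sup>2)"
      using L2_space_integrable[OF assms(1)] by simp
    show "AE x in M. norm ((cmod (f x))\<^sup>2) \<le> norm (C\<^sup>2 * (cmod (g x))\<^sup>2)"
      using assms(3)
    proof eventually_elim
      case (elim x)
      then have "(cmod (f x))\<^sup>2 \<le> (C * cmod (g x))\<^sup>2" by (intro power_mono) auto
      then show ?case by (simp add: power_mult_distrib)
    qed
  qed simp
  then show ?thesis using assms(2) by (simp add: L2_space_def)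
qed

lemma L2_mult_integrable:
  assumes "f \<in> L2_space M" "g \<in> L2_space M"
  shows "integrable M (\<lambda>x. cmod (f x) * cmod (g x))"
proof (rule Bochner_Integration.integrable_bound)
  have [measurable]: "f \<in> borel_measurable M" "g \<in> borel_measurable M"
    using assms by (auto simp: L2_space_def)
  show "(\<lambda>x. cmod (f x) * cmod (g x)) \<in> borel_measurable M" by simp
  show "integrable M (\<lambda>x. (cmod (f x))\<^sup>2 + (cmod (g x))\<^sup>2)"
    using assms by (auto simp: L2_space_def)
  have "p * q \<le> p\<^sup>2 + q\<^sup>2" if "p \<ge> 0" "q \<ge> 0" for p q :: real
  proof -
    have "2 * (p * q) \<le> p\<^sup>2 + q\<^sup>2" using sum_squares_bound[of p q] by simp
    moreover have "0 \<le> p * q" using that by simp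
    ultimately show ?thesis by linarith
  qed
  then show "AE x in M. norm (cmod (f x) * cmod (g x)) \<le> norm ((cmod (f x))\<^sup>2 + (cmod (g x))\<^sup>2)"
    by (simp add: abs_mult)
qed

lemma L2_inner_integrable:
  assumes "f \<in> L2_space M" "g \<in> L2_space M"
  shows "integrable M (\<lambda>x. f x * cnj (g x))"
proof -
  have [measurable]: "f \<in> borel_measurable M" "g \<in> borel_measurable M"
    using assms by (auto simp: L2_space_def)
  show ?thesis
    by (rule Bochner_Integration.integrable_bound[OF L2_mult_integrable[OF assms]])
       (auto simp: norm_mult)
qed

lemma L2_norm_nonneg [simp]: "0 \<le> L2_norm M f"
  by (simp add: L2_norm_def)

lemma L2_norm_sq: "(L2_norm M f)\<^sup>2 = (\<integral>x. (cmod (f x))\<^sup>2 \<partial>M)"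
  by (simp add: L2_norm_def)

text \<open>The squared norm of \<open>s * |f| - |g|\<close> is a quadratic polynomial in
  \<open>s\<close> without negative values, and its discriminant gives the bound. Moduli stand
  inside the integral because the later uses are domination arguments.\<close>

lemma L2_Cauchy_Schwarz:
  assumes "f \<in> L2_space M" "g \<in> L2_space M"
  shows "(\<integral>x. cmod (f x) * cmod (g x) \<partial>M) \<le> L2_norm M f * L2_norm M g"
proof -
  let ?A = "\<integral>x. (cmod (f x))\<^sup>2 \<partial>M" and ?B = "\<integral>x. (cmod (g x))\<^sup>2 \<partial>M"
  let ?C = "\<integral>x. cmod (f x) * cmod (g x) \<partial>M"
  have quad: "0 \<le> s\<^sup>2 * ?A - 2 * s * ?C + ?B" for s
  proof -
    have "(\<integral>x. (s * cmod (f x) - cmod (g x))\<^sup>2 \<partial>M) =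
        (\<integral>x. s\<^sup>2 * (cmod (f x))\<^sup>2 - 2 * s * (cmod (f x) * cmod (g x)) + (cmod (g x))\<^sup>2 \<partial>M)"
      by (rule Bochner_Integration.integral_cong) (auto simp: power2_eq_square algebra_simps)
    also have "\<dots> = s\<^sup>2 * ?A - 2 * s * ?C + ?B"
      using L2_mult_integrable[OF assms] L2_space_integrable[OF assms(1)] L2_space_integrable[OF assms(2)]
      by simp
    finally have eq: "(\<integral>x. (s * cmod (f x) - cmod (g x))\<^sup>2 \<partial>M) = s\<^sup>2 * ?A - 2 * s * ?C + ?B" .
    have "0 \<le> (\<integral>x. (s * cmod (f x) - cmod (g x))\<^sup>2 \<partial>M)"
      by (rule Bochner_Integration.integral_nonneg) simp
    then show ?thesis unfolding eq .
  qed
  have nn: "?A \<ge> 0" "?B \<ge> 0" "?C \<ge> 0" by auto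
  have "?C\<^sup>2 \<le> ?A * ?B"
  proof (cases "?A = 0")
    case True
    have "?C = 0"
    proof (rule ccontr)
      assume "?C \<noteq> 0"
      \<comment> \<open>With leading coefficient 0 the polynomial is \<open>?B - 2 * s * ?C\<close>,
        which equals -1 at this \<open>s\<close>.\<close>
      with quad[of "(?B + 1) / (2 * ?C)"] True show False by (simp add: field_simps)
    qed
    then show ?thesis using nn by simp
  next
    case False
    then have A: "?A > 0" using nn by linarith
    have "0 \<le> ?A * ((?C / ?A)\<^sup>2 * ?A - 2 * (?C / ?A) * ?C + ?B)"
      using quad[of "?C / ?A"] nn(1) by (rule mult_nonneg_nonneg[rotated])
    also have "\<dots> = ?A * ?B - ?C\<^sup>2"
      using A by (simp add: field_simps power2_eq_square)
    finally show ?thesis by simp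
  qed
  then have "?C \<le> sqrt (?A * ?B)" using nn by (simp add: real_le_rsqrt)
  then show ?thesis by (simp add: L2_norm_def real_sqrt_mult)
qed

lemma L2_space_add:
  assumes "f \<in> L2_space M" "g \<in> L2_space M"
  shows "(\<lambda>x. f x + g x) \<in> L2_space M"
proof -
  have [measurable]: "f \<in> borel_measurable M" "g \<in> borel_measurable M"
    using assms by (auto simp: L2_space_def)
  have "integrable M (\<lambda>x. (cmod (f x + g x))\<^sup>2)"
  proof (rule Bochner_Integration.integrable_bound)
    show "integrable M (\<lambda>x. (cmod (f x))\<^sup>2 + 2 * (cmod (f x) * cmod (g x)) + (cmod (g x))\<^sup>2)"
      using L2_mult_integrable[OF assms] assms by (auto simp: L2_space_def)
    show "AE x in M. norm ((cmod (f x + g x))\<^sup>2) \<le>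
        norm ((cmod (f x))\<^sup>2 + 2 * (cmod (f x) * cmod (g x)) + (cmod (g x))\<^sup>2)"
    proof (rule AE_I2)
      fix x
      have "(cmod (f x + g x))\<^sup>2 \<le> (cmod (f x) + cmod (g x))\<^sup>2"
        by (intro power_mono norm_triangle_ineq) auto
      then show "norm ((cmod (f x + g x))\<^sup>2) \<le>
        norm ((cmod (f x))\<^sup>2 + 2 * (cmod (f x) * cmod (g x)) + (cmod (g x))\<^sup>2)"
        by (simp add: power2_sum)
    qed
  qed simp
  then show ?thesis by (simp add: L2_space_def)
qed

lemma L2_space_cmult:
  assumes "f \<in> L2_space M"
  shows "(\<lambda>x. c * f x) \<in> L2_space M"
proof -
  have [measurable]: "f \<in> borel_measurable M" using assms by (auto simp: L2_space_def)
  show ?thesis by (rule L2_space_dominated[OF assms, of _ "cmod c"]) (auto simp: norm_mult)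
qed

lemma L2_space_zero: "(\<lambda>x. 0) \<in> L2_space M"
  by (simp add: L2_space_def)

lemma L2_space_lincomb:
  assumes "f \<in> L2_space M" "g \<in> L2_space M"
  shows "(\<lambda>x. a * f x + b * g x) \<in> L2_space M"
  by (intro L2_space_add L2_space_cmult assms)

lemma L2_space_diff:
  assumes "f \<in> L2_space M" "g \<in> L2_space M"
  shows "(\<lambda>x. f x - g x) \<in> L2_space M"
  using L2_space_lincomb[OF assms, of 1 "-1"] by simp

lemma L2_norm_cmult: "L2_norm M (\<lambda>x. c * f x) = cmod c * L2_norm M f"
  by (simp add: L2_norm_def norm_mult power_mult_distrib real_sqrt_mult)

lemma L2_norm_zero [simp]: "L2_norm M (\<lambda>x. 0) = 0"
  by (simp add: L2_norm_def)

lemma L2_norm_minus_commute: "L2_norm M (\<lambda>x. f x - g x) = L2_norm M (\<lambda>x. g x - f x)"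
  by (simp add: L2_norm_def norm_minus_commute)

lemma L2_norm_add:
  assumes "f \<in> L2_space M" "g \<in> L2_space M"
  shows "L2_norm M (\<lambda>x. f x + g x) \<le> L2_norm M f + L2_norm M g"
proof -
  have "(L2_norm M (\<lambda>x. f x + g x))\<^sup>2 \<le>
      (\<integral>x. (cmod (f x))\<^sup>2 + 2 * (cmod (f x) * cmod (g x)) + (cmod (g x))\<^sup>2 \<partial>M)"
    unfolding L2_norm_sq
  proof (rule integral_mono)
    show "integrable M (\<lambda>x. (cmod (f x + g x))\<^sup>2)"
      using L2_space_add[OF assms] by (simp add: L2_space_def)
    show "integrable M (\<lambda>x. (cmod (f x))\<^sup>2 + 2 * (cmod (f x) * cmod (g x)) + (cmod (g x))\<^sup>2)"
      using L2_mult_integrable[OF assms] assms by (auto simp: L2_space_def)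
    fix x
    have "(cmod (f x + g x))\<^sup>2 \<le> (cmod (f x) + cmod (g x))\<^sup>2"
      by (intro power_mono norm_triangle_ineq) auto
    then show "(cmod (f x + g x))\<^sup>2 \<le>
        (cmod (f x))\<^sup>2 + 2 * (cmod (f x) * cmod (g x)) + (cmod (g x))\<^sup>2"
      by (simp add: power2_sum)
  qed
  also have "\<dots> = (L2_norm M f)\<^sup>2 + 2 * (\<integral>x. cmod (f x) * cmod (g x) \<partial>M) + (L2_norm M g)\<^sup>2"
    unfolding L2_norm_sq using L2_mult_integrable[OF assms] assms by (auto simp: L2_space_def)
  also have "\<dots> \<le> (L2_norm M f)\<^sup>2 + 2 * (L2_norm M f * L2_norm M g) + (L2_norm M g)\<^sup>2"
    using L2_Cauchy_Schwarz[OF assms] by simp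
  also have "\<dots> = (L2_norm M f + L2_norm M g)\<^sup>2" by (simp add: power2_sum)
  finally show ?thesis by (rule power2_le_imp_le) simp
qed

lemma L2_norm_diff_triangle:
  assumes "f \<in> L2_space M" "g \<in> L2_space M" "h \<in> L2_space M"
  shows "L2_norm M (\<lambda>x. f x - h x) \<le> L2_norm M (\<lambda>x. f x - g x) + L2_norm M (\<lambda>x. g x - h x)"
  using L2_norm_add[OF L2_space_diff[OF assms(1,2)] L2_space_diff[OF assms(2,3)]] by simp

lemma L2_norm_le_add_diff:
  assumes "f \<in> L2_space M" "g \<in> L2_space M"
  shows "L2_norm M f \<le> L2_norm M g + L2_norm M (\<lambda>x. f x - g x)"
  using L2_norm_add[OF assms(2) L2_space_diff[OF assms]] by simp

lemma L2_norm_cong_AE: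
  assumes "f \<in> borel_measurable M" "g \<in> borel_measurable M" "AE x in M. f x = g x"
  shows "L2_norm M f = L2_norm M g"
  unfolding L2_norm_def
  by (rule arg_cong[where f = sqrt], rule integral_cong_AE) (use assms in auto)

lemma L2_norm_eq_0D:
  assumes "f \<in> L2_space M" "L2_norm M f = 0"
  shows "AE x in M. f x = 0"
proof -
  have "(\<integral>x. (cmod (f x))\<^sup>2 \<partial>M) = 0" using assms(2) by (simp add: L2_norm_def)
  then have "AE x in M. (cmod (f x))\<^sup>2 = 0"
    using integral_nonneg_eq_0_iff_AE[OF L2_space_integrable[OF assms(1)]] by simp
  then show ?thesis by simp
qed

lemma L2_norm_small_AE_eq:
  assumes "f \<in> L2_space M" "g \<in> L2_space M"
    and "\<And>\<epsilon>. \<epsilon> > 0 \<Longrightarrow> L2_norm M (\<lambda>x. f x - g x) \<le> \<epsilon>"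
  shows "AE x in M. f x = g x"
proof -
  have "L2_norm M (\<lambda>x. f x - g x) = 0"
  proof (rule ccontr)
    assume "L2_norm M (\<lambda>x. f x - g x) \<noteq> 0"
    then have "L2_norm M (\<lambda>x. f x - g x) > 0" using L2_norm_nonneg[of M "\<lambda>x. f x - g x"] by linarith
    with assms(3)[of "L2_norm M (\<lambda>x. f x - g x) / 2"] show False by linarith
  qed
  from L2_norm_eq_0D[OF L2_space_diff[OF assms(1,2)] this] show ?thesis by simp
qed

lemma L2_norm_eq_inner: "complex_of_real ((L2_norm M f)\<^sup>2) = L2_inner M f f"
proof -
  have "(\<lambda>x. f x * cnj (f x)) = (\<lambda>x. complex_of_real ((cmod (f x))\<^sup>2))"
    by (simp only: complex_norm_square)
  then show ?thesis unfolding L2_norm_sq L2_inner_def by (simp only: integral_complex_of_real)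
qed

text \<open>Square integrability of the limit is a conclusion here. This makes the lemma applicable
  to limits that are known only pointwise, and a bound on a tail of the sequence suffices because
  Fatou's lemma involves a limes inferior.\<close>

lemma L2_Fatou:
  assumes "\<And>n. f n \<in> L2_space M" "g \<in> borel_measurable M"
    and "AE x in M. (\<lambda>n. f n x) \<longlonglongrightarrow> g x"
    and "eventually (\<lambda>n. L2_norm M (f n) \<le> C) sequentially"
  shows "g \<in> L2_space M" "L2_norm M g \<le> C"
proof -
  have [measurable]: "f n \<in> borel_measurable M" for n using assms(1)[of n] by (simp add: L2_space_def)
  note [measurable] = assms(2)
  obtain N where N: "\<And>n. n \<ge> N \<Longrightarrow> L2_norm M (f n) \<le> C"
    using assms(4) by (auto simp: eventually_sequentially)
  have C: "C \<ge> 0" using N[of N] L2_norm_nonneg[of M "f N"] by linarith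
  have nn: "(\<integral>\<^sup>+x. ennreal ((cmod (f n x))\<^sup>2) \<partial>M) = ennreal ((L2_norm M (f n))\<^sup>2)" for n
    unfolding L2_norm_sq using L2_space_integrable[OF assms(1)[of n]]
    by (intro nn_integral_eq_integral) auto
  have "(\<integral>\<^sup>+x. ennreal ((cmod (g x))\<^sup>2) \<partial>M) = (\<integral>\<^sup>+x. liminf (\<lambda>n. ennreal ((cmod (f n x))\<^sup>2)) \<partial>M)"
  proof (rule nn_integral_cong_AE)
    show "AE x in M. ennreal ((cmod (g x))\<^sup>2) = liminf (\<lambda>n. ennreal ((cmod (f n x))\<^sup>2))"
      using assms(3)
    proof eventually_elim
      case (elim x)
      then have "(\<lambda>n. ennreal ((cmod (f n x))\<^sup>2)) \<longlonglongrightarrow> ennreal ((cmod (g x))\<^sup>2)"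
        by (intro tendsto_ennrealI tendsto_power tendsto_norm)
      then show ?case by (intro lim_imp_Liminf[symmetric]) auto
    qed
  qed
  also have "\<dots> \<le> liminf (\<lambda>n. \<integral>\<^sup>+x. ennreal ((cmod (f n x))\<^sup>2) \<partial>M)"
    by (rule nn_integral_liminf) simp
  also have "\<dots> \<le> ennreal (C\<^sup>2)"
  proof -
    have "eventually (\<lambda>n. (\<integral>\<^sup>+x. ennreal ((cmod (f n x))\<^sup>2) \<partial>M) \<le> ennreal (C\<^sup>2)) sequentially"
      using assms(4)
      by eventually_elim (simp add: nn power_mono ennreal_leI)
    from Liminf_mono[OF this] show ?thesis
      by (simp add: Liminf_const)
  qed
  finally have le: "(\<integral>\<^sup>+x. ennreal ((cmod (g x))\<^sup>2) \<partial>M) \<le> ennreal (C\<^sup>2)" .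
  have int: "integrable M (\<lambda>x. (cmod (g x))\<^sup>2)"
    by (rule integrableI_bounded)
       (use le in \<open>auto intro: le_less_trans\<close>)
  then show "g \<in> L2_space M" by (simp add: L2_space_def)
  have "ennreal (\<integral>x. (cmod (g x))\<^sup>2 \<partial>M) \<le> ennreal (C\<^sup>2)"
    using le int by (subst nn_integral_eq_integral[symmetric]) auto
  then have "(L2_norm M g)\<^sup>2 \<le> C\<^sup>2" unfolding L2_norm_sq by simp
  then show "L2_norm M g \<le> C" using C by (rule power2_le_imp_le)
qed

lemma L2_dominated_convergence:
  assumes "D \<in> L2_space M" "\<And>n. g n \<in> borel_measurable M" "f \<in> borel_measurable M"
    and "AE x in M. (\<lambda>n. g n x) \<longlonglongrightarrow> f x"
    and "\<And>n. AE x in M. cmod (g n x) \<le> cmod (D x)"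
  shows "f \<in> L2_space M" "\<And>n. g n \<in> L2_space M" "(\<lambda>n. L2_norm M (\<lambda>x. f x - g n x)) \<longlonglongrightarrow> 0"
proof -
  note [measurable] = assms(2,3)
  show g: "g n \<in> L2_space M" for n
    by (rule L2_space_dominated[OF assms(1), of _ 1]) (use assms(5)[of n] in auto)
  have fle: "AE x in M. cmod (f x) \<le> cmod (D x)"
  proof -
    have "AE x in M. \<forall>n. cmod (g n x) \<le> cmod (D x)" using assms(5) by (simp add: AE_all_countable)
    then show ?thesis using assms(4)
    proof eventually_elim
      case (elim x)
      from tendsto_norm[OF elim(2)] elim(1) show ?case
        by (intro LIMSEQ_le_const2) auto
    qed
  qed
  show f: "f \<in> L2_space M"
    by (rule L2_space_dominated[OF assms(1), of _ 1]) (use fle in auto)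
  have "(\<lambda>n. \<integral>x. (cmod (f x - g n x))\<^sup>2 \<partial>M) \<longlonglongrightarrow> (\<integral>x. 0 \<partial>M)"
  \<comment> \<open>Both \<open>f\<close> and \<open>g n\<close> are bounded by \<open>D\<close>, so
    the squared difference is at most \<open>(2 * |D|)^2\<close>.\<close>
  proof (rule integral_dominated_convergence[where w = "\<lambda>x. 4 * (cmod (D x))\<^sup>2"])
    show "integrable M (\<lambda>x. 4 * (cmod (D x))\<^sup>2)" using L2_space_integrable[OF assms(1)] by simp
    show "AE x in M. (\<lambda>n. (cmod (f x - g n x))\<^sup>2) \<longlonglongrightarrow> 0"
      using assms(4)
    proof eventually_elim
      case (elim x)
      then have "(\<lambda>n. (cmod (f x - g n x))\<^sup>2) \<longlonglongrightarrow> (cmod (f x - f x))\<^sup>2"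
        by (intro tendsto_intros)
      then show ?case by simp
    qed
    show "AE x in M. norm ((cmod (f x - g n x))\<^sup>2) \<le> 4 * (cmod (D x))\<^sup>2" for n
      using assms(5)[of n] fle
    proof eventually_elim
      case (elim x)
      have "cmod (f x - g n x) \<le> 2 * cmod (D x)"
        using norm_triangle_ineq4[of "f x" "g n x"] elim by linarith
      then have "(cmod (f x - g n x))\<^sup>2 \<le> (2 * cmod (D x))\<^sup>2" by (intro power_mono) auto
      then show ?case by (simp add: power_mult_distrib)
    qed
  qed auto
  from tendsto_real_sqrt[OF this] show "(\<lambda>n. L2_norm M (\<lambda>x. f x - g n x)) \<longlonglongrightarrow> 0"
    by (simp add: L2_norm_def)
qed

section \<open>Linear subspaces, spans and closures\<close>

definition lin_closed :: "('a \<Rightarrow> complex) set \<Rightarrow> bool" where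
  "lin_closed S \<longleftrightarrow> (\<lambda>_. 0) \<in> S \<and> (\<forall>f\<in>S. \<forall>g\<in>S. \<forall>a b. (\<lambda>x. a * f x + b * g x) \<in> S)"

lemma lin_closedD:
  assumes "lin_closed S"
  shows "(\<lambda>_. 0) \<in> S" "f \<in> S \<Longrightarrow> g \<in> S \<Longrightarrow> (\<lambda>x. a * f x + b * g x) \<in> S"
  using assms by (auto simp: lin_closed_def)

lemma lin_closed_cmult:
  assumes "lin_closed S" "f \<in> S"
  shows "(\<lambda>x. a * f x) \<in> S"
  using lin_closedD(2)[OF assms assms(2), of a 0] by simp

lemma lin_closed_diff:
  assumes "lin_closed S" "f \<in> S" "g \<in> S"
  shows "(\<lambda>x. f x - g x) \<in> S"
  using lin_closedD(2)[OF assms, of 1 "-1"] by simp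

lemma lin_closed_sum:
  assumes "lin_closed S" "finite I" "\<And>i. i \<in> I \<Longrightarrow> f i \<in> S"
  shows "(\<lambda>x. \<Sum>i\<in>I. f i x) \<in> S"
  using assms(2,3)
proof (induction I)
  case empty
  then show ?case using lin_closedD(1)[OF assms(1)] by simp
next
  case (insert i I)
  then have "f i \<in> S" "(\<lambda>x. \<Sum>i\<in>I. f i x) \<in> S" by auto
  from lin_closedD(2)[OF assms(1) this, of 1 1] insert show ?case by simp
qed

lemma complex_span_superset: "S \<subseteq> complex_span S"
proof
  fix g assume "g \<in> S"
  then show "g \<in> complex_span S"
    unfolding complex_span_def by (intro CollectI exI[of _ "{g}"] exI[of _ "\<lambda>_. 1"]) auto
qed

text \<open>The induction principle for spans. A property of all functions in a span follows once
  the functions enjoying it are \<open>lin_closed\<close> and include the generators; coefficients,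
  which a function in the span need not determine, never have to be chosen.\<close>

lemma complex_span_minimal:
  assumes "lin_closed P" "S \<subseteq> P"
  shows "complex_span S \<subseteq> P"
proof
  fix f assume "f \<in> complex_span S"
  then obtain A c where A: "finite A" "A \<subseteq> S" and f: "f = (\<lambda>x. \<Sum>g\<in>A. c g * g x)"
    by (auto simp: complex_span_def)
  show "f \<in> P" unfolding f
    by (rule lin_closed_sum[OF assms(1) A(1)]) (use A assms in \<open>auto intro: lin_closed_cmult\<close>)
qed

lemma lin_closed_complex_span: "lin_closed (complex_span S)"
  unfolding lin_closed_def
proof (intro conjI ballI allI)
  show "(\<lambda>_. 0) \<in> complex_span S"
    unfolding complex_span_def by (intro CollectI exI[of _ "{}"]) auto
next
  fix f g :: "'a \<Rightarrow> complex" and a b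
  assume "f \<in> complex_span S" "g \<in> complex_span S"
  then obtain A c B d where A: "finite A" "A \<subseteq> S" and f: "f = (\<lambda>x. \<Sum>g\<in>A. c g * g x)"
    and B: "finite B" "B \<subseteq> S" and g: "g = (\<lambda>x. \<Sum>g\<in>B. d g * g x)"
    by (auto simp: complex_span_def)
  \<comment> \<open>The two finite sets may overlap, so both coefficient families are extended by 0
    to the union and added there.\<close>
  let ?e = "\<lambda>h. (if h \<in> A then a * c h else 0) + (if h \<in> B then b * d h else 0)"
  have "(\<Sum>h\<in>A \<union> B. ?e h * h x) = a * f x + b * g x" for x
  proof -
    have "(\<Sum>h\<in>A \<union> B. ?e h * h x) =
        (\<Sum>h\<in>A \<union> B. (if h \<in> A then a * c h * h x else 0)) + (\<Sum>h\<in>A \<union> B. (if h \<in> B then b * d h * h x else 0))"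
      unfolding sum.distrib[symmetric] by (rule sum.cong) (auto simp: distrib_right)
    also have "(\<Sum>h\<in>A \<union> B. (if h \<in> A then a * c h * h x else 0)) = a * f x"
      using A B by (subst sum.inter_restrict[symmetric]) (auto simp: f sum_distrib_left Int_absorb1 mult.assoc)
    also have "(\<Sum>h\<in>A \<union> B. (if h \<in> B then b * d h * h x else 0)) = b * g x"
      using A B by (subst sum.inter_restrict[symmetric]) (auto simp: g sum_distrib_left Int_absorb1 mult.assoc)
    finally show ?thesis .
  qed
  then have "(\<lambda>x. a * f x + b * g x) = (\<lambda>x. \<Sum>h\<in>A \<union> B. ?e h * h x)" by (intro ext) (rule sym)
  moreover have "finite (A \<union> B)" "A \<union> B \<subseteq> S" using A B by auto
  ultimately show "(\<lambda>x. a * f x + b * g x) \<in> complex_span S"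
    unfolding complex_span_def by (intro CollectI exI[of _ "A \<union> B"] exI[of _ ?e]) simp
qed

lemma lin_closed_L2_space: "lin_closed (L2_space M)"
  unfolding lin_closed_def using L2_space_zero L2_space_lincomb by auto

lemma L2_closure_subset: "L2_closure M S \<subseteq> L2_space M"
  by (auto simp: L2_closure_def)

lemma L2_closure_superset: "S \<subseteq> L2_space M \<Longrightarrow> S \<subseteq> L2_closure M S"
  by (force simp: L2_closure_def)

lemma L2_closure_mono: "S \<subseteq> S' \<Longrightarrow> L2_closure M S \<subseteq> L2_closure M S'"
  unfolding L2_closure_def by blast

lemma L2_closure_idem: "L2_closure M (L2_closure M S) \<subseteq> L2_closure M S"
proof
  fix f assume f: "f \<in> L2_closure M (L2_closure M S)"
  have fL: "f \<in> L2_space M" using f by (simp add: L2_closure_def)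
  moreover have "\<exists>g \<in> S \<inter> L2_space M. L2_norm M (\<lambda>x. f x - g x) < \<epsilon>" if "\<epsilon> > 0" for \<epsilon>
  proof -
    have "\<epsilon> / 2 > 0" using that by simp
    then obtain h where h: "h \<in> L2_closure M S" "h \<in> L2_space M" "L2_norm M (\<lambda>x. f x - h x) < \<epsilon> / 2"
      using f unfolding L2_closure_def[of M "L2_closure M S"] by blast
    then obtain g where g: "g \<in> S \<inter> L2_space M" "L2_norm M (\<lambda>x. h x - g x) < \<epsilon> / 2"
      using \<open>\<epsilon> / 2 > 0\<close> unfolding L2_closure_def by blast
    have "L2_norm M (\<lambda>x. f x - g x) < \<epsilon>"
      using L2_norm_diff_triangle[OF fL h(2), of g] g h by auto
    with g show ?thesis by blast
  qed
  ultimately show "f \<in> L2_closure M S" by (simp add: L2_closure_def)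
qed

lemma lin_closed_L2_closure:
  assumes "lin_closed S"
  shows "lin_closed (L2_closure M S)"
  unfolding lin_closed_def
proof (intro conjI ballI allI)
  show "(\<lambda>_. 0) \<in> L2_closure M S"
    using lin_closedD(1)[OF assms] L2_space_zero by (force simp: L2_closure_def)
next
  fix f g :: "'a \<Rightarrow> complex" and a b
  assume fg: "f \<in> L2_closure M S" "g \<in> L2_closure M S"
  then have fgL: "f \<in> L2_space M" "g \<in> L2_space M" by (auto simp: L2_closure_def)
  have "\<exists>h \<in> S \<inter> L2_space M. L2_norm M (\<lambda>x. (a * f x + b * g x) - h x) < \<epsilon>" if "\<epsilon> > 0" for \<epsilon>
  proof -
    \<comment> \<open>The summand 1 keeps the denominator positive when \<open>a\<close> and
      \<open>b\<close> both vanish.\<close>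
    define \<delta> where "\<delta> = \<epsilon> / (cmod a + cmod b + 1)"
    have \<delta>: "\<delta> > 0" using that by (simp add: \<delta>_def add_nonneg_pos)
    obtain f' where f': "f' \<in> S" "f' \<in> L2_space M" "L2_norm M (\<lambda>x. f x - f' x) < \<delta>"
      using fg(1) \<delta> by (auto simp: L2_closure_def)
    obtain g' where g': "g' \<in> S" "g' \<in> L2_space M" "L2_norm M (\<lambda>x. g x - g' x) < \<delta>"
      using fg(2) \<delta> by (auto simp: L2_closure_def)
    have "L2_norm M (\<lambda>x. (a * f x + b * g x) - (a * f' x + b * g' x)) =
        L2_norm M (\<lambda>x. a * (f x - f' x) + b * (g x - g' x))"
      by (simp add: algebra_simps)
    also have "\<dots> \<le> cmod a * L2_norm M (\<lambda>x. f x - f' x) + cmod b * L2_norm M (\<lambda>x. g x - g' x)"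
      using L2_norm_add[of "\<lambda>x. a * (f x - f' x)" M "\<lambda>x. b * (g x - g' x)"] fgL f' g'
      by (simp add: L2_norm_cmult L2_space_cmult L2_space_diff)
    also have "\<dots> \<le> cmod a * \<delta> + cmod b * \<delta>"
      using f' g' by (intro add_mono mult_left_mono) auto
    also have "\<dots> < (cmod a + cmod b + 1) * \<delta>" using \<delta> by (simp add: algebra_simps)
    also have "\<dots> = \<epsilon>"
    proof -
      have "cmod a + cmod b + 1 > 0" by (simp add: add_nonneg_pos)
      then show ?thesis by (simp add: \<delta>_def)
    qed
    finally have "L2_norm M (\<lambda>x. (a * f x + b * g x) - (a * f' x + b * g' x)) < \<epsilon>" .
    moreover have "(\<lambda>x. a * f' x + b * g' x) \<in> S \<inter> L2_space M"
      using lin_closedD(2)[OF assms f'(1) g'(1)] L2_space_lincomb[OF f'(2) g'(2)] by blast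
    ultimately show ?thesis by (intro bexI[of _ "\<lambda>x. a * f' x + b * g' x"])
  qed
  with L2_space_lincomb[OF fgL] show "(\<lambda>x. a * f x + b * g x) \<in> L2_closure M S"
    by (simp add: L2_closure_def)
qed

lemma L2_closure_limit:
  assumes "f \<in> L2_space M" "\<And>n. g n \<in> S" "\<And>n. g n \<in> L2_space M"
    and "(\<lambda>n. L2_norm M (\<lambda>x. f x - g n x)) \<longlonglongrightarrow> 0"
  shows "f \<in> L2_closure M S"
proof -
  have "\<exists>h \<in> S \<inter> L2_space M. L2_norm M (\<lambda>x. f x - h x) < \<epsilon>" if "\<epsilon> > 0" for \<epsilon>
  proof -
    have "eventually (\<lambda>n. L2_norm M (\<lambda>x. f x - g n x) < \<epsilon>) sequentially"
      using assms(4) that by (rule order_tendstoD)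
    then obtain n where "L2_norm M (\<lambda>x. f x - g n x) < \<epsilon>" by (auto simp: eventually_sequentially)
    then show ?thesis using assms by blast
  qed
  with assms(1) show ?thesis by (simp add: L2_closure_def)
qed

text \<open>A geometric rate is fixed here so that consecutive differences of approximants are
  summable, which is the form in which completeness is used.\<close>

lemma L2_closure_sequence:
  assumes "f \<in> L2_closure M S"
  obtains g where "\<And>n. g n \<in> S" "\<And>n. g n \<in> L2_space M"
    "\<And>n. L2_norm M (\<lambda>x. f x - g n x) < (1/2) ^ n"
proof -
  have "\<forall>n. \<exists>g. g \<in> S \<and> g \<in> L2_space M \<and> L2_norm M (\<lambda>x. f x - g x) < (1/2) ^ n"
  proof
    fix n :: nat
    have "(0::real) < (1/2) ^ n" by simp
    with assms show "\<exists>g. g \<in> S \<and> g \<in> L2_space M \<and> L2_norm M (\<lambda>x. f x - g x) < (1/2) ^ n"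
      unfolding L2_closure_def by blast
  qed
  then show ?thesis using that by metis
qed

text \<open>On a finite measure space the $L^1$-norm is controlled by the $L^2$-norm, so a fast Cauchy
  sequence converges almost everywhere; Fatou's lemma then gives convergence in $L^2$.\<close>

lemma L2_complete:
  assumes "finite_measure M" "\<And>n. f n \<in> L2_space M"
    and "\<And>n. L2_norm M (\<lambda>x. f (Suc n) x - f n x) \<le> C * (1/2) ^ n"
  obtains g where "g \<in> L2_space M" "(\<lambda>n. L2_norm M (\<lambda>x. g x - f n x)) \<longlonglongrightarrow> 0"
proof -
  interpret finite_measure M by fact
  have [measurable]: "f n \<in> borel_measurable M" for n using assms(2)[of n] by (simp add: L2_space_def)
  have C: "C \<ge> 0" using assms(3)[of 0] L2_norm_nonneg[of M "\<lambda>x. f (Suc 0) x - f 0 x"] by (simp del: L2_norm_nonneg)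
  let ?d = "\<lambda>n x. f (Suc n) x - f n x"
  have d: "?d n \<in> L2_space M" for n by (intro L2_space_diff assms)
  have one: "(\<lambda>x. 1) \<in> L2_space M" by (simp add: L2_space_def)
  let ?K = "L2_norm M (\<lambda>x. 1 :: complex)"
  have dint: "integrable M (\<lambda>x. cmod (?d n x))" for n
    using L2_mult_integrable[OF d one] by simp
  \<comment> \<open>Cauchy-Schwarz against the constant 1, which is square integrable because the
    measure is finite.\<close>
  have dle: "(\<integral>x. cmod (?d n x) \<partial>M) \<le> ?K * C * (1/2) ^ n" for n
  proof -
    have "(\<integral>x. cmod (?d n x) \<partial>M) \<le> L2_norm M (?d n) * ?K"
      using L2_Cauchy_Schwarz[OF d one, of n] by simp
    also have "\<dots> \<le> C * (1/2) ^ n * ?K" by (intro mult_right_mono assms) simp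
    finally show ?thesis by (simp add: mult_ac)
  qed
  have "(\<integral>\<^sup>+x. (\<Sum>n. ennreal (cmod (?d n x))) \<partial>M) = (\<Sum>n. \<integral>\<^sup>+x. ennreal (cmod (?d n x)) \<partial>M)"
    by (rule nn_integral_suminf) simp
  also have "\<dots> = (\<Sum>n. ennreal (\<integral>x. cmod (?d n x) \<partial>M))"
    using dint by (intro suminf_cong nn_integral_eq_integral) auto
  also have "\<dots> \<le> (\<Sum>n. ennreal (?K * C * (1/2) ^ n))"
    by (intro suminf_le ennreal_leI dle) auto
  also have "\<dots> < \<infinity>"
  proof -
    have "summable (\<lambda>n. ?K * C * (1/2) ^ n :: real)" by (intro summable_mult summable_geometric) auto
    then have "(\<Sum>n. ennreal (?K * C * (1/2) ^ n)) = ennreal (\<Sum>n. ?K * C * (1/2) ^ n)"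
      using C by (intro suminf_ennreal2) auto
    then show ?thesis by simp
  qed
  finally have "AE x in M. (\<Sum>n. ennreal (cmod (?d n x))) \<noteq> \<infinity>"
    by (intro nn_integral_noteq_infinite) auto
  then have conv: "AE x in M. convergent (\<lambda>n. f n x)"
  proof eventually_elim
    case (elim x)
    then have "summable (\<lambda>n. cmod (?d n x))"
      by (intro summable_suminf_not_top) auto
    then have "summable (\<lambda>n. ?d n x)" by (rule summable_norm_cancel)
    then have "convergent (\<lambda>n. \<Sum>k<n. ?d k x)" by (simp add: summable_iff_convergent)
    moreover have "(\<Sum>k<n. ?d k x) = f n x - f 0 x" for n
      by (rule sum_lessThan_telescope)
    ultimately have "convergent (\<lambda>n. f n x - f 0 x)" by simp
    from convergent_add[OF this convergent_const[of "f 0 x"]] show ?case by simp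
  qed
  \<comment> \<open>\<open>lim\<close> has some value even at points of divergence, so
    \<open>g\<close> is a total measurable function; those points form a null set.\<close>
  define g where "g x = lim (\<lambda>n. f n x)" for x
  have [measurable]: "g \<in> borel_measurable M" unfolding g_def[abs_def] by measurable
  have lim: "AE x in M. (\<lambda>n. f n x) \<longlonglongrightarrow> g x"
    using conv by eventually_elim (simp add: g_def convergent_LIMSEQ_iff)
  \<comment> \<open>The geometric tail is subtracted on the right so that the induction on
    \<open>k\<close> closes; without it the bound would grow at each step.\<close>
  have cauchy: "L2_norm M (\<lambda>x. f (n + k) x - f n x) \<le> 2 * C * (1/2) ^ n - 2 * C * (1/2) ^ (n + k)" for n k
  proof (induction k)
    case (Suc k)
    have "L2_norm M (\<lambda>x. f (n + Suc k) x - f n x) \<le>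
        L2_norm M (\<lambda>x. f (Suc (n + k)) x - f (n + k) x) + L2_norm M (\<lambda>x. f (n + k) x - f n x)"
      using L2_norm_diff_triangle[OF assms(2)[of "Suc (n + k)"] assms(2)[of "n + k"] assms(2)[of n]] by simp
    also have "\<dots> \<le> C * (1/2) ^ (n + k) + (2 * C * (1/2) ^ n - 2 * C * (1/2) ^ (n + k))"
      by (intro add_mono Suc assms)
    finally show ?case by (simp add: algebra_simps)
  qed simp
  have diff: "(\<lambda>x. g x - f n x) \<in> L2_space M \<and> L2_norm M (\<lambda>x. g x - f n x) \<le> 2 * C * (1/2) ^ n" for n
  proof -
    have 1: "AE x in M. (\<lambda>k. f k x - f n x) \<longlonglongrightarrow> g x - f n x"
      using lim by eventually_elim (intro tendsto_intros)
    have 2: "eventually (\<lambda>k. L2_norm M (\<lambda>x. f k x - f n x) \<le> 2 * C * (1/2) ^ n) sequentially"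
      using eventually_ge_at_top[of n]
    proof eventually_elim
      case (elim k)
      then have "L2_norm M (\<lambda>x. f k x - f n x) \<le> 2 * C * (1/2) ^ n - 2 * C * (1/2) ^ k"
        using cauchy[of n "k - n"] by simp
      moreover have "0 \<le> 2 * C * (1/2) ^ k" using C by simp
      ultimately show ?case by linarith
    qed
    have 3: "(\<lambda>x. f k x - f n x) \<in> L2_space M" for k by (intro L2_space_diff assms)
    show ?thesis using L2_Fatou[OF 3 _ 1 2] by simp
  qed
  show ?thesis
  proof (rule that)
    show "g \<in> L2_space M"
      using L2_space_add[OF conjunct1[OF diff[of 0]] assms(2)[of 0]] by simp
    show "(\<lambda>n. L2_norm M (\<lambda>x. g x - f n x)) \<longlonglongrightarrow> 0"
    proof (rule tendsto_sandwich[of "\<lambda>_. 0" _ _ "\<lambda>n. 2 * C * (1/2) ^ n"])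
      show "(\<lambda>n. 2 * C * (1/2) ^ n) \<longlonglongrightarrow> 0"
        by (intro tendsto_mult_right_zero LIMSEQ_power_zero) simp
    qed (use diff in auto)
  qed
qed

section \<open>Inner products and polarization\<close>

lemma L2_inner_lincomb_left:
  assumes "f \<in> L2_space M" "g \<in> L2_space M" "h \<in> L2_space M"
  shows "L2_inner M (\<lambda>x. a * f x + b * g x) h = a * L2_inner M f h + b * L2_inner M g h"
proof -
  have "L2_inner M (\<lambda>x. a * f x + b * g x) h =
      (\<integral>x. a * (f x * cnj (h x)) + b * (g x * cnj (h x)) \<partial>M)"
    unfolding L2_inner_def by (simp add: algebra_simps)
  also have "\<dots> = a * L2_inner M f h + b * L2_inner M g h"
    unfolding L2_inner_def using L2_inner_integrable[OF assms(1,3)] L2_inner_integrable[OF assms(2,3)]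
    by simp
  finally show ?thesis .
qed

lemma L2_inner_cnj: "L2_inner M f g = cnj (L2_inner M g f)"
proof -
  have "cnj (\<integral>x. g x * cnj (f x) \<partial>M) = (\<integral>x. cnj (g x * cnj (f x)) \<partial>M)"
    by (rule Bochner_Integration.integral_cnj[symmetric])
  then show ?thesis unfolding L2_inner_def by (simp add: mult.commute)
qed

lemma L2_inner_lincomb_right:
  assumes "f \<in> L2_space M" "g \<in> L2_space M" "h \<in> L2_space M"
  shows "L2_inner M h (\<lambda>x. a * f x + b * g x) = cnj a * L2_inner M h f + cnj b * L2_inner M h g"
  by (subst (1 2 3) L2_inner_cnj) (simp add: L2_inner_lincomb_left[OF assms])

lemma L2_inner_cong_AE:
  assumes "f \<in> borel_measurable M" "f' \<in> borel_measurable M" "g \<in> borel_measurable M" "g' \<in> borel_measurable M"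
    and "AE x in M. f x = f' x" "AE x in M. g x = g' x"
  shows "L2_inner M f g = L2_inner M f' g'"
  unfolding L2_inner_def
proof (rule integral_cong_AE)
  note [measurable] = assms(1-4)
  show "(\<lambda>x. f x * cnj (g x)) \<in> borel_measurable M" "(\<lambda>x. f' x * cnj (g' x)) \<in> borel_measurable M"
    by auto
  show "AE x in M. f x * cnj (g x) = f' x * cnj (g' x)"
    using assms(5,6) by eventually_elim simp
qed

text \<open>In the expansion of the norm of \<open>f + c * g\<close> only the term with
  \<open>cnj c\<close> survives when \<open>c\<close> runs through the fourth roots of unity with
  weight \<open>c\<close>: the sums of \<open>c\<close>, of \<open>c * c\<close> and of
  \<open>c * (c * cnj c)\<close> vanish.\<close>

lemma L2_polarization:
  assumes "f \<in> L2_space M" "g \<in> L2_space M"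
  shows "4 * L2_inner M f g = (\<Sum>k<4. \<i> ^ k * complex_of_real ((L2_norm M (\<lambda>x. 1 * f x + \<i> ^ k * g x))\<^sup>2))"
proof -
  have e: "complex_of_real ((L2_norm M (\<lambda>x. 1 * f x + c * g x))\<^sup>2) =
      L2_inner M f f + cnj c * L2_inner M f g + c * (L2_inner M g f + cnj c * L2_inner M g g)" for c
    unfolding L2_norm_eq_inner
    by (subst L2_inner_lincomb_left[OF assms L2_space_lincomb[OF assms]],
        subst (1 2) L2_inner_lincomb_right) (use assms in auto)
  show ?thesis unfolding e by (simp add: eval_nat_numeral algebra_simps)
qed

text \<open>Reduces preservation of inner products to preservation of norms on a subspace. The
  literal factor \<open>1\<close> keeps the combination in the shape \<open>a * f + b * g\<close> in
  which linearity and closedness are stated.\<close>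

lemma L2_inner_eq_of_norm_eq:
  assumes "f \<in> L2_space M" "g \<in> L2_space M" "F \<in> L2_space N" "G \<in> L2_space N"
    and "\<And>c. L2_norm N (\<lambda>x. 1 * F x + c * G x) = L2_norm M (\<lambda>x. 1 * f x + c * g x)"
  shows "L2_inner N F G = L2_inner M f g"
proof -
  have "4 * L2_inner N F G = 4 * L2_inner M f g"
    unfolding L2_polarization[OF assms(1,2)] L2_polarization[OF assms(3,4)] assms(5) ..
  then show ?thesis by simp
qed

section \<open>The kernel\<close>

text \<open>For \<open>w > 0\<close> the series \<open>fpsA\<close> and \<open>fpsB\<close>
  represent \<open>Gamma (1 - H) * (w / 2) powr H\<close> times the Bessel functions of orders
  \<open>- H\<close> and \<open>1 - H\<close>. At \<open>w = z / 2\<close> they are the two real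
  components of \<open>phi H z\<close> once the phase \<open>exp (i z / 2)\<close> is removed. As
  formal series they turn the Bessel relations into identities between coefficients.\<close>

definition fpsA :: "real \<Rightarrow> real fps" where
  "fpsA H = Abs_fps (\<lambda>n. if even n
     then (-1) ^ (n div 2) / (fact (n div 2) * pochhammer (1 - H) (n div 2) * 2 ^ n) else 0)"

definition fpsB :: "real \<Rightarrow> real fps" where
  "fpsB H = Abs_fps (\<lambda>n. if odd n
     then (-1) ^ (n div 2) / (fact (n div 2) * pochhammer (1 - H) (Suc (n div 2)) * 2 ^ n) else 0)"

lemma pochhammer_ge_power:
  fixes x :: real
  assumes "x > 0"
  shows "x ^ n \<le> pochhammer x n"
proof (induction n)
  case (Suc n)
  have "x ^ n * x \<le> pochhammer x n * (x + real n)"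
    using Suc assms pochhammer_pos[OF assms, of n] by (intro mult_mono) auto
  then show ?case by (simp add: pochhammer_Suc mult.commute)
qed simp

lemma pochhammer_pos_real: "(x::real) > 0 \<Longrightarrow> pochhammer x n > 0"
  by (rule pochhammer_pos)

text \<open>Comparison with an exponential series through \<open>pochhammer x k >= x ^ k\<close>.
  The scalar field is left open because real arguments settle the radius of convergence and complex
  ones the comparison with \<open>bessel_red\<close>.\<close>

lemma summable_bessel_aux:
  fixes w :: "'a :: {real_normed_field, banach}"
  assumes "x > 0"
  shows "summable (\<lambda>k. of_real ((-1) ^ k / (fact k * pochhammer x k)) * w ^ k)"
proof (rule summable_comparison_test')
  show "summable (\<lambda>k. (norm w / x) ^ k /\<^sub>R fact k)"
    by (rule summable_exp_generic)
  fix k :: nat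
  have "norm (of_real ((-1) ^ k / (fact k * pochhammer x k)) * w ^ k) = norm w ^ k / (fact k * pochhammer x k)"
    using pochhammer_pos_real[OF assms, of k]
    by (simp add: norm_mult norm_power norm_divide abs_mult del: of_real_divide of_real_mult)
  also have "\<dots> \<le> norm w ^ k / (fact k * x ^ k)"
    using pochhammer_ge_power[of x k] assms pochhammer_pos_real[OF assms, of k]
    by (intro divide_left_mono mult_left_mono mult_pos_pos) auto
  also have "\<dots> = (norm w / x) ^ k /\<^sub>R fact k"
    by (simp add: power_divide field_simps)
  finally show "norm (of_real ((-1) ^ k / (fact k * pochhammer x k)) * w ^ k) \<le> (norm w / x) ^ k /\<^sub>R fact k" .
qed

lemma fpsA_sums:
  fixes w :: "'a :: {real_normed_field, banach}"
  assumes "H < 1"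
  shows "(\<lambda>n. of_real (fps_nth (fpsA H) n) * w ^ n) sums
    (\<Sum>k. of_real ((-1) ^ k / (fact k * pochhammer (1 - H) k)) * ((w/2)\<^sup>2) ^ k)"
proof -
  have "(\<lambda>k. of_real (fps_nth (fpsA H) (2 * k)) * w ^ (2 * k)) sums
    (\<Sum>k. of_real ((-1) ^ k / (fact k * pochhammer (1 - H) k)) * ((w/2)\<^sup>2) ^ k)"
  proof -
    have "of_real (fps_nth (fpsA H) (2 * k)) * w ^ (2 * k) =
        of_real ((-1) ^ k / (fact k * pochhammer (1 - H) k)) * ((w/2)\<^sup>2) ^ k" for k
    proof -
      have "(2::'a) ^ (2 * k) = 4 ^ k" by (simp add: power_mult)
      then show ?thesis by (simp add: fpsA_def power_divide power_mult [symmetric])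
    qed
    then show ?thesis
      using summable_sums[OF summable_bessel_aux[of "1 - H" "(w/2)\<^sup>2"]] assms by simp
  qed
  then show ?thesis
    by (subst (asm) sums_mono_reindex[where g = "\<lambda>k. 2 * k"])
       (auto simp: strict_mono_def fpsA_def image_iff elim: evenE)
qed

lemma fpsB_sums:
  fixes w :: "'a :: {real_normed_field, banach}"
  assumes "H < 1"
  shows "(\<lambda>n. of_real (fps_nth (fpsB H) n) * w ^ n) sums
    (w / (2 * of_real (1 - H)) * (\<Sum>k. of_real ((-1) ^ k / (fact k * pochhammer (2 - H) k)) * ((w/2)\<^sup>2) ^ k))"
proof -
  have "(\<lambda>k. of_real (fps_nth (fpsB H) (2 * k + 1)) * w ^ (2 * k + 1)) sums
    (w / (2 * of_real (1 - H)) * (\<Sum>k. of_real ((-1) ^ k / (fact k * pochhammer (2 - H) k)) * ((w/2)\<^sup>2) ^ k))"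
  proof -
    have "of_real (fps_nth (fpsB H) (2 * k + 1)) * w ^ (2 * k + 1) =
        w / (2 * of_real (1 - H)) * (of_real ((-1) ^ k / (fact k * pochhammer (2 - H) k)) * ((w/2)\<^sup>2) ^ k)" for k
    proof -
      have 2: "(2::'a) ^ (2 * k) = 4 ^ k" by (simp add: power_mult)
      have "1 - H \<noteq> 0" using assms by simp
      then have "of_real (1 - H) \<noteq> (0::'a)" by (simp del: of_real_diff)
      moreover have "pochhammer (2 - H) k \<noteq> 0" using pochhammer_pos_real[of "2 - H" k] assms by simp
      moreover have "complex_of_real (pochhammer (1 - H) (Suc k)) = of_real (1 - H) * of_real (pochhammer (2 - H) k)"
        by (simp add: pochhammer_rec)
      moreover have "of_real (pochhammer (1 - H) (Suc k)) = (of_real (1 - H) * of_real (pochhammer (2 - H) k) :: 'a)"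
        by (simp add: pochhammer_rec)
      moreover have "(2::'a) ^ (k * 2) = 4 ^ k" using 2 by (simp only: mult.commute)
      ultimately show ?thesis
        by (simp add: fpsB_def power_divide power_mult [symmetric] 2 field_simps del: of_real_diff pochhammer_Suc)
    qed
    then show ?thesis
      using sums_mult[OF summable_sums[OF summable_bessel_aux[of "2 - H" "(w/2)\<^sup>2"]], of "w / (2 * of_real (1 - H))"] assms
      by (simp only:)
  qed
  then show ?thesis
    by (subst (asm) sums_mono_reindex[where g = "\<lambda>k. 2 * k + 1"])
       (auto simp: strict_mono_def fpsB_def image_iff elim: oddE)
qed

lemma bessel_red_pochhammer:
  assumes "\<nu> + 1 > 0"
  shows "bessel_red \<nu> z = of_real (2 powr (-\<nu>) / Gamma (\<nu> + 1)) *
    (\<Sum>k. of_real ((-1) ^ k / (fact k * pochhammer (\<nu> + 1) k)) * ((z/2)\<^sup>2) ^ k)"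
proof -
  have nz: "\<nu> + 1 \<notin> \<int>\<^sub>\<le>\<^sub>0" using assms by (auto elim!: nonpos_Ints_cases)
  have G: "Gamma (of_nat k + \<nu> + 1) = Gamma (\<nu> + 1) * pochhammer (\<nu> + 1) k" for k
    using pochhammer_Gamma[OF nz, of k] Gamma_real_pos[OF assms] by (simp add: field_simps)
  have "(\<Sum>k. (-1) ^ k / (fact k * of_real (Gamma (of_nat k + \<nu> + 1))) * (z / 2) ^ (2 * k)) =
      (\<Sum>k. of_real (1 / Gamma (\<nu> + 1)) * (of_real ((-1) ^ k / (fact k * pochhammer (\<nu> + 1) k)) * ((z/2)\<^sup>2) ^ k))"
    unfolding G by (rule suminf_cong) (simp add: power_mult)
  also have "\<dots> = of_real (1 / Gamma (\<nu> + 1)) *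
      (\<Sum>k. of_real ((-1) ^ k / (fact k * pochhammer (\<nu> + 1) k)) * ((z/2)\<^sup>2) ^ k)"
    by (rule suminf_mult) (rule summable_bessel_aux[OF assms])
  finally show ?thesis unfolding bessel_red_def by simp
qed

lemma fpsA_conv: "H < 1 \<Longrightarrow> fps_conv_radius (fpsA H) = \<infinity>"
  unfolding fps_conv_radius_def
  by (rule conv_radius_inftyI'') (use fpsA_sums[where 'a = real] in \<open>auto simp: sums_iff\<close>)

lemma fpsB_conv: "H < 1 \<Longrightarrow> fps_conv_radius (fpsB H) = \<infinity>"
  unfolding fps_conv_radius_def
  by (rule conv_radius_inftyI'') (use fpsB_sums[where 'a = real] in \<open>auto simp: sums_iff\<close>)

text \<open>The bracket has real components, so the squared modulus of \<open>phi\<close> is the sum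
  of two real squares; the growth estimate is about that sum.\<close>

lemma phi_eq_fps:
  assumes "0 < H" "H < 1"
  shows "phi H z = exp (\<i> * of_real (z/2)) *
    (of_real (eval_fps (fpsA H) (z/2)) + \<i> * of_real (eval_fps (fpsB H) (z/2)))"
proof -
  have A: "complex_of_real (eval_fps (fpsA H) w) = of_real (Gamma (1 - H)) * of_real (2 powr (- H)) * bessel_red (- H) (of_real w)" for w
  proof -
    have "(\<lambda>n. of_real (fps_nth (fpsA H) n) * complex_of_real w ^ n) sums of_real (eval_fps (fpsA H) w)"
      using sums_of_real[OF summable_sums[OF sums_summable[OF fpsA_sums[OF assms(2), of w]]], where 'a = complex]
      by (simp add: eval_fps_def)
    from sums_unique2[OF this fpsA_sums[OF assms(2), of "complex_of_real w"]]
    have "complex_of_real (eval_fps (fpsA H) w) =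
      (\<Sum>k. of_real ((-1) ^ k / (fact k * pochhammer (1 - H) k)) * ((complex_of_real w/2)\<^sup>2) ^ k)" .
    moreover have "of_real (Gamma (1 - H)) * of_real (2 powr (- H)) * complex_of_real (2 powr (- (- H)) / Gamma (- H + 1)) = 1"
    proof -
      have "Gamma (1 - H) > 0" using assms by (intro Gamma_real_pos) simp
      moreover have "2 powr (-H) * 2 powr H = (1::real)" by (simp flip: powr_add)
      ultimately have "Gamma (1 - H) * (2 powr (- H)) * (2 powr (- (- H)) / Gamma (- H + 1)) = 1"
        by (simp add: field_simps)
      then show ?thesis by (metis of_real_mult of_real_1)
    qed
    moreover have "bessel_red (- H) (of_real w) = of_real (2 powr (- (- H)) / Gamma (- H + 1)) *
      (\<Sum>k. of_real ((-1) ^ k / (fact k * pochhammer (- H + 1) k)) * ((complex_of_real w/2)\<^sup>2) ^ k)"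
      by (rule bessel_red_pochhammer) (use assms in simp)
    ultimately show ?thesis
      by (simp only: mult.assoc[symmetric] mult_1_left) (simp add: add.commute)
  qed
  have B: "complex_of_real (eval_fps (fpsB H) w) = of_real (Gamma (1 - H)) * of_real (2 powr (- H)) *
      of_real w * bessel_red (1 - H) (of_real w)" for w
  proof -
    have "(\<lambda>n. of_real (fps_nth (fpsB H) n) * complex_of_real w ^ n) sums of_real (eval_fps (fpsB H) w)"
      using sums_of_real[OF summable_sums[OF sums_summable[OF fpsB_sums[OF assms(2), of w]]], where 'a = complex]
      by (simp add: eval_fps_def)
    from sums_unique2[OF this fpsB_sums[OF assms(2), of "complex_of_real w"]]
    have 1: "complex_of_real (eval_fps (fpsB H) w) = of_real w / (2 * of_real (1 - H)) *
      (\<Sum>k. of_real ((-1) ^ k / (fact k * pochhammer (2 - H) k)) * ((complex_of_real w/2)\<^sup>2) ^ k)" .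
    have g: "Gamma (1 - H) > 0" using assms by (intro Gamma_real_pos) simp
    have "1 - H \<notin> \<int>\<^sub>\<le>\<^sub>0" using assms by (auto elim!: nonpos_Ints_cases)
    then have g2: "Gamma (2 - H) = (1 - H) * Gamma (1 - H)" using Gamma_plus1[of "1 - H"]
      by (simp add: add.commute)
    have "2 powr (-H) * 2 powr (-(1 - H)) = (1/2::real)"
      by (subst powr_add[symmetric]) (simp add: powr_minus)
    then have "Gamma (1 - H) * (2 powr (-H)) * (2 powr (-(1 - H)) / Gamma (2 - H)) = 1 / (2 * (1 - H))"
      unfolding g2 using less_imp_neq[OF g] assms by (simp add: field_simps)
    then have "complex_of_real (Gamma (1 - H)) * of_real (2 powr (-H)) * of_real (2 powr (-(1 - H)) / Gamma (2 - H)) = 1 / (2 * of_real (1 - H))"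
      by (metis of_real_mult of_real_divide of_real_1 of_real_numeral)
    then have 2: "complex_of_real (Gamma (1 - H)) * of_real (2 powr (-H)) * of_real w * (of_real (2 powr (-(1 - H)) / Gamma (2 - H)) * S)
        = of_real w / (2 * of_real (1 - H)) * S" for S
      by (simp only: mult.assoc mult.left_commute[of _ "complex_of_real w"]) (simp only: mult.assoc[symmetric], simp)
    have "bessel_red (1 - H) (of_real w) = of_real (2 powr (- (1 - H)) / Gamma (1 - H + 1)) *
      (\<Sum>k. of_real ((-1) ^ k / (fact k * pochhammer (1 - H + 1) k)) * ((complex_of_real w/2)\<^sup>2) ^ k)"
      by (rule bessel_red_pochhammer) (use assms in simp)
    moreover have "1 - H + 1 = 2 - H" by simp
    ultimately show ?thesis unfolding 1 by (simp only: 2)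
  qed
  show ?thesis unfolding phi_entire_form[OF assms] A B by (simp add: algebra_simps)
qed

section \<open>Differential relations and the Taylor coefficients of the kernel\<close>

lemma fpsA_deriv:
  assumes "H < 1"
  shows "fps_deriv (fpsA H) = - fpsB H"
proof (rule fps_ext)
  fix n
  show "fps_nth (fps_deriv (fpsA H)) n = fps_nth (- fpsB H) n"
  proof (cases "even n")
    case False
    then obtain k where k: "n = 2 * k + 1" by (auto elim: oddE)
    define p where "p = pochhammer (1 - H) (Suc k)"
    have "p \<noteq> 0" using pochhammer_pos_real[of "1 - H" "Suc k"] assms by (simp add: p_def)
    moreover have "2 + 2 * real k \<noteq> 0" by linarith
    ultimately show ?thesis
      by (simp add: fpsA_def fpsB_def k fps_deriv_def p_def[symmetric] divide_simps)
  qed (simp add: fpsA_def fpsB_def)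
qed

text \<open>Together with \<open>fpsA_deriv\<close> this is the pair of Bessel relations for the
  derivatives of \<open>J_nu w / w powr nu\<close> at \<open>nu = - H\<close> and of
  \<open>w powr nu * J_nu w\<close> at \<open>nu = 1 - H\<close>. Since \<open>B\<close> carries the
  extra factor \<open>w powr (2 * H - 1)\<close>, a term \<open>(2 * H - 1) * B / w\<close> appears;
  multiplying by \<open>fps_X\<close> avoids the division.\<close>

lemma fpsB_deriv:
  assumes "H < 1"
  shows "fps_X * fps_deriv (fpsB H) = fps_const (2 * H - 1) * fpsB H + fps_X * fpsA H"
proof (rule fps_ext)
  fix n
  show "fps_nth (fps_X * fps_deriv (fpsB H)) n = fps_nth (fps_const (2 * H - 1) * fpsB H + fps_X * fpsA H) n"
  proof (cases "even n")
    case False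
    then obtain k where k: "n = 2 * k + 1" by (auto elim: oddE)
    have "1 - H + real k > 0" "pochhammer (1 - H) k > 0" using assms pochhammer_pos_real[of "1 - H" k] by auto
    then show ?thesis
      by (simp add: fpsA_def fpsB_def k pochhammer_Suc divide_simps) (simp add: algebra_simps)
  next
    case True
    then show ?thesis by (cases n) (auto simp: fpsA_def fpsB_def)
  qed
qed

text \<open>The Bessel series have real coefficients and are evaluated at real points, while the
  recurrence for \<open>phi\<close> needs the factor \<open>exp (i X)\<close>. This embedding
  connects the two settings.\<close>

definition fps_cx :: "real fps \<Rightarrow> complex fps" where
  "fps_cx F = Abs_fps (\<lambda>n. of_real (fps_nth F n))"

lemma fps_cx_hom:
  "fps_cx (F + G) = fps_cx F + fps_cx G" "fps_cx (- F) = - fps_cx F"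
  "fps_cx (F * G) = fps_cx F * fps_cx G" "fps_cx (fps_const c) = fps_const (of_real c)"
  "fps_cx fps_X = fps_X" "fps_cx (fps_deriv F) = fps_deriv (fps_cx F)"
  by (rule fps_ext; auto simp: fps_cx_def fps_mult_nth fps_X_def)+

lemma fps_conv_radius_cx [simp]: "fps_conv_radius (fps_cx F) = fps_conv_radius F"
proof -
  have "fps_conv_radius (fps_cx F) = fps_conv_radius (Abs_fps (\<lambda>n. norm (fps_nth (fps_cx F) n)))"
    by simp
  also have "Abs_fps (\<lambda>n. norm (fps_nth (fps_cx F) n)) = Abs_fps (\<lambda>n. norm (fps_nth F n))"
    by (simp add: fps_cx_def)
  also have "fps_conv_radius \<dots> = fps_conv_radius F" by (rule fps_conv_radius_norm)
  finally show ?thesis .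
qed

lemma eval_fps_cx:
  assumes "fps_conv_radius F = \<infinity>"
  shows "eval_fps (fps_cx F) (of_real w) = of_real (eval_fps F w)"
  unfolding eval_fps_def fps_cx_def using summable_fps[of w F] assms
  by (simp flip: of_real_power of_real_mult add: suminf_of_real)

text \<open>The letters stand for the variable \<open>X\<close>, the constant series
  \<open>c = i\<close>, the exponential \<open>E\<close>, the two Bessel series and
  \<open>b = B'\<close>. Isolated in an arbitrary commutative ring, the step is a polynomial
  identity modulo the two hypotheses.\<close>

lemma ring_step_Y:
  fixes X :: "'a :: comm_ring_1"
  assumes "c * c = - 1" "X * b = 2 * al * B + X * A"
  shows "X * (c * E * (A + c * B) + E * (- B + c * b)) =
    2 * c * (X * (E * (A + c * B))) + al * (E * (A + c * B) - E * (A - c * B))"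
proof -
  have "X * (c * E * (A + c * B) + E * (- B + c * b)) =
      c * E * X * (A + c * B) + (- 1) * E * X * B + c * E * (X * b)"
    by (simp add: algebra_simps)
  also have "\<dots> = c * E * X * (A + c * B) + (c * c) * E * X * B + c * E * (2 * al * B + X * A)"
    unfolding assms ..
  finally show ?thesis by (simp add: algebra_simps)
qed

lemma ring_step_Z:
  fixes X :: "'a :: comm_ring_1"
  assumes "c * c = - 1" "X * b = 2 * al * B + X * A"
  shows "X * (c * E * (A - c * B) + E * (- B - c * b)) =
    - (al * (E * (A + c * B) - E * (A - c * B)))"
proof -
  have "X * (c * E * (A - c * B) + E * (- B - c * b)) =
      c * E * X * (A - c * B) + (- 1) * E * X * B - c * E * (X * b)"
    by (simp add: algebra_simps)
  also have "\<dots> = c * E * X * (A - c * B) + (c * c) * E * X * B - c * E * (2 * al * B + X * A)"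
    unfolding assms ..
  finally show ?thesis by (simp add: algebra_simps)
qed

text \<open>With $Y = e^{iX}(A + iB)$ and $Z = e^{iX}(A - iB)$, the relations between $A$ and $B$ become
  $XY' = 2iXY + (H - \frac12)(Y - Z)$ and $XZ' = -(H - \frac12)(Y - Z)$; eliminating $Z$ gives a
  two-term recurrence for the coefficients of $Y$.\<close>

lemma fps_phi_nth:
  assumes "0 < H" "H < 1"
  shows "fps_nth (fps_exp \<i> * (fps_cx (fpsA H) + fps_const \<i> * fps_cx (fpsB H))) n =
    of_real (pochhammer (3/2 - H) n / pochhammer (2 - 2 * H) n) * (2 * \<i>) ^ n / fact n"
proof -
  define A where "A = fps_cx (fpsA H)"
  define B where "B = fps_cx (fpsB H)"
  define E where "E = fps_exp \<i>"
  define a :: complex where "a = of_real (H - 1/2)"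
  have dA: "fps_deriv A = - B"
    unfolding A_def B_def fps_cx_hom(6)[symmetric] fpsA_deriv[OF assms(2)] fps_cx_hom ..
  have "fps_X * fps_deriv B = fps_const (of_real (2 * H - 1)) * B + fps_X * A"
    using arg_cong[OF fpsB_deriv[OF assms(2)], of fps_cx] unfolding fps_cx_hom A_def B_def .
  moreover have "complex_of_real (2 * H - 1) = 2 * a" by (simp add: a_def)
  ultimately have dB: "fps_X * fps_deriv B = fps_const (2 * a) * B + fps_X * A" by simp
  have dE: "fps_deriv E = fps_const \<i> * E" by (simp add: E_def)
  define Y where "Y = E * (A + fps_const \<i> * B)"
  define Z where "Z = E * (A - fps_const \<i> * B)"
  define c where "c = fps_const \<i>"
  have cc: "c * c = - 1" by (simp add: c_def fps_const_mult fps_const_neg[symmetric] del: fps_const_neg)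
  have c2: "fps_const (2 * \<i>) = 2 * c" and a2: "fps_const (2 * a) = 2 * fps_const a"
    by (simp_all add: c_def numeral_fps_const)
  have dc: "fps_deriv c = 0" by (simp add: c_def)
  have YZ: "Y = E * (A + c * B)" "Z = E * (A - c * B)" by (simp_all add: Y_def Z_def c_def)
  have dY: "fps_deriv Y = c * E * (A + c * B) + E * (- B + c * fps_deriv B)"
    unfolding YZ by (simp add: dE dA dc c_def[symmetric])
  have dZ: "fps_deriv Z = c * E * (A - c * B) + E * (- B - c * fps_deriv B)"
    unfolding YZ by (simp add: dE dA dc c_def[symmetric])
  have Y': "fps_X * fps_deriv Y = fps_const (2 * \<i>) * (fps_X * Y) + fps_const a * (Y - Z)"
    unfolding dY c2 unfolding YZ by (rule ring_step_Y[OF cc dB[unfolded a2]])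
  have Z': "fps_X * fps_deriv Z = - (fps_const a * (Y - Z))"
    unfolding dZ unfolding YZ by (rule ring_step_Z[OF cc dB[unfolded a2]])
  have rec: "of_nat (Suc n) * (of_nat (Suc n) - 2 * a) * fps_nth Y (Suc n) = 2 * \<i> * (of_nat (Suc n) - a) * fps_nth Y n" for n
  proof -
    define N :: complex where "N = of_nat (Suc n)"
    have 1: "N * fps_nth Y (Suc n) = 2 * \<i> * fps_nth Y n + a * (fps_nth Y (Suc n) - fps_nth Z (Suc n))"
      using arg_cong[OF Y', of "\<lambda>F. fps_nth F (Suc n)"] by (simp add: N_def)
    have 2: "N * fps_nth Z (Suc n) = - a * (fps_nth Y (Suc n) - fps_nth Z (Suc n))"
      using arg_cong[OF Z', of "\<lambda>F. fps_nth F (Suc n)"] by (simp add: N_def)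
    \<comment> \<open>Multiplying by \<open>N - a\<close> eliminates the coefficient of
      \<open>Z\<close> without dividing.\<close>
    have "N * (N - 2 * a) * fps_nth Y (Suc n) = 2 * \<i> * (N - a) * fps_nth Y n"
    proof -
      have z: "(N - a) * fps_nth Z (Suc n) = - a * fps_nth Y (Suc n)"
        using 2 by (simp add: algebra_simps)
      have "(N - a) * (N * fps_nth Y (Suc n)) =
          2 * \<i> * (N - a) * fps_nth Y n + a * ((N - a) * fps_nth Y (Suc n)) - a * ((N - a) * fps_nth Z (Suc n))"
        unfolding 1 by (simp add: algebra_simps)
      then show ?thesis unfolding z by (simp add: algebra_simps)
    qed
    then show ?thesis by (simp add: N_def)
  qed
  have "fps_nth Y n = of_real (pochhammer (3/2 - H) n / pochhammer (2 - 2 * H) n) * (2 * \<i>) ^ n / fact n"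
  proof (induction n)
    case 0
    then show ?case by (simp add: Y_def E_def A_def B_def fps_cx_def fpsA_def fpsB_def)
  next
    case (Suc n)
    define N :: complex where "N = of_nat (Suc n)"
    define p :: complex where "p = of_real (2 - 2 * H + real n)"
    define q :: complex where "q = of_real (3/2 - H + real n)"
    have pN: "p = N - 2 * a" "q = N - a" by (auto simp: p_def q_def N_def a_def)
    have "2 - 2 * H + real n \<noteq> 0" using assms by simp
    then have p: "p \<noteq> 0" unfolding p_def by (simp only: of_real_eq_0_iff) simp
    have N: "N \<noteq> 0" by (simp add: N_def del: of_nat_Suc)
    have fN: "fact (Suc n) = N * fact n" by (simp add: N_def)
    have P: "complex_of_real (pochhammer (3/2 - H) (Suc n) / pochhammer (2 - 2 * H) (Suc n)) =
        of_real (pochhammer (3/2 - H) n / pochhammer (2 - 2 * H) n) * q / p"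
      by (simp add: pochhammer_Suc q_def p_def)
    have "N * p * fps_nth Y (Suc n) = 2 * \<i> * q * fps_nth Y n"
      using rec[of n] unfolding pN N_def .
    then have "fps_nth Y (Suc n) = 2 * \<i> * q * fps_nth Y n / (N * p)"
      using p N by (simp add: field_simps)
    then show ?case unfolding Suc.IH fN P using p N by (simp add: field_simps)
  qed
  then show ?thesis by (simp add: Y_def E_def A_def B_def)
qed

text \<open>This is Kummer's function 1F1 with parameters \<open>3/2 - H\<close> and
  \<open>2 - 2 * H\<close> at \<open>i z\<close>. The Pochhammer quotient is the one whose
  reciprocal occurs in the moments of the kernels \<open>x_t\<close>.\<close>

lemma phi_sums:
  assumes "0 < H" "H < 1"
  shows "(\<lambda>n. of_real (pochhammer (3/2 - H) n / pochhammer (2 - 2 * H) n) * (\<i> * of_real z) ^ n / fact n)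
    sums phi H z"
proof -
  define A where "A = fps_cx (fpsA H)"
  define B where "B = fps_cx (fpsB H)"
  define E where "E = fps_exp \<i>"
  have cA: "fps_conv_radius A = \<infinity>" "fps_conv_radius B = \<infinity>" "fps_conv_radius E = \<infinity>"
    using fpsA_conv fpsB_conv assms by (auto simp: A_def B_def E_def)
  have ciB: "fps_conv_radius (fps_const \<i> * B) = \<infinity>"
    using fps_conv_radius_mult[of "fps_const \<i>" B] cA by simp
  have cAB: "fps_conv_radius (A + fps_const \<i> * B) = \<infinity>"
    using fps_conv_radius_add[of A "fps_const \<i> * B"] cA ciB by simp
  have cY: "fps_conv_radius (E * (A + fps_const \<i> * B)) = \<infinity>"
    using fps_conv_radius_mult[of E "A + fps_const \<i> * B"] cA cAB by simp
  \<comment> \<open>The series is evaluated at \<open>z / 2\<close>, where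
    \<open>(2 * i) ^ n * (z / 2) ^ n\<close> combines to \<open>(i z) ^ n\<close>.\<close>
  let ?w = "complex_of_real (z/2)"
  have "eval_fps (E * (A + fps_const \<i> * B)) ?w = exp (\<i> * ?w) * (eval_fps A ?w + \<i> * eval_fps B ?w)"
    using cA cAB ciB by (simp add: eval_fps_mult eval_fps_add E_def eval_fps_exp)
  also have "\<dots> = phi H z"
    unfolding A_def B_def phi_eq_fps[OF assms]
    using eval_fps_cx[OF fpsA_conv[OF assms(2)], of "z/2"] eval_fps_cx[OF fpsB_conv[OF assms(2)], of "z/2"] by simp
  finally have "(\<lambda>n. fps_nth (E * (A + fps_const \<i> * B)) n * ?w ^ n) sums phi H z"
    using sums_eval_fps[of ?w "E * (A + fps_const \<i> * B)"] cY by simp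
  also have "(\<lambda>n. fps_nth (E * (A + fps_const \<i> * B)) n * ?w ^ n) =
      (\<lambda>n. of_real (pochhammer (3/2 - H) n / pochhammer (2 - 2 * H) n) * (\<i> * of_real z) ^ n / fact n)"
    unfolding A_def B_def E_def fps_phi_nth[OF assms]
    by (auto simp: power_mult_distrib power_divide)
  finally show ?thesis .
qed

section \<open>Continuity and growth of the kernel\<close>

lemma continuous_phi:
  assumes "0 < H" "H < 1"
  shows "continuous_on UNIV (phi H)"
proof -
  have "continuous_on UNIV (eval_fps (fpsA H))" "continuous_on UNIV (eval_fps (fpsB H))"
    using fpsA_conv fpsB_conv assms
    by (auto intro!: continuous_on_subset[OF continuous_on_eval_fps] simp: eball_def)
  then have "continuous_on UNIV (\<lambda>z. eval_fps (fpsA H) (z/2))" "continuous_on UNIV (\<lambda>z. eval_fps (fpsB H) (z/2))"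
    using continuous_on_compose2[of UNIV "eval_fps (fpsA H)" UNIV "\<lambda>z. z / 2"]
      continuous_on_compose2[of UNIV "eval_fps (fpsB H)" UNIV "\<lambda>z. z / 2"]
    by (simp_all add: continuous_on_divide continuous_on_id)
  then have "continuous_on UNIV (\<lambda>z. exp (\<i> * of_real (z/2)) *
    (of_real (eval_fps (fpsA H) (z/2)) + \<i> * of_real (eval_fps (fpsB H) (z/2))))"
    by (intro continuous_on_mult continuous_on_add continuous_on_of_real continuous_on_const
      continuous_on_exp continuous_on_divide continuous_on_id) auto
  then show ?thesis unfolding phi_eq_fps[OF assms, abs_def] .
qed

lemma borel_measurable_phi [measurable]:
  assumes "0 < H" "H < 1"
  shows "phi H \<in> borel_measurable borel"
  using continuous_phi[OF assms] by (rule borel_measurable_continuous_onI)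

text \<open>Since \<open>B' = (2H - 1) B / w + A\<close> and \<open>A' = - B\<close>, the quantity \<open>(A\<^sup>2 + B\<^sup>2) / w\<^sup>2\<close> is decreasing for \<open>w > 0\<close>.\<close>

lemma phi_bound:
  assumes "0 < H" "H < 1"
  obtains C where "C \<ge> 0" "\<And>z. cmod (phi H z) \<le> C * (1 + \<bar>z\<bar>)"
proof -
  define A where "A = eval_fps (fpsA H)"
  define B where "B = eval_fps (fpsB H)"
  have dA: "(A has_real_derivative - B w) (at w)" for w
    using has_field_derivative_eval_fps[of w "fpsA H"] fpsA_conv[OF assms(2)] fpsB_conv[OF assms(2)]
    by (simp add: A_def B_def fpsA_deriv[OF assms(2)] eval_fps_minus)
  have dB: "(B has_real_derivative eval_fps (fps_deriv (fpsB H)) w) (at w)" for w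
    using has_field_derivative_eval_fps[of w "fpsB H"] fpsB_conv[OF assms(2)]
    by (simp add: B_def)
  have dB': "w * eval_fps (fps_deriv (fpsB H)) w = (2 * H - 1) * B w + w * A w" for w
  proof -
    have c: "fps_conv_radius (fps_deriv (fpsB H)) = \<infinity>"
      using fps_conv_radius_deriv[of "fpsB H"] fpsB_conv[OF assms(2)] by simp
    have c1: "fps_conv_radius (fps_const (2 * H - 1) * fpsB H) = \<infinity>"
      using fps_conv_radius_mult[of "fps_const (2 * H - 1)" "fpsB H"] fpsB_conv[OF assms(2)] by simp
    have c2: "fps_conv_radius (fps_X * fpsA H) = \<infinity>"
      using fps_conv_radius_mult[of fps_X "fpsA H"] fpsA_conv[OF assms(2)] by simp
    show ?thesis using arg_cong[OF fpsB_deriv[OF assms(2)], of "\<lambda>F. eval_fps F w"]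
      using c c1 c2 fpsA_conv[OF assms(2)] fpsB_conv[OF assms(2)]
      by (simp add: eval_fps_mult eval_fps_add A_def B_def)
  qed
  define G where "G w = ((A w)\<^sup>2 + (B w)\<^sup>2) / w\<^sup>2" for w
  \<comment> \<open>Monotonicity is used only from \<open>w = 1\<close> on, away from the
    singularity of \<open>G\<close> at 0. The remaining range, \<open>z\<close> between 0 and 2, is
    compact and covered by continuity.\<close>
  have G: "G w \<le> G 1" if "w \<ge> 1" for w
  proof (rule DERIV_nonpos_imp_nonincreasing[OF that])
    fix x :: real assume x: "1 \<le> x" "x \<le> w"
    define B' where "B' = eval_fps (fps_deriv (fpsB H)) x"
    have B': "x * B' = (2 * H - 1) * B x + x * A x" using dB'[of x] by (simp add: B'_def)
    have "(G has_real_derivative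
        ((2 * A x * (- B x) + 2 * B x * B') * x\<^sup>2 - ((A x)\<^sup>2 + (B x)\<^sup>2) * (2 * x)) / (x\<^sup>2 * x\<^sup>2)) (at x)"
      unfolding G_def[abs_def] B'_def using x
      by (auto intro!: derivative_eq_intros dA dB simp: power2_eq_square)
    moreover have "((2 * A x * (- B x) + 2 * B x * B') * x\<^sup>2 - ((A x)\<^sup>2 + (B x)\<^sup>2) * (2 * x)) / (x\<^sup>2 * x\<^sup>2) \<le> 0"
    proof -
      have "(2 * A x * (- B x) + 2 * B x * B') * x\<^sup>2 - ((A x)\<^sup>2 + (B x)\<^sup>2) * (2 * x) =
          2 * x * (B x * (x * B') - A x * B x * x - (A x)\<^sup>2 - (B x)\<^sup>2)"
        by (simp add: power2_eq_square algebra_simps)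
      also have "\<dots> = 2 * x * (- ((2 - 2 * H) * (B x)\<^sup>2) - (A x)\<^sup>2)"
        unfolding B' by (simp add: power2_eq_square algebra_simps)
      also have "\<dots> \<le> 0"
      proof -
        have "0 \<le> (2 - 2 * H) * (B x)\<^sup>2" using assms by simp
        then have "- ((2 - 2 * H) * (B x)\<^sup>2) - (A x)\<^sup>2 \<le> 0" using zero_le_power2[of "A x"] by linarith
        then show ?thesis using x by (intro mult_nonneg_nonpos) auto
      qed
      finally show ?thesis by (intro divide_nonpos_nonneg) auto
    qed
    ultimately show "\<exists>y. (G has_real_derivative y) (at x) \<and> y \<le> 0" by blast
  qed
  \<comment> \<open>\<open>A\<close> is even and \<open>B\<close> is odd, so the modulus of
    \<open>phi\<close> is even and \<open>z >= 0\<close> may be assumed.\<close>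
  have even: "A (- w) = A w" "B (- w) = - B w" for w
  proof -
    have "fps_nth (fpsA H) n * (- w) ^ n = fps_nth (fpsA H) n * w ^ n" for n
      by (cases "even n") (auto simp: fpsA_def)
    then show "A (- w) = A w" unfolding A_def eval_fps_def by (rule suminf_cong)
    have "fps_nth (fpsB H) n * (- w) ^ n = - (fps_nth (fpsB H) n * w ^ n)" for n
      by (cases "even n") (auto simp: fpsB_def)
    moreover have "summable (\<lambda>n. fps_nth (fpsB H) n * w ^ n)"
      using summable_fps[of w "fpsB H"] fpsB_conv[OF assms(2)] by simp
    ultimately show "B (- w) = - B w" by (simp add: B_def eval_fps_def suminf_minus)
  qed
  have cm: "(cmod (phi H z))\<^sup>2 = (A (z/2))\<^sup>2 + (B (z/2))\<^sup>2" for z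
  proof -
    have "cmod (of_real (A (z/2)) + \<i> * of_real (B (z/2))) = sqrt ((A (z/2))\<^sup>2 + (B (z/2))\<^sup>2)"
      by (simp add: cmod_def)
    moreover have "cmod (exp (\<i> * of_real (z/2))) = 1" by (simp add: norm_exp_i_times)
    ultimately have "cmod (phi H z) = sqrt ((A (z/2))\<^sup>2 + (B (z/2))\<^sup>2)"
      unfolding phi_eq_fps[OF assms] norm_mult A_def B_def by simp
    then show ?thesis by simp
  qed
  have abs_eq: "cmod (phi H z) = cmod (phi H \<bar>z\<bar>)" for z
  proof -
    have "(cmod (phi H z))\<^sup>2 = (cmod (phi H \<bar>z\<bar>))\<^sup>2"
      unfolding cm using even[of "z/2"] by (cases "z \<ge> 0") auto
    then show ?thesis by (simp add: power2_eq_iff_nonneg)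
  qed
  have "bounded (phi H ` {0..2})"
    by (intro compact_imp_bounded compact_continuous_image continuous_on_subset[OF continuous_phi[OF assms]]) auto
  then obtain K where K: "\<And>z. z \<in> {0..2} \<Longrightarrow> cmod (phi H z) \<le> K"
    unfolding bounded_iff by (meson imageI)
  have "cmod (phi H 0) \<le> K" by (rule K) simp
  then have K0: "K \<ge> 0" using norm_ge_zero[of "phi H 0"] by linarith
  define C where "C = K + sqrt (G 1)"
  have G1: "G 1 \<ge> 0" by (simp add: G_def)
  have C: "cmod (phi H z) \<le> C * (1 + z)" if z: "z \<ge> 0" for z
  proof (cases "z \<le> 2")
    case True
    have "cmod (phi H z) \<le> K" using K z True by simp
    also have "K \<le> C * 1" using G1 by (simp add: C_def)
    also have "\<dots> \<le> C * (1 + z)" using z K0 G1 by (intro mult_left_mono) (auto simp: C_def)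
    finally show ?thesis .
  next
    case False
    have "(cmod (phi H z))\<^sup>2 = G (z/2) * (z/2)\<^sup>2" using False by (simp add: cm G_def)
    also have "\<dots> \<le> G 1 * (z/2)\<^sup>2" using False by (intro mult_right_mono G) auto
    also have "\<dots> = (sqrt (G 1) * (z/2))\<^sup>2" unfolding power_mult_distrib using G1 by simp
    finally have "cmod (phi H z) \<le> sqrt (G 1) * (z/2)"
      by (rule power2_le_imp_le) (use G1 z in simp)
    also have "\<dots> \<le> C * (1 + z)" using z K0 G1 by (intro mult_mono) (auto simp: C_def)
    finally show ?thesis .
  qed
  show ?thesis
  proof (rule that[of C])
    show "C \<ge> 0" using K0 G1 by (simp add: C_def)
    show "cmod (phi H z) \<le> C * (1 + \<bar>z\<bar>)" for z using C[of "\<bar>z\<bar>"] abs_eq[of z] by simp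
  qed
qed

section \<open>Gamma and Beta integrals\<close>

text \<open>These integrals are evaluated as extended nonnegative integrals: Tonelli's theorem then
  needs no prior integrability, which instead follows from the finite value.\<close>

lemma nn_integral_Gamma:
  assumes "p > 0" "c > 0"
  shows "(\<integral>\<^sup>+x. ennreal (indicator {0<..} x * x powr (p - 1) * exp (- (c * x))) \<partial>lborel) = ennreal (Gamma p / c powr p)"
proof -
  define g where "g x = ennreal (indicator {0<..} x * x powr (p - 1) * exp (- (c * x)))" for x :: real
  have [measurable]: "g \<in> borel_measurable borel" unfolding g_def[abs_def] by measurable
  have "(\<integral>\<^sup>+x. g x \<partial>lborel) = \<bar>1 / c\<bar> * (\<integral>\<^sup>+x. g (0 + 1 / c * x) \<partial>lborel)"
    using assms by (intro nn_integral_real_affine) auto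
  also have "(\<integral>\<^sup>+x. g (0 + 1 / c * x) \<partial>lborel) =
      (\<integral>\<^sup>+x. ennreal (1 / c powr (p - 1)) * ennreal (indicator {0..} x * x powr (p - 1) / exp x) \<partial>lborel)"
    using assms
    by (intro nn_integral_cong)
       (auto simp: g_def indicator_def powr_divide exp_minus field_simps zero_less_mult_iff
          zero_less_divide_iff ennreal_mult'[symmetric])
  also have "\<dots> = ennreal (1 / c powr (p - 1)) * ennreal (Gamma p)"
    using assms by (subst nn_integral_cmult) (auto simp: Gamma_conv_nn_integral_real)
  also have "ennreal \<bar>1 / c\<bar> * (ennreal (1 / c powr (p - 1)) * ennreal (Gamma p)) = ennreal (Gamma p / c powr p)"
    using assms Gamma_real_pos[of p]
    by (simp add: ennreal_mult'[symmetric] powr_diff field_simps)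
  finally show ?thesis by (simp add: g_def)
qed

lemma nn_integral_Beta:
  assumes "p > 0" "q > 0" "v > 0"
  shows "(\<integral>\<^sup>+x. ennreal (indicator {0<..<v} x * x powr (p - 1) * (v - x) powr (q - 1)) \<partial>lborel) =
    ennreal (v powr (p + q - 1) * Beta p q)"
proof -
  define g where "g x = ennreal (indicator {0<..<v} x * x powr (p - 1) * (v - x) powr (q - 1))" for x :: real
  have [measurable]: "g \<in> borel_measurable borel" unfolding g_def[abs_def] by measurable
  have B: "(\<integral>\<^sup>+x. ennreal (indicator {0..1} x * (x powr (p - 1) * (1 - x) powr (q - 1))) \<partial>lborel) = ennreal (Beta p q)"
    using nn_integral_has_integral_lebesgue[OF _ has_integral_Beta_real[OF assms(1,2)]] by simp
  have Bpos: "Beta p q \<ge> 0" using assms Gamma_real_pos by (auto simp: Beta_def intro!: divide_nonneg_pos mult_nonneg_nonneg less_imp_le)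
  have "(\<integral>\<^sup>+x. g x \<partial>lborel) = \<bar>v\<bar> * (\<integral>\<^sup>+x. g (0 + v * x) \<partial>lborel)"
    using assms by (intro nn_integral_real_affine) auto
  also have "(\<integral>\<^sup>+x. g (0 + v * x) \<partial>lborel) =
      (\<integral>\<^sup>+x. ennreal (v powr (p + q - 2)) * ennreal (indicator {0..1} x * (x powr (p - 1) * (1 - x) powr (q - 1))) \<partial>lborel)"
  proof (intro nn_integral_cong_AE)
    have "AE x in lborel. x \<noteq> 0 \<and> x \<noteq> (1::real)" using AE_lborel_singleton[of 0] AE_lborel_singleton[of 1] by eventually_elim simp
    then show "AE x in lborel. g (0 + v * x) =
        ennreal (v powr (p + q - 2)) * ennreal (indicator {0..1} x * (x powr (p - 1) * (1 - x) powr (q - 1)))"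
    proof eventually_elim
      case (elim x)
      show ?case
      proof (cases "0 < x \<and> x < 1")
        case True
        have "v - v * x = v * (1 - x)" by (simp add: algebra_simps)
        moreover have "v powr (p - 1) * v powr (q - 1) = v powr (p + q - 2)"
          by (subst powr_add[symmetric]) (simp add: algebra_simps)
        ultimately show ?thesis using True assms
          by (simp add: g_def powr_mult ennreal_mult'[symmetric] mult_ac)
      next
        case False
        then show ?thesis using elim assms
          by (auto simp: g_def indicator_def zero_less_mult_iff)
      qed
    qed
  qed
  also have "\<dots> = ennreal (v powr (p + q - 2)) * ennreal (Beta p q)"
    unfolding B[symmetric] by (rule nn_integral_cmult) auto
  also have "ennreal \<bar>v\<bar> * (ennreal (v powr (p + q - 2)) * ennreal (Beta p q)) = ennreal (v powr (p + q - 1) * Beta p q)"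
  proof -
    have "v powr (p + q - 1) = v powr (1 + (p + q - 2))" by (simp add: algebra_simps)
    also have "\<dots> = v * v powr (p + q - 2)" using assms by (subst powr_add) simp
    finally show ?thesis using assms Bpos by (simp add: ennreal_mult'[symmetric] mult_ac)
  qed
  finally show ?thesis by (simp add: g_def)
qed

lemma Beta_nonneg_real: "p > 0 \<Longrightarrow> q > 0 \<Longrightarrow> Beta p (q::real) \<ge> 0"
  by (auto simp: Beta_def intro!: divide_nonneg_pos mult_nonneg_nonneg less_imp_le Gamma_real_pos)

text \<open>Writing \<open>(1 + s) powr - (p + q)\<close> as a Gamma integral reduces the improper Beta integral to
  three Gamma integrals.\<close>

lemma nn_integral_Beta_prime:
  assumes "p > 0" "q > 0"
  shows "(\<integral>\<^sup>+s. ennreal (indicator {0<..} s * s powr (p - 1) * (1 + s) powr (- p - q)) \<partial>lborel) = ennreal (Beta p q)"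
proof -
  define h where "h s y = ennreal (indicator {0<..} s * s powr (p - 1) * (indicator {0<..} y * y powr (p + q - 1) * exp (- ((1 + s) * y))))" for s y :: real
  have [measurable]: "(\<lambda>(s, y). h s y) \<in> borel_measurable (lborel \<Otimes>\<^sub>M lborel)"
    unfolding h_def[abs_def] by measurable
  have G: "Gamma p > 0" "Gamma q > 0" "Gamma (p + q) > 0" using assms Gamma_real_pos by auto
  have 1: "(\<integral>\<^sup>+y. h s y \<partial>lborel) = ennreal (Gamma (p + q)) * ennreal (indicator {0<..} s * s powr (p - 1) * (1 + s) powr (- p - q))" for s
  proof (cases "s > 0")
    case True
    have "(\<integral>\<^sup>+y. h s y \<partial>lborel) = (\<integral>\<^sup>+y. ennreal (s powr (p - 1)) * ennreal (indicator {0<..} y * y powr (p + q - 1) * exp (- ((1 + s) * y))) \<partial>lborel)"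
      using True by (intro nn_integral_cong) (simp add: h_def ennreal_mult'[symmetric])
    also have "\<dots> = ennreal (s powr (p - 1)) * ennreal (Gamma (p + q) / (1 + s) powr (p + q))"
      using assms True by (subst nn_integral_cmult) (auto simp: nn_integral_Gamma)
    also have "\<dots> = ennreal (Gamma (p + q)) * ennreal (indicator {0<..} s * s powr (p - 1) * (1 + s) powr (- p - q))"
    proof -
      have "(1 + s) powr (- p - q) = inverse ((1 + s) powr (p + q))"
        by (subst powr_minus[symmetric]) simp
      then show ?thesis using True G by (simp add: ennreal_mult'[symmetric] field_simps)
    qed
    finally show ?thesis .
  qed (simp add: h_def)
  have 2: "(\<integral>\<^sup>+s. h s y \<partial>lborel) = ennreal (Gamma p) * ennreal (indicator {0<..} y * y powr (q - 1) * exp (- (1 * y)))" for y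
  proof (cases "y > 0")
    case True
    have "(\<integral>\<^sup>+s. h s y \<partial>lborel) = (\<integral>\<^sup>+s. ennreal (y powr (p + q - 1) * exp (- y)) * ennreal (indicator {0<..} s * s powr (p - 1) * exp (- (y * s))) \<partial>lborel)"
      using True by (intro nn_integral_cong) (simp add: h_def ennreal_mult'[symmetric] algebra_simps exp_diff exp_minus divide_inverse)
    also have "\<dots> = ennreal (y powr (p + q - 1) * exp (- y)) * ennreal (Gamma p / y powr p)"
      using assms True by (subst nn_integral_cmult) (auto simp: nn_integral_Gamma)
    also have "\<dots> = ennreal (Gamma p) * ennreal (indicator {0<..} y * y powr (q - 1) * exp (- (1 * y)))"
    proof -
      have "y powr (p + q - 1) = y powr p * y powr (q - 1)"
        by (subst powr_add[symmetric]) (simp add: algebra_simps)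
      then show ?thesis using True G by (simp add: ennreal_mult'[symmetric] field_simps)
    qed
    finally show ?thesis .
  qed (simp add: h_def)
  let ?I = "\<integral>\<^sup>+s. ennreal (indicator {0<..} s * s powr (p - 1) * (1 + s) powr (- p - q)) \<partial>lborel"
  have "ennreal (Gamma (p + q)) * ?I = (\<integral>\<^sup>+s. \<integral>\<^sup>+y. h s y \<partial>lborel \<partial>lborel)"
    unfolding 1 by (subst nn_integral_cmult) auto
  also have "\<dots> = (\<integral>\<^sup>+y. \<integral>\<^sup>+s. h s y \<partial>lborel \<partial>lborel)"
    by (rule lborel_pair.Fubini') measurable
  also have "\<dots> = ennreal (Gamma p) * ennreal (Gamma q)"
    unfolding 2 by (subst nn_integral_cmult) (use assms nn_integral_Gamma[of q 1] in auto)
  also have "\<dots> = ennreal (Gamma (p + q)) * ennreal (Beta p q)"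
    using G by (simp add: Beta_def ennreal_mult'[symmetric])
  finally show ?thesis using G
    by (subst (asm) ennreal_mult_cancel_left) auto
qed

lemma Beta_one_right: "p > 0 \<Longrightarrow> Beta p 1 = 1 / (p::real)"
proof -
  assume p: "p > 0"
  then have "p \<notin> \<int>\<^sub>\<le>\<^sub>0" by (auto elim!: nonpos_Ints_cases)
  from Gamma_plus1[OF this] show ?thesis using p less_imp_neq[OF Gamma_real_pos[OF p]]
    by (simp add: Beta_def)
qed

lemma nn_integral_powr_Ioo:
  assumes "p > 0" "v > 0"
  shows "(\<integral>\<^sup>+x. ennreal (indicator {0<..<v} x * x powr (p - 1)) \<partial>lborel) = ennreal (v powr p / p)"
proof -
  have "(\<integral>\<^sup>+x. ennreal (indicator {0<..<v} x * x powr (p - 1)) \<partial>lborel) =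
      (\<integral>\<^sup>+x. ennreal (indicator {0<..<v} x * x powr (p - 1) * (v - x) powr (1 - 1)) \<partial>lborel)"
    by (intro nn_integral_cong) (auto simp: indicator_def)
  also have "\<dots> = ennreal (v powr p / p)"
    using assms by (subst nn_integral_Beta) (auto simp: Beta_one_right)
  finally show ?thesis .
qed

lemma integrable_powr_Ioo:
  fixes p v :: real
  assumes "p > 0"
  shows "integrable lborel (\<lambda>x. if 0 < x \<and> x < v then x powr (p - 1) else 0)"
proof (cases "v > 0")
  case True
  have "(\<integral>\<^sup>+x. ennreal (if 0 < x \<and> x < v then x powr (p - 1) else 0) \<partial>lborel) = ennreal (v powr p / p)"
    unfolding nn_integral_powr_Ioo[OF assms True, symmetric]
    by (intro nn_integral_cong) (auto simp: indicator_def)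
  then show ?thesis by (intro integrableI_nonneg) auto
next
  case False
  then have "(\<lambda>x. if 0 < x \<and> x < v then x powr (p - 1) else 0) = (\<lambda>x. 0)" by (auto simp: fun_eq_iff)
  then show ?thesis by simp
qed

lemma has_bochner_integral_powr_tail:
  fixes e t :: real
  assumes "e > 0" "t > 0"
  shows "has_bochner_integral lborel (\<lambda>v. if t \<le> v then v powr (- e - 1) else 0) (t powr (- e) / e)"
proof -
  have "(\<integral>\<^sup>+v. ennreal (v powr (- e - 1)) * indicator {t..} v \<partial>lborel) = 0 - (- (t powr (- e)) / e)"
  proof (rule nn_integral_FTC_atLeast)
    show "DERIV (\<lambda>v. - (v powr (- e)) / e) v :> v powr (- e - 1)" if "t \<le> v" for v
      using that assms by (auto intro!: derivative_eq_intros simp: field_simps)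
    show "((\<lambda>v. - (v powr (- e)) / e) \<longlongrightarrow> 0) at_top"
    proof -
      have "((\<lambda>v. v powr (- e)) \<longlongrightarrow> 0) at_top"
        using tendsto_neg_powr[of "- e" "\<lambda>v. v" at_top] assms by (simp add: filterlim_ident)
      from tendsto_divide[OF tendsto_minus[OF this] tendsto_const[of e]] assms show ?thesis by simp
    qed
  qed auto
  then have "(\<integral>\<^sup>+v. ennreal (if t \<le> v then v powr (- e - 1) else 0) \<partial>lborel) = ennreal (t powr (- e) / e)"
    by (subst nn_integral_cong[of _ _ "\<lambda>v. ennreal (v powr (- e - 1)) * indicator {t..} v"])
       (auto simp: indicator_def)
  then show ?thesis using assms by (intro has_bochner_integral_nn_integral) auto
qed

section \<open>The time side\<close>

text \<open>All exponents become affine in \<open>a\<close>, and Brownian motion is the case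
  \<open>a = 0\<close>. As a locale parameter, \<open>a\<close> is opaque to simplification and is
  related to \<open>H\<close> only where \<open>a_bounds\<close> is invoked.\<close>

locale hurst =
  fixes H a :: real
  assumes H: "0 < H" "H < 1" and a_def: "a = H - 1/2"
begin

lemma a_bounds: "-1/2 < a" "a < 1/2" "2 * H = 2 * a + 1" "3/2 - H = 1 - a" "2 - 2 * H = 1 - 2 * a"
  "1 - 2 * H = - (2 * a)" "H - 1/2 = a" "H - 3/2 = a - 1" "H + 1/2 = a + 1" "3 - 2 * H = 2 - 2 * a"
  using H a_def by auto

text \<open>On the positive half-line \<open>V_fun\<close> has derivative
  \<open>V_const * u powr (- 2 * a)\<close>, so this is \<open>d_sq H * (2 - 2 * H)\<close> with the
  factor absorbed into the Gamma function.\<close>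

definition V_const :: real where
  "V_const = Gamma (1 - a) / (2 * H * Gamma (1 + a) * Gamma (1 - 2 * a))"

lemma Gammas_pos: "Gamma (1 - a) > 0" "Gamma (1 + a) > 0" "Gamma (1 - 2 * a) > 0"
  using a_bounds by (auto intro!: Gamma_real_pos)

lemma V_const_pos: "V_const > 0"
  unfolding V_const_def using Gammas_pos H by simp

lemma d_sq_eq: "d_sq H = V_const / (1 - 2 * a)"
proof -
  have "1 - 2 * a \<notin> \<int>\<^sub>\<le>\<^sub>0" using a_bounds by (auto elim!: nonpos_Ints_cases)
  from Gamma_plus1[OF this] have "Gamma (2 - 2 * a) = (1 - 2 * a) * Gamma (1 - 2 * a)"
    by (simp add: algebra_simps)
  then show ?thesis unfolding d_sq_def V_const_def a_bounds(4,9,10) by (simp add: add.commute mult_ac)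
qed

lemma d_sq_pos: "d_sq H > 0"
  unfolding d_sq_eq using V_const_pos a_bounds by simp

definition Vdens :: "real \<Rightarrow> real" where
  "Vdens u = indicator {0<..} u * (V_const * u powr (- 2 * a))"

lemma Vdens_measurable [measurable]: "Vdens \<in> borel_measurable borel"
  unfolding Vdens_def[abs_def] by measurable

lemma Vdens_nonneg: "Vdens u \<ge> 0"
  using V_const_pos by (simp add: Vdens_def)

lemma V_fun_mono: "x \<le> y \<Longrightarrow> V_fun H x \<le> V_fun H y"
  using d_sq_pos H by (auto simp: V_fun_def intro!: mult_left_mono powr_mono2)

lemma V_fun_continuous: "continuous_on UNIV (V_fun H)"
proof -
  have "V_fun H = (\<lambda>t. d_sq H * (max t 0) powr (2 - 2 * H))"
    by (auto simp: V_fun_def fun_eq_iff max_def)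
  moreover have "continuous_on UNIV (\<lambda>t. d_sq H * (max t 0) powr (2 - 2 * H))"
    using H by (intro continuous_intros continuous_on_powr') auto
  ultimately show ?thesis by simp
qed

lemma nn_integral_Vdens_Ioc:
  assumes "T > 0"
  shows "(\<integral>\<^sup>+u. ennreal (Vdens u) * indicator {..T} u \<partial>lborel) = ennreal (V_fun H T)"
proof -
  have "(\<integral>\<^sup>+u. ennreal (Vdens u) * indicator {..T} u \<partial>lborel) =
      (\<integral>\<^sup>+u. ennreal V_const * ennreal (indicator {0<..<T} u * u powr ((1 - 2 * a) - 1)) \<partial>lborel)"
  proof (rule nn_integral_cong_AE)
    show "AE u in lborel. ennreal (Vdens u) * indicator {..T} u =
        ennreal V_const * ennreal (indicator {0<..<T} u * u powr ((1 - 2 * a) - 1))"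
      using AE_lborel_singleton[of T]
      by eventually_elim (use V_const_pos in \<open>auto simp: Vdens_def indicator_def ennreal_mult'\<close>)
  qed
  also have "\<dots> = ennreal V_const * ennreal (T powr (1 - 2 * a) / (1 - 2 * a))"
    using assms a_bounds by (subst nn_integral_cmult) (auto simp only: nn_integral_powr_Ioo, auto)
  also have "\<dots> = ennreal (V_fun H T)"
    unfolding V_fun_def a_bounds(5)
    using assms a_bounds V_const_pos by (simp add: d_sq_eq ennreal_mult'[symmetric])
  finally show ?thesis .
qed

text \<open>Half-open intervals are stable under intersection and generate the Borel sets, and both
  measures give them the increment of \<open>V_fun\<close>. On the density side the increment is a
  difference of half-lines, legitimate because these have finite mass.\<close>

lemma interval_measure_V: "interval_measure (V_fun H) = density lborel (\<lambda>u. ennreal (Vdens u))"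
proof (rule measure_eqI_generator_eq)
  let ?I = "interval_measure (V_fun H)" and ?D = "density lborel (\<lambda>u. ennreal (Vdens u))"
  let ?E = "range (\<lambda>(a, b). {a<..b::real})"
  show "Int_stable ?E"
  proof (rule Int_stableI_image)
    fix p q :: "real \<times> real"
    obtain a b c d where "p = (a, b)" "q = (c, d)" by (cases p; cases q)
    then show "\<exists>r\<in>UNIV. (case p of (a, b) \<Rightarrow> {a<..b}) \<inter> (case q of (a, b) \<Rightarrow> {a<..b}) = (case r of (a, b) \<Rightarrow> {a<..b})"
      by (intro bexI[of _ "(max a c, min b d)"]) auto
  qed
  show "?E \<subseteq> Pow UNIV" "sets ?I = sigma_sets UNIV ?E" "sets ?D = sigma_sets UNIV ?E"
    by (auto simp: borel_sigma_sets_Ioc)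
  have cont: "continuous (at_right b) (V_fun H)" for b
    using V_fun_continuous by (simp add: continuous_on_eq_continuous_at continuous_at_imp_continuous_at_within)
  have I: "emeasure ?I {x<..y} = ennreal (V_fun H y - V_fun H x)" if "x \<le> y" for x y
    using that V_fun_mono cont by (intro emeasure_interval_measure_Ioc) auto
  have D: "emeasure ?D {..x} = ennreal (V_fun H x)" for x
  proof (cases "x > 0")
    case True
    then show ?thesis using nn_integral_Vdens_Ioc[OF True] by (simp add: emeasure_density)
  next
    case False
    then have "(\<lambda>u. ennreal (Vdens u) * indicator {..x} u) = (\<lambda>_. 0)"
      by (auto simp: Vdens_def indicator_def fun_eq_iff)
    then show ?thesis using False by (simp add: emeasure_density V_fun_def)
  qed
  have D': "emeasure ?D {x<..y} = ennreal (V_fun H y - V_fun H x)" if "x \<le> y" for x y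
  proof -
    have "{x<..y} = {..y} - {..x}" by auto
    then have "emeasure ?D {x<..y} = emeasure ?D {..y} - emeasure ?D {..x}"
      using that D[of x] by (simp add: emeasure_Diff)
    moreover have "V_fun H x \<ge> 0" using d_sq_pos by (simp add: V_fun_def)
    ultimately show ?thesis unfolding D by (simp add: ennreal_minus)
  qed
  show "emeasure ?I X = emeasure ?D X" if X: "X \<in> ?E" for X
  proof -
    from X obtain x y where "X = {x<..y}" by auto
    then show ?thesis using I[of x y] D'[of x y] by (cases "x \<le> y") auto
  qed
  show "range (\<lambda>n::nat. {- real n<..real n}) \<subseteq> ?E" by auto
  show "(\<Union>n::nat. {- real n<..real n}) = UNIV"
  proof -
    have "\<exists>n::nat. - real n < x \<and> x \<le> real n" for x
    proof -
      obtain n :: nat where "\<bar>x\<bar> < real n" using reals_Archimedean2 by blast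
      then show ?thesis by (intro exI[of _ n]) auto
    qed
    then show ?thesis by auto
  qed
  show "emeasure ?I {- real n<..real n} \<noteq> \<infinity>" for n :: nat
    using I[of "- real n" "real n"] by simp
qed

lemma V_measure_eq: "V_measure H T = restrict_space (density lborel (\<lambda>u. ennreal (Vdens u))) {0..T}"
  unfolding V_measure_def interval_measure_V ..

lemma space_V [simp]: "space (V_measure H T) = {0..T}"
  by (simp add: V_measure_eq space_restrict_space)

lemma borel_measurable_V: "f \<in> borel_measurable borel \<Longrightarrow> f \<in> borel_measurable (V_measure H T)"
  unfolding V_measure_eq by (intro measurable_restrict_space1) simp

lemma nn_integral_V:
  assumes [measurable]: "f \<in> borel_measurable borel"
  shows "(\<integral>\<^sup>+u. f u \<partial>V_measure H T) = (\<integral>\<^sup>+u. ennreal (indicator {0..T} u * Vdens u) * f u \<partial>lborel)"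
proof -
  have "(\<integral>\<^sup>+u. f u \<partial>V_measure H T) = (\<integral>\<^sup>+u. f u * indicator {0..T} u \<partial>density lborel (\<lambda>u. ennreal (Vdens u)))"
    unfolding V_measure_eq by (rule nn_integral_restrict_space) auto
  also have "\<dots> = (\<integral>\<^sup>+u. ennreal (Vdens u) * (f u * indicator {0..T} u) \<partial>lborel)"
    by (rule nn_integral_density) auto
  also have "\<dots> = (\<integral>\<^sup>+u. ennreal (indicator {0..T} u * Vdens u) * f u \<partial>lborel)"
    by (intro nn_integral_cong) (auto simp: indicator_def)
  finally show ?thesis .
qed

lemma has_bochner_integral_V:
  fixes f :: "real \<Rightarrow> 'b :: {banach, second_countable_topology}"
  assumes [measurable]: "f \<in> borel_measurable borel"
    and "has_bochner_integral lborel (\<lambda>u. (indicator {0..T} u * Vdens u) *\<^sub>R f u) I"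
  shows "integrable (V_measure H T) f" "(\<integral>u. f u \<partial>V_measure H T) = I"
proof -
  have "has_bochner_integral lborel (\<lambda>u. Vdens u *\<^sub>R (indicator {0..T} u *\<^sub>R f u)) I"
    using assms(2) by (simp add: mult.commute)
  then have "has_bochner_integral (density lborel (\<lambda>u. ennreal (Vdens u))) (\<lambda>u. indicator {0..T} u *\<^sub>R f u) I"
    using Vdens_nonneg by (intro has_bochner_integral_density) auto
  then show "integrable (V_measure H T) f" "(\<integral>u. f u \<partial>V_measure H T) = I"
    unfolding V_measure_eq
    by (auto simp: integrable_restrict_space integral_restrict_space has_bochner_integral_iff)
qed

lemma finite_measure_V: "T > 0 \<Longrightarrow> finite_measure (V_measure H T)"
proof
  assume T: "T > 0"
  have "emeasure (V_measure H T) (space (V_measure H T)) = (\<integral>\<^sup>+u. 1 \<partial>V_measure H T)" by simp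
  also have "\<dots> = (\<integral>\<^sup>+u. ennreal (indicator {0..T} u * Vdens u) * 1 \<partial>lborel)"
    by (rule nn_integral_V) simp
  also have "\<dots> = (\<integral>\<^sup>+u. ennreal (Vdens u) * indicator {..T} u \<partial>lborel)"
    by (intro nn_integral_cong) (auto simp: indicator_def Vdens_def)
  finally show "emeasure (V_measure H T) (space (V_measure H T)) \<noteq> \<infinity>"
    using nn_integral_Vdens_Ioc[OF T] by simp
qed

end

section \<open>The binomial series\<close>

lemma binomial_sums:
  fixes e x :: real
  assumes "\<bar>x\<bar> < 1"
  shows "(\<lambda>k. pochhammer (- e) k / fact k * x ^ k) sums (1 - x) powr e"
proof -
  have "(\<lambda>k. (e gchoose k) * (- x) ^ k) sums (1 + - x) powr e"
    using assms by (intro gen_binomial_real) simp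
  moreover have "(e gchoose k) * (- x) ^ k = pochhammer (- e) k / fact k * x ^ k" for k
    unfolding gbinomial_pochhammer power_minus[of x k]
    by (simp add: power_mult_distrib[symmetric])
  ultimately show ?thesis by simp
qed

text \<open>A power series that converges at the larger point \<open>(1 + x) / 2\<close> converges
  absolutely at \<open>x\<close>.\<close>

lemma binomial_abs_summable:
  fixes e x :: real
  assumes "0 \<le> x" "x < 1"
  shows "summable (\<lambda>k. \<bar>pochhammer (- e) k\<bar> / fact k * x ^ k)"
proof -
  have y: "\<bar>(1 + x) / 2\<bar> < 1" and xy: "norm x < norm ((1 + x) / 2)" using assms by auto
  have "summable (\<lambda>k. norm (pochhammer (- e) k / fact k * x ^ k))"
    by (rule powser_insidea[OF sums_summable[OF binomial_sums[OF y]] xy])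
  then show ?thesis using assms by (simp add: abs_mult power_abs)
qed

section \<open>The kernels x_t: closed form, sign and expansion\<close>

context hurst
begin

text \<open>The exponent \<open>b\<close> is left free because the integral occurs with
  \<open>b = a - 1\<close> in the definition of the kernel and with \<open>b = a - 2\<close> after
  integration by parts.\<close>

definition kernel_int :: "real \<Rightarrow> real \<Rightarrow> real \<Rightarrow> real" where
  "kernel_int b t u = (\<integral>v. (if u < v \<and> v < t then (v - u) powr a * v powr b else 0) \<partial>lborel)"

lemma kernel_int_measurable [measurable]: "kernel_int b t \<in> borel_measurable borel"
  unfolding kernel_int_def[abs_def] by measurable

lemma kernel_int_integrable:
  assumes "0 < u"
  shows "integrable lborel (\<lambda>v. if u < v \<and> v < t then (v - u) powr a * v powr b else 0)"
proof (rule Bochner_Integration.integrable_bound)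
  have "integrable lborel (\<lambda>x. if 0 < - u + 1 * x \<and> - u + 1 * x < t - u then (- u + 1 * x) powr ((a + 1) - 1) else 0)"
    using a_bounds by (intro lborel_integrable_real_affine[OF integrable_powr_Ioo]) auto
  \<comment> \<open>The sum \<open>u powr b + t powr b\<close> bounds \<open>v powr b\<close>
    between \<open>u\<close> and \<open>t\<close> for either sign of \<open>b\<close>.\<close>
  then show "integrable lborel (\<lambda>v. (u powr b + t powr b) * (if u < v \<and> v < t then (v - u) powr a else 0))"
    by (intro integrable_mult_right) (simp cong: if_cong)
  show "AE v in lborel. norm (if u < v \<and> v < t then (v - u) powr a * v powr b else 0)
      \<le> norm ((u powr b + t powr b) * (if u < v \<and> v < t then (v - u) powr a else 0))"
  proof (rule AE_I2)
    fix v
    show "norm (if u < v \<and> v < t then (v - u) powr a * v powr b else 0)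
      \<le> norm ((u powr b + t powr b) * (if u < v \<and> v < t then (v - u) powr a else 0))"
    proof (cases "u < v \<and> v < t")
      case True
      have "v powr b \<le> u powr b + t powr b"
      proof (cases "b \<ge> 0")
        case True
        then have "v powr b \<le> t powr b" using \<open>u < v \<and> v < t\<close> assms by (intro powr_mono2) auto
        then show ?thesis by (simp add: add_increasing)
      next
        case False
        then have "v powr b \<le> u powr b" using \<open>u < v \<and> v < t\<close> assms by (intro powr_mono2') auto
        then show ?thesis by (simp add: add_increasing2)
      qed
      then have "(v - u) powr a * v powr b \<le> (u powr b + t powr b) * (v - u) powr a"
        by (subst mult.commute) (intro mult_right_mono, auto)
      then show ?thesis using True by (auto simp: abs_mult)
    qed auto
  qed
qed measurable

definition xr :: "real \<Rightarrow> real \<Rightarrow> real" where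
  "xr t u = (if 0 < u \<and> u < t then 2 * H * (t powr a * (t - u) powr a - a * kernel_int (a - 1) t u) else 0)"

lemma xr_measurable [measurable]: "xr t \<in> borel_measurable borel"
  unfolding xr_def[abs_def] by measurable

lemma x_fun_eq: "x_fun H t u = of_real (xr t u)"
proof (cases "0 < u \<and> u < t")
  case True
  have "(LINT v:{u..t}|lborel. (v - u) powr a * (a * v powr (a - 1))) =
      (\<integral>v. a * (if u < v \<and> v < t then (v - u) powr a * v powr (a - 1) else 0) \<partial>lborel)"
    unfolding set_lebesgue_integral_def
  proof (rule integral_cong_AE)
    show "AE v in lborel. indicator {u..t} v *\<^sub>R ((v - u) powr a * (a * v powr (a - 1))) =
        a * (if u < v \<and> v < t then (v - u) powr a * v powr (a - 1) else 0)"
      using AE_lborel_singleton[of u] AE_lborel_singleton[of t]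
      by eventually_elim (auto simp: indicator_def)
  qed measurable
  also have "\<dots> = a * kernel_int (a - 1) t u" by (simp add: kernel_int_def)
  finally show ?thesis using True unfolding x_fun_def xr_def a_bounds by simp
qed (auto simp: x_fun_def xr_def)

text \<open>Integration by parts lowers the exponent to \<open>a - 2\<close>, for which the integral up to infinity converges.\<close>

lemma kernel_int_parts:
  assumes "0 < u" "u < t"
  shows "2 * a * kernel_int (a - 1) t u = t powr (a - 1) * (t - u) powr (a + 1) - (1 - a) * u * kernel_int (a - 2) t u"
proof -
  define F where "F v = v powr (a - 1) * (v - u) powr (a + 1)" for v
  define f where "f v = 2 * a * ((v - u) powr a * v powr (a - 1)) + (1 - a) * u * ((v - u) powr a * v powr (a - 2))" for v
  have "(f has_integral (F t - F u)) {u..t}"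
  \<comment> \<open>For \<open>a < 0\<close> the integrand is unbounded at \<open>v = u\<close>. The
    interior version needs only that \<open>F\<close> is continuous on the closed interval, which
    holds since \<open>a + 1 > 0\<close>.\<close>
  proof (rule fundamental_theorem_of_calculus_interior)
    show "continuous_on {u..t} F"
      unfolding F_def using assms a_bounds
      by (intro continuous_intros continuous_on_powr') auto
    show "(F has_vector_derivative f v) (at v)" if v: "v \<in> {u<..<t}" for v
    proof -
      have "(F has_real_derivative ((a - 1) * v powr (a - 2) * (v - u) powr (a + 1) + v powr (a - 1) * ((a + 1) * (v - u) powr a))) (at v)"
        unfolding F_def[abs_def] using v assms
        by (auto intro!: derivative_eq_intros simp: algebra_simps)
      moreover have "(a - 1) * v powr (a - 2) * (v - u) powr (a + 1) + v powr (a - 1) * ((a + 1) * (v - u) powr a) = f v"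
      proof -
        have 1: "(v - u) powr (a + 1) = (v - u) powr a * (v - u)" using v by (simp add: powr_add)
        have "v powr (a - 1) = v powr ((a - 2) + 1)" by simp
        also have "\<dots> = v powr (a - 2) * v" using v assms by (subst powr_add) simp
        finally show ?thesis unfolding f_def 1 by (simp add: algebra_simps)
      qed
      ultimately show ?thesis by (simp add: has_real_derivative_iff_has_vector_derivative)
    qed
  qed (use assms in simp)
  moreover have "(f has_integral (2 * a * kernel_int (a - 1) t u + (1 - a) * u * kernel_int (a - 2) t u)) {u..t}"
  proof -
    let ?g = "\<lambda>v. 2 * a * (if u < v \<and> v < t then (v - u) powr a * v powr (a - 1) else 0) +
      (1 - a) * u * (if u < v \<and> v < t then (v - u) powr a * v powr (a - 2) else 0)"
    have g: "integrable lborel ?g"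
      by (intro Bochner_Integration.integrable_add integrable_mult_right kernel_int_integrable assms)
    have "integral\<^sup>L lborel ?g = 2 * a * kernel_int (a - 1) t u + (1 - a) * u * kernel_int (a - 2) t u"
      unfolding kernel_int_def using kernel_int_integrable[OF assms(1)] by simp
    with has_integral_integral_lborel[OF g]
    have "(?g has_integral (2 * a * kernel_int (a - 1) t u + (1 - a) * u * kernel_int (a - 2) t u)) UNIV" by simp
    also have "?g = (\<lambda>v. if v \<in> {u<..<t} then f v else 0)" by (auto simp: f_def fun_eq_iff)
    finally have "(f has_integral (2 * a * kernel_int (a - 1) t u + (1 - a) * u * kernel_int (a - 2) t u)) {u<..<t}"
      by (simp only: has_integral_restrict_UNIV)
    then show ?thesis by (simp add: has_integral_Icc_iff_Ioo)
  qed
  ultimately have "F t - F u = 2 * a * kernel_int (a - 1) t u + (1 - a) * u * kernel_int (a - 2) t u"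
    by (rule has_integral_unique)
  then show ?thesis by (simp add: F_def)
qed

lemma xr_closed:
  assumes "0 < u" "u < t"
  shows "xr t u = 2 * H * (t powr a * (t - u) powr a - t powr (a - 1) * (t - u) powr (a + 1) / 2
    + (1 - a) / 2 * u * kernel_int (a - 2) t u)"
proof -
  have "a * kernel_int (a - 1) t u = t powr (a - 1) * (t - u) powr (a + 1) / 2 - (1 - a) / 2 * u * kernel_int (a - 2) t u"
    using kernel_int_parts[OF assms] by (simp add: field_simps)
  then show ?thesis using assms unfolding xr_def by (simp only: if_True conj_absorb) simp
qed

lemma kernel_int_nonneg: "kernel_int b t u \<ge> 0"
  unfolding kernel_int_def by (rule Bochner_Integration.integral_nonneg) auto

text \<open>For \<open>a > 0\<close> the definition subtracts a nonnegative integral, so the sign is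
  not visible there. After integration by parts the only negative term is at most half of the first
  one, because \<open>t - u <= t\<close>. The sign makes integrals of moduli equal to moments, which
  justifies the termwise integrations below.\<close>

lemma xr_nonneg: "xr t u \<ge> 0"
proof (cases "0 < u \<and> u < t")
  case True
  have "t powr (a - 1) * (t - u) powr (a + 1) = t powr (a - 1) * (t - u) * (t - u) powr a"
    using True by (simp add: powr_add)
  also have "\<dots> \<le> t powr (a - 1) * t * (t - u) powr a"
    using True by (intro mult_right_mono mult_left_mono) auto
  also have "t powr (a - 1) * t = t powr a" using True by (simp add: powr_diff)
  finally have "t powr (a - 1) * (t - u) powr (a + 1) / 2 \<le> t powr a * (t - u) powr a"
  proof -
    assume le: "t powr (a - 1) * (t - u) powr (a + 1) \<le> t powr a * (t - u) powr a"
    have "0 \<le> t powr a * (t - u) powr a" by (intro mult_nonneg_nonneg powr_ge_zero)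
    with le show ?thesis by linarith
  qed
  moreover have "0 \<le> (1 - a) / 2 * u * kernel_int (a - 2) t u"
    using True a_bounds kernel_int_nonneg by simp
  ultimately show ?thesis using True H by (subst xr_closed) auto
qed (auto simp: xr_def)

definition beta :: real where "beta = Beta (a + 1) (1 - 2 * a)"

definition kernel_tail :: "real \<Rightarrow> real \<Rightarrow> real" where
  "kernel_tail t u = (\<integral>v. (if t \<le> v then (v - u) powr a * v powr (a - 2) else 0) \<partial>lborel)"

text \<open>The substitution \<open>v = u * (1 + s)\<close> gives the integrand
  \<open>s powr a * (1 + s) powr (a - 2)\<close>, an improper Beta integral with parameters
  \<open>a + 1\<close> and \<open>1 - 2 * a\<close>.\<close>

lemma nn_integral_kernel_infinity:
  assumes "0 < u"
  shows "(\<integral>\<^sup>+v. ennreal (if u < v then (v - u) powr a * v powr (a - 2) else 0) \<partial>lborel) = ennreal (u powr (2 * a - 1) * beta)"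
proof -
  define g where "g v = ennreal (if u < v then (v - u) powr a * v powr (a - 2) else 0)" for v
  have [measurable]: "g \<in> borel_measurable borel" unfolding g_def[abs_def] by measurable
  have "(\<integral>\<^sup>+v. g v \<partial>lborel) = \<bar>u\<bar> * (\<integral>\<^sup>+s. g (u + u * s) \<partial>lborel)"
    using assms by (intro nn_integral_real_affine) auto
  also have "(\<integral>\<^sup>+s. g (u + u * s) \<partial>lborel) =
     (\<integral>\<^sup>+s. ennreal (u powr (2 * a - 2)) * ennreal (indicator {0<..} s * s powr ((a + 1) - 1) * (1 + s) powr (- (a + 1) - (1 - 2 * a))) \<partial>lborel)"
  proof (intro nn_integral_cong)
    fix s
    show "g (u + u * s) = ennreal (u powr (2 * a - 2)) * ennreal (indicator {0<..} s * s powr ((a + 1) - 1) * (1 + s) powr (- (a + 1) - (1 - 2 * a)))"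
    proof (cases "s > 0")
      case True
      have "g (u + u * s) = ennreal ((u * s) powr a * (u * (1 + s)) powr (a - 2))"
        using True assms by (simp add: g_def algebra_simps)
      moreover have "u powr (2 * a - 2) = u powr a * u powr (a - 2)" by (subst powr_add[symmetric]) simp
      ultimately show ?thesis using True assms
        by (simp add: powr_mult ennreal_mult'[symmetric] mult_ac)
    next
      case False
      then show ?thesis using assms by (auto simp: g_def zero_less_mult_iff)
    qed
  qed
  also have "\<dots> = ennreal (u powr (2 * a - 2)) * ennreal beta"
    unfolding beta_def using a_bounds nn_integral_Beta_prime[of "a + 1" "1 - 2 * a"]
    by (subst nn_integral_cmult) auto
  also have "ennreal \<bar>u\<bar> * (ennreal (u powr (2 * a - 2)) * ennreal beta) = ennreal (u powr (2 * a - 1) * beta)"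
  proof -
    have "u powr (2 * a - 1) = u powr (1 + (2 * a - 2))" by (simp add: algebra_simps)
    also have "\<dots> = u * u powr (2 * a - 2)" using assms by (subst powr_add) simp
    finally have "u powr (2 * a - 1) = u * u powr (2 * a - 2)" .
    moreover have "beta \<ge> 0" unfolding beta_def using a_bounds by (intro Beta_nonneg_real) auto
    ultimately show ?thesis using assms by (simp add: ennreal_mult'[symmetric])
  qed
  finally show ?thesis by (simp add: g_def)
qed

text \<open>The integral up to infinity is homogeneous in \<open>u\<close> and carries the whole
  singularity at \<open>u = 0\<close>; what is removed, the part beyond \<open>t\<close>, has a
  power series in \<open>u / t\<close>.\<close>

lemma kernel_int_eq_tail:
  assumes "0 < u" "u < t"
  shows "kernel_int (a - 2) t u = u powr (2 * a - 1) * beta - kernel_tail t u"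
proof -
  let ?f = "\<lambda>v. if u < v then (v - u) powr a * v powr (a - 2) else 0"
  have f: "integrable lborel ?f \<and> integral\<^sup>L lborel ?f = u powr (2 * a - 1) * beta"
  proof -
    have "beta \<ge> 0" unfolding beta_def using a_bounds by (intro Beta_nonneg_real) auto
    then show ?thesis
      using nn_integral_kernel_infinity[OF assms(1)]
      by (subst nn_integral_eq_integrable[symmetric]) auto
  qed
  have t: "integrable lborel (\<lambda>v. if t \<le> v then (v - u) powr a * v powr (a - 2) else 0)"
    by (rule Bochner_Integration.integrable_bound[OF conjunct1[OF f]]) (use assms in auto)
  have "integral\<^sup>L lborel ?f = (\<integral>v. (if u < v \<and> v < t then (v - u) powr a * v powr (a - 2) else 0) +
      (if t \<le> v then (v - u) powr a * v powr (a - 2) else 0) \<partial>lborel)"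
    by (rule Bochner_Integration.integral_cong) (use assms in auto)
  also have "\<dots> = kernel_int (a - 2) t u + kernel_tail t u"
    unfolding kernel_int_def kernel_tail_def using kernel_int_integrable[OF assms(1)] t by simp
  finally show ?thesis using f by simp
qed

definition binom_coeff :: "nat \<Rightarrow> real" where "binom_coeff k = pochhammer (- a) k / fact k"

text \<open>For \<open>v >= t > u\<close> the factor \<open>(v - u) powr a\<close> equals
  \<open>v powr a * (1 - u / v) powr a\<close>, whose binomial series is integrated term by term.
  The integrated moduli are dominated by the absolutely convergent series at
  \<open>u / t\<close>.\<close>

lemma kernel_tail_sums:
  assumes "0 < u" "u < t"
  shows "(\<lambda>k. binom_coeff k * u ^ k * (t powr (2 * a - 1 - real k) / (real k + 1 - 2 * a))) sums kernel_tail t u"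
proof -
  define f where "f k v = (if t \<le> v then binom_coeff k * u ^ k * v powr (2 * a - 2 - real k) else 0)" for k :: nat and v :: real
  have hb: "has_bochner_integral lborel (\<lambda>v. if t \<le> v then v powr (2 * a - 2 - real k) else 0) (t powr (2 * a - 1 - real k) / (real k + 1 - 2 * a))" for k
  proof -
    have "- (real k + 1 - 2 * a) = 2 * a - 1 - real k" "- (real k + 1 - 2 * a) - 1 = 2 * a - 2 - real k"
      "real k + 1 - 2 * a > 0" using a_bounds by auto
    with has_bochner_integral_powr_tail[of "real k + 1 - 2 * a" t] assms show ?thesis
      by (simp only:)
  qed
  have f: "has_bochner_integral lborel (f k) (binom_coeff k * u ^ k * (t powr (2 * a - 1 - real k) / (real k + 1 - 2 * a)))" for k
  proof -
    have "f k = (\<lambda>v. (binom_coeff k * u ^ k) * (if t \<le> v then v powr (2 * a - 2 - real k) else 0))" by (auto simp: f_def)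
    then show ?thesis using has_bochner_integral_mult_right[OF hb[of k], of "binom_coeff k * u ^ k"] by simp
  qed
  have nf: "has_bochner_integral lborel (\<lambda>v. norm (f k v)) (\<bar>binom_coeff k\<bar> * u ^ k * (t powr (2 * a - 1 - real k) / (real k + 1 - 2 * a)))" for k
  proof -
    have "(\<lambda>v. norm (f k v)) = (\<lambda>v. (\<bar>binom_coeff k\<bar> * u ^ k) * (if t \<le> v then v powr (2 * a - 2 - real k) else 0))"
      using assms by (auto simp: f_def abs_mult fun_eq_iff)
    then show ?thesis using has_bochner_integral_mult_right[OF hb[of k], of "\<bar>binom_coeff k\<bar> * u ^ k"] by simp
  qed
  have sums_f: "(\<lambda>k. f k v) sums (if t \<le> v then (v - u) powr a * v powr (a - 2) else 0)
      \<and> summable (\<lambda>k. norm (f k v))" for v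
  proof (cases "t \<le> v")
    case True
    then have v: "v > 0" "u / v < 1" "0 \<le> u / v" using assms by auto
    have fk: "f k v = v powr (2 * a - 2) * (binom_coeff k * (u / v) ^ k)" for k
      using True v assms by (simp add: f_def powr_diff powr_realpow power_divide)
    have "(\<lambda>k. f k v) sums (v powr (2 * a - 2) * (1 - u / v) powr a)"
      unfolding fk binom_coeff_def using v assms by (intro sums_mult binomial_sums) auto
    also have "v powr (2 * a - 2) * (1 - u / v) powr a = (v - u) powr a * v powr (a - 2)"
    proof -
      have "1 - u / v = (v - u) / v" using v by (simp add: field_simps)
      moreover have "v powr (2 * a - 2) = v powr a * v powr (a - 2)" by (subst powr_add[symmetric]) simp
      ultimately show ?thesis using True assms v by (simp add: powr_divide)
    qed
    finally have "(\<lambda>k. f k v) sums ((v - u) powr a * v powr (a - 2))" .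
    moreover have "summable (\<lambda>k. norm (f k v))"
    proof -
      have "summable (\<lambda>k. v powr (2 * a - 2) * (\<bar>pochhammer (- a) k\<bar> / fact k * (u / v) ^ k))"
        by (intro summable_mult binomial_abs_summable v)
      moreover have "norm (f k v) = v powr (2 * a - 2) * (\<bar>pochhammer (- a) k\<bar> / fact k * (u / v) ^ k)" for k
        unfolding fk binom_coeff_def using v assms by (simp add: abs_mult power_abs)
      ultimately show ?thesis by simp
    qed
    ultimately show ?thesis using True by simp
  qed (auto simp: f_def)
  have "summable (\<lambda>k. \<integral>v. norm (f k v) \<partial>lborel)"
  proof (rule summable_comparison_test')
    show "summable (\<lambda>k. t powr (2 * a - 1) / (1 - 2 * a) * (\<bar>pochhammer (- a) k\<bar> / fact k * (u / t) ^ k))"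
      using assms by (intro summable_mult binomial_abs_summable) auto
    fix k :: nat
    have "(\<integral>v. norm (f k v) \<partial>lborel) = t powr (2 * a - 1) / (real k + 1 - 2 * a) * (\<bar>binom_coeff k\<bar> * (u / t) ^ k)"
      using has_bochner_integral_integral_eq[OF nf[of k]] assms
      by (simp add: powr_diff powr_realpow power_divide mult_ac)
    also have "\<dots> \<le> t powr (2 * a - 1) / (1 - 2 * a) * (\<bar>binom_coeff k\<bar> * (u / t) ^ k)"
      using a_bounds assms by (intro mult_right_mono divide_left_mono) auto
    finally show "norm (\<integral>v. norm (f k v) \<partial>lborel) \<le> t powr (2 * a - 1) / (1 - 2 * a) * (\<bar>pochhammer (- a) k\<bar> / fact k * (u / t) ^ k)"
      by (simp add: binom_coeff_def)
  qed
  then have "(\<lambda>k. integral\<^sup>L lborel (f k)) sums (\<integral>v. (\<Sum>k. f k v) \<partial>lborel)"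
    using f sums_f by (intro sums_integral) (auto simp: has_bochner_integral_iff)
  also have "(\<integral>v. (\<Sum>k. f k v) \<partial>lborel) = kernel_tail t u"
    unfolding kernel_tail_def using sums_f by (simp add: sums_iff)
  finally show ?thesis using has_bochner_integral_integral_eq[OF f] by simp
qed

text \<open>Apart from the singular term \<open>(u / t) powr (2 * a)\<close>, the kernel is a power series in \<open>u / t\<close>;
  integrating it against \<open>x\<^sub>s\<close> term by term gives the binomial series of \<open>(1 - s / t) powr (2 * H)\<close>.\<close>

definition xr_coeff :: "nat \<Rightarrow> real" where
  "xr_coeff k = pochhammer (- (2 * a)) k * pochhammer (1 - a) k / (2 * (fact k * pochhammer (1 - 2 * a) k))"

text \<open>The three contributions come from \<open>(1 - x) powr a\<close>, from
  \<open>(1 - x) powr (a + 1)\<close> and from the tail. The tail appears with index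
  \<open>j\<close> because \<open>xr_closed\<close> multiplies the integral by a further factor
  \<open>u\<close>.\<close>

lemma xr_coeff_Suc:
  "xr_coeff (Suc j) = binom_coeff (Suc j) - pochhammer (- (a + 1)) (Suc j) / fact (Suc j) / 2 - (1 - a) / 2 * (binom_coeff j / (real j + 1 - 2 * a))"
proof -
  define N where "N = real (Suc j)"
  have N: "N > 0" "N - 2 * a > 0" "real j = N - 1" using a_bounds by (auto simp: N_def)
  define P where "P = pochhammer (- a) j"
  have f: "fact (Suc j) = N * (fact j :: real)" by (simp add: N_def)
  have 1: "pochhammer (- a) (Suc j) = P * (N - 1 - a)" by (simp add: P_def pochhammer_Suc N)
  have 2: "pochhammer (- (a + 1)) (Suc j) = - ((a + 1) * P)" by (simp add: P_def pochhammer_rec algebra_simps)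
  have 3: "pochhammer (- (2 * a)) (Suc j) = - 2 * a * pochhammer (1 - 2 * a) j" by (simp add: pochhammer_rec)
  have 4: "pochhammer (1 - 2 * a) (Suc j) = pochhammer (1 - 2 * a) j * (N - 2 * a)" by (simp add: pochhammer_Suc N)
  \<comment> \<open>Both sides are \<open>pochhammer (- a) (j + 2)\<close>. The factor
    \<open>- a\<close> stays on the left, since dividing by it is impossible for
    \<open>H = 1/2\<close>.\<close>
  have 5: "- a * pochhammer (1 - a) (Suc j) = P * (N - 1 - a) * (N - a)"
    using pochhammer_rec[of "- a" "Suc j"] by (simp add: pochhammer_Suc[of "- a"] P_def N algebra_simps)
  have "pochhammer (1 - 2 * a) j > 0" using a_bounds by (intro pochhammer_pos) simp
  then have "xr_coeff (Suc j) = - a * pochhammer (1 - a) (Suc j) / (N * fact j * (N - 2 * a))"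
    unfolding xr_coeff_def 3 4 f using N by (simp add: field_simps)
  also have "\<dots> = P * (N - 1 - a) * (N - a) / (N * fact j * (N - 2 * a))" unfolding 5 ..
  also have "\<dots> = P * (N - 1 - a) / (N * fact j) + (a + 1) * P / (N * fact j) / 2 - (1 - a) / 2 * (P / fact j / (N - 2 * a))"
  proof -
    have "(fact j :: real) > 0" by simp
    then show ?thesis using N(1,2) by (simp add: divide_simps) (simp add: algebra_simps)
  qed
  finally show ?thesis unfolding binom_coeff_def 1 2 f N(3) P_def by (simp del: minus_add_distrib minus_diff_eq)
qed

lemma xr_sums:
  assumes "0 < u" "u < t"
  shows "(\<lambda>k. xr_coeff k * (u / t) ^ k) sums (xr t u / (2 * H * t powr (2 * a)) - (1 - a) / 2 * beta * (u / t) powr (2 * a))"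
proof -
  define x where "x = u / t"
  have x: "0 < x" "x < 1" "u = t * x" "t > 0" using assms by (auto simp: x_def)
  define D where "D = kernel_tail t u * u / t powr (2 * a)"
  have s1: "(\<lambda>k. binom_coeff k * x ^ k) sums (1 - x) powr a"
    unfolding binom_coeff_def using x by (intro binomial_sums) auto
  have s2: "(\<lambda>k. pochhammer (- (a + 1)) k / fact k * x ^ k) sums (1 - x) powr (a + 1)"
    using x by (intro binomial_sums) auto
  have s3: "(\<lambda>k. binom_coeff k / (real k + 1 - 2 * a) * x ^ Suc k) sums D"
  proof -
    have "(\<lambda>k. binom_coeff k * u ^ k * (t powr (2 * a - 1 - real k) / (real k + 1 - 2 * a)) * (u / t powr (2 * a))) sums (kernel_tail t u * (u / t powr (2 * a)))"
      by (rule sums_mult2[OF kernel_tail_sums[OF assms]])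
    moreover have "binom_coeff k * u ^ k * (t powr (2 * a - 1 - real k) / (real k + 1 - 2 * a)) * (u / t powr (2 * a)) = binom_coeff k / (real k + 1 - 2 * a) * x ^ Suc k" for k
      using x by (simp add: powr_diff powr_realpow power_mult_distrib divide_simps)
    ultimately show ?thesis by (simp add: D_def)
  qed
  \<comment> \<open>The tail series starts at the first power of \<open>x\<close>; a zero
    coefficient in front aligns it with the two binomial series.\<close>
  define d where "d k = (case k of 0 \<Rightarrow> 0 | Suc j \<Rightarrow> binom_coeff j / (real j + 1 - 2 * a) * x ^ Suc j)" for k
  have s3': "d sums D"
    using s3 sums_Suc_iff[of d "D"] by (simp add: d_def)
  have "(\<lambda>k. binom_coeff k * x ^ k - 1 / 2 * (pochhammer (- (a + 1)) k / fact k * x ^ k) - (1 - a) / 2 * d k) sums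
      ((1 - x) powr a - 1 / 2 * (1 - x) powr (a + 1) - (1 - a) / 2 * D)"
    by (intro sums_diff sums_mult s1 s2 s3')
  moreover have "binom_coeff k * x ^ k - 1 / 2 * (pochhammer (- (a + 1)) k / fact k * x ^ k) - (1 - a) / 2 * d k = xr_coeff k * x ^ k" for k
  proof (cases k)
    case 0
    then show ?thesis by (simp add: binom_coeff_def xr_coeff_def d_def)
  next
    case (Suc j)
    show ?thesis unfolding Suc xr_coeff_Suc by (simp add: d_def algebra_simps)
  qed
  moreover have "(1 - x) powr a - 1 / 2 * (1 - x) powr (a + 1) - (1 - a) / 2 * D =
      xr t u / (2 * H * t powr (2 * a)) - (1 - a) / 2 * beta * x powr (2 * a)"
  proof -
    have tu: "t - u = t * (1 - x)" using x by (simp add: algebra_simps)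
    have e1: "t powr a * (t - u) powr a = t powr (2 * a) * (1 - x) powr a"
      unfolding tu using x by (simp add: powr_mult powr_add[symmetric] mult.assoc[symmetric])
    have "t powr (a - 1) * t powr (a + 1) = t powr (2 * a)" by (subst powr_add[symmetric]) simp
    then have e2: "t powr (a - 1) * (t - u) powr (a + 1) = t powr (2 * a) * (1 - x) powr (a + 1)"
      unfolding tu using x by (simp add: powr_mult mult.assoc[symmetric])
    have "u * u powr (2 * a - 1) = u powr (2 * a)" using assms by (simp add: powr_diff)
    then have e3: "u * kernel_int (a - 2) t u = t powr (2 * a) * (x powr (2 * a) * beta - D)"
      unfolding kernel_int_eq_tail[OF assms] D_def using x
      by (simp add: powr_mult right_diff_distrib mult.assoc[symmetric])
    have "xr t u / (2 * H) = t powr a * (t - u) powr a - t powr (a - 1) * (t - u) powr (a + 1) / 2 + (1 - a) / 2 * (u * kernel_int (a - 2) t u)"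
      using xr_closed[OF assms] H by simp
    also have "\<dots> = t powr (2 * a) * ((1 - x) powr a - 1 / 2 * (1 - x) powr (a + 1) + (1 - a) / 2 * (x powr (2 * a) * beta - D))"
      unfolding e1 e2 e3 by (simp add: algebra_simps)
    finally have "xr t u / (2 * H * t powr (2 * a)) = (1 - x) powr a - 1 / 2 * (1 - x) powr (a + 1) + (1 - a) / 2 * (x powr (2 * a) * beta - D)"
      using x H by (simp add: field_simps)
    then show ?thesis by (simp add: algebra_simps)
  qed
  ultimately show ?thesis unfolding x_def by simp
qed

section \<open>Moments and inner products of the kernels\<close>

lemma xr_moment:
  assumes "t > 0" "\<rho> > - 1" "\<rho> - 2 * a > - 1"
  shows "has_bochner_integral lborel (\<lambda>u. xr t u * u powr (\<rho> - 2 * a))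
    (2 * H * Beta (\<rho> - 2 * a + 1) (a + 1) * (1 - a / (\<rho> + 1)) * t powr (\<rho> + 1))"
proof -
  define b where "b = Beta (\<rho> - 2 * a + 1) (a + 1)"
  have b: "b \<ge> 0" unfolding b_def using assms a_bounds by (intro Beta_nonneg_real) auto
  have Bt: "(\<integral>\<^sup>+u. ennreal (indicator {0<..<v} u * u powr (\<rho> - 2 * a) * (v - u) powr a) \<partial>lborel) =
      ennreal (v powr (\<rho> - a + 1) * b)" if "v > 0" for v
    using nn_integral_Beta[of "\<rho> - 2 * a + 1" "a + 1" v] assms a_bounds that by (simp add: b_def algebra_simps)
  have I1: "has_bochner_integral lborel (\<lambda>u. indicator {0<..<t} u * u powr (\<rho> - 2 * a) * (t - u) powr a) (t powr (\<rho> - a + 1) * b)"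
    using b Bt[OF assms(1)] by (intro has_bochner_integral_nn_integral) auto
  \<comment> \<open>Integration over the triangle \<open>u < v < t\<close> is done with
    \<open>u\<close> innermost. The \<open>u\<close>-integral is then the same Beta integral as for
    the first term of the kernel, and a pure power of \<open>v\<close> remains; this is where the
    factor \<open>1 - a / (rho + 1)\<close> comes from.\<close>
  define h where "h u v = ennreal (if 0 < u \<and> u < v \<and> v < t then u powr (\<rho> - 2 * a) * ((v - u) powr a * v powr (a - 1)) else 0)" for u v
  have [measurable]: "(\<lambda>(u, v). h u v) \<in> borel_measurable (lborel \<Otimes>\<^sub>M lborel)"
    unfolding h_def[abs_def] by measurable
  have "(\<integral>\<^sup>+u. ennreal (indicator {0<..<t} u * u powr (\<rho> - 2 * a) * kernel_int (a - 1) t u) \<partial>lborel) = (\<integral>\<^sup>+u. \<integral>\<^sup>+v. h u v \<partial>lborel \<partial>lborel)"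
  proof (rule nn_integral_cong)
    fix u :: real
    show "ennreal (indicator {0<..<t} u * u powr (\<rho> - 2 * a) * kernel_int (a - 1) t u) = (\<integral>\<^sup>+v. h u v \<partial>lborel)"
    proof (cases "0 < u \<and> u < t")
      case True
      have "(\<integral>\<^sup>+v. h u v \<partial>lborel) = (\<integral>\<^sup>+v. ennreal (u powr (\<rho> - 2 * a)) * ennreal (if u < v \<and> v < t then (v - u) powr a * v powr (a - 1) else 0) \<partial>lborel)"
        using True by (intro nn_integral_cong) (auto simp: h_def ennreal_mult'[symmetric])
      also have "\<dots> = ennreal (u powr (\<rho> - 2 * a)) * ennreal (kernel_int (a - 1) t u)"
        unfolding kernel_int_def using True
        by (subst nn_integral_cmult, simp, subst nn_integral_eq_integral[OF kernel_int_integrable]) auto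
      finally show ?thesis using True by (simp add: ennreal_mult'[symmetric])
    next
      case False
      then have "h u v = 0" for v by (auto simp: h_def)
      then show ?thesis using False by (auto simp: indicator_def)
    qed
  qed
  also have "\<dots> = (\<integral>\<^sup>+v. \<integral>\<^sup>+u. h u v \<partial>lborel \<partial>lborel)"
    by (rule lborel_pair.Fubini') measurable
  also have "\<dots> = (\<integral>\<^sup>+v. ennreal b * ennreal (indicator {0<..<t} v * v powr ((\<rho> + 1) - 1)) \<partial>lborel)"
  proof (rule nn_integral_cong)
    fix v :: real
    show "(\<integral>\<^sup>+u. h u v \<partial>lborel) = ennreal b * ennreal (indicator {0<..<t} v * v powr ((\<rho> + 1) - 1))"
    proof (cases "0 < v \<and> v < t")
      case True
      have "(\<integral>\<^sup>+u. h u v \<partial>lborel) = (\<integral>\<^sup>+u. ennreal (v powr (a - 1)) * ennreal (indicator {0<..<v} u * u powr (\<rho> - 2 * a) * (v - u) powr a) \<partial>lborel)"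
        using True by (intro nn_integral_cong) (auto simp: h_def indicator_def ennreal_mult'[symmetric] mult_ac)
      also have "\<dots> = ennreal (v powr (a - 1)) * ennreal (v powr (\<rho> - a + 1) * b)"
        using True by (subst nn_integral_cmult) (auto simp: Bt)
      also have "\<dots> = ennreal b * ennreal (indicator {0<..<t} v * v powr ((\<rho> + 1) - 1))"
      proof -
        have "v powr (a - 1) * v powr (\<rho> - a + 1) = v powr ((\<rho> + 1) - 1)"
          by (subst powr_add[symmetric]) simp
        then show ?thesis using True b by (simp add: ennreal_mult'[symmetric] mult_ac)
      qed
      finally show ?thesis .
    next
      case False
      then have "h u v = 0" for u by (auto simp: h_def)
      then show ?thesis using False by (auto simp: indicator_def)
    qed
  qed
  also have "\<dots> = ennreal b * ennreal (t powr (\<rho> + 1) / (\<rho> + 1))"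
    using nn_integral_powr_Ioo[of "\<rho> + 1" t] assms by (subst nn_integral_cmult) auto
  also have "\<dots> = ennreal (b * (t powr (\<rho> + 1) / (\<rho> + 1)))" by (rule ennreal_mult'[OF b, symmetric])
  finally have I2: "has_bochner_integral lborel (\<lambda>u. indicator {0<..<t} u * u powr (\<rho> - 2 * a) * kernel_int (a - 1) t u) (b * (t powr (\<rho> + 1) / (\<rho> + 1)))"
    using b kernel_int_nonneg assms by (intro has_bochner_integral_nn_integral) auto
  have "has_bochner_integral lborel (\<lambda>u. 2 * H * t powr a * (indicator {0<..<t} u * u powr (\<rho> - 2 * a) * (t - u) powr a) -
      2 * H * a * (indicator {0<..<t} u * u powr (\<rho> - 2 * a) * kernel_int (a - 1) t u))
    (2 * H * t powr a * (t powr (\<rho> - a + 1) * b) - 2 * H * a * (b * (t powr (\<rho> + 1) / (\<rho> + 1))))"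
    by (intro has_bochner_integral_diff has_bochner_integral_mult_right I1 I2)
  moreover have "2 * H * t powr a * (indicator {0<..<t} u * u powr (\<rho> - 2 * a) * (t - u) powr a) -
      2 * H * a * (indicator {0<..<t} u * u powr (\<rho> - 2 * a) * kernel_int (a - 1) t u) = xr t u * u powr (\<rho> - 2 * a)" for u
    by (simp add: xr_def indicator_def algebra_simps)
  moreover have "2 * H * t powr a * (t powr (\<rho> - a + 1) * b) - 2 * H * a * (b * (t powr (\<rho> + 1) / (\<rho> + 1))) =
      2 * H * b * (1 - a / (\<rho> + 1)) * t powr (\<rho> + 1)"
  proof -
    have "t powr a * t powr (\<rho> - a + 1) = t powr (\<rho> + 1)" by (subst powr_add[symmetric]) simp
    then have "t powr a * (t powr (\<rho> - a + 1) * b) = t powr (\<rho> + 1) * b" by (simp only: mult.assoc[symmetric])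
    then show ?thesis by (simp add: algebra_simps)
  qed
  ultimately show ?thesis by (simp only: b_def)
qed

definition moment :: "nat \<Rightarrow> real" where
  "moment k = pochhammer (1 - 2 * a) k / (pochhammer (1 - a) k * (real k + 1))"

lemma poch_pos: "pochhammer (1 - 2 * a) k > 0" "pochhammer (1 - a) k > 0"
  using a_bounds by (auto intro!: pochhammer_pos)

lemma moment_pos: "moment k > 0"
  unfolding moment_def using poch_pos[of k] by (auto intro!: divide_pos_pos mult_pos_pos)

lemma cV_2H: "V_const * (2 * H) = Gamma (1 - a) / (Gamma (1 + a) * Gamma (1 - 2 * a))"
  unfolding V_const_def using H by simp

lemma moment_nat:
  assumes "t > 0"
  shows "has_bochner_integral lborel (\<lambda>u. xr t u * (u ^ k * Vdens u)) (moment k * t ^ (k + 1))"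
proof -
  have "has_bochner_integral lborel (\<lambda>u. V_const * (xr t u * u powr (real k - 2 * a)))
    (V_const * (2 * H * Beta (real k - 2 * a + 1) (a + 1) * (1 - a / (real k + 1)) * t powr (real k + 1)))"
    using a_bounds assms by (intro has_bochner_integral_mult_right xr_moment) auto
  moreover have "V_const * (xr t u * u powr (real k - 2 * a)) = xr t u * (u ^ k * Vdens u)" for u
    by (auto simp: xr_def Vdens_def powr_diff powr_realpow powr_minus divide_inverse)
  moreover have "V_const * (2 * H * Beta (real k - 2 * a + 1) (a + 1) * (1 - a / (real k + 1)) * t powr (real k + 1)) = moment k * t ^ (k + 1)"
  proof -
    have n1: "1 - 2 * a \<notin> \<int>\<^sub>\<le>\<^sub>0" and n2: "1 - a \<notin> \<int>\<^sub>\<le>\<^sub>0"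
      using a_bounds by (auto elim!: nonpos_Ints_cases)
    have g1: "Gamma (real k - 2 * a + 1) = pochhammer (1 - 2 * a) k * Gamma (1 - 2 * a)"
      using pochhammer_Gamma[OF n1, of k] Gammas_pos by (simp add: algebra_simps)
    have "Gamma (real k - 2 * a + 1 + (a + 1)) = pochhammer (1 - a) (Suc k) * Gamma (1 - a)"
      using pochhammer_Gamma[OF n2, of "Suc k"] Gammas_pos by (simp add: algebra_simps del: pochhammer_Suc)
    then have g2: "Gamma (real k - 2 * a + 1 + (a + 1)) = pochhammer (1 - a) k * (1 - a + real k) * Gamma (1 - a)"
      by (simp add: pochhammer_Suc)
    have pw: "t powr (real k + 1) = t ^ (k + 1)"
      using assms powr_realpow[of t "k + 1"] by (simp add: add.commute)
    have "1 - a + real k > 0" using a_bounds by simp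
    then have "V_const * (2 * H) * Beta (real k - 2 * a + 1) (a + 1) * (1 - a / (real k + 1)) = moment k"
      unfolding cV_2H Beta_def g1 g2 moment_def add.commute[of 1 a]
      using Gammas_pos poch_pos[of k] by (simp add: add.commute divide_simps)
    then show ?thesis unfolding pw by (simp only: mult.assoc[symmetric])
  qed
  ultimately show ?thesis by simp
qed

lemma moment_zero:
  assumes "s > 0"
  shows "has_bochner_integral lborel (\<lambda>u. 2 * H * ((1 - a) / 2 * beta) * (xr s u * (u powr (2 * a) * Vdens u))) (s powr (2 * H) / 2)"
proof -
  have "has_bochner_integral lborel (\<lambda>u. (2 * H * ((1 - a) / 2 * beta) * V_const) * (xr s u * u powr (2 * a - 2 * a)))
    (2 * H * ((1 - a) / 2 * beta) * V_const * (2 * H * Beta (2 * a - 2 * a + 1) (a + 1) * (1 - a / (2 * a + 1)) * s powr (2 * a + 1)))"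
    using a_bounds assms by (intro has_bochner_integral_mult_right xr_moment) auto
  moreover have "(2 * H * ((1 - a) / 2 * beta) * V_const) * (xr s u * u powr (2 * a - 2 * a)) =
      2 * H * ((1 - a) / 2 * beta) * (xr s u * (u powr (2 * a) * Vdens u))" for u
    by (auto simp: xr_def Vdens_def powr_minus)
  moreover have "2 * H * ((1 - a) / 2 * beta) * V_const * (2 * H * Beta (2 * a - 2 * a + 1) (a + 1) * (1 - a / (2 * a + 1)) * s powr (2 * a + 1)) = s powr (2 * H) / 2"
  proof -
    have "1 - a \<notin> \<int>\<^sub>\<le>\<^sub>0" using a_bounds by (auto elim!: nonpos_Ints_cases)
    then have g: "Gamma (2 - a) = (1 - a) * Gamma (1 - a)" using Gamma_plus1[of "1 - a"] by (simp add: algebra_simps)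
    \<comment> \<open>\<open>beta\<close> has denominator
      \<open>Gamma (2 - a) = (1 - a) * Gamma (1 - a)\<close>, and the remaining Gamma values are
      those of \<open>V_const\<close>.\<close>
    have 1: "(1 - a) * beta * (V_const * (2 * H)) = 1"
    proof -
      have e: "a + 1 + (1 - 2 * a) = 2 - a" by simp
      show ?thesis unfolding beta_def Beta_def cV_2H e g
        using Gammas_pos a_bounds(1,2) by (simp add: add.commute[of a 1] less_imp_neq[symmetric])
    qed
    have 2: "Beta (2 * a - 2 * a + 1) (a + 1) = 1 / (a + 1)"
      using Beta_one_right[of "a + 1"] a_bounds by (simp add: Beta_commute)
    have "2 * H * ((1 - a) / 2 * beta) * V_const * (2 * H * Beta (2 * a - 2 * a + 1) (a + 1) * (1 - a / (2 * a + 1)) * s powr (2 * a + 1))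
      = ((1 - a) * beta * (V_const * (2 * H))) * ((2 * H) / 2 * (1 / (a + 1)) * (1 - a / (2 * a + 1))) * s powr (2 * a + 1)"
      unfolding 2 by simp
    also have "\<dots> = s powr (2 * H) / 2"
      unfolding 1 unfolding a_bounds(3) using a_bounds(1,2) by (simp add: divide_simps)
    finally show ?thesis .
  qed
  ultimately show ?thesis by (simp only:)
qed

text \<open>The coefficient of \<open>x ^ (k + 1)\<close> in
  \<open>(1 - (1 - x) powr (2 * H)) / 2\<close>.\<close>

definition cov_coeff :: "nat \<Rightarrow> real" where
  "cov_coeff k = H * pochhammer (- (2 * a)) k / fact (Suc k)"

text \<open>The Pochhammer symbols of the kernel coefficients cancel against those of the moments.
  What is left is the binomial series of \<open>(1 - x) powr (2 * H)\<close>, hence the covariance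
  of fractional Brownian motion.\<close>

lemma xr_coeff_moment: "2 * H * xr_coeff k * moment k = cov_coeff k"
  unfolding xr_coeff_def moment_def cov_coeff_def using poch_pos[of k] by (simp add: divide_simps)

text \<open>The norm of \<open>x_t\<close> is the case \<open>s = t\<close>, where the series is
  evaluated at 1, on the boundary of its disc of convergence. A closed form of the partial sums
  reduces convergence there to a limit of Pochhammer quotients.\<close>

lemma cov_coeff_partial_sum: "(\<Sum>k<n. cov_coeff k) = (1 - pochhammer (- (2 * a)) n / fact n) / 2"
proof (induction n)
  case (Suc n)
  define P where "P = pochhammer (- (2 * a)) n"
  have "(\<Sum>k<Suc n. cov_coeff k) = (1 - P / fact n) / 2 + cov_coeff n" using Suc by (simp add: P_def)
  also have "\<dots> = (1 - P * (real n - 2 * a) / (fact n * (real n + 1))) / 2"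
  proof -
    have "cov_coeff n = (2 * H) * P / (2 * (fact n * (real n + 1)))"
      unfolding cov_coeff_def P_def by (simp add: mult.commute add.commute)
    moreover have "(fact n :: real) > 0" "real n + 1 > 0" by auto
    ultimately show ?thesis unfolding a_bounds(3)
      by (simp add: divide_simps) (simp add: algebra_simps)
  qed
  finally show ?case unfolding P_def by (simp add: pochhammer_Suc mult_ac add_ac)
qed simp

text \<open>By Euler's limit for the reciprocal Gamma function the quotient behaves like
  \<open>n powr (z - 1)\<close> up to a constant factor, and \<open>z - 1\<close> is
  negative.\<close>

lemma poch_fact_tendsto_0:
  fixes z :: real
  assumes "z < 1"
  shows "(\<lambda>n. pochhammer z n / fact n) \<longlonglongrightarrow> 0"
proof -
  have "(\<lambda>n. rGamma_series z n * (real n powr z / real (Suc n))) \<longlonglongrightarrow> rGamma z * 0"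
  proof (intro tendsto_mult rGamma_series_LIMSEQ)
    show "(\<lambda>n. real n powr z / real (Suc n)) \<longlonglongrightarrow> 0"
    proof (rule tendsto_sandwich[of "\<lambda>_. 0" _ _ "\<lambda>n. real n powr (z - 1)"])
      show "(\<lambda>n. real n powr (z - 1)) \<longlonglongrightarrow> 0"
        using tendsto_neg_powr[of "z - 1" real sequentially] assms filterlim_real_sequentially by simp
      show "eventually (\<lambda>n. real n powr z / real (Suc n) \<le> real n powr (z - 1)) sequentially"
        using eventually_gt_at_top[of 0]
      proof eventually_elim
        case (elim n)
        then have "real n powr z / real (Suc n) \<le> real n powr z / real n"
          by (intro divide_left_mono) auto
        then show ?case using elim by (simp add: powr_diff)
      qed
    qed auto
  qed
  moreover have "eventually (\<lambda>n. rGamma_series z n * (real n powr z / real (Suc n)) = pochhammer z (Suc n) / fact (Suc n)) sequentially"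
    using eventually_gt_at_top[of 0]
  proof eventually_elim
    case (elim n)
    have "exp (z * ln (real n)) \<noteq> 0" by simp
    then show ?case using elim
      by (simp add: rGamma_series_def powr_def del: pochhammer_Suc)
  qed
  ultimately have "(\<lambda>n. pochhammer z (Suc n) / fact (Suc n)) \<longlonglongrightarrow> 0"
    by (simp add: tendsto_cong)
  then show ?thesis by (rule LIMSEQ_imp_Suc)
qed

lemma cov_coeff_sums_1: "cov_coeff sums (1 / 2)"
proof -
  have "(\<lambda>n. (1 - pochhammer (- (2 * a)) n / fact n) / 2) \<longlonglongrightarrow> (1 - 0) / 2"
    using a_bounds by (intro tendsto_intros poch_fact_tendsto_0) auto
  then show ?thesis by (simp add: sums_def cov_coeff_partial_sum)
qed

text \<open>From index 1 on all coefficients have the sign of \<open>- a\<close>, so convergence is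
  automatically absolute.\<close>

lemma cov_coeff_abs_summable: "summable (\<lambda>k. \<bar>cov_coeff k\<bar>)"
proof -
  have s: "summable (\<lambda>k. cov_coeff (Suc k))" using sums_summable[OF cov_coeff_sums_1] by (simp add: summable_Suc_iff)
  have sign: "cov_coeff (Suc k) = - (2 * a) * (H * pochhammer (1 - 2 * a) k / fact (Suc (Suc k)))" for k
    by (simp add: cov_coeff_def pochhammer_rec)
  have nn: "H * pochhammer (1 - 2 * a) k / fact (Suc (Suc k)) \<ge> 0" for k
    using poch_pos(1)[of k] H by (intro divide_nonneg_pos mult_nonneg_nonneg) auto
  have "\<bar>cov_coeff (Suc k)\<bar> = (if a \<le> 0 then cov_coeff (Suc k) else - cov_coeff (Suc k))" for k
    unfolding sign abs_mult abs_of_nonneg[OF nn[of k]] by simp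
  then have "summable (\<lambda>k. \<bar>cov_coeff (Suc k)\<bar>)"
    using s summable_minus[OF s] by (cases "a \<le> 0") auto
  then show ?thesis using summable_Suc_iff[of "\<lambda>k. \<bar>cov_coeff k\<bar>"] by simp
qed

lemma cov_coeff_sums:
  assumes "0 \<le> x" "x \<le> 1"
  shows "(\<lambda>k. cov_coeff k * x ^ (k + 1)) sums ((1 - (1 - x) powr (2 * H)) / 2)"
    and "summable (\<lambda>k. \<bar>cov_coeff k\<bar> * x ^ (k + 1))"
proof -
  show "(\<lambda>k. cov_coeff k * x ^ (k + 1)) sums ((1 - (1 - x) powr (2 * H)) / 2)"
  proof (cases "x < 1")
    case True
    then have "(\<lambda>k. pochhammer (- (2 * H)) k / fact k * x ^ k) sums (1 - x) powr (2 * H)"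
      using assms by (intro binomial_sums) auto
    then have "(\<lambda>k. pochhammer (- (2 * H)) (Suc k) / fact (Suc k) * x ^ Suc k) sums ((1 - x) powr (2 * H) - 1)"
      by (subst sums_Suc_iff) simp
    then have "(\<lambda>k. (- 1 / 2) * (pochhammer (- (2 * H)) (Suc k) / fact (Suc k) * x ^ Suc k)) sums ((- 1 / 2) * ((1 - x) powr (2 * H) - 1))"
      by (rule sums_mult)
    moreover have "(- 1 / 2) * (pochhammer (- (2 * H)) (Suc k) / fact (Suc k) * x ^ Suc k) = cov_coeff k * x ^ (k + 1)" for k
    proof -
      have "- (2 * H) + 1 = - (2 * a)" using a_bounds by simp
      then show ?thesis by (simp add: cov_coeff_def pochhammer_rec)
    qed
    moreover have "(- 1 / 2) * ((1 - x) powr (2 * H) - 1) = (1 - (1 - x) powr (2 * H)) / 2"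
      by (simp add: field_simps)
    ultimately show ?thesis by (simp only:)
  next
    case False
    then have "x = 1" using assms by simp
    then show ?thesis using cov_coeff_sums_1 by simp
  qed
  show "summable (\<lambda>k. \<bar>cov_coeff k\<bar> * x ^ (k + 1))"
    by (rule summable_comparison_test'[OF cov_coeff_abs_summable])
       (use assms in \<open>auto simp: abs_mult intro!: mult_left_le power_le_one mult_le_one\<close>)
qed

lemma xr_coeff_abs_summable:
  assumes "0 < u" "u < t"
  shows "summable (\<lambda>k. \<bar>xr_coeff k\<bar> * (u / t) ^ k)"
proof -
  have u: "0 < (u + t) / 2" "(u + t) / 2 < t" using assms by auto
  have "norm (u / t) < norm ((u + t) / 2 / t)" using assms by (simp add: field_simps)
  from powser_insidea[OF sums_summable[OF xr_sums[OF u]] this]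
  show ?thesis using assms by (simp add: abs_mult power_abs)
qed

lemma Vdens_abs: "\<bar>Vdens u\<bar> = Vdens u" using Vdens_nonneg by simp
lemma xr_abs: "\<bar>xr t u\<bar> = xr t u" using xr_nonneg by simp

text \<open>The kernel with the larger parameter is expanded, because \<open>u < t\<close>
  throughout the support of \<open>x_s\<close>. Moments being positive, the integrated moduli are
  the absolute values of the covariance coefficients, which are summable up to and including
  \<open>s = t\<close>.\<close>

lemma xr_inner:
  assumes "0 < s" "s \<le> t"
  shows "has_bochner_integral lborel (\<lambda>u. xr s u * xr t u * Vdens u)
    ((s powr (2 * H) + t powr (2 * H) - (t - s) powr (2 * H)) / 2)"
proof -
  have t: "t > 0" using assms by simp
  define K where "K k = 2 * H * t powr (2 * a) * xr_coeff k / t ^ k" for k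
  define f where "f k u = K k * (xr s u * (u ^ k * Vdens u))" for k u
  have absK: "\<bar>K k\<bar> = 2 * H * t powr (2 * a) * \<bar>xr_coeff k\<bar> / t ^ k" for k
    unfolding K_def using t H by (simp add: abs_mult)
  have val: "2 * H * t powr (2 * a) * xr_coeff k / t ^ k * (moment k * s ^ (k + 1)) = t powr (2 * H) * (cov_coeff k * (s / t) ^ (k + 1))" for k
  proof -
    have "t powr (2 * H) = t powr (2 * a) * t" unfolding a_bounds(3) using t by (simp add: powr_add)
    then show ?thesis unfolding xr_coeff_moment[symmetric] using t by (simp add: power_divide)
  qed
  have f: "has_bochner_integral lborel (f k) (t powr (2 * H) * (cov_coeff k * (s / t) ^ (k + 1)))" for k
  proof -
    have "has_bochner_integral lborel (f k) (K k * (moment k * s ^ (k + 1)))"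
      unfolding f_def[abs_def] by (intro has_bochner_integral_mult_right moment_nat assms)
    then show ?thesis unfolding K_def val .
  qed
  have nf: "has_bochner_integral lborel (\<lambda>u. norm (f k u)) (t powr (2 * H) * (\<bar>cov_coeff k\<bar> * (s / t) ^ (k + 1)))" for k
  proof -
    have "norm (f k u) = \<bar>K k\<bar> * (xr s u * (u ^ k * Vdens u))" for u
    proof (cases "u > 0")
      case True
      then show ?thesis by (simp add: f_def abs_mult xr_abs Vdens_abs)
    qed (simp add: f_def xr_def)
    moreover have "has_bochner_integral lborel (\<lambda>u. \<bar>K k\<bar> * (xr s u * (u ^ k * Vdens u))) (\<bar>K k\<bar> * (moment k * s ^ (k + 1)))"
      by (intro has_bochner_integral_mult_right moment_nat assms)
    moreover have "\<bar>K k\<bar> * (moment k * s ^ (k + 1)) = \<bar>K k * (moment k * s ^ (k + 1))\<bar>"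
      using moment_pos[of k] assms by (simp add: abs_mult)
    moreover have "\<bar>K k * (moment k * s ^ (k + 1))\<bar> = t powr (2 * H) * (\<bar>cov_coeff k\<bar> * (s / t) ^ (k + 1))"
      unfolding K_def val using t assms by (simp add: abs_mult)
    ultimately show ?thesis by simp
  qed
  \<comment> \<open>\<open>G\<close> is the integrand without the singular part of
    \<open>x_t\<close>; that part is added back through \<open>moment_zero\<close>.\<close>
  define G where "G u = xr s u * xr t u * Vdens u - 2 * H * ((1 - a) / 2 * beta) * (xr s u * (u powr (2 * a) * Vdens u))" for u
  \<comment> \<open>The expansion of \<open>x_t\<close> is claimed only for \<open>u < t\<close>;
    outside \<open>(0, s)\<close> every term vanishes because \<open>x_s\<close> does.\<close>
  have fs: "(\<lambda>k. f k u) sums G u \<and> summable (\<lambda>k. norm (f k u))" for u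
  proof (cases "0 < u \<and> u < s")
    case True
    then have u: "0 < u" "u < t" using assms by auto
    have fk: "f k u = (2 * H * t powr (2 * a) * xr s u * Vdens u) * (xr_coeff k * (u / t) ^ k)" for k
      by (simp add: f_def K_def power_divide)
    have "(\<lambda>k. f k u) sums ((2 * H * t powr (2 * a) * xr s u * Vdens u) * (xr t u / (2 * H * t powr (2 * a)) - (1 - a) / 2 * beta * (u / t) powr (2 * a)))"
      unfolding fk by (intro sums_mult xr_sums u)
    also have "(2 * H * t powr (2 * a) * xr s u * Vdens u) * (xr t u / (2 * H * t powr (2 * a)) - (1 - a) / 2 * beta * (u / t) powr (2 * a)) = G u"
    proof -
      have "t powr (2 * a) > 0" using t by simp
      moreover have "(u / t) powr (2 * a) = u powr (2 * a) / t powr (2 * a)" using u t by (simp add: powr_divide)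
      ultimately show ?thesis using H by (simp add: G_def right_diff_distrib field_simps)
    qed
    finally have "(\<lambda>k. f k u) sums G u" .
    moreover have "summable (\<lambda>k. norm (f k u))"
    proof -
      have "norm (f k u) = (2 * H * t powr (2 * a) * xr s u * Vdens u) * (\<bar>xr_coeff k\<bar> * (u / t) ^ k)" for k
        unfolding fk using H u t by (simp add: abs_mult xr_abs Vdens_abs power_abs)
      then show ?thesis using summable_mult[OF xr_coeff_abs_summable[OF u]] by simp
    qed
    ultimately show ?thesis ..
  next
    case False
    then have "xr s u = 0" by (auto simp: xr_def)
    then show ?thesis by (simp add: f_def G_def)
  qed
  have x: "0 \<le> s / t" "s / t \<le> 1" using assms by auto
  have "summable (\<lambda>k. \<integral>u. norm (f k u) \<partial>lborel)"
    unfolding has_bochner_integral_integral_eq[OF nf] by (intro summable_mult cov_coeff_sums(2) x)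
  note sm = this
  have intf: "integrable lborel (f k)" for k using f by (simp add: has_bochner_integral_iff)
  have 1: "(\<lambda>k. integral\<^sup>L lborel (f k)) sums (\<integral>u. (\<Sum>k. f k u) \<partial>lborel)"
    using fs by (intro sums_integral intf sm) auto
  have 2: "integrable lborel (\<lambda>u. (\<Sum>k. f k u))"
    using fs by (intro integrable_suminf intf sm) auto
  have Gs: "(\<Sum>k. f k u) = G u" for u using fs[of u] by (simp add: sums_iff)
  have "(\<lambda>k. t powr (2 * H) * (cov_coeff k * (s / t) ^ (k + 1))) sums (integral\<^sup>L lborel G)"
    using 1 has_bochner_integral_integral_eq[OF f] unfolding Gs by simp
  moreover have "(\<lambda>k. t powr (2 * H) * (cov_coeff k * (s / t) ^ (k + 1))) sums (t powr (2 * H) * ((1 - (1 - s / t) powr (2 * H)) / 2))"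
    by (intro sums_mult cov_coeff_sums(1) x)
  ultimately have "integral\<^sup>L lborel G = t powr (2 * H) * ((1 - (1 - s / t) powr (2 * H)) / 2)"
    by (rule sums_unique2)
  also have "\<dots> = (t powr (2 * H) - (t - s) powr (2 * H)) / 2"
  proof -
    have "1 - s / t = (t - s) / t" using t by (simp add: field_simps)
    then have "t powr (2 * H) * (1 - s / t) powr (2 * H) = (t - s) powr (2 * H)"
      using t assms by (simp add: powr_divide)
    then show ?thesis by (simp add: right_diff_distrib)
  qed
  finally have "has_bochner_integral lborel G ((t powr (2 * H) - (t - s) powr (2 * H)) / 2)"
    using 2 unfolding Gs has_bochner_integral_iff by simp
  from has_bochner_integral_add[OF this moment_zero[OF assms(1)]]
  have "has_bochner_integral lborel (\<lambda>u. xr s u * xr t u * Vdens u) ((t powr (2 * H) - (t - s) powr (2 * H)) / 2 + s powr (2 * H) / 2)"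
    by (simp add: G_def)
  moreover have "(t powr (2 * H) - (t - s) powr (2 * H)) / 2 + s powr (2 * H) / 2 = (s powr (2 * H) + t powr (2 * H) - (t - s) powr (2 * H)) / 2"
    by (simp add: field_simps)
  ultimately show ?thesis by simp
qed

section \<open>The transform of x_t is e_t\<close>

lemma phi_sums': "(\<lambda>n. of_real (pochhammer (1 - a) n / pochhammer (1 - 2 * a) n) * (\<i> * of_real z) ^ n / fact n) sums phi H z"
  using phi_sums[OF H, of z] unfolding a_bounds(4,5) .

lemma phi_abs_summable:
  "summable (\<lambda>n. norm (of_real (pochhammer (1 - a) n / pochhammer (1 - 2 * a) n) * (\<i> * of_real z) ^ n / fact n))"
proof -
  let ?g = "\<lambda>n. of_real (pochhammer (1 - a) n / pochhammer (1 - 2 * a) n) * \<i> ^ n / fact n"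
  have "summable (\<lambda>n. ?g n * of_real (\<bar>z\<bar> + 1) ^ n)"
    using sums_summable[OF phi_sums'[of "\<bar>z\<bar> + 1"]] by (simp only: power_mult_distrib times_divide_eq_left mult.assoc)
  from powser_insidea[OF this, of "of_real z"]
  have "summable (\<lambda>n. norm (?g n * of_real z ^ n))" by (simp del: of_real_add)
  then show ?thesis by (simp only: power_mult_distrib times_divide_eq_left mult.assoc)
qed

lemma e_fun_sums: "(\<lambda>n. (\<i> * of_real l) ^ n * of_real (t ^ (n + 1)) / fact (Suc n)) sums e_fun t l"
proof (cases "l = 0")
  case True
  then have "(\<lambda>n. (\<i> * of_real l) ^ n * of_real (t ^ (n + 1)) / fact (Suc n)) = (\<lambda>n. if n = 0 then of_real t else 0)"
    by (auto simp: fun_eq_iff)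
  then show ?thesis using True sums_single[of 0 "\<lambda>_. complex_of_real t"] by (simp add: e_fun_def)
next
  case False
  let ?z = "\<i> * of_real l * of_real t"
  have "(\<lambda>n. ?z ^ n / fact n) sums exp ?z"
    using exp_converges[of ?z] by (simp add: scaleR_conv_of_real field_simps)
  then have "(\<lambda>n. ?z ^ Suc n / fact (Suc n)) sums (exp ?z - 1)"
    by (subst sums_Suc_iff) simp
  then have "(\<lambda>n. ?z ^ Suc n / fact (Suc n) / (\<i> * of_real l)) sums ((exp ?z - 1) / (\<i> * of_real l))"
    by (rule sums_divide)
  moreover have "?z ^ Suc n / fact (Suc n) / (\<i> * of_real l) = (\<i> * of_real l) ^ n * of_real (t ^ (n + 1)) / fact (Suc n)" for n
  proof -
    have "?z ^ Suc n = (\<i> * of_real l) * ((\<i> * of_real l) ^ n * of_real (t ^ (n + 1)))"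
      by (simp add: power_mult_distrib mult_ac)
    then show ?thesis using False by (simp del: power_Suc fact_Suc)
  qed
  ultimately show ?thesis using False by (simp only: e_fun_def if_False)
qed

lemma phi_transform_xr:
  assumes "t > 0"
  shows "has_bochner_integral lborel (\<lambda>u. of_real (xr t u * Vdens u) * phi H (u * l)) (e_fun t l)"
proof -
  define P where "P n = pochhammer (1 - a) n / pochhammer (1 - 2 * a) n" for n
  have Ppos: "P n > 0" for n unfolding P_def using poch_pos[of n] by simp
  define K where "K n = of_real (P n) * (\<i> * of_real l) ^ n / fact n" for n
  define f where "f n u = K n * complex_of_real (xr t u * (u ^ n * Vdens u))" for n u
  \<comment> \<open>The quotient in the coefficients of \<open>phi\<close> is reciprocal to the one
    in \<open>moment\<close>; only \<open>n! * (n + 1)\<close> remains in the denominator.\<close>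
  have PM: "P n / fact n * moment n = 1 / fact (Suc n)" for n
    unfolding P_def moment_def using poch_pos[of n] by (simp add: divide_simps)
  have f: "has_bochner_integral lborel (f n) ((\<i> * of_real l) ^ n * of_real (t ^ (n + 1)) / fact (Suc n))" for n
  proof -
    have "has_bochner_integral lborel (f n) (K n * complex_of_real (moment n * t ^ (n + 1)))"
      unfolding f_def[abs_def] by (intro has_bochner_integral_mult_right has_bochner_integral_of_real moment_nat assms)
    also have "K n * complex_of_real (moment n * t ^ (n + 1)) = (\<i> * of_real l) ^ n * of_real (t ^ (n + 1)) * of_real (P n / fact n * moment n)"
      by (simp add: K_def)
    also have "\<dots> = (\<i> * of_real l) ^ n * of_real (t ^ (n + 1)) / fact (Suc n)"
      unfolding PM by (simp del: fact_Suc)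
    finally show ?thesis .
  qed
  have nf: "(\<integral>u. norm (f n u) \<partial>lborel) = \<bar>l\<bar> ^ n * t ^ (n + 1) / fact (Suc n)" for n
  proof -
    have "norm (f n u) = norm (K n) * (xr t u * (u ^ n * Vdens u))" for u
    proof (cases "u > 0")
      case True
      then show ?thesis unfolding f_def norm_mult norm_of_real abs_mult by (simp add: xr_abs Vdens_abs)
    qed (simp add: f_def xr_def)
    moreover have "has_bochner_integral lborel (\<lambda>u. norm (K n) * (xr t u * (u ^ n * Vdens u))) (norm (K n) * (moment n * t ^ (n + 1)))"
      by (intro has_bochner_integral_mult_right moment_nat assms)
    ultimately have "(\<integral>u. norm (f n u) \<partial>lborel) = norm (K n) * (moment n * t ^ (n + 1))"
      by (simp only: has_bochner_integral_integral_eq)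
    also have "norm (K n) = P n * \<bar>l\<bar> ^ n / fact n"
      using less_imp_le[OF Ppos[of n]] by (simp add: K_def norm_mult norm_divide norm_power)
    also have "P n * \<bar>l\<bar> ^ n / fact n * (moment n * t ^ (n + 1)) = \<bar>l\<bar> ^ n * t ^ (n + 1) * (P n / fact n * moment n)" by simp
    finally show ?thesis unfolding PM by (simp del: fact_Suc)
  qed
  have sm: "summable (\<lambda>n. \<integral>u. norm (f n u) \<partial>lborel)"
  proof (rule summable_comparison_test')
    show "summable (\<lambda>n. t * ((\<bar>l\<bar> * t) ^ n /\<^sub>R fact n))"
      by (intro summable_mult summable_exp_generic)
    fix n :: nat
    have "\<bar>l\<bar> ^ n * t ^ (n + 1) / fact (Suc n) \<le> \<bar>l\<bar> ^ n * t ^ (n + 1) / fact n"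
      using assms by (intro divide_left_mono fact_mono) auto
    also have "\<dots> = t * ((\<bar>l\<bar> * t) ^ n /\<^sub>R fact n)" by (simp add: power_mult_distrib field_simps)
    finally show "norm (\<integral>u. norm (f n u) \<partial>lborel) \<le> t * ((\<bar>l\<bar> * t) ^ n /\<^sub>R fact n)"
      unfolding nf using assms by (simp del: fact_Suc)
  qed
  have fn: "f n u = complex_of_real (xr t u * Vdens u) * (of_real (pochhammer (1 - a) n / pochhammer (1 - 2 * a) n) * (\<i> * of_real (u * l)) ^ n / fact n)" for n u
    unfolding f_def K_def P_def by (simp add: power_mult_distrib)
  have fs: "(\<lambda>n. f n u) sums (of_real (xr t u * Vdens u) * phi H (u * l))" for u
    unfolding fn by (intro sums_mult phi_sums')
  have fa: "summable (\<lambda>n. norm (f n u))" for u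
    unfolding fn norm_mult[of "complex_of_real (xr t u * Vdens u)"] by (intro summable_mult phi_abs_summable)
  have intf: "integrable lborel (f k)" for k using f by (simp add: has_bochner_integral_iff)
  have 1: "(\<lambda>k. integral\<^sup>L lborel (f k)) sums (\<integral>u. (\<Sum>k. f k u) \<partial>lborel)"
    using fa by (intro sums_integral intf sm) auto
  have 2: "integrable lborel (\<lambda>u. (\<Sum>k. f k u))"
    using fa by (intro integrable_suminf intf sm) auto
  have S: "(\<Sum>k. f k u) = of_real (xr t u * Vdens u) * phi H (u * l)" for u using fs[of u] by (simp add: sums_iff)
  have "(\<integral>u. of_real (xr t u * Vdens u) * phi H (u * l) \<partial>lborel) = e_fun t l"
    using 1 e_fun_sums[of l t] unfolding has_bochner_integral_integral_eq[OF f] S by (rule sums_unique2)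
  then show ?thesis using 2 unfolding S has_bochner_integral_iff by simp
qed

end

section \<open>Functions orthogonal to the kernels\<close>

text \<open>The positive and the negative part of \<open>k\<close> are densities of finite measures
  which agree on all half-lines, hence are equal. The two parts then agree almost everywhere, and
  since at most one of them is nonzero at a point, both vanish.\<close>

lemma integral_Ioi_zero_AE:
  fixes k :: "real \<Rightarrow> real"
  assumes "integrable lborel k" "\<And>x. (\<integral>u. k u * indicator {x<..} u \<partial>lborel) = 0"
  shows "AE u in lborel. k u = 0"
proof -
  have [measurable]: "k \<in> borel_measurable borel" using assms(1) by auto
  let ?P = "\<lambda>u. ennreal (max 0 (k u))" and ?N = "\<lambda>u. ennreal (max 0 (- k u))"
  have iP: "integrable lborel (\<lambda>u. max 0 (k u) * indicator {x<..} u)" for x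
    by (rule Bochner_Integration.integrable_bound[OF assms(1)]) (auto simp: indicator_def)
  have iN: "integrable lborel (\<lambda>u. max 0 (- k u) * indicator {x<..} u)" for x
    by (rule Bochner_Integration.integrable_bound[OF assms(1)]) (auto simp: indicator_def)
  have eP: "emeasure (density lborel ?P) {x<..} = ennreal (\<integral>u. max 0 (k u) * indicator {x<..} u \<partial>lborel)" for x
  proof -
    have "emeasure (density lborel ?P) {x<..} = (\<integral>\<^sup>+u. ennreal (max 0 (k u) * indicator {x<..} u) \<partial>lborel)"
      by (subst emeasure_density) (auto intro!: nn_integral_cong simp: indicator_def)
    also have "\<dots> = ennreal (\<integral>u. max 0 (k u) * indicator {x<..} u \<partial>lborel)"
      by (rule nn_integral_eq_integral[OF iP]) (auto simp: indicator_def)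
    finally show ?thesis .
  qed
  have eN: "emeasure (density lborel ?N) {x<..} = ennreal (\<integral>u. max 0 (- k u) * indicator {x<..} u \<partial>lborel)" for x
  proof -
    have "emeasure (density lborel ?N) {x<..} = (\<integral>\<^sup>+u. ennreal (max 0 (- k u) * indicator {x<..} u) \<partial>lborel)"
      by (subst emeasure_density) (auto intro!: nn_integral_cong simp: indicator_def)
    also have "\<dots> = ennreal (\<integral>u. max 0 (- k u) * indicator {x<..} u \<partial>lborel)"
      by (rule nn_integral_eq_integral[OF iN]) (auto simp: indicator_def)
    finally show ?thesis .
  qed
  have "(\<integral>u. max 0 (k u) * indicator {x<..} u \<partial>lborel) = (\<integral>u. max 0 (- k u) * indicator {x<..} u \<partial>lborel)" for x
  proof -
    have "(\<integral>u. max 0 (k u) * indicator {x<..} u \<partial>lborel) - (\<integral>u. max 0 (- k u) * indicator {x<..} u \<partial>lborel) =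
        (\<integral>u. max 0 (k u) * indicator {x<..} u - max 0 (- k u) * indicator {x<..} u \<partial>lborel)"
      by (rule Bochner_Integration.integral_diff[symmetric, OF iP iN])
    also have "\<dots> = (\<integral>u. k u * indicator {x<..} u \<partial>lborel)"
      by (rule Bochner_Integration.integral_cong) (auto simp: indicator_def max_def)
    finally show ?thesis using assms(2) by simp
  qed
  then have "density lborel ?P = density lborel ?N"
    by (intro measure_eqI_lessThan) (auto simp: eP eN)
  then have "AE u in lborel. ?P u = ?N u"
    by (subst (asm) sigma_finite_measure.density_unique_iff[OF sigma_finite_lborel]) auto
  then show ?thesis
    by eventually_elim (auto simp: max_def split: if_splits)
qed

text \<open>Weierstrass approximation carries the vanishing from polynomials to continuous
  functions, and continuous ramps carry it on to indicators of half-lines. Powers of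
  \<open>T - u\<close> are used because these are what superpositions of the kernels
  produce.\<close>

lemma moments_zero_AE_real:
  fixes k :: "real \<Rightarrow> real"
  assumes "integrable lborel k" "\<And>u. u \<notin> {0..T} \<Longrightarrow> k u = 0"
    and "\<And>j::nat. (\<integral>u. k u * (T - u) ^ j \<partial>lborel) = 0"
  shows "AE u in lborel. k u = 0"
proof (rule integral_Ioi_zero_AE[OF assms(1)])
  have [measurable]: "k \<in> borel_measurable borel" using assms(1) by auto
  have kint: "integrable lborel (\<lambda>u. k u * g u)" if "continuous_on UNIV g" for g :: "real \<Rightarrow> real"
  proof -
    have [measurable]: "g \<in> borel_measurable borel" using that by (rule borel_measurable_continuous_onI)
    have "bounded (g ` {0..T})"
      by (intro compact_imp_bounded compact_continuous_image continuous_on_subset[OF that]) auto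
    then obtain B where B: "\<And>u. u \<in> {0..T} \<Longrightarrow> \<bar>g u\<bar> \<le> B" unfolding bounded_iff
      by (metis imageI real_norm_def)
    show ?thesis
    proof (rule Bochner_Integration.integrable_bound)
      show "integrable lborel (\<lambda>u. B * k u)" using assms(1) by simp
      show "AE u in lborel. norm (k u * g u) \<le> norm (B * k u)"
      proof (rule AE_I2)
        fix u show "norm (k u * g u) \<le> norm (B * k u)"
        proof (cases "u \<in> {0..T}")
          case True
          then have "\<bar>g u\<bar> \<le> \<bar>B\<bar>" using B[OF True] by linarith
          then show ?thesis by (simp add: abs_mult mult.commute mult_right_mono)
        qed (simp add: assms(2))
      qed
    qed measurable
  qed
  have poly: "(\<integral>u. k u * P u \<partial>lborel) = 0" if "real_polynomial_function P" for P
  proof -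
    \<comment> \<open>Reflecting the argument expresses an arbitrary polynomial in powers of
      \<open>T - u\<close>.\<close>
    have "polynomial_function (\<lambda>y::real. T - y)" by (intro polynomial_function_diff) auto
    from real_polynomial_function_compose[OF this that]
    have "real_polynomial_function (\<lambda>y. P (T - y))" by (simp add: o_def)
    then obtain c n where c: "(\<lambda>y. P (T - y)) = (\<lambda>y. \<Sum>i\<le>n. c i * y ^ i)"
      by (auto simp: real_polynomial_function_iff_sum)
    have "P u = (\<Sum>i\<le>n. c i * (T - u) ^ i)" for u using fun_cong[OF c, of "T - u"] by simp
    then have "(\<integral>u. k u * P u \<partial>lborel) = (\<integral>u. (\<Sum>i\<le>n. c i * (k u * (T - u) ^ i)) \<partial>lborel)"
      by (simp add: sum_distrib_left mult_ac)
    also have "\<dots> = (\<Sum>i\<le>n. c i * (\<integral>u. k u * (T - u) ^ i \<partial>lborel))"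
      by (subst Bochner_Integration.integral_sum)
         (auto intro!: integrable_mult_right kint continuous_intros)
    finally show ?thesis using assms(3) by simp
  qed
  have cont: "(\<integral>u. k u * g u \<partial>lborel) = 0" if g: "continuous_on UNIV g" for g :: "real \<Rightarrow> real"
  proof -
    let ?L = "\<integral>u. \<bar>k u\<bar> \<partial>lborel"
    have le: "\<bar>\<integral>u. k u * g u \<partial>lborel\<bar> \<le> e" if "e > 0" for e
    proof -
      \<comment> \<open>The summand 1 keeps the tolerance defined when \<open>k\<close> has integral
        norm 0.\<close>
      define d where "d = e / (?L + 1)"
      have L: "?L \<ge> 0" by simp
      have d: "d > 0" using that L by (simp add: d_def add_nonneg_pos)
      obtain P where P: "real_polynomial_function P" "\<And>u. u \<in> {0..T} \<Longrightarrow> \<bar>g u - P u\<bar> < d"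
        using Stone_Weierstrass_polynomial_function[OF compact_Icc continuous_on_subset[OF g subset_UNIV] d, of 0 T]
        by (auto simp: real_polynomial_function_eq)
      have Pc: "continuous_on UNIV P"
        using P(1) by (intro continuous_on_polymonial_function) (simp add: real_polynomial_function_eq)
      have "(\<integral>u. k u * g u \<partial>lborel) = (\<integral>u. k u * g u \<partial>lborel) - (\<integral>u. k u * P u \<partial>lborel)"
        using poly[OF P(1)] by simp
      also have "\<dots> = (\<integral>u. k u * g u - k u * P u \<partial>lborel)"
        by (rule Bochner_Integration.integral_diff[symmetric, OF kint[OF g] kint[OF Pc]])
      finally have "\<bar>\<integral>u. k u * g u \<partial>lborel\<bar> \<le> (\<integral>u. \<bar>k u * g u - k u * P u\<bar> \<partial>lborel)"
        using integral_abs_bound[of lborel "\<lambda>u. k u * g u - k u * P u"] by simp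
      also have "\<dots> \<le> (\<integral>u. d * \<bar>k u\<bar> \<partial>lborel)"
      proof (rule integral_mono)
        show "integrable lborel (\<lambda>u. \<bar>k u * g u - k u * P u\<bar>)"
          using kint[OF g] kint[OF Pc] by auto
        show "integrable lborel (\<lambda>u. d * \<bar>k u\<bar>)" using assms(1) by auto
        fix u
        show "\<bar>k u * g u - k u * P u\<bar> \<le> d * \<bar>k u\<bar>"
        proof (cases "u \<in> {0..T}")
          case True
          have "\<bar>k u * g u - k u * P u\<bar> = \<bar>g u - P u\<bar> * \<bar>k u\<bar>" by (simp add: right_diff_distrib[symmetric] abs_mult)
          then show ?thesis using P(2)[OF True] by (simp add: mult_right_mono)
        qed (simp add: assms(2))
      qed
      also have "\<dots> = d * ?L" by simp
      also have "\<dots> \<le> e"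
      proof -
        have "d * ?L \<le> d * (?L + 1)" using d by simp
        also have "\<dots> = e"
        proof -
          have "?L + 1 \<noteq> 0" using L by linarith
          then show ?thesis by (simp add: d_def)
        qed
        finally show ?thesis .
      qed
      finally show ?thesis .
    qed
    have "\<bar>\<integral>u. k u * g u \<partial>lborel\<bar> \<le> 0" by (rule field_le_epsilon) (simp add: le)
    then show ?thesis by simp
  qed
  fix x :: real
  \<comment> \<open>The ramps are 0 up to and including \<open>x\<close> and reach 1 eventually at
    every point beyond it, so they converge everywhere to the indicator of the open
    half-line.\<close>
  have "(\<lambda>n. \<integral>u. k u * min 1 (max 0 (real n * (u - x))) \<partial>lborel) \<longlonglongrightarrow> (\<integral>u. k u * indicator {x<..} u \<partial>lborel)"
  proof (rule integral_dominated_convergence[where w = "\<lambda>u. \<bar>k u\<bar>"])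
    show "AE u in lborel. (\<lambda>n. k u * min 1 (max 0 (real n * (u - x)))) \<longlonglongrightarrow> k u * indicator {x<..} u"
    proof (rule AE_I2, intro tendsto_mult tendsto_const)
      fix u :: real
      show "(\<lambda>n. min 1 (max 0 (real n * (u - x)))) \<longlonglongrightarrow> indicator {x<..} u"
      proof (rule tendsto_eventually)
        show "eventually (\<lambda>n. min 1 (max 0 (real n * (u - x))) = indicator {x<..} u) sequentially"
        proof (cases "u > x")
          case True
          obtain N :: nat where N: "1 / (u - x) < real N" using reals_Archimedean2 by blast
          show ?thesis using eventually_ge_at_top[of N]
          proof eventually_elim
            case (elim n)
            then have "1 / (u - x) < real n" using N by linarith
            then have "1 < real n * (u - x)" using True by (simp add: field_simps)
            then show ?case using True by simp
          qed
        next
          case False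
          then have "real n * (u - x) \<le> 0" for n by (intro mult_nonneg_nonpos) auto
          then have "min 1 (max 0 (real n * (u - x))) = (indicator {x<..} u :: real)" for n
            using False by (simp add: max_absorb1)
          then show ?thesis by simp
        qed
      qed
    qed
    show "AE u in lborel. norm (k u * min 1 (max 0 (real n * (u - x)))) \<le> \<bar>k u\<bar>" for n
      by (auto simp: abs_mult intro!: mult_left_le)
  qed (use assms(1) in auto)
  moreover have "(\<integral>u. k u * min 1 (max 0 (real n * (u - x))) \<partial>lborel) = 0" for n
    by (intro cont continuous_intros)
  ultimately show "(\<integral>u. k u * indicator {x<..} u \<partial>lborel) = 0"
    by (simp add: LIMSEQ_const_iff)
qed

lemma moments_zero_AE:
  fixes k :: "real \<Rightarrow> complex"
  assumes "integrable lborel k" "\<And>u. u \<notin> {0..T} \<Longrightarrow> k u = 0"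
    and "\<And>j::nat. (\<integral>u. k u * of_real ((T - u) ^ j) \<partial>lborel) = 0"
  shows "AE u in lborel. k u = 0"
proof -
  have [measurable]: "k \<in> borel_measurable borel" using assms(1) by auto
  have int: "integrable lborel (\<lambda>u. k u * of_real ((T - u) ^ j))" for j
  proof (rule Bochner_Integration.integrable_bound)
    show "integrable lborel (\<lambda>u. of_real (\<bar>T\<bar> ^ j) * k u)" using assms(1) by (rule integrable_mult_right)
    show "AE u in lborel. norm (k u * of_real ((T - u) ^ j)) \<le> norm (of_real (\<bar>T\<bar> ^ j) * k u)"
    proof (rule AE_I2)
      fix u show "norm (k u * of_real ((T - u) ^ j)) \<le> norm (of_real (\<bar>T\<bar> ^ j) * k u)"
      proof (cases "u \<in> {0..T}")
        case True
        then have "\<bar>T - u\<bar> ^ j \<le> \<bar>T\<bar> ^ j" by (intro power_mono) auto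
        then have "cmod (k u) * \<bar>T - u\<bar> ^ j \<le> cmod (k u) * \<bar>T\<bar> ^ j" by (intro mult_left_mono) auto
        then show ?thesis
          unfolding norm_mult norm_of_real power_abs abs_abs by (simp add: mult.commute power_abs)
      qed (simp add: assms(2))
    qed
  qed measurable
  have "AE u in lborel. Re (k u) = 0"
  proof (rule moments_zero_AE_real)
    fix j
    have "(\<integral>u. Re (k u) * (T - u) ^ j \<partial>lborel) = (\<integral>u. Re (k u * of_real ((T - u) ^ j)) \<partial>lborel)"
      by (simp del: of_real_power of_real_diff)
    also have "\<dots> = Re (\<integral>u. k u * of_real ((T - u) ^ j) \<partial>lborel)" by (rule integral_Re[OF int])
    finally show "(\<integral>u. Re (k u) * (T - u) ^ j \<partial>lborel) = 0" using assms(3) by simp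
  qed (use assms in auto)
  moreover have "AE u in lborel. Im (k u) = 0"
  proof (rule moments_zero_AE_real)
    fix j
    have "(\<integral>u. Im (k u) * (T - u) ^ j \<partial>lborel) = (\<integral>u. Im (k u * of_real ((T - u) ^ j)) \<partial>lborel)"
      by (simp del: of_real_power of_real_diff)
    also have "\<dots> = Im (\<integral>u. k u * of_real ((T - u) ^ j) \<partial>lborel)" by (rule integral_Im[OF int])
    finally show "(\<integral>u. Im (k u) * (T - u) ^ j \<partial>lborel) = 0" using assms(3) by simp
  qed (use assms in auto)
  ultimately show ?thesis by eventually_elim (simp add: complex_eq_iff)
qed

section \<open>Polynomials as superpositions of the kernels\<close>

context hurst
begin

text \<open>The weight \<open>w\<close> is \<open>- W'\<close> for \<open>W v = v powr (- a) * (T - v) powr m\<close>; it is chosen such that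
  \<open>v powr a * w v - a * v powr (a - 1) * W v\<close> collapses to \<open>m * (T - v) powr (m - 1)\<close>, and with
  \<open>m = n - a\<close> the superposition of the kernels with weight \<open>w\<close> is a multiple of \<open>(T - u) ^ n\<close>.\<close>

definition weight :: "real \<Rightarrow> real \<Rightarrow> real \<Rightarrow> real" where
  "weight T m t = (if 0 < t \<and> t < T then t powr (- a - 1) * (T - t) powr (m - 1) * (a * (T - t) + m * t) else 0)"

lemma weight_measurable [measurable]: "weight T m \<in> borel_measurable borel"
  unfolding weight_def[abs_def] by measurable

lemma kernel_int_measurable_left [measurable]: "(\<lambda>t. kernel_int b t u) \<in> borel_measurable borel"
  unfolding kernel_int_def by measurable

lemma weight_bound:
  assumes "m > 0" "T > 0"
  shows "\<bar>weight T m t\<bar> \<le> (1 + m) * T * (if 0 < t \<and> t < T then t powr (- a - 1) * (T - t) powr (m - 1) else 0)"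
proof (cases "0 < t \<and> t < T")
  case True
  have "\<bar>a * (T - t) + m * t\<bar> \<le> \<bar>a\<bar> * (T - t) + m * t"
    using abs_triangle_ineq[of "a * (T - t)" "m * t"] True assms by (simp add: abs_mult)
  also have "\<dots> \<le> 1 * T + m * T"
    using True assms a_bounds by (intro add_mono mult_mono) auto
  finally have "\<bar>a * (T - t) + m * t\<bar> \<le> (1 + m) * T" by (simp add: algebra_simps)
  then have "t powr (- a - 1) * (T - t) powr (m - 1) * \<bar>a * (T - t) + m * t\<bar> \<le> t powr (- a - 1) * (T - t) powr (m - 1) * ((1 + m) * T)"
    by (intro mult_left_mono) auto
  then show ?thesis using True by (simp add: weight_def abs_mult mult_ac)
qed (auto simp: weight_def)

text \<open>Because \<open>m > 0\<close>, the primitive \<open>W\<close> vanishes at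
  \<open>T\<close>, so integrating \<open>- W'\<close> from \<open>v\<close> to \<open>T\<close>
  returns \<open>W v\<close>.\<close>

lemma weight_integral:
  assumes "m > 0" "0 < v" "v < T"
  shows "has_bochner_integral lborel (\<lambda>t. if v < t then weight T m t else 0) (v powr (- a) * (T - v) powr m)"
proof -
  have T: "T > 0" using assms by simp
  have int: "integrable lborel (\<lambda>t. if v < t then weight T m t else 0)"
  proof (rule Bochner_Integration.integrable_bound)
    have "integrable lborel (\<lambda>t. if 0 < T + (- 1) * t \<and> T + (- 1) * t < T - v then (T + (- 1) * t) powr (m - 1) else 0)"
      using assms by (intro lborel_integrable_real_affine[OF integrable_powr_Ioo]) auto
    then show "integrable lborel (\<lambda>t. ((1 + m) * T * v powr (- a - 1)) * (if v < t \<and> t < T then (T - t) powr (m - 1) else 0))"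
      by (intro integrable_mult_right) (simp add: conj_commute cong: if_cong)
    show "AE t in lborel. norm (if v < t then weight T m t else 0) \<le> norm (((1 + m) * T * v powr (- a - 1)) * (if v < t \<and> t < T then (T - t) powr (m - 1) else 0))"
    proof (rule AE_I2)
      fix t
      show "norm (if v < t then weight T m t else 0) \<le> norm (((1 + m) * T * v powr (- a - 1)) * (if v < t \<and> t < T then (T - t) powr (m - 1) else 0))"
      proof (cases "v < t \<and> t < T")
        case True
        have "\<bar>weight T m t\<bar> \<le> (1 + m) * T * (t powr (- a - 1) * (T - t) powr (m - 1))"
          using weight_bound[OF assms(1) T, of t] True assms by simp
        also have "\<dots> \<le> (1 + m) * T * (v powr (- a - 1) * (T - t) powr (m - 1))"
          using True assms a_bounds T by (intro mult_left_mono mult_right_mono powr_mono2') auto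
        finally show ?thesis using True assms T by (simp add: abs_mult mult_ac)
      next
        case False
        then show ?thesis by (auto simp: weight_def)
      qed
    qed
  qed measurable
  define F where "F t = - (t powr (- a) * (T - t) powr m)" for t
  have "(weight T m has_integral (F T - F v)) {v..T}"
  proof (rule fundamental_theorem_of_calculus_interior)
    show "continuous_on {v..T} F"
      unfolding F_def using assms by (intro continuous_intros continuous_on_powr') auto
    show "(F has_vector_derivative weight T m t) (at t)" if t: "t \<in> {v<..<T}" for t
    proof -
      have "(F has_real_derivative (- ((- a) * t powr (- a - 1) * (T - t) powr m + t powr (- a) * (- (m * (T - t) powr (m - 1)))))) (at t)"
        unfolding F_def[abs_def] using t assms by (auto intro!: derivative_eq_intros simp: algebra_simps)
      moreover have "- ((- a) * t powr (- a - 1) * (T - t) powr m + t powr (- a) * (- (m * (T - t) powr (m - 1)))) = weight T m t"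
      proof -
        have "(T - t) powr m = (T - t) powr ((m - 1) + 1)" by simp
        also have "\<dots> = (T - t) powr (m - 1) * (T - t)" using t by (subst powr_add) simp
        finally have 1: "(T - t) powr m = (T - t) powr (m - 1) * (T - t)" .
        have "t powr (- a) = t powr ((- a - 1) + 1)" by simp
        also have "\<dots> = t powr (- a - 1) * t" using t assms by (subst powr_add) simp
        finally have 2: "t powr (- a) = t powr (- a - 1) * t" .
        show ?thesis unfolding 1 2 weight_def using t assms by (simp add: algebra_simps)
      qed
      ultimately show ?thesis by (simp add: has_real_derivative_iff_has_vector_derivative)
    qed
  qed (use assms in simp)
  moreover have "(weight T m has_integral (\<integral>t. (if v < t then weight T m t else 0) \<partial>lborel)) {v..T}"
  proof -
    have "(\<lambda>t. if v < t then weight T m t else 0) = (\<lambda>t. if t \<in> {v<..<T} then weight T m t else 0)"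
      by (auto simp: weight_def fun_eq_iff)
    with has_integral_integral_lborel[OF int]
    have "(weight T m has_integral (\<integral>t. (if v < t then weight T m t else 0) \<partial>lborel)) {v<..<T}"
      by (simp only: has_integral_restrict_UNIV)
    then show ?thesis by (simp add: has_integral_Icc_iff_Ioo)
  qed
  ultimately have "F T - F v = (\<integral>t. (if v < t then weight T m t else 0) \<partial>lborel)"
    by (rule has_integral_unique)
  then show ?thesis using int assms by (simp add: has_bochner_integral_iff F_def)
qed

lemma Beta_shift_integral:
  assumes "m > 0" "u < T"
  shows "has_bochner_integral lborel (\<lambda>v. if u < v \<and> v < T then (v - u) powr a * (T - v) powr (m - 1) else 0)
    ((T - u) powr (a + m) * Beta (a + 1) m)"
proof -
  define g where "g x = ennreal (indicator {0<..<T - u} x * x powr ((a + 1) - 1) * (T - u - x) powr (m - 1))" for x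
  have [measurable]: "g \<in> borel_measurable borel" unfolding g_def[abs_def] by measurable
  have B: "Beta (a + 1) m \<ge> 0" using assms a_bounds by (intro Beta_nonneg_real) auto
  have "(\<integral>\<^sup>+v. ennreal (if u < v \<and> v < T then (v - u) powr a * (T - v) powr (m - 1) else 0) \<partial>lborel) = (\<integral>\<^sup>+v. g (- u + 1 * v) \<partial>lborel)"
    by (rule nn_integral_cong) (auto simp: g_def indicator_def)
  also have "\<dots> = (\<integral>\<^sup>+v. g v \<partial>lborel)"
    using nn_integral_real_affine[of g 1 "- u"] by simp
  also have "\<dots> = ennreal ((T - u) powr (a + 1 + m - 1) * Beta (a + 1) m)"
    unfolding g_def using assms a_bounds by (intro nn_integral_Beta) auto
  finally show ?thesis using B
    by (intro has_bochner_integral_nn_integral) auto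
qed

lemma weight_kernel:
  assumes "m > 0" "0 < u" "u < T"
  shows "(\<integral>t. weight T m t * xr t u \<partial>lborel) = 2 * H * m * Beta (a + 1) m * (T - u) powr (a + m)"
proof -
  have T: "T > 0" using assms by simp
  define j where "j t v = (if u < v \<and> v < t then (v - u) powr a * v powr (a - 1) else 0)" for t v :: real
  have [measurable]: "(\<lambda>(t, v). j t v) \<in> borel_measurable (lborel \<Otimes>\<^sub>M lborel)" unfolding j_def[abs_def] by measurable
  have jint: "integrable lborel (j t)" for t unfolding j_def[abs_def] by (rule kernel_int_integrable[OF assms(2)])
  have jJ: "integral\<^sup>L lborel (j t) = kernel_int (a - 1) t u" for t unfolding j_def[abs_def] kernel_int_def ..
  have j0: "j t v \<ge> 0" for t v by (simp add: j_def)
  \<comment> \<open>The integrand is nonnegative and its range grows with \<open>t\<close>, so the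
    value at \<open>T\<close> majorises all others; this gives the integrability needed for
    exchanging the integrals.\<close>
  have Jmono: "kernel_int (a - 1) t u \<le> kernel_int (a - 1) T u" if "t \<le> T" for t
    unfolding jJ[symmetric] using that by (intro integral_mono jint) (auto simp: j_def)
  have wv: "has_bochner_integral lborel (\<lambda>t. if v < t then weight T m t else 0) (v powr (- a) * (T - v) powr m)" if "0 < v" "v < T" for v
    using weight_integral[OF assms(1) that] .
  have absw: "integrable lborel (\<lambda>t. if u < t then \<bar>weight T m t\<bar> else 0)"
  proof -
    have "integrable lborel (\<lambda>t. norm (if u < t then weight T m t else 0))"
      using wv[OF assms(2,3)] by (intro integrable_norm) (simp add: has_bochner_integral_iff)
    then show ?thesis by (simp add: if_distrib cong: if_cong)
  qed
  have prod: "integrable (lborel \<Otimes>\<^sub>M lborel) (\<lambda>(t, v). weight T m t * j t v)"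
  proof (rule lborel_pair.Fubini_integrable)
    show "(\<lambda>(t, v). weight T m t * j t v) \<in> borel_measurable (lborel \<Otimes>\<^sub>M lborel)" by measurable
    have eq: "(\<integral>v. norm (case (t, v) of (t, v) \<Rightarrow> weight T m t * j t v) \<partial>lborel) = \<bar>weight T m t\<bar> * kernel_int (a - 1) t u" for t
      using jJ[of t] j0 by (simp add: abs_mult)
    show "integrable lborel (\<lambda>t. \<integral>v. norm (case (t, v) of (t, v) \<Rightarrow> weight T m t * j t v) \<partial>lborel)"
      unfolding eq
    proof (rule Bochner_Integration.integrable_bound[OF integrable_mult_right[OF absw, of "kernel_int (a - 1) T u"]])
      show "AE t in lborel. norm (\<bar>weight T m t\<bar> * kernel_int (a - 1) t u) \<le> norm (kernel_int (a - 1) T u * (if u < t then \<bar>weight T m t\<bar> else 0))"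
      proof (rule AE_I2)
        fix t
        show "norm (\<bar>weight T m t\<bar> * kernel_int (a - 1) t u) \<le> norm (kernel_int (a - 1) T u * (if u < t then \<bar>weight T m t\<bar> else 0))"
        proof (cases "u < t \<and> t < T")
          case True
          then have "\<bar>weight T m t\<bar> * kernel_int (a - 1) t u \<le> \<bar>weight T m t\<bar> * kernel_int (a - 1) T u"
            using Jmono[of t] by (intro mult_left_mono) auto
          then show ?thesis using True kernel_int_nonneg[of "a - 1"] by (simp add: abs_mult mult.commute)
        next
          case False
          have "kernel_int (a - 1) t u = 0" if "t \<le> u"
          proof -
            have "j t = (\<lambda>_. 0)" using that by (auto simp: j_def fun_eq_iff)
            then show ?thesis unfolding jJ[symmetric] by simp
          qed
          then show ?thesis using False by (cases "t \<le> u") (auto simp: weight_def)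
        qed
      qed
    qed measurable
    show "AE t in lborel. integrable lborel (\<lambda>v. case (t, v) of (t, v) \<Rightarrow> weight T m t * j t v)"
      using jint by auto
  qed
  have I2: "has_bochner_integral lborel (\<lambda>t. weight T m t * kernel_int (a - 1) t u)
      (\<integral>v. (if u < v \<and> v < T then (v - u) powr a * v powr (a - 1) * (v powr (- a) * (T - v) powr m) else 0) \<partial>lborel)"
  proof -
    have "integrable lborel (\<lambda>t. \<integral>v. weight T m t * j t v \<partial>lborel)"
      using lborel_pair.integrable_fst[OF prod] by simp
    moreover have "(\<integral>t. (\<integral>v. weight T m t * j t v \<partial>lborel) \<partial>lborel) = (\<integral>v. (\<integral>t. weight T m t * j t v \<partial>lborel) \<partial>lborel)"
      using lborel_pair.Fubini_integral[OF prod] by simp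
    moreover have "(\<integral>t. weight T m t * j t v \<partial>lborel) = (if u < v \<and> v < T then (v - u) powr a * v powr (a - 1) * (v powr (- a) * (T - v) powr m) else 0)" for v
    proof (cases "u < v \<and> v < T")
      case True
      have "(\<integral>t. weight T m t * j t v \<partial>lborel) = (\<integral>t. (v - u) powr a * v powr (a - 1) * (if v < t then weight T m t else 0) \<partial>lborel)"
        using True by (intro Bochner_Integration.integral_cong) (auto simp: j_def)
      also have "\<dots> = (v - u) powr a * v powr (a - 1) * (v powr (- a) * (T - v) powr m)"
        using has_bochner_integral_integral_eq[OF has_bochner_integral_mult_right[OF wv[of v], of "(v - u) powr a * v powr (a - 1)"]] True assms by simp
      finally show ?thesis using True by simp
    next
      case False
      then have "(\<lambda>t. weight T m t * j t v) = (\<lambda>_. 0)" by (auto simp: j_def weight_def fun_eq_iff)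
      then show ?thesis using False by auto
    qed
    ultimately show ?thesis using jJ by (simp add: has_bochner_integral_iff)
  qed
  have simp2: "(if u < v \<and> v < T then (v - u) powr a * v powr (a - 1) * (v powr (- a) * (T - v) powr m) else 0) =
      (if u < v \<and> v < T then (v - u) powr a * (T - v) powr (m - 1) * ((T - v) / v) else 0)" for v
  proof (cases "u < v \<and> v < T")
    case True
    have "v powr (a - 1) * v powr (- a) = v powr (- 1)" by (subst powr_add[symmetric]) simp
    also have "\<dots> = 1 / v" using True assms by (simp add: powr_minus_divide)
    finally have 1: "v powr (a - 1) * v powr (- a) = 1 / v" .
    have "(T - v) powr m = (T - v) powr ((m - 1) + 1)" by simp
    also have "\<dots> = (T - v) powr (m - 1) * (T - v)" using True by (subst powr_add) simp
    finally have 2: "(T - v) powr m = (T - v) powr (m - 1) * (T - v)" .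
    have "(v - u) powr a * v powr (a - 1) * (v powr (- a) * (T - v) powr m) = (v - u) powr a * (v powr (a - 1) * v powr (- a)) * (T - v) powr m"
      by (simp only: mult_ac)
    then show ?thesis unfolding 1 2 using True by simp
  qed auto
  define b where "b v = (if u < v \<and> v < T then (v - u) powr a * (T - v) powr (m - 1) else 0)" for v
  have b: "has_bochner_integral lborel b ((T - u) powr (a + m) * Beta (a + 1) m)"
    unfolding b_def[abs_def] by (rule Beta_shift_integral[OF assms(1,3)])
  have bint: "integrable lborel b" using b by (simp add: has_bochner_integral_iff)
  have [measurable]: "b \<in> borel_measurable borel" using bint by auto
  have b2: "integrable lborel (\<lambda>v. b v * ((T - v) / v))"
  proof (rule Bochner_Integration.integrable_bound[OF integrable_mult_right[OF bint, of "T / u"]])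
    show "AE v in lborel. norm (b v * ((T - v) / v)) \<le> norm (T / u * b v)"
    proof (rule AE_I2)
      fix v show "norm (b v * ((T - v) / v)) \<le> norm (T / u * b v)"
      proof (cases "u < v \<and> v < T")
        case True
        then have "(T - v) / v \<le> T / u" using assms by (intro frac_le) auto
        moreover have "0 \<le> (T - v) / v" "0 \<le> T / u" "0 \<le> b v" using True assms T by (auto simp: b_def)
        ultimately show ?thesis by (simp only: real_norm_def abs_mult abs_of_nonneg mult.commute[of "b v"] mult_right_mono)
      qed (auto simp: b_def)
    qed
  qed measurable
  \<comment> \<open>The second summand equals the integrand obtained from the
    \<open>kernel_int\<close> part, so the two cancel in the final difference and only
    \<open>m * b v\<close> is left.\<close>
  have I1: "(\<lambda>t. weight T m t * (if u < t then t powr a * (t - u) powr a else 0)) = (\<lambda>v. m * b v + a * (b v * ((T - v) / v)))"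
  proof
    fix v
    show "weight T m v * (if u < v then v powr a * (v - u) powr a else 0) = m * b v + a * (b v * ((T - v) / v))"
    proof (cases "u < v \<and> v < T")
      case True
      have "v powr (- a - 1) * v powr a = v powr (- 1)" by (subst powr_add[symmetric]) simp
      also have "\<dots> = 1 / v" using True assms by (simp add: powr_minus_divide)
      finally have 1: "v powr (- a - 1) * v powr a = 1 / v" .
      have "weight T m v * (v powr a * (v - u) powr a) = (v powr (- a - 1) * v powr a) * (T - v) powr (m - 1) * (a * (T - v) + m * v) * (v - u) powr a"
        using True assms by (simp add: weight_def mult_ac)
      then show ?thesis unfolding 1 using True assms by (simp add: b_def field_simps)
    qed (auto simp: b_def weight_def)
  qed
  have int1: "integrable lborel (\<lambda>t. weight T m t * (if u < t then t powr a * (t - u) powr a else 0))"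
    unfolding I1 by (intro Bochner_Integration.integrable_add integrable_mult_right bint b2)
  have xw: "weight T m t * xr t u = 2 * H * (weight T m t * (if u < t then t powr a * (t - u) powr a else 0)) - 2 * H * a * (weight T m t * kernel_int (a - 1) t u)" for t
  proof (cases "u < t")
    case True
    then show ?thesis using assms by (simp add: xr_def algebra_simps)
  next
    case False
    then have "j t = (\<lambda>_. 0)" by (auto simp: j_def fun_eq_iff)
    then have "kernel_int (a - 1) t u = 0" unfolding jJ[symmetric] by simp
    then show ?thesis using False by (simp add: xr_def)
  qed
  have "(\<integral>t. weight T m t * xr t u \<partial>lborel) = 2 * H * (\<integral>t. weight T m t * (if u < t then t powr a * (t - u) powr a else 0) \<partial>lborel) - 2 * H * a * (\<integral>t. weight T m t * kernel_int (a - 1) t u \<partial>lborel)"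
    unfolding xw using int1 I2 by (subst Bochner_Integration.integral_diff) (auto simp: has_bochner_integral_iff)
  also have "(\<integral>t. weight T m t * kernel_int (a - 1) t u \<partial>lborel) = (\<integral>v. b v * ((T - v) / v) \<partial>lborel)"
    unfolding has_bochner_integral_integral_eq[OF I2] simp2 by (rule Bochner_Integration.integral_cong) (auto simp: b_def)
  also have "(\<integral>t. weight T m t * (if u < t then t powr a * (t - u) powr a else 0) \<partial>lborel) = m * integral\<^sup>L lborel b + a * (\<integral>v. b v * ((T - v) / v) \<partial>lborel)"
    unfolding I1 Bochner_Integration.integral_add[OF integrable_mult_right[OF bint] integrable_mult_right[OF b2]]
      integral_mult_right_zero ..
  finally have "(\<integral>t. weight T m t * xr t u \<partial>lborel) = 2 * H * m * integral\<^sup>L lborel b" by (simp add: algebra_simps)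
  then show ?thesis using has_bochner_integral_integral_eq[OF b] by simp
qed

text \<open>The bound of order \<open>t powr H\<close> replaces square integrability of
  \<open>g\<close> relative to \<open>dV\<close>: the weights blow up like
  \<open>t powr (- a - 1)\<close> at 0, and the bound makes the double integral of weight, kernel
  and \<open>g\<close> absolutely convergent.\<close>

lemma orthogonal_kernels_AE:
  fixes g :: "real \<Rightarrow> complex"
  assumes T: "T > 0" and g: "integrable lborel g" "\<And>u. u \<notin> {0<..T} \<Longrightarrow> g u = 0"
    and bound: "\<And>t. 0 < t \<Longrightarrow> t \<le> T \<Longrightarrow> (\<integral>\<^sup>+u. ennreal (cmod (g u) * xr t u) \<partial>lborel) \<le> ennreal (C * t powr H)"
    and C: "C \<ge> 0"
    and orth: "\<And>t. 0 < t \<Longrightarrow> t \<le> T \<Longrightarrow> (\<integral>u. g u * of_real (xr t u) \<partial>lborel) = 0"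
  shows "AE u in lborel. g u = 0"
proof -
  have [measurable]: "g \<in> borel_measurable borel" using g(1) by auto
  have xm [measurable]: "(\<lambda>(t, u). xr t u) \<in> borel_measurable (lborel \<Otimes>\<^sub>M lborel)"
    unfolding xr_def kernel_int_def by measurable
  have mom: "(\<integral>u. g u * of_real ((T - u) ^ n) \<partial>lborel) = 0" if n: "n \<ge> 1" for n :: nat
  proof -
    \<comment> \<open>Then \<open>a + m = n\<close>, so the superposition is a multiple of
      \<open>(T - u) ^ n\<close>. The requirement \<open>m > 0\<close> would fail for
      \<open>n = 0\<close> when \<open>a >= 0\<close>.\<close>
    define m where "m = real n - a"
    have m: "m > 0" using n a_bounds by (simp add: m_def)
    let ?k = "\<lambda>(t, u). of_real (weight T m t * xr t u) * g u"
    have [measurable]: "?k \<in> borel_measurable (lborel \<Otimes>\<^sub>M lborel)" by measurable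
    have prod: "integrable (lborel \<Otimes>\<^sub>M lborel) ?k"
    proof (rule integrableI_bounded)
      have "(\<integral>\<^sup>+z. ennreal (norm (?k z)) \<partial>(lborel \<Otimes>\<^sub>M lborel)) = (\<integral>\<^sup>+t. \<integral>\<^sup>+u. ennreal (norm (?k (t, u))) \<partial>lborel \<partial>lborel)"
        by (rule lborel.nn_integral_fst[symmetric]) measurable
      also have "\<dots> \<le> (\<integral>\<^sup>+t. ennreal ((1 + m) * T * C) * ennreal (indicator {0<..<T} t * t powr (1/2 - 1) * (T - t) powr (m - 1)) \<partial>lborel)"
      proof (rule nn_integral_mono)
        fix t
        show "(\<integral>\<^sup>+u. ennreal (norm (?k (t, u))) \<partial>lborel) \<le> ennreal ((1 + m) * T * C) * ennreal (indicator {0<..<T} t * t powr (1/2 - 1) * (T - t) powr (m - 1))"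
        proof (cases "0 < t \<and> t < T")
          case True
          have "(\<integral>\<^sup>+u. ennreal (norm (?k (t, u))) \<partial>lborel) = (\<integral>\<^sup>+u. ennreal \<bar>weight T m t\<bar> * ennreal (cmod (g u) * xr t u) \<partial>lborel)"
            using xr_nonneg by (intro nn_integral_cong) (simp add: norm_mult abs_mult ennreal_mult'[symmetric] mult_ac)
          also have "\<dots> = ennreal \<bar>weight T m t\<bar> * (\<integral>\<^sup>+u. ennreal (cmod (g u) * xr t u) \<partial>lborel)"
            by (rule nn_integral_cmult) measurable
          also have "\<dots> \<le> ennreal \<bar>weight T m t\<bar> * ennreal (C * t powr H)"
            using True by (intro mult_left_mono bound) auto
          also have "\<dots> = ennreal (\<bar>weight T m t\<bar> * (C * t powr H))" using C by (simp add: ennreal_mult')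
          also have "\<dots> \<le> ennreal (((1 + m) * T * (t powr (- a - 1) * (T - t) powr (m - 1))) * (C * t powr H))"
            using weight_bound[OF m T, of t] True C by (intro ennreal_leI mult_right_mono) auto
          also have "((1 + m) * T * (t powr (- a - 1) * (T - t) powr (m - 1))) * (C * t powr H) = ((1 + m) * T * C) * (t powr (1/2 - 1) * (T - t) powr (m - 1))"
          proof -
            \<comment> \<open>Since \<open>H = a + 1/2\<close>, the exponents add up to
              \<open>- 1/2\<close>, whatever \<open>H\<close> is.\<close>
            have "t powr (- a - 1) * t powr H = t powr (1/2 - 1)"
              by (subst powr_add[symmetric]) (simp add: a_def)
            moreover have "((1 + m) * T * (t powr (- a - 1) * (T - t) powr (m - 1))) * (C * t powr H) =
                ((1 + m) * T * C) * ((t powr (- a - 1) * t powr H) * (T - t) powr (m - 1))"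
              by (simp only: mult_ac)
            ultimately show ?thesis by (simp only:)
          qed
          also have "ennreal \<dots> = ennreal ((1 + m) * T * C) * ennreal (indicator {0<..<T} t * t powr (1/2 - 1) * (T - t) powr (m - 1))"
            using True m T C by (simp add: ennreal_mult'[symmetric])
          finally show ?thesis .
        next
          case False
          then have "weight T m t = 0" by (auto simp: weight_def)
          then show ?thesis by simp
        qed
      qed
      also have "\<dots> = ennreal ((1 + m) * T * C) * ennreal (T powr (1/2 + m - 1) * Beta (1/2) m)"
        using nn_integral_Beta[of "1/2" m T] m T by (subst nn_integral_cmult) auto
      also have "\<dots> < \<infinity>" by (simp add: ennreal_mult_less_top)
      finally show "(\<integral>\<^sup>+z. ennreal (norm (?k z)) \<partial>(lborel \<Otimes>\<^sub>M lborel)) < \<infinity>" .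
    qed measurable
    have inner: "(\<integral>u. ?k (t, u) \<partial>lborel) = 0" for t
      proof (cases "0 < t \<and> t < T")
        case True
        have "(\<integral>u. ?k (t, u) \<partial>lborel) = (\<integral>u. of_real (weight T m t) * (g u * of_real (xr t u)) \<partial>lborel)"
          by (rule Bochner_Integration.integral_cong) (auto simp: mult_ac)
        also have "\<dots> = of_real (weight T m t) * (\<integral>u. g u * of_real (xr t u) \<partial>lborel)" by simp
        finally show ?thesis using orth[of t] True by simp
      next
        case False
        then have "weight T m t = 0" by (auto simp: weight_def)
        then show ?thesis by simp
      qed
    have z: "(\<integral>u. (\<integral>t. ?k (t, u) \<partial>lborel) \<partial>lborel) = 0"
    proof -
      have "(\<integral>u. (\<integral>t. ?k (t, u) \<partial>lborel) \<partial>lborel) = (\<integral>t. (\<integral>u. ?k (t, u) \<partial>lborel) \<partial>lborel)"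
        using lborel_pair.Fubini_integral[OF prod] by simp
      also have "\<dots> = 0" unfolding inner by simp
      finally show ?thesis .
    qed
    define K where "K = 2 * H * m * Beta (a + 1) m"
    have "K > 0" unfolding K_def Beta_def using H m a_bounds Gamma_real_pos
      by (intro mult_pos_pos divide_pos_pos) auto
    have "(\<integral>t. ?k (t, u) \<partial>lborel) = of_real K * (g u * of_real ((T - u) ^ n))" if "u \<noteq> T" for u
    proof (cases "u \<in> {0<..<T}")
      case True
      have "(\<integral>t. ?k (t, u) \<partial>lborel) = of_real (\<integral>t. weight T m t * xr t u \<partial>lborel) * g u"
        by (simp only: prod.case integral_mult_left_zero integral_complex_of_real)
      also have "(\<integral>t. weight T m t * xr t u \<partial>lborel) = K * (T - u) ^ n"
        using weight_kernel[OF m, of u T] True powr_realpow[of "T - u" n] by (simp add: K_def m_def)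
      finally show ?thesis by (simp add: mult_ac)
    next
      case False
      then have "g u = 0" using g(2)[of u] that by auto
      then show ?thesis by simp
    qed
    then have "(\<integral>u. (\<integral>t. ?k (t, u) \<partial>lborel) \<partial>lborel) = (\<integral>u. of_real K * (g u * of_real ((T - u) ^ n)) \<partial>lborel)"
      using AE_lborel_singleton[of T]
      by (intro integral_cong_AE) (auto intro!: lborel.borel_measurable_lebesgue_integral)
    with z \<open>K > 0\<close> show ?thesis by simp
  qed
  have "AE u in lborel. g u * of_real (T - u) = 0"
  proof (rule moments_zero_AE)
    show "integrable lborel (\<lambda>u. g u * of_real (T - u))"
    proof (rule Bochner_Integration.integrable_bound[OF integrable_mult_right[OF g(1), of "of_real T"]])
      show "AE u in lborel. norm (g u * of_real (T - u)) \<le> norm (of_real T * g u)"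
      proof (rule AE_I2)
        fix u show "norm (g u * of_real (T - u)) \<le> norm (of_real T * g u)"
        proof (cases "u \<in> {0<..T}")
          case True
          then have "cmod (g u) * \<bar>T - u\<bar> \<le> cmod (g u) * T" by (intro mult_left_mono) auto
          then show ?thesis unfolding norm_mult norm_of_real using T by (simp add: mult.commute)
        qed (simp add: g(2))
      qed
    qed measurable
    show "g u * of_real (T - u) = 0" if "u \<notin> {0..T}" for u using that g(2)[of u] by auto
    fix j
    show "(\<integral>u. g u * of_real (T - u) * of_real ((T - u) ^ j) \<partial>lborel) = 0"
      using mom[of "Suc j"] by (simp add: mult.assoc)
  qed
  then show ?thesis using AE_lborel_singleton[of T] by eventually_elim auto
qed

end

section \<open>The spectral side\<close>

definition spectral_const :: "real \<Rightarrow> real" where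
  "spectral_const H = sin (pi * H) * Gamma (1 + 2 * H) / (2 * pi)"

definition spectral_density :: "real \<Rightarrow> real \<Rightarrow> real" where
  "spectral_density H l = spectral_const H * \<bar>l\<bar> powr (1 - 2 * H)"

lemma spectral_density_measurable [measurable]: "spectral_density H \<in> borel_measurable borel"
  unfolding spectral_density_def[abs_def] by measurable

lemma spectral_measure_eq: "spectral_measure H = density lborel (\<lambda>l. ennreal (spectral_density H l))"
  unfolding spectral_measure_def spectral_density_def spectral_const_def ..

lemma space_spectral [simp]: "space (spectral_measure H) = UNIV"
  and sets_spectral [simp, measurable_cong]: "sets (spectral_measure H) = sets borel"
  by (auto simp: spectral_measure_eq)

lemma sigma_finite_spectral: "sigma_finite_measure (spectral_measure H)"
  unfolding spectral_measure_eq
  by (subst sigma_finite_measure.sigma_finite_iff_density_finite[OF sigma_finite_lborel]) auto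

lemma spectral_const_pos:
  assumes "0 < H" "H < 1"
  shows "spectral_const H > 0"
proof -
  have "sin (pi * H) > 0" using assms by (intro sin_gt_zero) auto
  then show ?thesis unfolding spectral_const_def using assms Gamma_real_pos[of "1 + 2 * H"] by simp
qed

lemma has_bochner_integral_spectral:
  fixes f :: "real \<Rightarrow> 'b :: {banach, second_countable_topology}"
  assumes "0 < H" "H < 1" and [measurable]: "f \<in> borel_measurable borel"
    and "has_bochner_integral lborel (\<lambda>l. spectral_density H l *\<^sub>R f l) I"
  shows "has_bochner_integral (spectral_measure H) f I"
  unfolding spectral_measure_eq
  by (rule has_bochner_integral_density) (use assms spectral_const_pos[of H] in \<open>auto simp: spectral_density_def\<close>)

section \<open>The functions e_t and their inner products\<close>

lemma e_fun_measurable [measurable]: "e_fun t \<in> borel_measurable borel"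
  unfolding e_fun_def[abs_def] by measurable

lemma e_fun_0 [simp]: "e_fun 0 l = 0"
  by (simp add: e_fun_def)

lemma norm_exp_i_mult: "cmod (exp (\<i> * of_real l * of_real t)) = 1"
  by (metis mult.assoc norm_exp_i_times of_real_mult)

lemma exp_i_mult_eq: "exp (\<i> * of_real l * of_real t) = Complex (cos (l * t)) (sin (l * t))"
proof -
  have "exp (\<i> * of_real l * of_real t) = cis (l * t)"
    by (simp add: cis_conv_exp mult.assoc)
  then show ?thesis by (simp add: complex_eq_iff)
qed

lemma norm_e_fun_sq: "l \<noteq> 0 \<Longrightarrow> (cmod (e_fun t l))\<^sup>2 = 2 * (1 - cos (l * t)) / l\<^sup>2"
proof -
  assume l: "l \<noteq> 0"
  have "(cmod (exp (\<i> * of_real l * of_real t) - 1))\<^sup>2 = 2 * (1 - cos (l * t))"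
    unfolding exp_i_mult_eq cmod_power2 using sin_cos_squared_add[of "l * t"]
    by (simp add: power2_diff algebra_simps)
  then show ?thesis using l by (simp add: e_fun_def norm_divide norm_mult power_divide)
qed

lemma norm_e_fun_le:
  "cmod (e_fun t l) \<le> \<bar>t\<bar>" "l \<noteq> 0 \<Longrightarrow> cmod (e_fun t l) \<le> 2 / \<bar>l\<bar>"
proof -
  show "l \<noteq> 0 \<Longrightarrow> cmod (e_fun t l) \<le> 2 / \<bar>l\<bar>"
  proof -
    assume l: "l \<noteq> 0"
    have "cmod (exp (\<i> * of_real l * of_real t) - 1) \<le> cmod (exp (\<i> * of_real l * of_real t)) + cmod 1"
      by (rule norm_triangle_ineq4)
    then have "cmod (exp (\<i> * of_real l * of_real t) - 1) \<le> 2" by (simp add: norm_exp_i_mult)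
    then show ?thesis using l by (simp add: e_fun_def norm_divide norm_mult divide_right_mono)
  qed
  show "cmod (e_fun t l) \<le> \<bar>t\<bar>"
  proof (cases "l = 0")
    case False
    have "1 - cos (l * t) \<le> (l * t)\<^sup>2 / 2"
    proof -
      have "cos (l * t) = 1 - 2 * (sin (l * t / 2))\<^sup>2" using cos_double_sin[of "l * t / 2"] by simp
      moreover have "(sin (l * t / 2))\<^sup>2 \<le> (l * t / 2)\<^sup>2"
        using abs_sin_x_le_abs_x[of "l * t / 2"] by (simp only: abs_le_square_iff)
      ultimately show ?thesis by (simp add: power_divide)
    qed
    then have "(cmod (e_fun t l))\<^sup>2 \<le> (\<bar>t\<bar>)\<^sup>2"
      unfolding norm_e_fun_sq[OF False] using False by (simp add: field_simps power_mult_distrib)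
    then show ?thesis by (rule power2_le_imp_le) simp
  qed (simp add: e_fun_def)
qed

text \<open>The integral is computed by writing \<open>l powr (- 1 - 2 * H)\<close> as a Gamma integral in an auxiliary
  variable \<open>r\<close>; the \<open>l\<close>-integral is then elementary and the remaining \<open>r\<close>-integral is a Beta integral.\<close>

lemma nn_integral_exp_one_minus_cos:
  assumes "r > 0"
  shows "(\<integral>\<^sup>+l. ennreal (exp (- (r * l)) * (1 - cos (l * t))) * indicator {0..} l \<partial>lborel) = ennreal (t\<^sup>2 / (r * (r\<^sup>2 + t\<^sup>2)))"
proof -
  have D: "r\<^sup>2 + t\<^sup>2 > 0" using assms by (simp add: add_pos_nonneg)
  \<comment> \<open>The primitive of \<open>exp (- (r * l)) * (1 - cos (l * t))\<close> that
    vanishes at infinity.\<close>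
  define F where "F l = - exp (- (r * l)) / r + exp (- (r * l)) * (r * cos (l * t) - t * sin (l * t)) / (r\<^sup>2 + t\<^sup>2)" for l
  have "(\<integral>\<^sup>+l. ennreal (exp (- (r * l)) * (1 - cos (l * t))) * indicator {0..} l \<partial>lborel) = ennreal (0 - F 0)"
  proof (rule nn_integral_FTC_atLeast)
    show "DERIV F l :> exp (- (r * l)) * (1 - cos (l * t))" if "0 \<le> l" for l
    proof -
      have "DERIV F l :> exp (- (r * l)) + (- r * exp (- (r * l)) * (r * cos (l * t) - t * sin (l * t)) + exp (- (r * l)) * (- r * t * sin (l * t) - t * t * cos (l * t))) / (r\<^sup>2 + t\<^sup>2)"
      proof -
        have E: "DERIV (\<lambda>l. exp (- (r * l))) l :> - r * exp (- (r * l))"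
          by (auto intro!: derivative_eq_intros)
        have P: "DERIV (\<lambda>l. r * cos (l * t) - t * sin (l * t)) l :> - r * t * sin (l * t) - t * t * cos (l * t)"
          by (auto intro!: derivative_eq_intros)
        have "DERIV F l :> - (- r * exp (- (r * l))) / r + (- r * exp (- (r * l)) * (r * cos (l * t) - t * sin (l * t)) + (- r * t * sin (l * t) - t * t * cos (l * t)) * exp (- (r * l))) / (r\<^sup>2 + t\<^sup>2)"
          unfolding F_def[abs_def] by (intro DERIV_add DERIV_cdivide DERIV_mult DERIV_minus E P)
        then show ?thesis using assms by (simp add: mult.commute)
      qed
      also have "- r * exp (- (r * l)) * (r * cos (l * t) - t * sin (l * t)) + exp (- (r * l)) * (- r * t * sin (l * t) - t * t * cos (l * t)) = - (exp (- (r * l)) * cos (l * t)) * (r\<^sup>2 + t\<^sup>2)"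
        by (simp add: power2_eq_square algebra_simps)
      also have "- (exp (- (r * l)) * cos (l * t)) * (r\<^sup>2 + t\<^sup>2) / (r\<^sup>2 + t\<^sup>2) = - (exp (- (r * l)) * cos (l * t))"
        by (rule nonzero_mult_div_cancel_right) (use D in linarith)
      finally show ?thesis by (simp add: right_diff_distrib)
    qed
    have e0: "((\<lambda>l. exp (- (r * l))) \<longlongrightarrow> 0) at_top"
      by (rule filterlim_compose[OF exp_at_bot])
         (auto simp: filterlim_uminus_at_bot intro!: filterlim_tendsto_pos_mult_at_top[OF tendsto_const assms] filterlim_ident)
    have e1: "((\<lambda>l. exp (- (r * l)) * (r * cos (l * t) - t * sin (l * t))) \<longlongrightarrow> 0) at_top"
    proof (rule tendsto_0_le[OF e0, of _ "r + \<bar>t\<bar>"], rule always_eventually, rule allI)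
      fix l
      have "\<bar>r * cos (l * t) - t * sin (l * t)\<bar> \<le> \<bar>r * cos (l * t)\<bar> + \<bar>t * sin (l * t)\<bar>"
        by (rule abs_triangle_ineq4)
      also have "\<dots> \<le> r * 1 + \<bar>t\<bar> * 1"
        unfolding abs_mult using assms by (intro add_mono mult_mono) auto
      finally show "norm (exp (- (r * l)) * (r * cos (l * t) - t * sin (l * t))) \<le> norm (exp (- (r * l))) * (r + \<bar>t\<bar>)"
        by (simp add: abs_mult)
    qed
    show "(F \<longlongrightarrow> 0) at_top"
      unfolding F_def[abs_def]
      using tendsto_add[OF tendsto_divide[OF tendsto_minus[OF e0] tendsto_const[of r]] tendsto_divide[OF e1 tendsto_const[of "r\<^sup>2 + t\<^sup>2"]]] assms D
      by simp
  qed auto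
  also have "0 - F 0 = t\<^sup>2 / (r * (r\<^sup>2 + t\<^sup>2))"
    using assms D by (simp add: F_def field_simps power2_eq_square)
  finally show ?thesis .
qed

text \<open>The substitution \<open>s = r ^ 2\<close> in the improper Beta integral with integrand
  \<open>s powr (H - 1) / (1 + s)\<close>.\<close>

lemma has_integral_Beta_half:
  assumes "0 < H" "H < 1"
  shows "((\<lambda>r::real. 2 * (r powr (2 * H - 1) / (1 + r\<^sup>2))) has_integral Beta H (1 - H)) {0<..}"
proof -
  define f where "f s = s powr (H - 1) / (1 + s)" for s :: real
  have B: "Beta H (1 - H) \<ge> 0" using assms by (intro Beta_nonneg_real) auto
  have "(\<integral>\<^sup>+s. ennreal (indicator {0<..} s * f s) \<partial>lborel) = ennreal (Beta H (1 - H))"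
  proof -
    have "indicator {0<..} s * s powr (H - 1) * (1 + s) powr (- H - (1 - H)) = indicator {0<..} s * f s" for s
      by (auto simp: f_def indicator_def powr_minus_divide)
    then show ?thesis using nn_integral_Beta_prime[of H "1 - H"] assms by simp
  qed
  moreover have "0 \<le> indicator {0<..} s * f s" for s by (simp add: f_def indicator_def)
  ultimately have "integrable lborel (\<lambda>s. indicator {0<..} s * f s) \<and> integral\<^sup>L lborel (\<lambda>s. indicator {0<..} s * f s) = Beta H (1 - H)"
    using B by (subst nn_integral_eq_integrable[symmetric]) (simp_all, simp add: f_def)
  then have "((\<lambda>s. indicator {0<..} s * f s) has_integral Beta H (1 - H)) UNIV"
    using has_integral_integral_lborel by metis
  also have "(\<lambda>s. indicator {0<..} s * f s) = (\<lambda>s. if s \<in> {0<..} then f s else 0)" by (auto simp: indicator_def)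
  finally have hf: "(f has_integral Beta H (1 - H)) {0<..}" by (simp only: has_integral_restrict_UNIV)
  have im: "(\<lambda>r::real. r\<^sup>2) ` {0<..} = {0<..}"
  proof (intro equalityI subsetI)
    fix s :: real assume "s \<in> {0<..}"
    then have "s = (sqrt s)\<^sup>2" "sqrt s \<in> {0<..}" by auto
    then show "s \<in> (\<lambda>r. r\<^sup>2) ` {0<..}" by blast
  qed auto
  have "f absolutely_integrable_on {0<..}"
    using hf by (intro nonnegative_absolutely_integrable_1) (auto simp: f_def)
  then have "f absolutely_integrable_on (\<lambda>r::real. r\<^sup>2) ` {0<..} \<and> integral ((\<lambda>r::real. r\<^sup>2) ` {0<..}) f = Beta H (1 - H)"
    unfolding im using hf by (auto intro: integral_unique)
  then have "(\<lambda>r. \<bar>2 * r\<bar> * f (r\<^sup>2)) absolutely_integrable_on {0<..} \<and> integral {0<..} (\<lambda>r. \<bar>2 * r\<bar> * f (r\<^sup>2)) = Beta H (1 - H)"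
    by (subst has_absolute_integral_change_of_variables_1')
       (auto intro!: derivative_eq_intros inj_onI simp: power2_eq_iff)
  then have "((\<lambda>r. \<bar>2 * r\<bar> * f (r\<^sup>2)) has_integral Beta H (1 - H)) {0<..}"
    by (metis absolutely_integrable_on_def has_integral_integral)
  moreover have "\<bar>2 * r\<bar> * f (r\<^sup>2) = 2 * (r powr (2 * H - 1) / (1 + r\<^sup>2))" if "r \<in> {0<..}" for r
  proof -
    have r: "r > 0" using that by simp
    have "(r\<^sup>2) powr (H - 1) = r powr (2 * (H - 1))" using r by (simp add: powr_powr flip: powr_numeral)
    moreover have "r * r powr (2 * (H - 1)) = r powr (2 * H - 1)"
      using r powr_add[of r 1 "2 * (H - 1)"] by (simp add: algebra_simps)
    ultimately show ?thesis using r by (simp add: f_def)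
  qed
  ultimately show ?thesis by (subst (asm) has_integral_cong) auto
qed

text \<open>As \<open>Gamma 1 = 1\<close>, this is Euler's reflection formula. The sine produced
  here cancels the one in the spectral constant.\<close>

lemma Beta_reflection:
  assumes "0 < H" "H < 1"
  shows "Beta H (1 - H) = pi / sin (pi * H :: real)"
proof -
  have "complex_of_real (Gamma H * Gamma (1 - H)) = of_real (pi / sin (pi * H))"
    using Gamma_reflection_complex[of "of_real H"]
  proof -
    have "Gamma (complex_of_real H) = of_real (Gamma H)" "Gamma (1 - complex_of_real H) = of_real (Gamma (1 - H))"
      using Gamma_complex_of_real[of H] Gamma_complex_of_real[of "1 - H"] by simp_all
    moreover have "sin (of_real pi * complex_of_real H) = of_real (sin (pi * H))"
      by (simp only: of_real_mult[symmetric] sin_of_real)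
    moreover assume "Gamma (complex_of_real H) * Gamma (1 - complex_of_real H) = complex_of_real pi / sin (complex_of_real pi * complex_of_real H)"
    ultimately show ?thesis by simp
  qed
  then have "Gamma H * Gamma (1 - H) = pi / sin (pi * H)" by (simp only: of_real_eq_iff)
  then show ?thesis by (simp add: Beta_def)
qed

lemma nn_integral_powr_mult_rational:
  assumes "0 < H" "H < 1" "t > 0"
  shows "(\<integral>\<^sup>+r. ennreal (indicator {0<..} r * (r powr (2 * H) * (t\<^sup>2 / (r * (r\<^sup>2 + t\<^sup>2))))) \<partial>lborel) = ennreal (t powr (2 * H) * Beta H (1 - H) / 2)"
proof -
  define g where "g r = ennreal (indicator {0<..} r * (r powr (2 * H) * (t\<^sup>2 / (r * (r\<^sup>2 + t\<^sup>2)))))" for r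
  have [measurable]: "g \<in> borel_measurable borel" unfolding g_def[abs_def] by measurable
  have B: "(\<integral>\<^sup>+r. ennreal (indicator {0<..} r * (2 * (r powr (2 * H - 1) / (1 + r\<^sup>2)))) \<partial>lborel) = ennreal (Beta H (1 - H))"
    using nn_integral_has_integral_lebesgue[OF _ has_integral_Beta_half[OF assms(1,2)]] by simp
  have "(\<integral>\<^sup>+r. g r \<partial>lborel) = \<bar>t\<bar> * (\<integral>\<^sup>+r. g (0 + t * r) \<partial>lborel)"
    using assms by (intro nn_integral_real_affine) auto
  also have "(\<integral>\<^sup>+r. g (0 + t * r) \<partial>lborel) = (\<integral>\<^sup>+r. ennreal (t powr (2 * H - 1) / 2) * ennreal (indicator {0<..} r * (2 * (r powr (2 * H - 1) / (1 + r\<^sup>2)))) \<partial>lborel)"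
  proof (rule nn_integral_cong)
    fix r :: real
    show "g (0 + t * r) = ennreal (t powr (2 * H - 1) / 2) * ennreal (indicator {0<..} r * (2 * (r powr (2 * H - 1) / (1 + r\<^sup>2))))"
    proof (cases "r > 0")
      case True
      have D: "(t * r)\<^sup>2 + t\<^sup>2 = t\<^sup>2 * (1 + r\<^sup>2)" by (simp add: power_mult_distrib algebra_simps)
      have "1 + r\<^sup>2 \<noteq> 0" by (simp add: add_nonneg_eq_0_iff)
      then have "(t * r) powr (2 * H) * (t\<^sup>2 / (t * r * ((t * r)\<^sup>2 + t\<^sup>2))) = (t powr (2 * H) / t) * (r powr (2 * H) / r) / (1 + r\<^sup>2)"
        unfolding D using assms True by (simp add: powr_mult)
      also have "\<dots> = t powr (2 * H - 1) * r powr (2 * H - 1) / (1 + r\<^sup>2)"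
        using assms True by (simp add: powr_diff)
      finally show ?thesis using assms True by (simp add: g_def ennreal_mult'[symmetric])
    next
      case False
      then show ?thesis using assms by (simp add: g_def zero_less_mult_iff)
    qed
  qed
  also have "\<dots> = ennreal (t powr (2 * H - 1) / 2) * ennreal (Beta H (1 - H))"
    unfolding B[symmetric] by (rule nn_integral_cmult) measurable
  also have "ennreal \<bar>t\<bar> * (ennreal (t powr (2 * H - 1) / 2) * ennreal (Beta H (1 - H))) = ennreal (t powr (2 * H) * Beta H (1 - H) / 2)"
  proof -
    have "t * t powr (2 * H - 1) = t powr (2 * H)" using assms by (simp add: powr_diff)
    moreover have "Beta H (1 - H) \<ge> 0" using assms by (intro Beta_nonneg_real) auto
    ultimately show ?thesis using assms by (simp add: ennreal_mult'[symmetric] mult_ac)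
  qed
  finally show ?thesis by (simp add: g_def)
qed

lemma nn_integral_one_minus_cos:
  assumes "0 < H" "H < 1" "t > 0"
  shows "(\<integral>\<^sup>+l. ennreal (indicator {0<..} l * ((1 - cos (l * t)) * l powr (- 1 - 2 * H))) \<partial>lborel) =
    ennreal (t powr (2 * H) * Beta H (1 - H) / 2 / Gamma (1 + 2 * H))"
proof -
  have G: "Gamma (1 + 2 * H) > 0" using assms by (intro Gamma_real_pos) auto
  \<comment> \<open>Since \<open>1 - cos\<close> is nonnegative, so is the double integrand, and
    Tonelli's theorem permits the exchange.\<close>
  define h where "h l r = ennreal (indicator {0<..} l * indicator {0<..} r * ((1 - cos (l * t)) * (r powr (2 * H) * exp (- (l * r)))))" for l r :: real
  have [measurable]: "(\<lambda>(l, r). h l r) \<in> borel_measurable (lborel \<Otimes>\<^sub>M lborel)" unfolding h_def[abs_def] by measurable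
  have 1: "(\<integral>\<^sup>+r. h l r \<partial>lborel) = ennreal (Gamma (1 + 2 * H)) * ennreal (indicator {0<..} l * ((1 - cos (l * t)) * l powr (- 1 - 2 * H)))" for l
  proof (cases "l > 0")
    case True
    have "(\<integral>\<^sup>+r. h l r \<partial>lborel) = (\<integral>\<^sup>+r. ennreal (1 - cos (l * t)) * ennreal (indicator {0<..} r * r powr ((1 + 2 * H) - 1) * exp (- (l * r))) \<partial>lborel)"
      using True by (intro nn_integral_cong) (simp add: h_def ennreal_mult'[symmetric] mult_ac)
    also have "\<dots> = ennreal (1 - cos (l * t)) * ennreal (Gamma (1 + 2 * H) / l powr (1 + 2 * H))"
      using nn_integral_Gamma[of "1 + 2 * H" l] assms True by (subst nn_integral_cmult) auto
    also have "\<dots> = ennreal (Gamma (1 + 2 * H)) * ennreal (indicator {0<..} l * ((1 - cos (l * t)) * l powr (- 1 - 2 * H)))"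
    proof -
      have "l powr (- 1 - 2 * H) = inverse (l powr (1 + 2 * H))" by (subst powr_minus[symmetric]) simp
      then show ?thesis using True G by (simp add: ennreal_mult'[symmetric] divide_inverse mult_ac)
    qed
    finally show ?thesis .
  qed (simp add: h_def)
  have 2: "(\<integral>\<^sup>+l. h l r \<partial>lborel) = ennreal (indicator {0<..} r * (r powr (2 * H) * (t\<^sup>2 / (r * (r\<^sup>2 + t\<^sup>2)))))" for r
  proof (cases "r > 0")
    case True
    have "(\<integral>\<^sup>+l. h l r \<partial>lborel) = (\<integral>\<^sup>+l. ennreal (r powr (2 * H)) * (ennreal (exp (- (r * l)) * (1 - cos (l * t))) * indicator {0..} l) \<partial>lborel)"
    proof (rule nn_integral_cong)
      fix l
      show "h l r = ennreal (r powr (2 * H)) * (ennreal (exp (- (r * l)) * (1 - cos (l * t))) * indicator {0..} l)"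
        using True by (cases "l = 0") (auto simp: h_def indicator_def ennreal_mult'[symmetric] mult_ac)
    qed
    also have "\<dots> = ennreal (r powr (2 * H)) * ennreal (t\<^sup>2 / (r * (r\<^sup>2 + t\<^sup>2)))"
      using nn_integral_exp_one_minus_cos[OF True, of t] by (subst nn_integral_cmult) auto
    finally show ?thesis using True by (simp add: ennreal_mult'[symmetric])
  qed (simp add: h_def)
  let ?I = "\<integral>\<^sup>+l. ennreal (indicator {0<..} l * ((1 - cos (l * t)) * l powr (- 1 - 2 * H))) \<partial>lborel"
  have "ennreal (Gamma (1 + 2 * H)) * ?I = (\<integral>\<^sup>+l. \<integral>\<^sup>+r. h l r \<partial>lborel \<partial>lborel)"
    unfolding 1 by (subst nn_integral_cmult) auto
  also have "\<dots> = (\<integral>\<^sup>+r. \<integral>\<^sup>+l. h l r \<partial>lborel \<partial>lborel)"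
    by (rule lborel_pair.Fubini') measurable
  also have "\<dots> = ennreal (t powr (2 * H) * Beta H (1 - H) / 2)"
    unfolding 2 by (rule nn_integral_powr_mult_rational[OF assms])
  also have "\<dots> = ennreal (Gamma (1 + 2 * H)) * ennreal (t powr (2 * H) * Beta H (1 - H) / 2 / Gamma (1 + 2 * H))"
    using G by (simp add: ennreal_mult'[symmetric])
  finally show ?thesis using G
    by (subst (asm) ennreal_mult_cancel_left) auto
qed

lemma spectral_density_one_minus_cos:
  assumes "0 < H" "H < 1"
  shows "has_bochner_integral lborel (\<lambda>l. spectral_density H l * ((1 - cos (l * t)) / l\<^sup>2)) (\<bar>t\<bar> powr (2 * H) / 2)"
proof (cases "t = 0")
  case True
  then show ?thesis using has_bochner_integral_zero[of lborel] by simp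
next
  case False
  then have t: "\<bar>t\<bar> > 0" by simp
  let ?f = "\<lambda>l. ennreal (indicator {0<..} l * ((1 - cos (l * \<bar>t\<bar>)) * l powr (- 1 - 2 * H)))"
  let ?K = "\<bar>t\<bar> powr (2 * H) * Beta H (1 - H) / 2 / Gamma (1 + 2 * H)"
  have K: "?K \<ge> 0" using assms Beta_nonneg_real[of H "1 - H"] Gamma_real_pos[of "1 + 2 * H"] by simp
  have c: "cos (l * \<bar>t\<bar>) = cos (l * t)" for l by (cases "t \<ge> 0") (auto simp: abs_if)
  have "(\<integral>\<^sup>+l. ennreal (spectral_density H l * ((1 - cos (l * t)) / l\<^sup>2)) \<partial>lborel) = (\<integral>\<^sup>+l. ennreal (spectral_const H) * (?f l + ?f (- l)) \<partial>lborel)"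
  proof (rule nn_integral_cong)
    fix l :: real
    show "ennreal (spectral_density H l * ((1 - cos (l * t)) / l\<^sup>2)) = ennreal (spectral_const H) * (?f l + ?f (- l))"
    proof (cases "l = 0")
      case False
      have "\<bar>l\<bar> powr (- 1 - 2 * H) = \<bar>l\<bar> powr ((1 - 2 * H) - 2)" by simp
      also have "\<dots> = \<bar>l\<bar> powr (1 - 2 * H) / l\<^sup>2"
        using False by (subst powr_diff) (simp add: powr_numeral)
      finally have "\<bar>l\<bar> powr (- 1 - 2 * H) = \<bar>l\<bar> powr (1 - 2 * H) / l\<^sup>2" .
      then show ?thesis using False spectral_const_pos[OF assms]
        by (cases "l > 0") (auto simp: c spectral_density_def indicator_def ennreal_mult'[symmetric] mult_ac)
    qed simp
  qed
  also have "\<dots> = ennreal (spectral_const H) * ((\<integral>\<^sup>+l. ?f l \<partial>lborel) + (\<integral>\<^sup>+l. ?f (- l) \<partial>lborel))"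
    by (subst nn_integral_cmult, measurable) (subst nn_integral_add, auto)
  also have "(\<integral>\<^sup>+l. ?f (- l) \<partial>lborel) = (\<integral>\<^sup>+l. ?f l \<partial>lborel)"
    using nn_integral_real_affine[of ?f "-1" 0] by simp
  also have "(\<integral>\<^sup>+l. ?f l \<partial>lborel) = ennreal ?K"
    by (rule nn_integral_one_minus_cos[OF assms t])
  \<comment> \<open>The two half-lines give \<open>2 * ?K\<close>. By the reflection formula sine,
    \<open>pi\<close> and the Gamma value of the spectral normalisation all cancel.\<close>
  also have "ennreal (spectral_const H) * (ennreal ?K + ennreal ?K) = ennreal (\<bar>t\<bar> powr (2 * H) / 2)"
  proof -
    have "sin (pi * H) > 0" using assms by (intro sin_gt_zero) auto
    moreover have "Gamma (1 + 2 * H) > 0" using assms by (intro Gamma_real_pos) auto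
    ultimately have "spectral_const H * (?K + ?K) = \<bar>t\<bar> powr (2 * H) / 2"
      unfolding spectral_const_def Beta_reflection[OF assms] by (simp add: field_simps)
    then show ?thesis using K spectral_const_pos[OF assms]
      by (simp only: ennreal_plus[OF K K, symmetric] ennreal_mult'[OF less_imp_le, symmetric])
  qed
  finally show ?thesis
    using spectral_const_pos[OF assms] by (intro has_bochner_integral_nn_integral) (auto simp: spectral_density_def)
qed

lemma e_fun_L2:
  assumes "0 < H" "H < 1"
  shows "e_fun t \<in> L2_space (spectral_measure H)"
proof -
  have "has_bochner_integral lborel (\<lambda>l. spectral_density H l *\<^sub>R (cmod (e_fun t l))\<^sup>2) (2 * (\<bar>t\<bar> powr (2 * H) / 2))"
  proof (subst has_bochner_integral_cong_AE[where g = "\<lambda>l. 2 * (spectral_density H l * ((1 - cos (l * t)) / l\<^sup>2))"])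
    show "AE l in lborel. spectral_density H l *\<^sub>R (cmod (e_fun t l))\<^sup>2 = 2 * (spectral_density H l * ((1 - cos (l * t)) / l\<^sup>2))"
      using AE_lborel_singleton[of 0] by eventually_elim (simp add: norm_e_fun_sq)
    show "has_bochner_integral lborel (\<lambda>l. 2 * (spectral_density H l * ((1 - cos (l * t)) / l\<^sup>2))) (2 * (\<bar>t\<bar> powr (2 * H) / 2))"
      by (intro has_bochner_integral_mult_right spectral_density_one_minus_cos assms)
  qed measurable
  from has_bochner_integral_spectral[OF assms _ this] show ?thesis
    by (auto simp: L2_space_def has_bochner_integral_iff spectral_measure_eq)
qed

lemma e_fun_uminus: "e_fun t (- l) = cnj (e_fun t l)"
proof -
  have "cnj (exp (\<i> * of_real l * of_real t)) = exp (\<i> * of_real (- l) * of_real t)"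
    unfolding exp_cnj by simp
  then show ?thesis by (simp add: e_fun_def)
qed

text \<open>Changing the sign of \<open>l\<close> conjugates both factors, so the inner product is
  real; its real part is a combination of three integrals of \<open>1 - cos\<close>, at
  \<open>s\<close>, \<open>t\<close> and \<open>s - t\<close>.\<close>

lemma e_fun_inner:
  assumes "0 < H" "H < 1"
  shows "L2_inner (spectral_measure H) (e_fun s) (e_fun t) =
    of_real ((\<bar>s\<bar> powr (2 * H) + \<bar>t\<bar> powr (2 * H) - \<bar>s - t\<bar> powr (2 * H)) / 2)"
proof -
  define F where "F l = e_fun s l * cnj (e_fun t l)" for l
  have [measurable]: "F \<in> borel_measurable borel" unfolding F_def[abs_def] by measurable
  have int: "integrable (spectral_measure H) F"
    unfolding F_def by (intro L2_inner_integrable e_fun_L2 assms)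
  have nn: "spectral_density H l \<ge> 0" for l using spectral_const_pos[OF assms] by (simp add: spectral_density_def)
  have eq: "integral\<^sup>L (spectral_measure H) F = (\<integral>l. spectral_density H l *\<^sub>R F l \<partial>lborel)"
    unfolding spectral_measure_eq by (rule integral_density) (auto simp: nn)
  have int': "integrable lborel (\<lambda>l. spectral_density H l *\<^sub>R F l)"
    using int unfolding spectral_measure_eq by (subst (asm) integrable_density) (auto simp: nn)
  \<comment> \<open>Reflection in \<open>l\<close>, under which the density is invariant.\<close>
  have "(\<integral>l. spectral_density H l *\<^sub>R F l \<partial>lborel) = (\<integral>l. spectral_density H l *\<^sub>R cnj (F l) \<partial>lborel)"
    using lborel_integral_real_affine[of "-1" "\<lambda>l. spectral_density H l *\<^sub>R F l" 0]
    by (simp add: F_def e_fun_uminus spectral_density_def)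
  also have "\<dots> = cnj (\<integral>l. spectral_density H l *\<^sub>R F l \<partial>lborel)"
    by (subst Bochner_Integration.integral_cnj[symmetric]) (simp add: scaleR_conv_of_real)
  finally have im: "Im (\<integral>l. spectral_density H l *\<^sub>R F l \<partial>lborel) = 0" by (metis Reals_cnj_iff complex_is_Real_iff)
  have "Re (\<integral>l. spectral_density H l *\<^sub>R F l \<partial>lborel) = (\<integral>l. Re (spectral_density H l *\<^sub>R F l) \<partial>lborel)"
    by (rule integral_Re[OF int', symmetric])
  also have "\<dots> = (\<integral>l. spectral_density H l * ((1 - cos (l * s)) / l\<^sup>2) + spectral_density H l * ((1 - cos (l * t)) / l\<^sup>2) - spectral_density H l * ((1 - cos (l * (s - t))) / l\<^sup>2) \<partial>lborel)"
  proof (rule integral_cong_AE)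
    show "AE l in lborel. Re (spectral_density H l *\<^sub>R F l) = spectral_density H l * ((1 - cos (l * s)) / l\<^sup>2) + spectral_density H l * ((1 - cos (l * t)) / l\<^sup>2) - spectral_density H l * ((1 - cos (l * (s - t))) / l\<^sup>2)"
      using AE_lborel_singleton[of 0]
    proof eventually_elim
      case (elim l)
      have "F l = (exp (\<i> * of_real l * of_real s) - 1) * cnj (exp (\<i> * of_real l * of_real t) - 1) / of_real (l\<^sup>2)"
      proof -
        have "\<i> * complex_of_real l * cnj (\<i> * complex_of_real l) = of_real (l\<^sup>2)"
          by (simp add: power2_eq_square complex_eq_iff)
        then show ?thesis using elim
          by (simp only: F_def e_fun_def if_False complex_cnj_divide times_divide_times_eq)
      qed
      then have "Re (F l) = ((cos (l * s) - 1) * (cos (l * t) - 1) + sin (l * s) * sin (l * t)) / l\<^sup>2"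
        unfolding exp_i_mult_eq by (simp add: Re_divide_of_real del: of_real_power)
      \<comment> \<open>The addition formula for the cosine, regrouped so that each summand vanishes
        to second order at \<open>l = 0\<close> and is integrable on its own.\<close>
      also have "(cos (l * s) - 1) * (cos (l * t) - 1) + sin (l * s) * sin (l * t) = (1 - cos (l * s)) + (1 - cos (l * t)) - (1 - cos (l * (s - t)))"
        by (simp add: right_diff_distrib[of l] cos_diff algebra_simps)
      finally have e: "Re (F l) = ((1 - cos (l * s)) + (1 - cos (l * t)) - (1 - cos (l * (s - t)))) / l\<^sup>2" .
      show ?case unfolding scaleR_complex.sel e
        by (simp only: add_divide_distrib diff_divide_distrib distrib_left right_diff_distrib)
    qed
  qed measurable
  also have "\<dots> = \<bar>s\<bar> powr (2 * H) / 2 + \<bar>t\<bar> powr (2 * H) / 2 - \<bar>s - t\<bar> powr (2 * H) / 2"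
    by (intro has_bochner_integral_integral_eq has_bochner_integral_diff has_bochner_integral_add spectral_density_one_minus_cos assms)
  finally show ?thesis using im unfolding L2_inner_def F_def[symmetric] eq
    by (simp add: complex_eq_iff add_divide_distrib diff_divide_distrib)
qed

section \<open>Integrability against the spectral measure\<close>

lemma integrable_even_extension:
  fixes g :: "real \<Rightarrow> real"
  assumes "integrable lborel (\<lambda>l. if 0 < l then g l else 0)"
  shows "integrable lborel (\<lambda>l. if l \<noteq> 0 then g \<bar>l\<bar> else 0)"
proof -
  have "integrable lborel (\<lambda>l. if 0 < 0 + (- 1) * l then g (0 + (- 1) * l) else 0)"
    by (rule lborel_integrable_real_affine[OF assms]) simp
  from Bochner_Integration.integrable_add[OF assms this] show ?thesis
    by (rule Bochner_Integration.integrable_cong[THEN iffD1, rotated 2]) auto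
qed

text \<open>Up to a constant this is the spectral density times a function that is bounded for
  \<open>|l| < 1\<close> and equal to \<open>1 / l^2\<close> beyond. Its exponents satisfy
  \<open>1 - 2 * H > - 1\<close> and \<open>- 1 - 2 * H < - 1\<close>, so it is integrable for every
  \<open>H\<close> in the open unit interval.\<close>

definition spectral_majorant :: "real \<Rightarrow> real \<Rightarrow> real" where
  "spectral_majorant H l = (if \<bar>l\<bar> < 1 then \<bar>l\<bar> powr (1 - 2 * H) else \<bar>l\<bar> powr (- 1 - 2 * H))"

lemma spectral_majorant_integrable:
  assumes "0 < H" "H < 1"
  shows "integrable lborel (spectral_majorant H)"
proof -
  interpret hurst H "H - 1/2" by unfold_locales (use assms in auto)
  have 1: "integrable lborel (\<lambda>x. if 0 < x \<and> x < 1 then x powr ((2 - 2 * H) - 1) else 0)"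
    using assms by (intro integrable_powr_Ioo) auto
  have "- (2 * H) - 1 = - 1 - 2 * H" by simp
  then have 2: "integrable lborel (\<lambda>v. if 1 \<le> v then v powr (- 1 - 2 * H) else 0)"
    using has_bochner_integral_powr_tail[of "2 * H" 1] assms by (simp only: has_bochner_integral_iff)
  have "integrable lborel (\<lambda>l. if 0 < l then spectral_majorant H l else 0)"
    by (rule Bochner_Integration.integrable_cong[THEN iffD1, OF refl _ Bochner_Integration.integrable_add[OF 1 2]])
       (auto simp: spectral_majorant_def)
  from integrable_even_extension[OF this] show ?thesis
    by (rule Bochner_Integration.integrable_cong[THEN iffD1, rotated 2]) (auto simp: spectral_majorant_def)
qed

lemma integrable_spectralI:
  fixes f :: "real \<Rightarrow> real"
  assumes H: "0 < H" "H < 1" and [measurable]: "f \<in> borel_measurable borel"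
    and b: "\<And>l. \<bar>l\<bar> < 1 \<Longrightarrow> \<bar>f l\<bar> \<le> C" "\<And>l. 1 \<le> \<bar>l\<bar> \<Longrightarrow> \<bar>f l\<bar> \<le> C / l\<^sup>2"
  shows "integrable (spectral_measure H) f"
proof -
  have C: "C \<ge> 0" using b(1)[of 0] by simp
  have "integrable lborel (\<lambda>l. spectral_density H l *\<^sub>R f l)"
  proof (rule Bochner_Integration.integrable_bound[OF integrable_mult_right[OF spectral_majorant_integrable[OF H], of "spectral_const H * C"]])
    show "AE l in lborel. norm (spectral_density H l *\<^sub>R f l) \<le> norm (spectral_const H * C * spectral_majorant H l)"
    proof (rule AE_I2)
      fix l
      have c: "spectral_const H > 0" by (rule spectral_const_pos[OF H])
      show "norm (spectral_density H l *\<^sub>R f l) \<le> norm (spectral_const H * C * spectral_majorant H l)"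
      proof (cases "\<bar>l\<bar> < 1")
        case True
        have "spectral_const H * \<bar>l\<bar> powr (1 - 2 * H) * \<bar>f l\<bar> \<le> spectral_const H * \<bar>l\<bar> powr (1 - 2 * H) * C"
          using c b(1)[OF True] by (intro mult_left_mono) auto
        then show ?thesis using True c C by (simp add: spectral_density_def spectral_majorant_def abs_mult mult_ac)
      next
        case False
        then have l: "l \<noteq> 0" by auto
        have "\<bar>l\<bar> powr (- 1 - 2 * H) = \<bar>l\<bar> powr ((1 - 2 * H) - 2)" by simp
        also have "\<dots> = \<bar>l\<bar> powr (1 - 2 * H) / l\<^sup>2"
          using l by (subst powr_diff) (simp add: powr_numeral)
        finally have e: "\<bar>l\<bar> powr (- 1 - 2 * H) = \<bar>l\<bar> powr (1 - 2 * H) / l\<^sup>2" .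
        have "spectral_const H * \<bar>l\<bar> powr (1 - 2 * H) * \<bar>f l\<bar> \<le> spectral_const H * \<bar>l\<bar> powr (1 - 2 * H) * (C / l\<^sup>2)"
          using c b(2)[of l] False by (intro mult_left_mono) auto
        moreover have "norm (spectral_density H l *\<^sub>R f l) = spectral_const H * \<bar>l\<bar> powr (1 - 2 * H) * \<bar>f l\<bar>"
          using c by (simp add: spectral_density_def abs_mult)
        moreover have "norm (spectral_const H * C * spectral_majorant H l) = spectral_const H * \<bar>l\<bar> powr (1 - 2 * H) * (C / l\<^sup>2)"
          using False c C e by (simp add: spectral_majorant_def abs_mult)
        ultimately show ?thesis by simp
      qed
    qed
  qed measurable
  then show ?thesis
    using has_bochner_integral_spectral[OF H assms(3), of "\<integral>l. spectral_density H l *\<^sub>R f l \<partial>lborel"]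
    by (simp add: has_bochner_integral_iff)
qed

section \<open>The spaces L_T: modulation and smoothing\<close>

definition e_span :: "real \<Rightarrow> (real \<Rightarrow> complex) set" where
  "e_span T = complex_span (e_fun ` {0..T})"

lemma L_space_eq: "L_space H T = L2_closure (spectral_measure H) (e_span T)"
  by (simp add: L_space_def e_span_def)

lemma lin_closed_e_span: "lin_closed (e_span T)"
  unfolding e_span_def by (rule lin_closed_complex_span)

lemma e_span_mono: "S \<le> T \<Longrightarrow> e_span S \<subseteq> e_span T"
  unfolding e_span_def
  by (rule complex_span_minimal[OF lin_closed_complex_span]) (use complex_span_superset[of "e_fun ` {0..T}"] in force)

lemma e_span_L2: "0 < H \<Longrightarrow> H < 1 \<Longrightarrow> e_span T \<subseteq> L2_space (spectral_measure H)"
  unfolding e_span_def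
  by (rule complex_span_minimal[OF lin_closed_L2_space]) (auto intro: e_fun_L2)

lemma L_space_L2: "L_space H T \<subseteq> L2_space (spectral_measure H)"
  unfolding L_space_eq by (rule L2_closure_subset)

lemma lin_closed_L_space: "lin_closed (L_space H T)"
  unfolding L_space_eq by (rule lin_closed_L2_closure[OF lin_closed_e_span])

lemma L_space_mono: "S \<le> T \<Longrightarrow> L_space H S \<subseteq> L_space H T"
  unfolding L_space_eq by (intro L2_closure_mono e_span_mono)

lemma L_space_closed: "L2_closure (spectral_measure H) (L_space H T) \<subseteq> L_space H T"
  unfolding L_space_eq by (rule L2_closure_idem)

lemma e_fun_L_space:
  assumes "0 < H" "H < 1" "0 \<le> t" "t \<le> T"
  shows "e_fun t \<in> L_space H T"
proof -
  have "e_fun t \<in> e_span T" unfolding e_span_def using assms complex_span_superset by fastforce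
  then show ?thesis unfolding L_space_eq using L2_closure_superset[OF e_span_L2[OF assms(1,2)]] by blast
qed

text \<open>\<open>e_t\<close> is the Fourier transform of the indicator of \<open>(0, t)\<close>,
  and the exponential factor translates it to \<open>(s, t + s)\<close>. For this reason modulation
  by \<open>s\<close> enlarges \<open>T\<close> to \<open>T + s\<close> below.\<close>

lemma modulation_e_fun: "exp (\<i> * of_real l * of_real s) * e_fun t l = e_fun (t + s) l - e_fun s l"
proof (cases "l = 0")
  case False
  have "exp (\<i> * of_real l * of_real s) * (exp (\<i> * of_real l * of_real t) - 1) =
      (exp (\<i> * of_real l * of_real (t + s)) - 1) - (exp (\<i> * of_real l * of_real s) - 1)"
    by (simp add: algebra_simps exp_add)
  then show ?thesis using False by (simp add: e_fun_def diff_divide_distrib[symmetric])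
qed (simp add: e_fun_def)

lemma modulation_e_span:
  assumes "0 \<le> s" "f \<in> e_span T"
  shows "(\<lambda>l. exp (\<i> * of_real l * of_real s) * f l) \<in> e_span (T + s)"
proof -
  let ?P = "{f. (\<lambda>l. exp (\<i> * of_real l * of_real s) * f l) \<in> e_span (T + s)}"
  have "lin_closed ?P"
    unfolding lin_closed_def
  proof (intro conjI ballI allI)
    show "(\<lambda>_. 0) \<in> ?P" using lin_closedD(1)[OF lin_closed_e_span] by simp
    fix f g a b assume "f \<in> ?P" "g \<in> ?P"
    then show "(\<lambda>x. a * f x + b * g x) \<in> ?P"
      using lin_closedD(2)[OF lin_closed_e_span, of "\<lambda>l. exp (\<i> * of_real l * of_real s) * f l" "T + s" "\<lambda>l. exp (\<i> * of_real l * of_real s) * g l" a b]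
      by (simp add: algebra_simps)
  qed
  moreover have "e_fun ` {0..T} \<subseteq> ?P"
  proof
    fix f assume "f \<in> e_fun ` {0..T}"
    then obtain t where t: "0 \<le> t" "t \<le> T" "f = e_fun t" by auto
    have "e_fun (t + s) \<in> e_span (T + s)" "e_fun s \<in> e_span (T + s)"
      unfolding e_span_def using complex_span_superset[of "e_fun ` {0..T + s}"] t assms(1) by auto
    from lin_closed_diff[OF lin_closed_e_span this] show "f \<in> ?P"
      by (simp add: t(3) modulation_e_fun)
  qed
  ultimately have "e_span T \<subseteq> ?P" unfolding e_span_def by (rule complex_span_minimal)
  then show ?thesis using assms(2) by auto
qed

lemma modulation_L2:
  assumes "f \<in> L2_space (spectral_measure H)"
  shows "(\<lambda>l. exp (\<i> * of_real l * of_real s) * f l) \<in> L2_space (spectral_measure H)"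
proof -
  have [measurable]: "f \<in> borel_measurable (spectral_measure H)" using assms by (rule L2_space_measurable)
  show ?thesis by (rule L2_space_dominated[OF assms, of _ 1]) (auto simp: norm_mult norm_exp_i_mult)
qed

lemma modulation_L_space:
  assumes "0 \<le> s" "f \<in> L_space H T"
  shows "(\<lambda>l. exp (\<i> * of_real l * of_real s) * f l) \<in> L_space H (T + s)"
proof -
  have "f \<in> L2_closure (spectral_measure H) (e_span T)" using assms(2) by (simp add: L_space_eq)
  then obtain g where g: "\<And>n. g n \<in> e_span T" "\<And>n. g n \<in> L2_space (spectral_measure H)"
    "\<And>n. L2_norm (spectral_measure H) (\<lambda>x. f x - g n x) < (1/2) ^ n"
    using L2_closure_sequence[of f "spectral_measure H" "e_span T"] by blast
  have n: "L2_norm (spectral_measure H) (\<lambda>l. exp (\<i> * of_real l * of_real s) * f l - exp (\<i> * of_real l * of_real s) * g n l) =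
      L2_norm (spectral_measure H) (\<lambda>x. f x - g n x)" for n
    unfolding L2_norm_def by (simp add: right_diff_distrib[symmetric] norm_mult norm_exp_i_mult)
  have fL: "f \<in> L2_space (spectral_measure H)" using assms(2) L_space_L2 by blast
  show ?thesis unfolding L_space_eq
  proof (rule L2_closure_limit)
    show "(\<lambda>l. exp (\<i> * of_real l * of_real s) * f l) \<in> L2_space (spectral_measure H)"
      by (rule modulation_L2[OF fL])
    show "(\<lambda>l. exp (\<i> * of_real l * of_real s) * g n l) \<in> e_span (T + s)" for n
      by (rule modulation_e_span[OF assms(1) g(1)])
    show "(\<lambda>l. exp (\<i> * of_real l * of_real s) * g n l) \<in> L2_space (spectral_measure H)" for n
      by (rule modulation_L2[OF g(2)])
    show "(\<lambda>n. L2_norm (spectral_measure H) (\<lambda>l. exp (\<i> * of_real l * of_real s) * f l - exp (\<i> * of_real l * of_real s) * g n l)) \<longlonglongrightarrow> 0"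
      unfolding n
      by (rule tendsto_sandwich[of "\<lambda>_. 0" _ _ "\<lambda>n. (1/2) ^ n"])
         (use less_imp_le[OF g(3)] in \<open>auto intro: LIMSEQ_power_zero\<close>)
  qed
qed

text \<open>\<open>e_b\<close> is the integral of \<open>exp (i l s)\<close> over
  \<open>[0, b]\<close>, and these are its left Riemann sums; they are geometric sums, so the limit
  reduces to the derivative of \<open>exp\<close> at 0. \<open>Suc n\<close> keeps the number of
  nodes positive.\<close>

lemma exp_Riemann_sum:
  "(\<lambda>n. \<Sum>k<Suc n. of_real (b / real (Suc n)) * exp (\<i> * of_real l * of_real (real k * b / real (Suc n)))) \<longlonglongrightarrow> e_fun b l"
proof (cases "l * b = 0")
  case True
  then have "\<i> * of_real l * of_real (real k * b / real (Suc n)) = 0" for k n by auto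
  moreover have "e_fun b l = of_real b" using True by (auto simp: e_fun_def)
  moreover have "of_nat (Suc n) * (of_real (b / real (Suc n)) :: complex) = of_real b" for n
  proof -
    have "real (Suc n) * (b / real (Suc n)) = b" by simp
    then show ?thesis by (metis of_real_mult of_real_of_nat_eq)
  qed
  ultimately have "(\<lambda>n. \<Sum>k<Suc n. of_real (b / real (Suc n)) * exp (\<i> * of_real l * of_real (real k * b / real (Suc n)))) = (\<lambda>n. e_fun b l)"
    by (simp only: exp_zero mult_1_right sum_constant card_lessThan)
  then show ?thesis by (simp only: tendsto_const)
next
  case False
  define w where "w = \<i> * complex_of_real (l * b)"
  have w: "w \<noteq> 0" using False by (simp add: w_def)
  define z where "z n = exp (w / of_nat (Suc n))" for n
  have d: "((\<lambda>h. (exp h - 1) / h) \<longlongrightarrow> 1) (at (0::complex))"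
    using DERIV_exp[of "0::complex"] by (simp add: DERIV_def)
  have h0: "filterlim (\<lambda>n. w / of_nat (Suc n)) (at 0) sequentially"
  proof (rule filterlim_atI)
    show "((\<lambda>n. w / of_nat (Suc n)) \<longlongrightarrow> 0) sequentially"
      using LIMSEQ_Suc[OF lim_const_over_n[of w]] .
    show "eventually (\<lambda>n. w / of_nat (Suc n) \<noteq> 0) sequentially" using w by (simp del: of_nat_Suc)
  qed
  have lim1: "(\<lambda>n. (z n - 1) / (w / of_nat (Suc n))) \<longlonglongrightarrow> 1"
    unfolding z_def by (rule filterlim_compose[OF d h0])
  then have lim: "(\<lambda>n. of_real b * ((exp w - 1) / w) / ((z n - 1) / (w / of_nat (Suc n)))) \<longlonglongrightarrow> of_real b * ((exp w - 1) / w) / 1"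
    by (intro tendsto_divide tendsto_const) auto
  \<comment> \<open>For small \<open>n\<close> the number \<open>w / (n + 1)\<close> may be a
    multiple of \<open>2 pi i\<close>, and then the geometric sum formula does not apply.\<close>
  have ev: "eventually (\<lambda>n. z n \<noteq> 1) sequentially"
    by (rule eventually_mono[OF tendsto_imp_eventually_ne[OF lim1, of 0]]) auto
  have "eventually (\<lambda>n. of_real b * ((exp w - 1) / w) / ((z n - 1) / (w / of_nat (Suc n))) =
      (\<Sum>k<Suc n. of_real (b / real (Suc n)) * exp (\<i> * of_real l * of_real (real k * b / real (Suc n))))) sequentially"
    using ev
  proof eventually_elim
    case (elim n)
    have "exp (\<i> * of_real l * of_real (real k * b / real (Suc n))) = z n ^ k" for k
      unfolding z_def exp_of_nat_mult[symmetric] w_def by (simp add: mult_ac)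
    then have "(\<Sum>k<Suc n. of_real (b / real (Suc n)) * exp (\<i> * of_real l * of_real (real k * b / real (Suc n)))) =
        of_real (b / real (Suc n)) * (\<Sum>k<Suc n. z n ^ k)"
      by (simp only: sum_distrib_left)
    also have "(\<Sum>k<Suc n. z n ^ k) = (z n ^ Suc n - 1) / (z n - 1)"
      using elim by (rule geometric_sum)
    also have "z n ^ Suc n = exp w"
      unfolding z_def exp_of_nat_mult[symmetric] by (simp del: of_nat_Suc)
    finally have eq: "(\<Sum>k<Suc n. of_real (b / real (Suc n)) * exp (\<i> * of_real l * of_real (real k * b / real (Suc n)))) =
        of_real (b / real (Suc n)) * ((exp w - 1) / (z n - 1))" .
    define N where "N = complex_of_nat (Suc n)"
    have N: "N \<noteq> 0" "complex_of_real (b / real (Suc n)) = of_real b / N" by (simp_all add: N_def del: of_nat_Suc)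
    then show ?case unfolding eq unfolding N(2) N_def[symmetric] using w elim by (simp add: divide_simps)
  qed
  then have "(\<lambda>n. \<Sum>k<Suc n. of_real (b / real (Suc n)) * exp (\<i> * of_real l * of_real (real k * b / real (Suc n)))) \<longlonglongrightarrow> of_real b * ((exp w - 1) / w) / 1"
    by (rule Lim_transform_eventually[OF lim])
  moreover have "of_real b * ((exp w - 1) / w) / 1 = e_fun b l"
    using False by (simp add: e_fun_def w_def mult.assoc)
  ultimately show ?thesis by simp
qed

text \<open>Multiplication by \<open>e_b\<close> integrates the modulations of \<open>f\<close> over
  shifts between 0 and \<open>b\<close>. The Riemann sums stay below \<open>b * |f|\<close>, so they
  converge in L2, and the space is closed.\<close>

lemma e_fun_mult_L_space:
  assumes "0 < H" "H < 1" "0 \<le> b" "f \<in> L_space H T"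
  shows "(\<lambda>l. e_fun b l * f l) \<in> L_space H (T + b)"
proof -
  let ?\<mu> = "spectral_measure H"
  have fL: "f \<in> L2_space ?\<mu>" using assms(4) L_space_L2 by blast
  have [measurable]: "f \<in> borel_measurable borel" using L2_space_measurable[OF fL] by (simp add: measurable_def space_spectral)
  define g where "g n l = (\<Sum>k<Suc n. of_real (b / real (Suc n)) * exp (\<i> * of_real l * of_real (real k * b / real (Suc n)))) * f l" for n l
  have [measurable]: "g n \<in> borel_measurable borel" for n unfolding g_def by measurable
  have D: "(\<lambda>l. of_real b * f l) \<in> L2_space ?\<mu>" by (rule L2_space_cmult[OF fL])
  have lim: "AE l in ?\<mu>. (\<lambda>n. g n l) \<longlonglongrightarrow> e_fun b l * f l"
    unfolding g_def by (intro AE_I2 tendsto_mult exp_Riemann_sum tendsto_const)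
  have bd: "AE l in ?\<mu>. cmod (g n l) \<le> cmod (of_real b * f l)" for n
  proof (rule AE_I2)
    fix l
    have "cmod (\<Sum>k<Suc n. of_real (b / real (Suc n)) * exp (\<i> * of_real l * of_real (real k * b / real (Suc n)))) \<le>
        (\<Sum>k<Suc n. cmod (of_real (b / real (Suc n)) * exp (\<i> * of_real l * of_real (real k * b / real (Suc n)))))"
      by (rule norm_sum)
    also have "\<dots> = b"
      using assms(3) by (simp only: norm_mult norm_exp_i_mult norm_of_real) simp
    finally show "cmod (g n l) \<le> cmod (of_real b * f l)"
      unfolding g_def norm_mult using assms(3) by (intro mult_right_mono) auto
  qed
  have mem: "g n \<in> L_space H (T + b)" for n
  proof -
    have "(\<lambda>l. \<Sum>k<Suc n. of_real (b / real (Suc n)) * (exp (\<i> * of_real l * of_real (real k * b / real (Suc n))) * f l)) \<in> L_space H (T + b)"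
    proof (rule lin_closed_sum[OF lin_closed_L_space], simp, rule lin_closed_cmult[OF lin_closed_L_space])
      fix k assume "k \<in> {..<Suc n}"
      then have k: "real k \<le> real (Suc n)" by simp
      have s: "0 \<le> real k * b / real (Suc n)" "real k * b / real (Suc n) \<le> b"
        using assms(3) mult_right_mono[OF k assms(3)] by (auto simp: divide_le_eq mult.commute)
      show "(\<lambda>l. exp (\<i> * of_real l * of_real (real k * b / real (Suc n))) * f l) \<in> L_space H (T + b)"
        using modulation_L_space[OF s(1) assms(4)] L_space_mono[of "T + real k * b / real (Suc n)" "T + b" H] s(2) by auto
    qed
    then show ?thesis unfolding g_def[abs_def] by (simp only: sum_distrib_right mult.assoc)
  qed
  have "(\<lambda>l. e_fun b l * f l) \<in> L2_closure ?\<mu> (L_space H (T + b))"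
  proof (rule L2_closure_limit)
    show "(\<lambda>l. e_fun b l * f l) \<in> L2_space ?\<mu>"
      by (rule L2_dominated_convergence(1)[OF D _ _ lim bd]) measurable
    show "g n \<in> L2_space ?\<mu>" for n
      by (rule L2_dominated_convergence(2)[OF D _ _ lim bd]) measurable
    show "(\<lambda>n. L2_norm ?\<mu> (\<lambda>l. e_fun b l * f l - g n l)) \<longlonglongrightarrow> 0"
      by (rule L2_dominated_convergence(3)[OF D _ _ lim bd]) measurable
  qed (rule mem)
  then show ?thesis using L_space_closed by blast
qed

text \<open>Multiplication by \<open>e\<^sub>\<epsilon> / \<epsilon>\<close> is convolution with a uniform density in the time domain; two such
  factors make the smoothed \<open>e\<^sub>t\<close> decay cubically.\<close>

definition e_smooth :: "real \<Rightarrow> real \<Rightarrow> real \<Rightarrow> complex" where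
  "e_smooth t \<epsilon> l = e_fun \<epsilon> l / of_real \<epsilon> * (e_fun \<epsilon> l / of_real \<epsilon> * e_fun (t - 2 * \<epsilon>) l)"

lemma e_smooth_measurable [measurable]: "e_smooth t \<epsilon> \<in> borel_measurable borel"
  unfolding e_smooth_def[abs_def] by measurable

text \<open>Each smoothing factor lengthens the time interval by \<open>epsilon\<close>. The
  definition starts from \<open>t - 2 * epsilon\<close> so that the result still fits into
  \<open>[0, t]\<close>.\<close>

lemma e_smooth_L_space:
  assumes "0 < H" "H < 1" "0 < \<epsilon>" "2 * \<epsilon> \<le> t" "t \<le> T"
  shows "e_smooth t \<epsilon> \<in> L_space H T"
proof -
  have "e_fun (t - 2 * \<epsilon>) \<in> L_space H (t - 2 * \<epsilon>)" using assms by (intro e_fun_L_space) auto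
  from e_fun_mult_L_space[OF assms(1,2) _ e_fun_mult_L_space[OF assms(1,2) _ this, of \<epsilon>], of \<epsilon>]
  have "(\<lambda>l. e_fun \<epsilon> l * (e_fun \<epsilon> l * e_fun (t - 2 * \<epsilon>) l)) \<in> L_space H (t - 2 * \<epsilon> + \<epsilon> + \<epsilon>)" using assms by simp
  moreover have "t - 2 * \<epsilon> + \<epsilon> + \<epsilon> = t" by simp
  ultimately have "(\<lambda>l. e_fun \<epsilon> l * (e_fun \<epsilon> l * e_fun (t - 2 * \<epsilon>) l)) \<in> L_space H T"
    using L_space_mono[OF assms(5), of H] by auto
  from lin_closed_cmult[OF lin_closed_L_space this, of "1 / (of_real \<epsilon> * of_real \<epsilon>)"]
  show ?thesis unfolding e_smooth_def[abs_def] by (simp add: mult_ac)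
qed

lemma norm_e_fun_div_le: "\<epsilon> > 0 \<Longrightarrow> cmod (e_fun \<epsilon> l / of_real \<epsilon>) \<le> 1"
  using norm_e_fun_le(1)[of \<epsilon> l] by (simp add: norm_divide)

lemma e_smooth_bound:
  assumes "0 < \<epsilon>" "2 * \<epsilon> \<le> t"
  shows "cmod (e_smooth t \<epsilon> l) \<le> cmod (e_fun (t - 2 * \<epsilon>) l)"
    "l \<noteq> 0 \<Longrightarrow> cmod (e_smooth t \<epsilon> l) \<le> 8 / \<epsilon>\<^sup>2 / \<bar>l\<bar> ^ 3"
proof -
  let ?q = "cmod (e_fun \<epsilon> l / of_real \<epsilon>)" and ?e = "cmod (e_fun (t - 2 * \<epsilon>) l)"
  have q: "?q \<le> 1" "0 \<le> ?q" using norm_e_fun_div_le[OF assms(1), of l] by auto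
  have n: "cmod (e_smooth t \<epsilon> l) = ?q * (?q * ?e)" unfolding e_smooth_def by (simp only: norm_mult)
  have "?q * (?q * ?e) \<le> 1 * (1 * ?e)" using q by (intro mult_mono) auto
  then show "cmod (e_smooth t \<epsilon> l) \<le> ?e" unfolding n by simp
  assume l: "l \<noteq> 0"
  have "?q \<le> 2 / \<bar>l\<bar> / \<epsilon>"
    using divide_right_mono[OF norm_e_fun_le(2)[OF l, of \<epsilon>], of \<epsilon>] assms by (simp add: norm_divide)
  then have "?q * (?q * ?e) \<le> (2 / \<bar>l\<bar> / \<epsilon>) * ((2 / \<bar>l\<bar> / \<epsilon>) * (2 / \<bar>l\<bar>))"
    using norm_e_fun_le(2)[OF l, of "t - 2 * \<epsilon>"] assms q(2) by (intro mult_mono) auto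
  also have "\<dots> = 8 / \<epsilon>\<^sup>2 / \<bar>l\<bar> ^ 3" by (simp add: power2_eq_square power3_eq_cube)
  finally show "cmod (e_smooth t \<epsilon> l) \<le> 8 / \<epsilon>\<^sup>2 / \<bar>l\<bar> ^ 3" unfolding n .
qed

lemma e_fun_tendsto_right: "((\<lambda>\<epsilon>. e_fun \<epsilon> l / of_real \<epsilon>) \<longlongrightarrow> 1) (at_right 0)"
proof (cases "l = 0")
  case True
  have "eventually (\<lambda>\<epsilon>. e_fun \<epsilon> l / of_real \<epsilon> = 1) (at_right 0)"
    using eventually_at_right_less[of "0::real"] by eventually_elim (simp add: e_fun_def True)
  then show ?thesis by (rule tendsto_eventually)
next
  case False
  have d: "((\<lambda>h. (exp h - 1) / h) \<longlongrightarrow> 1) (at (0::complex))"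
    using DERIV_exp[of "0::complex"] by (simp add: DERIV_def)
  have "filterlim (\<lambda>\<epsilon>. \<i> * of_real l * complex_of_real \<epsilon>) (at 0) (at_right 0)"
  proof (rule filterlim_atI)
    have "((\<lambda>\<epsilon>. \<i> * of_real l * complex_of_real \<epsilon>) \<longlongrightarrow> \<i> * of_real l * complex_of_real 0) (at_right 0)"
      by (intro tendsto_intros)
    then show "((\<lambda>\<epsilon>. \<i> * of_real l * complex_of_real \<epsilon>) \<longlongrightarrow> 0) (at_right 0)" by simp
    show "eventually (\<lambda>\<epsilon>. \<i> * of_real l * complex_of_real \<epsilon> \<noteq> 0) (at_right 0)"
      using eventually_at_right_less[of "0::real"] by eventually_elim (simp add: False)
  qed
  from filterlim_compose[OF d this] show ?thesis using False by (simp add: e_fun_def mult.assoc)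
qed

lemma e_smooth_tendsto: "((\<lambda>\<epsilon>. e_smooth t \<epsilon> l) \<longlongrightarrow> e_fun t l) (at_right 0)"
proof -
  have "((\<lambda>\<epsilon>. e_fun (t - 2 * \<epsilon>) l) \<longlongrightarrow> e_fun (t - 2 * 0) l) (at_right 0)"
  proof (cases "l = 0")
    case True
    then show ?thesis by (auto simp: e_fun_def intro!: tendsto_eq_intros)
  next
    case False
    then show ?thesis by (simp only: e_fun_def if_False) (intro tendsto_intros, auto)
  qed
  from tendsto_mult[OF e_fun_tendsto_right tendsto_mult[OF e_fun_tendsto_right this]]
  show ?thesis unfolding e_smooth_def by simp
qed

text \<open>The smoothed functions are bounded by \<open>t\<close> and by \<open>2 / |l|\<close>
  uniformly in \<open>epsilon\<close>, and the combination of the two bounds is square integrable;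
  dominated convergence does the rest. The set \<open>S\<close> is later the class
  \<open>L'\<close>.\<close>

lemma e_fun_closure:
  assumes "0 < H" "H < 1" "0 < t" "\<And>\<epsilon>. 0 < \<epsilon> \<Longrightarrow> 2 * \<epsilon> \<le> t \<Longrightarrow> e_smooth t \<epsilon> \<in> S"
  shows "e_fun t \<in> L2_closure (spectral_measure H) S"
proof -
  let ?\<mu> = "spectral_measure H"
  \<comment> \<open>A positive null sequence whose largest member is \<open>t / 2\<close>, so that
    \<open>2 * epsilon <= t\<close> always holds.\<close>
  define \<epsilon> where "\<epsilon> n = t / 2 * inverse (real (Suc n))" for n
  have \<epsilon>: "0 < \<epsilon> n" "2 * \<epsilon> n \<le> t" for n using assms(3) by (auto simp: \<epsilon>_def field_simps)
  have "\<epsilon> \<longlonglongrightarrow> t / 2 * 0" unfolding \<epsilon>_def by (intro tendsto_mult tendsto_const LIMSEQ_inverse_real_of_nat)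
  then have e0: "filterlim \<epsilon> (at_right 0) sequentially"
    using \<epsilon>(1) less_imp_neq[OF \<epsilon>(1), symmetric] by (auto simp: filterlim_at)
  define D where "D l = complex_of_real (if \<bar>l\<bar> < 1 then t else 2 / \<bar>l\<bar>)" for l
  have [measurable]: "D \<in> borel_measurable borel" unfolding D_def[abs_def] by measurable
  have "integrable ?\<mu> (\<lambda>l. (cmod (D l))\<^sup>2)"
  proof (rule integrable_spectralI[OF assms(1,2), of _ "t\<^sup>2 + 4"])
    show "\<bar>(cmod (D l))\<^sup>2\<bar> \<le> (t\<^sup>2 + 4) / l\<^sup>2" if "1 \<le> \<bar>l\<bar>" for l
    proof -
      have "(cmod (D l))\<^sup>2 = 4 / l\<^sup>2" using that unfolding D_def norm_of_real by (simp add: power_divide)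
      then show ?thesis by (simp add: divide_right_mono)
    qed
  qed (auto simp: D_def)
  then have D: "D \<in> L2_space ?\<mu>" by (simp add: L2_space_def)
  have lim: "AE l in ?\<mu>. (\<lambda>n. e_smooth t (\<epsilon> n) l) \<longlonglongrightarrow> e_fun t l"
    by (intro AE_I2 filterlim_compose[OF e_smooth_tendsto e0])
  have bd: "AE l in ?\<mu>. cmod (e_smooth t (\<epsilon> n) l) \<le> cmod (D l)" for n
  proof (rule AE_I2)
    fix l
    have "cmod (e_fun (t - 2 * \<epsilon> n) l) \<le> cmod (D l)"
      using norm_e_fun_le(1)[of "t - 2 * \<epsilon> n" l] norm_e_fun_le(2)[of l "t - 2 * \<epsilon> n"] \<epsilon>[of n] assms(3)
      by (auto simp: D_def)
    with e_smooth_bound(1)[OF \<epsilon>, of n l] show "cmod (e_smooth t (\<epsilon> n) l) \<le> cmod (D l)" by linarith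
  qed
  show ?thesis
  proof (rule L2_closure_limit)
    show "e_fun t \<in> L2_space ?\<mu>" by (rule e_fun_L2[OF assms(1,2)])
    show "e_smooth t (\<epsilon> n) \<in> S" for n using \<epsilon> by (intro assms(4))
    show "e_smooth t (\<epsilon> n) \<in> L2_space ?\<mu>" for n
      by (rule L2_dominated_convergence(2)[OF D _ _ lim bd]) measurable
    show "(\<lambda>n. L2_norm ?\<mu> (\<lambda>l. e_fun t l - e_smooth t (\<epsilon> n) l)) \<longlonglongrightarrow> 0"
      by (rule L2_dominated_convergence(3)[OF D _ _ lim bd]) measurable
  qed
qed

section \<open>The transformation\<close>

context hurst
begin

text \<open>Measurability with respect to \<open>V_measure H T\<close> says nothing about the values
  of \<open>f\<close> outside \<open>[0, T]\<close>; only after multiplication by the indicator is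
  the function Borel on the whole line.\<close>

lemma has_bochner_integral_V_lborel:
  fixes f :: "real \<Rightarrow> 'b :: {banach, second_countable_topology}"
  assumes "f \<in> borel_measurable (V_measure H T)"
  shows "integrable (V_measure H T) f \<longleftrightarrow> integrable lborel (\<lambda>u. (indicator {0..T} u * Vdens u) *\<^sub>R f u)"
    and "(\<integral>u. f u \<partial>V_measure H T) = (\<integral>u. (indicator {0..T} u * Vdens u) *\<^sub>R f u \<partial>lborel)"
    and "(\<lambda>u. (indicator {0..T} u * Vdens u) *\<^sub>R f u) \<in> borel_measurable borel"
proof -
  have m: "(\<lambda>u. indicator {0..T} u *\<^sub>R f u) \<in> borel_measurable (density lborel (\<lambda>u. ennreal (Vdens u)))"
    using assms unfolding V_measure_eq by (subst (asm) borel_measurable_restrict_space_iff) auto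
  then have m' [measurable]: "(\<lambda>u. indicator {0..T} u *\<^sub>R f u) \<in> borel_measurable borel" by simp
  have eq: "(\<lambda>u. (indicator {0..T} u * Vdens u) *\<^sub>R f u) = (\<lambda>u. Vdens u *\<^sub>R (indicator {0..T} u *\<^sub>R f u))"
    by (simp add: mult.commute)
  show "(\<lambda>u. (indicator {0..T} u * Vdens u) *\<^sub>R f u) \<in> borel_measurable borel"
    unfolding eq by measurable
  have "integrable (V_measure H T) f \<longleftrightarrow> integrable (density lborel (\<lambda>u. ennreal (Vdens u))) (\<lambda>u. indicator {0..T} u *\<^sub>R f u)"
    unfolding V_measure_eq by (rule integrable_restrict_space) auto
  also have "\<dots> \<longleftrightarrow> integrable lborel (\<lambda>u. Vdens u *\<^sub>R (indicator {0..T} u *\<^sub>R f u))"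
    by (rule integrable_density) (auto simp: Vdens_nonneg)
  finally show "integrable (V_measure H T) f \<longleftrightarrow> integrable lborel (\<lambda>u. (indicator {0..T} u * Vdens u) *\<^sub>R f u)"
    unfolding eq .
  have "(\<integral>u. f u \<partial>V_measure H T) = (\<integral>u. indicator {0..T} u *\<^sub>R f u \<partial>density lborel (\<lambda>u. ennreal (Vdens u)))"
    unfolding V_measure_eq by (rule integral_restrict_space) auto
  also have "\<dots> = (\<integral>u. Vdens u *\<^sub>R (indicator {0..T} u *\<^sub>R f u) \<partial>lborel)"
    by (rule integral_density) (auto simp: Vdens_nonneg)
  finally show "(\<integral>u. f u \<partial>V_measure H T) = (\<integral>u. (indicator {0..T} u * Vdens u) *\<^sub>R f u \<partial>lborel)"
    unfolding eq .
qed

section \<open>The kernels x_t in the time-side space\<close>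

lemma xr_support: "t \<le> T \<Longrightarrow> indicator {0..T} u * xr t u = xr t u"
  by (auto simp: xr_def indicator_def)

lemma x_fun_measurable [measurable]: "x_fun H t \<in> borel_measurable borel"
  unfolding x_fun_eq[abs_def] by measurable

lemma x_fun_0: "x_fun H 0 = (\<lambda>_. 0)"
  by (auto simp: x_fun_def)

lemma x_fun_inner_le:
  assumes "0 \<le> s" "s \<le> t" "t \<le> T"
  shows "integrable (V_measure H T) (\<lambda>u. x_fun H s u * cnj (x_fun H t u))"
    "L2_inner (V_measure H T) (x_fun H s) (x_fun H t) = of_real ((s powr (2 * H) + t powr (2 * H) - (t - s) powr (2 * H)) / 2)"
proof -
  have "integrable (V_measure H T) (\<lambda>u. x_fun H s u * cnj (x_fun H t u)) \<and>
    (\<integral>u. x_fun H s u * cnj (x_fun H t u) \<partial>V_measure H T) = of_real ((s powr (2 * H) + t powr (2 * H) - (t - s) powr (2 * H)) / 2)"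
  proof (cases "s = 0")
    case True
    then show ?thesis using H by (simp add: x_fun_0)
  next
    case False
    have "has_bochner_integral lborel (\<lambda>u. complex_of_real (xr s u * xr t u * Vdens u)) (of_real ((s powr (2 * H) + t powr (2 * H) - (t - s) powr (2 * H)) / 2))"
      using False assms by (intro has_bochner_integral_of_real xr_inner) auto
    moreover have "complex_of_real (xr s u * xr t u * Vdens u) = (indicator {0..T} u * Vdens u) *\<^sub>R (x_fun H s u * cnj (x_fun H t u))" for u
    proof -
      have "complex_of_real (xr s u * xr t u * Vdens u) = of_real ((indicator {0..T} u * xr s u) * xr t u * Vdens u)"
        using xr_support[of s T u] assms by simp
      then show ?thesis by (simp add: x_fun_eq scaleR_conv_of_real mult_ac)
    qed
    ultimately have b: "has_bochner_integral lborel (\<lambda>u. (indicator {0..T} u * Vdens u) *\<^sub>R (x_fun H s u * cnj (x_fun H t u))) (of_real ((s powr (2 * H) + t powr (2 * H) - (t - s) powr (2 * H)) / 2))"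
      by (simp only:)
    show ?thesis using has_bochner_integral_V[OF _ b] by simp
  qed
  then show "integrable (V_measure H T) (\<lambda>u. x_fun H s u * cnj (x_fun H t u))"
    "L2_inner (V_measure H T) (x_fun H s) (x_fun H t) = of_real ((s powr (2 * H) + t powr (2 * H) - (t - s) powr (2 * H)) / 2)"
    by (simp_all add: L2_inner_def)
qed

lemma x_fun_L2:
  assumes "0 \<le> t" "t \<le> T"
  shows "x_fun H t \<in> L2_space (V_measure H T)" "L2_norm (V_measure H T) (x_fun H t) = t powr H"
proof -
  have sq: "x_fun H t u * cnj (x_fun H t u) = complex_of_real ((cmod (x_fun H t u))\<^sup>2)" for u
    by (simp only: complex_norm_square)
  have "integrable (V_measure H T) (\<lambda>u. complex_of_real ((cmod (x_fun H t u))\<^sup>2))"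
    using x_fun_inner_le(1)[OF assms(1) order_refl assms(2)] unfolding sq .
  then have "integrable (V_measure H T) (\<lambda>u. Re (complex_of_real ((cmod (x_fun H t u))\<^sup>2)))" by (rule integrable_Re)
  then show "x_fun H t \<in> L2_space (V_measure H T)"
    by (simp add: L2_space_def borel_measurable_V)
  have "complex_of_real ((L2_norm (V_measure H T) (x_fun H t))\<^sup>2) = of_real (t powr (2 * H))"
    unfolding L2_norm_eq_inner x_fun_inner_le(2)[OF assms(1) order_refl assms(2)] using H by simp
  then have "(L2_norm (V_measure H T) (x_fun H t))\<^sup>2 = (t powr H)\<^sup>2"
    by (simp only: of_real_eq_iff) (simp add: power2_eq_square powr_add[symmetric])
  then show "L2_norm (V_measure H T) (x_fun H t) = t powr H"
    by (simp add: power2_eq_iff_nonneg)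
qed

lemma x_fun_inner:
  assumes "0 \<le> s" "s \<le> T" "0 \<le> t" "t \<le> T"
  shows "L2_inner (V_measure H T) (x_fun H s) (x_fun H t) = L2_inner (spectral_measure H) (e_fun s) (e_fun t)"
proof (cases "s \<le> t")
  case True
  then show ?thesis using x_fun_inner_le(2)[OF assms(1) True assms(4)] assms by (simp add: e_fun_inner[OF H])
next
  case False
  then have "t \<le> s" by simp
  from x_fun_inner_le(2)[OF assms(3) this assms(2)]
  have "L2_inner (V_measure H T) (x_fun H s) (x_fun H t) = cnj (of_real ((t powr (2 * H) + s powr (2 * H) - (s - t) powr (2 * H)) / 2))"
    by (subst L2_inner_cnj) (simp only:)
  then show ?thesis using False assms by (simp add: e_fun_inner[OF H] add.commute)
qed

section \<open>The integral transform Phi\<close>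

lemma phi_measurable [measurable]: "phi H \<in> borel_measurable borel"
  by (rule borel_measurable_phi[OF H])

lemma phi_pair_measurable: "(\<lambda>(u, l). phi H (u * l)) \<in> borel_measurable (V_measure H T \<Otimes>\<^sub>M spectral_measure H)"
proof -
  have "(\<lambda>(u, l). phi H (u * l)) \<in> borel_measurable (borel \<Otimes>\<^sub>M borel)" by measurable
  moreover have "id \<in> V_measure H T \<rightarrow>\<^sub>M borel" by (rule borel_measurable_V) simp
  then have "(\<lambda>p. (fst p, snd p)) \<in> (V_measure H T \<Otimes>\<^sub>M spectral_measure H) \<rightarrow>\<^sub>M (borel \<Otimes>\<^sub>M borel)"
    by (intro measurable_Pair) (auto intro: measurable_compose[OF measurable_fst] simp: id_def)
  ultimately have "(\<lambda>p. (\<lambda>(u, l). phi H (u * l)) (fst p, snd p)) \<in> borel_measurable (V_measure H T \<Otimes>\<^sub>M spectral_measure H)"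
    by (rule measurable_compose[rotated])
  then show ?thesis by (simp add: case_prod_beta)
qed

definition phi_norm :: "real \<Rightarrow> real \<Rightarrow> real" where
  "phi_norm T l = L2_norm (V_measure H T) (\<lambda>u. phi H (u * l))"

text \<open>Linear growth of \<open>phi\<close> in \<open>u * l\<close> becomes linear growth in
  \<open>l\<close> alone, because \<open>u\<close> stays in \<open>[0, T]\<close> and
  \<open>dV\<close> is finite.\<close>

lemma phi_norm_bound:
  assumes "T > 0"
  obtains K where "K \<ge> 0" "\<And>l. (\<lambda>u. phi H (u * l)) \<in> L2_space (V_measure H T)" "\<And>l. phi_norm T l \<le> K * (1 + \<bar>l\<bar>)"
proof -
  obtain C where C: "C \<ge> 0" "\<And>z. cmod (phi H z) \<le> C * (1 + \<bar>z\<bar>)" using phi_bound[OF H] by blast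
  interpret V: finite_measure "V_measure H T" by (rule finite_measure_V[OF assms])
  have one: "(\<lambda>u. 1) \<in> L2_space (V_measure H T)" by (simp add: L2_space_def)
  define K where "K = C * (1 + T) * L2_norm (V_measure H T) (\<lambda>u. 1)"
  have b: "cmod (phi H (u * l)) \<le> C * (1 + T) * (1 + \<bar>l\<bar>)" if "u \<in> {0..T}" for u l
  proof -
    have "cmod (phi H (u * l)) \<le> C * (1 + \<bar>u * l\<bar>)" by (rule C)
    also have "1 + \<bar>u * l\<bar> \<le> (1 + T) * (1 + \<bar>l\<bar>)"
    proof -
      have "\<bar>u * l\<bar> \<le> T * \<bar>l\<bar>" using that by (simp add: abs_mult mult_right_mono)
      then show ?thesis using assms by (simp add: algebra_simps)
    qed
    then have "C * (1 + \<bar>u * l\<bar>) \<le> C * ((1 + T) * (1 + \<bar>l\<bar>))" using C by (intro mult_left_mono) auto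
    finally show ?thesis by (simp add: mult.assoc)
  qed
  have meas: "(\<lambda>u. phi H (u * l)) \<in> borel_measurable (V_measure H T)" for l by (rule borel_measurable_V) measurable
  show ?thesis
  proof (rule that[of K])
    show "K \<ge> 0" using C assms by (simp add: K_def)
    show L2: "(\<lambda>u. phi H (u * l)) \<in> L2_space (V_measure H T)" for l
      by (rule L2_space_dominated[OF one meas, where C = "C * (1 + T) * (1 + \<bar>l\<bar>)"]) (use b in auto)
    show "phi_norm T l \<le> K * (1 + \<bar>l\<bar>)" for l
    proof -
      have "(phi_norm T l)\<^sup>2 \<le> (\<integral>u. (C * (1 + T) * (1 + \<bar>l\<bar>))\<^sup>2 * (cmod 1)\<^sup>2 \<partial>V_measure H T)"
        unfolding phi_norm_def L2_norm_sq
      proof (rule integral_mono)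
        show "integrable (V_measure H T) (\<lambda>u. (cmod (phi H (u * l)))\<^sup>2)" by (rule L2_space_integrable[OF L2])
        fix u assume "u \<in> space (V_measure H T)"
        then show "(cmod (phi H (u * l)))\<^sup>2 \<le> (C * (1 + T) * (1 + \<bar>l\<bar>))\<^sup>2 * (cmod 1)\<^sup>2"
          using power_mono[OF b[of u l], of 2] by simp
      qed simp
      also have "\<dots> = (C * (1 + T) * (1 + \<bar>l\<bar>))\<^sup>2 * (L2_norm (V_measure H T) (\<lambda>u. 1))\<^sup>2"
        unfolding L2_norm_sq by (rule integral_mult_right_zero)
      also have "\<dots> = (K * (1 + \<bar>l\<bar>))\<^sup>2" by (simp add: K_def power_mult_distrib)
      finally show ?thesis by (rule power2_le_imp_le) (use C assms in \<open>simp add: K_def\<close>)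
    qed
  qed
qed

lemma phi_slice_L2: "T > 0 \<Longrightarrow> (\<lambda>u. phi H (u * l)) \<in> L2_space (V_measure H T)"
  using phi_norm_bound by metis

lemma phi_norm_measurable:
  assumes "T > 0"
  shows "phi_norm T \<in> borel_measurable (spectral_measure H)"
proof -
  interpret V: finite_measure "V_measure H T" by (rule finite_measure_V[OF assms])
  have "(\<lambda>(l, u). (cmod (phi H (u * l)))\<^sup>2) \<in> borel_measurable (spectral_measure H \<Otimes>\<^sub>M V_measure H T)"
    using phi_pair_measurable[of T] by (subst measurable_pair_swap_iff) (simp add: case_prod_beta)
  from V.borel_measurable_lebesgue_integral[OF this] show ?thesis
    unfolding phi_norm_def[abs_def] L2_norm_def by measurable
qed

lemma phi_norm_nonneg: "phi_norm T l \<ge> 0"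
  by (simp add: phi_norm_def)

definition Phi :: "real \<Rightarrow> (real \<Rightarrow> complex) \<Rightarrow> real \<Rightarrow> complex" where
  "Phi T f l = (\<integral>u. f u * phi H (u * l) \<partial>V_measure H T)"

lemma Phi_integrable:
  assumes "T > 0" "f \<in> L2_space (V_measure H T)"
  shows "integrable (V_measure H T) (\<lambda>u. f u * phi H (u * l))"
proof -
  have [measurable]: "f \<in> borel_measurable (V_measure H T)" "(\<lambda>u. phi H (u * l)) \<in> borel_measurable (V_measure H T)"
    using assms L2_space_measurable[OF phi_slice_L2] by (auto simp: L2_space_def)
  show ?thesis
    by (rule Bochner_Integration.integrable_bound[OF L2_mult_integrable[OF assms(2) phi_slice_L2[OF assms(1), of l]]])
       (auto simp: norm_mult)
qed

lemma Phi_bound: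
  assumes "T > 0" "f \<in> L2_space (V_measure H T)"
  shows "(\<integral>u. cmod (f u) * cmod (phi H (u * l)) \<partial>V_measure H T) \<le> L2_norm (V_measure H T) f * phi_norm T l"
    "cmod (Phi T f l) \<le> L2_norm (V_measure H T) f * phi_norm T l"
proof -
  show 1: "(\<integral>u. cmod (f u) * cmod (phi H (u * l)) \<partial>V_measure H T) \<le> L2_norm (V_measure H T) f * phi_norm T l"
    unfolding phi_norm_def by (rule L2_Cauchy_Schwarz[OF assms(2) phi_slice_L2[OF assms(1)]])
  have "cmod (Phi T f l) \<le> (\<integral>u. cmod (f u * phi H (u * l)) \<partial>V_measure H T)"
    unfolding Phi_def by (rule integral_norm_bound)
  then show "cmod (Phi T f l) \<le> L2_norm (V_measure H T) f * phi_norm T l" using 1 by (simp add: norm_mult)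
qed

lemma Phi_lincomb:
  assumes "T > 0" "f \<in> L2_space (V_measure H T)" "g \<in> L2_space (V_measure H T)"
  shows "Phi T (\<lambda>u. \<alpha> * f u + \<beta> * g u) l = \<alpha> * Phi T f l + \<beta> * Phi T g l"
proof -
  have "Phi T (\<lambda>u. \<alpha> * f u + \<beta> * g u) l = (\<integral>u. \<alpha> * (f u * phi H (u * l)) + \<beta> * (g u * phi H (u * l)) \<partial>V_measure H T)"
    unfolding Phi_def by (simp add: algebra_simps)
  also have "\<dots> = \<alpha> * Phi T f l + \<beta> * Phi T g l"
    unfolding Phi_def using Phi_integrable[OF assms(1,2), of l] Phi_integrable[OF assms(1,3), of l] by simp
  finally show ?thesis .
qed

lemma Phi_diff:
  assumes "T > 0" "f \<in> L2_space (V_measure H T)" "g \<in> L2_space (V_measure H T)"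
  shows "Phi T (\<lambda>u. f u - g u) l = Phi T f l - Phi T g l"
  using Phi_lincomb[OF assms, of 1 "-1"] by simp

lemma Phi_zero: "Phi T (\<lambda>_. 0) = (\<lambda>_. 0)"
  by (simp add: Phi_def fun_eq_iff)

lemma Phi_x_fun:
  assumes "0 \<le> t" "t \<le> T"
  shows "Phi T (x_fun H t) = e_fun t"
proof
  fix l
  show "Phi T (x_fun H t) l = e_fun t l"
  proof (cases "t = 0")
    case True
    then show ?thesis by (simp add: x_fun_0 Phi_def)
  next
    case False
    have "(indicator {0..T} u * Vdens u) *\<^sub>R (x_fun H t u * phi H (u * l)) = of_real (xr t u * Vdens u) * phi H (u * l)" for u
    proof -
      have "complex_of_real (xr t u * Vdens u) = of_real ((indicator {0..T} u * xr t u) * Vdens u)"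
        using xr_support[OF assms(2), of u] by simp
      then show ?thesis by (simp add: x_fun_eq scaleR_conv_of_real mult_ac)
    qed
    then have "has_bochner_integral lborel (\<lambda>u. (indicator {0..T} u * Vdens u) *\<^sub>R (x_fun H t u * phi H (u * l))) (e_fun t l)"
      using phi_transform_xr[of t l] False assms by simp
    from has_bochner_integral_V(2)[OF _ this] show ?thesis unfolding Phi_def by simp
  qed
qed

section \<open>Phi on the span of the kernels and on its closure\<close>

definition x_span :: "real \<Rightarrow> (real \<Rightarrow> complex) set" where
  "x_span T = complex_span (x_fun H ` {0..T})"

lemma K_space_eq: "K_space H T = L2_closure (V_measure H T) (x_span T)"
  by (simp add: K_space_def x_span_def)

lemma lin_closed_x_span: "lin_closed (x_span T)"
  unfolding x_span_def by (rule lin_closed_complex_span)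

lemma x_span_L2: "x_span T \<subseteq> L2_space (V_measure H T)"
  unfolding x_span_def by (rule complex_span_minimal[OF lin_closed_L2_space]) (auto intro: x_fun_L2)

lemma K_space_L2: "K_space H T \<subseteq> L2_space (V_measure H T)"
  unfolding K_space_eq by (rule L2_closure_subset)

lemma lin_closed_K_space: "lin_closed (K_space H T)"
  unfolding K_space_eq by (rule lin_closed_L2_closure[OF lin_closed_x_span])

lemma Phi_lincomb_x_span:
  assumes "T > 0" "f \<in> x_span T" "g \<in> x_span T"
  shows "Phi T (\<lambda>u. \<alpha> * f u + \<beta> * g u) = (\<lambda>l. \<alpha> * Phi T f l + \<beta> * Phi T g l)"
proof -
  have "f \<in> L2_space (V_measure H T)" "g \<in> L2_space (V_measure H T)" using assms x_span_L2 by blast+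
  from Phi_lincomb[OF assms(1) this] show ?thesis by blast
qed

lemma x_span_K_space: "x_span T \<subseteq> K_space H T"
  unfolding K_space_eq by (rule L2_closure_superset[OF x_span_L2])

lemma x_fun_x_span: "0 \<le> t \<Longrightarrow> t \<le> T \<Longrightarrow> x_fun H t \<in> x_span T"
  unfolding x_span_def using complex_span_superset[of "x_fun H ` {0..T}"] by auto

lemma Phi_x_span:
  assumes "T > 0" "f \<in> x_span T"
  shows "Phi T f \<in> e_span T"
proof -
  let ?P = "{f \<in> L2_space (V_measure H T). Phi T f \<in> e_span T}"
  have "lin_closed ?P"
    unfolding lin_closed_def
  proof (intro conjI ballI allI)
    show "(\<lambda>_. 0) \<in> ?P" using lin_closedD(1)[OF lin_closed_e_span] by (simp add: Phi_zero L2_space_zero)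
    fix f g a b assume fg: "f \<in> ?P" "g \<in> ?P"
    then have "Phi T (\<lambda>x. a * f x + b * g x) = (\<lambda>l. a * Phi T f l + b * Phi T g l)"
      using Phi_lincomb[OF assms(1)] by auto
    then show "(\<lambda>x. a * f x + b * g x) \<in> ?P"
      using fg lin_closedD(2)[OF lin_closed_e_span, of "Phi T f" T "Phi T g" a b] by (simp add: L2_space_lincomb)
  qed
  moreover have "x_fun H ` {0..T} \<subseteq> ?P"
    using complex_span_superset[of "e_fun ` {0..T}"]
    by (auto simp: Phi_x_fun x_fun_L2 e_span_def)
  ultimately have "x_span T \<subseteq> ?P" unfolding x_span_def by (rule complex_span_minimal)
  then show ?thesis using assms(2) by auto
qed

text \<open>On the spans surjectivity holds exactly, not merely almost everywhere; this provides
  preimages of the approximants in \<open>Phi_onto\<close>.\<close>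

lemma e_span_Phi:
  assumes "T > 0" "h \<in> e_span T"
  obtains f where "f \<in> x_span T" "Phi T f = h"
proof -
  let ?P = "{h. \<exists>f\<in>x_span T. Phi T f = h}"
  have "lin_closed ?P"
    unfolding lin_closed_def
  proof (intro conjI ballI allI)
    show "(\<lambda>_. 0) \<in> ?P" using lin_closedD(1)[OF lin_closed_x_span] Phi_zero by blast
    fix h k a b assume "h \<in> ?P" "k \<in> ?P"
    then obtain f g where fg: "f \<in> x_span T" "g \<in> x_span T" "Phi T f = h" "Phi T g = k" by auto
    then have "Phi T (\<lambda>x. a * f x + b * g x) = (\<lambda>l. a * h l + b * k l)"
      using Phi_lincomb_x_span[OF assms(1)] by auto
    then show "(\<lambda>x. a * h x + b * k x) \<in> ?P"
      using lin_closedD(2)[OF lin_closed_x_span fg(1,2), of a b] by auto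
  qed
  moreover have "e_fun ` {0..T} \<subseteq> ?P"
    using x_fun_x_span Phi_x_fun by fastforce
  ultimately have "e_span T \<subseteq> ?P" unfolding e_span_def by (rule complex_span_minimal)
  then show ?thesis using assms(2) that by auto
qed

text \<open>Equality of the Gram matrices is extended in one argument at a time: over the span on
  the left against a fixed \<open>x_t\<close>, then over the span on the right.\<close>

lemma Phi_x_span_inner:
  assumes T: "T > 0" and f: "f \<in> x_span T" and g: "g \<in> x_span T"
  shows "L2_inner (spectral_measure H) (Phi T f) (Phi T g) = L2_inner (V_measure H T) f g"
proof -
  let ?V = "V_measure H T" and ?\<mu> = "spectral_measure H"
  have PL: "Phi T f \<in> L2_space ?\<mu>" if "f \<in> x_span T" for f
    using Phi_x_span[OF T that] e_span_L2[OF H] by blast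
  have 1: "L2_inner ?\<mu> (Phi T f) (e_fun t) = L2_inner ?V f (x_fun H t)" if "f \<in> x_span T" "0 \<le> t" "t \<le> T" for f t
  proof -
    let ?P = "{f \<in> x_span T. L2_inner ?\<mu> (Phi T f) (e_fun t) = L2_inner ?V f (x_fun H t)}"
    have "lin_closed ?P"
      unfolding lin_closed_def
    proof (intro conjI ballI allI)
      show "(\<lambda>_. 0) \<in> ?P" using lin_closedD(1)[OF lin_closed_x_span] by (simp add: Phi_zero L2_inner_def)
      fix f g a b assume fg: "f \<in> ?P" "g \<in> ?P"
      have "Phi T (\<lambda>x. a * f x + b * g x) = (\<lambda>l. a * Phi T f l + b * Phi T g l)"
        using fg by (intro Phi_lincomb_x_span[OF T]) auto
      moreover have "L2_inner ?\<mu> (\<lambda>l. a * Phi T f l + b * Phi T g l) (e_fun t) = a * L2_inner ?\<mu> (Phi T f) (e_fun t) + b * L2_inner ?\<mu> (Phi T g) (e_fun t)"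
        using fg by (intro L2_inner_lincomb_left PL e_fun_L2 H) auto
      moreover have "L2_inner ?V (\<lambda>x. a * f x + b * g x) (x_fun H t) = a * L2_inner ?V f (x_fun H t) + b * L2_inner ?V g (x_fun H t)"
        using fg x_span_L2 that by (intro L2_inner_lincomb_left x_fun_L2) auto
      ultimately show "(\<lambda>x. a * f x + b * g x) \<in> ?P"
        using fg lin_closedD(2)[OF lin_closed_x_span] by simp
    qed
    moreover have "x_fun H ` {0..T} \<subseteq> ?P"
      using that x_fun_x_span x_fun_inner by (auto simp: Phi_x_fun)
    ultimately have "x_span T \<subseteq> ?P" by (subst x_span_def) (rule complex_span_minimal)
    then show ?thesis using that by auto
  qed
  \<comment> \<open>Now \<open>f\<close> is a fixed element of the span, and \<open>1\<close>
    supplies the generators in the second argument; linearity there is conjugate.\<close>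
  let ?Q = "{g \<in> x_span T. L2_inner ?\<mu> (Phi T f) (Phi T g) = L2_inner ?V f g}"
  have "lin_closed ?Q"
    unfolding lin_closed_def
  proof (intro conjI ballI allI)
    show "(\<lambda>_. 0) \<in> ?Q" using lin_closedD(1)[OF lin_closed_x_span] by (simp add: Phi_zero L2_inner_def)
    fix g h a b assume gh: "g \<in> ?Q" "h \<in> ?Q"
    have "Phi T (\<lambda>x. a * g x + b * h x) = (\<lambda>l. a * Phi T g l + b * Phi T h l)"
      using gh by (intro Phi_lincomb_x_span[OF T]) auto
    moreover have "L2_inner ?\<mu> (Phi T f) (\<lambda>l. a * Phi T g l + b * Phi T h l) = cnj a * L2_inner ?\<mu> (Phi T f) (Phi T g) + cnj b * L2_inner ?\<mu> (Phi T f) (Phi T h)"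
      using gh f by (intro L2_inner_lincomb_right PL) auto
    moreover have "L2_inner ?V f (\<lambda>x. a * g x + b * h x) = cnj a * L2_inner ?V f g + cnj b * L2_inner ?V f h"
      using gh f x_span_L2 by (intro L2_inner_lincomb_right) auto
    ultimately show "(\<lambda>x. a * g x + b * h x) \<in> ?Q"
      using gh lin_closedD(2)[OF lin_closed_x_span] by simp
  qed
  moreover have "x_fun H ` {0..T} \<subseteq> ?Q"
    using f x_fun_x_span 1 by (auto simp: Phi_x_fun)
  ultimately have "x_span T \<subseteq> ?Q" by (subst x_span_def) (rule complex_span_minimal)
  then show ?thesis using g by auto
qed

lemma Phi_x_span_norm:
  assumes "T > 0" "f \<in> x_span T"
  shows "L2_norm (spectral_measure H) (Phi T f) = L2_norm (V_measure H T) f"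
proof -
  have "complex_of_real ((L2_norm (spectral_measure H) (Phi T f))\<^sup>2) = of_real ((L2_norm (V_measure H T) f)\<^sup>2)"
    unfolding L2_norm_eq_inner by (rule Phi_x_span_inner[OF assms(1,2,2)])
  then have "(L2_norm (spectral_measure H) (Phi T f))\<^sup>2 = (L2_norm (V_measure H T) f)\<^sup>2" by (simp only: of_real_eq_iff)
  then show ?thesis by (simp add: power2_eq_iff_nonneg)
qed

lemma Phi_measurable:
  assumes "T > 0" "f \<in> L2_space (V_measure H T)"
  shows "Phi T f \<in> borel_measurable (spectral_measure H)"
proof -
  interpret V: finite_measure "V_measure H T" by (rule finite_measure_V[OF assms(1)])
  have [measurable]: "f \<in> borel_measurable (V_measure H T)" by (rule L2_space_measurable[OF assms(2)])
  note [measurable] = phi_pair_measurable[of T]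
  have f1: "(\<lambda>p. f (fst p)) \<in> borel_measurable (V_measure H T \<Otimes>\<^sub>M spectral_measure H)"
    by (rule measurable_compose[OF measurable_fst]) simp
  have "(\<lambda>(u, l). f u * phi H (u * l)) \<in> borel_measurable (V_measure H T \<Otimes>\<^sub>M spectral_measure H)"
    unfolding case_prod_beta by (intro borel_measurable_times f1 phi_pair_measurable[unfolded case_prod_beta])
  then have "(\<lambda>(l, u). f u * phi H (u * l)) \<in> borel_measurable (spectral_measure H \<Otimes>\<^sub>M V_measure H T)"
    by (subst measurable_pair_swap_iff) (simp add: case_prod_beta)
  from V.borel_measurable_lebesgue_integral[OF this] show ?thesis
    unfolding Phi_def[abs_def] .
qed

text \<open>Two kinds of convergence meet here. For each fixed \<open>l\<close> the values
  \<open>Phi T (g k) l\<close> converge, by Cauchy-Schwarz; on the span the transform is isometric,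
  so the differences \<open>Phi T (g k) - Phi T (g n)\<close> have norm at most
  \<open>2 * (1/2) ^ n\<close> for \<open>k >= n\<close>. Fatou's lemma passes this bound to the
  pointwise limit.\<close>

lemma Phi_K_space_approx:
  assumes T: "T > 0" and f: "f \<in> L2_space (V_measure H T)" and g: "\<And>n. g n \<in> x_span T"
    and lim: "\<And>n. L2_norm (V_measure H T) (\<lambda>x. f x - g n x) < (1/2) ^ n"
  shows "Phi T f \<in> L2_space (spectral_measure H)"
    "\<And>n. L2_norm (spectral_measure H) (\<lambda>l. Phi T f l - Phi T (g n) l) \<le> 2 * (1/2) ^ n"
proof -
  let ?V = "V_measure H T" and ?\<mu> = "spectral_measure H"
  have gL: "g n \<in> L2_space ?V" for n using g x_span_L2 by blast
  have PL: "Phi T (g n) \<in> L2_space ?\<mu>" for n using Phi_x_span[OF T g] e_span_L2[OF H] by blast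
  have ptw: "(\<lambda>k. Phi T (g k) l) \<longlonglongrightarrow> Phi T f l" for l
  proof -
    have "(\<lambda>k. Phi T (g k) l - Phi T f l) \<longlonglongrightarrow> 0"
    proof (rule Lim_null_comparison)
      show "eventually (\<lambda>k. norm (Phi T (g k) l - Phi T f l) \<le> (1/2) ^ k * phi_norm T l) sequentially"
      proof (rule always_eventually, rule allI)
        fix k
        have "norm (Phi T (g k) l - Phi T f l) = norm (Phi T (\<lambda>u. f u - g k u) l)"
          using Phi_diff[OF T f gL] by (simp add: norm_minus_commute)
        also have "\<dots> \<le> L2_norm ?V (\<lambda>u. f u - g k u) * phi_norm T l"
          by (rule Phi_bound(2)[OF T L2_space_diff[OF f gL]])
        also have "\<dots> \<le> (1/2) ^ k * phi_norm T l"
          using lim[of k] by (intro mult_right_mono phi_norm_nonneg) auto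
        finally show "norm (Phi T (g k) l - Phi T f l) \<le> (1/2) ^ k * phi_norm T l" .
      qed
      show "(\<lambda>k. (1/2) ^ k * phi_norm T l) \<longlonglongrightarrow> 0"
        by (intro tendsto_mult_left_zero LIMSEQ_power_zero) simp
    qed
    then show ?thesis by (simp add: LIM_zero_iff)
  qed
  have diff: "(\<lambda>l. Phi T f l - Phi T (g n) l) \<in> L2_space ?\<mu> \<and> L2_norm ?\<mu> (\<lambda>l. Phi T f l - Phi T (g n) l) \<le> 2 * (1/2) ^ n" for n
  proof -
    have 3: "(\<lambda>l. Phi T (g k) l - Phi T (g n) l) \<in> L2_space ?\<mu>" for k by (intro L2_space_diff PL)
    have m: "(\<lambda>l. Phi T f l - Phi T (g n) l) \<in> borel_measurable ?\<mu>"
      by (intro borel_measurable_diff Phi_measurable T f gL)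
    have 1: "AE l in ?\<mu>. (\<lambda>k. Phi T (g k) l - Phi T (g n) l) \<longlonglongrightarrow> Phi T f l - Phi T (g n) l"
      by (intro AE_I2 tendsto_diff ptw tendsto_const)
    have 2: "eventually (\<lambda>k. L2_norm ?\<mu> (\<lambda>l. Phi T (g k) l - Phi T (g n) l) \<le> 2 * (1/2) ^ n) sequentially"
      using eventually_ge_at_top[of n]
    proof eventually_elim
      case (elim k)
      have "(\<lambda>l. Phi T (g k) l - Phi T (g n) l) = Phi T (\<lambda>u. g k u - g n u)"
        using Phi_diff[OF T gL gL] by auto
      then have "L2_norm ?\<mu> (\<lambda>l. Phi T (g k) l - Phi T (g n) l) = L2_norm ?V (\<lambda>u. g k u - g n u)"
        using Phi_x_span_norm[OF T lin_closed_diff[OF lin_closed_x_span g g]] by simp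
      also have "\<dots> \<le> L2_norm ?V (\<lambda>u. g k u - f u) + L2_norm ?V (\<lambda>u. f u - g n u)"
        by (rule L2_norm_diff_triangle[OF gL f gL])
      also have "L2_norm ?V (\<lambda>u. g k u - f u) = L2_norm ?V (\<lambda>u. f u - g k u)" by (rule L2_norm_minus_commute)
      also have "L2_norm ?V (\<lambda>u. f u - g k u) + L2_norm ?V (\<lambda>u. f u - g n u) \<le> (1/2) ^ k + (1/2) ^ n"
        using lim[of k] lim[of n] by linarith
      also have "(1/2) ^ k \<le> ((1/2) ^ n :: real)" using elim by (intro power_decreasing) auto
      finally show ?case by simp
    qed
    show ?thesis using L2_Fatou[OF 3 m 1 2] by simp
  qed
  show "L2_norm ?\<mu> (\<lambda>l. Phi T f l - Phi T (g n) l) \<le> 2 * (1/2) ^ n" for n using diff by simp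
  show "Phi T f \<in> L2_space ?\<mu>"
    using L2_space_add[OF conjunct1[OF diff[of 0]] PL[of 0]] by simp
qed

lemma half_power_small: "(\<And>n. x \<le> C * (1/2) ^ n) \<Longrightarrow> x \<le> (0::real)"
proof (rule LIMSEQ_le_const[of "\<lambda>n. C * (1/2) ^ n" 0])
  show "(\<lambda>n. C * (1/2) ^ n) \<longlonglongrightarrow> 0" by (intro tendsto_mult_right_zero LIMSEQ_power_zero) simp
qed auto

lemma Phi_K_space:
  assumes T: "T > 0" and f: "f \<in> K_space H T"
  shows "Phi T f \<in> L_space H T" "L2_norm (spectral_measure H) (Phi T f) = L2_norm (V_measure H T) f"
proof -
  let ?V = "V_measure H T" and ?\<mu> = "spectral_measure H"
  have fL: "f \<in> L2_space ?V" using f K_space_L2 by blast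
  obtain g where g: "\<And>n. g n \<in> x_span T" "\<And>n. g n \<in> L2_space ?V" "\<And>n. L2_norm ?V (\<lambda>x. f x - g n x) < (1/2) ^ n"
    using L2_closure_sequence[of f ?V "x_span T"] f unfolding K_space_eq by blast
  note P = Phi_K_space_approx[OF T fL g(1) g(3)]
  have PL: "Phi T (g n) \<in> L2_space ?\<mu>" for n using Phi_x_span[OF T g(1)] e_span_L2[OF H] by blast
  have t0: "(\<lambda>n. 2 * (1/2::real) ^ n) \<longlonglongrightarrow> 0" by (intro tendsto_mult_right_zero LIMSEQ_power_zero) simp
  show "Phi T f \<in> L_space H T" unfolding L_space_eq
  proof (rule L2_closure_limit[OF P(1)])
    show "Phi T (g n) \<in> e_span T" for n by (rule Phi_x_span[OF T g(1)])
    show "(\<lambda>n. L2_norm ?\<mu> (\<lambda>l. Phi T f l - Phi T (g n) l)) \<longlonglongrightarrow> 0"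
      by (rule tendsto_sandwich[OF _ _ tendsto_const t0]) (use P(2) in auto)
  qed (rule PL)
  have n: "L2_norm ?\<mu> (Phi T (g n)) = L2_norm ?V (g n)" for n by (rule Phi_x_span_norm[OF T g(1)])
  \<comment> \<open>The constant 3 adds the error 2 on the transform side to the error 1 in the
    approximation of \<open>f\<close>.\<close>
  have "L2_norm ?\<mu> (Phi T f) - L2_norm ?V f \<le> 3 * (1/2) ^ n" for n
    using L2_norm_le_add_diff[OF P(1) PL[of n]] P(2)[of n] n[of n] L2_norm_le_add_diff[OF g(2)[of n] fL]
      L2_norm_minus_commute[of ?V f "g n"] g(3)[of n] by linarith
  then have "L2_norm ?\<mu> (Phi T f) - L2_norm ?V f \<le> 0" by (rule half_power_small)
  moreover have "L2_norm ?V f - L2_norm ?\<mu> (Phi T f) \<le> 3 * (1/2) ^ n" for n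
    using L2_norm_le_add_diff[OF fL g(2)[of n]] P(2)[of n] n[of n] L2_norm_le_add_diff[OF PL[of n] P(1)]
      L2_norm_minus_commute[of ?\<mu> "Phi T f" "Phi T (g n)"] g(3)[of n] by linarith
  then have "L2_norm ?V f - L2_norm ?\<mu> (Phi T f) \<le> 0" by (rule half_power_small)
  ultimately show "L2_norm ?\<mu> (Phi T f) = L2_norm ?V f" by linarith
qed

lemma Phi_K_space_inner:
  assumes T: "T > 0" and f: "f \<in> K_space H T" and g: "g \<in> K_space H T"
  shows "L2_inner (spectral_measure H) (Phi T f) (Phi T g) = L2_inner (V_measure H T) f g"
proof (rule L2_inner_eq_of_norm_eq)
  show fL: "f \<in> L2_space (V_measure H T)" and gL: "g \<in> L2_space (V_measure H T)" using f g K_space_L2 by auto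
  show "Phi T f \<in> L2_space (spectral_measure H)" "Phi T g \<in> L2_space (spectral_measure H)"
    using Phi_K_space(1)[OF T f] Phi_K_space(1)[OF T g] L_space_L2 by auto
  fix c
  have "Phi T (\<lambda>x. 1 * f x + c * g x) = (\<lambda>l. 1 * Phi T f l + c * Phi T g l)"
    using Phi_lincomb[OF T fL gL] by blast
  then show "L2_norm (spectral_measure H) (\<lambda>x. 1 * Phi T f x + c * Phi T g x) = L2_norm (V_measure H T) (\<lambda>x. 1 * f x + c * g x)"
    using Phi_K_space(2)[OF T lin_closedD(2)[OF lin_closed_K_space f g, of 1 c]] by simp
qed

lemma Phi_onto:
  assumes T: "T > 0" and \<psi>: "\<psi> \<in> L_space H T"
  obtains f where "f \<in> K_space H T" "AE l in spectral_measure H. Phi T f l = \<psi> l"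
proof -
  let ?V = "V_measure H T" and ?\<mu> = "spectral_measure H"
  have \<psi>L: "\<psi> \<in> L2_space ?\<mu>" using \<psi> L_space_L2 by blast
  obtain h where h: "\<And>n. h n \<in> e_span T" "\<And>n. h n \<in> L2_space ?\<mu>" "\<And>n. L2_norm ?\<mu> (\<lambda>x. \<psi> x - h n x) < (1/2) ^ n"
    using L2_closure_sequence[of \<psi> ?\<mu> "e_span T"] \<psi> unfolding L_space_eq by blast
  have "\<forall>n. \<exists>f. f \<in> x_span T \<and> Phi T f = h n" using e_span_Phi[OF T h(1)] by metis
  then obtain g where g: "\<And>n. g n \<in> x_span T" "\<And>n. Phi T (g n) = h n" by metis
  have gL: "g n \<in> L2_space ?V" for n using g(1) x_span_L2 by blast
  \<comment> \<open>The approximants of \<open>psi\<close> are pulled back to the span, where the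
    transform preserves norms; so the preimages inherit the fast Cauchy property.\<close>
  have step: "L2_norm ?V (\<lambda>x. g (Suc n) x - g n x) \<le> 2 * (1/2) ^ n" for n
  proof -
    have "L2_norm ?V (\<lambda>x. g (Suc n) x - g n x) = L2_norm ?\<mu> (Phi T (\<lambda>x. g (Suc n) x - g n x))"
      by (rule Phi_x_span_norm[OF T lin_closed_diff[OF lin_closed_x_span g(1) g(1)], symmetric])
    also have "Phi T (\<lambda>x. g (Suc n) x - g n x) = (\<lambda>l. h (Suc n) l - h n l)"
      using Phi_diff[OF T gL gL] g(2) by auto
    also have "L2_norm ?\<mu> (\<lambda>l. h (Suc n) l - h n l) \<le> L2_norm ?\<mu> (\<lambda>l. h (Suc n) l - \<psi> l) + L2_norm ?\<mu> (\<lambda>l. \<psi> l - h n l)"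
      by (rule L2_norm_diff_triangle[OF h(2) \<psi>L h(2)])
    also have "\<dots> \<le> (1/2) ^ Suc n + (1/2) ^ n"
      using h(3)[of n] h(3)[of "Suc n"] L2_norm_minus_commute[of ?\<mu> "h (Suc n)" \<psi>] by linarith
    also have "\<dots> \<le> 2 * (1/2) ^ n" by simp
    finally show ?thesis .
  qed
  obtain f where f: "f \<in> L2_space ?V" "(\<lambda>n. L2_norm ?V (\<lambda>x. f x - g n x)) \<longlonglongrightarrow> 0"
    using L2_complete[OF finite_measure_V[OF T] gL step] by blast
  have fK: "f \<in> K_space H T" unfolding K_space_eq by (rule L2_closure_limit[OF f(1) g(1) gL f(2)])
  have PfL: "Phi T f \<in> L2_space ?\<mu>" using Phi_K_space(1)[OF T fK] L_space_L2 by blast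
  have le: "L2_norm ?\<mu> (\<lambda>l. Phi T f l - \<psi> l) \<le> L2_norm ?V (\<lambda>x. f x - g n x) + (1/2) ^ n" for n
  proof -
    have "L2_norm ?\<mu> (\<lambda>l. Phi T f l - \<psi> l) \<le> L2_norm ?\<mu> (\<lambda>l. Phi T f l - h n l) + L2_norm ?\<mu> (\<lambda>l. h n l - \<psi> l)"
      by (rule L2_norm_diff_triangle[OF PfL h(2) \<psi>L])
    also have "(\<lambda>l. Phi T f l - h n l) = Phi T (\<lambda>x. f x - g n x)"
      using Phi_diff[OF T f(1) gL] g(2) by auto
    also have "L2_norm ?\<mu> (Phi T (\<lambda>x. f x - g n x)) = L2_norm ?V (\<lambda>x. f x - g n x)"
      using g(1) x_span_K_space by (intro Phi_K_space(2)[OF T] lin_closed_diff[OF lin_closed_K_space fK]) auto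
    also have "L2_norm ?\<mu> (\<lambda>l. h n l - \<psi> l) = L2_norm ?\<mu> (\<lambda>l. \<psi> l - h n l)" by (rule L2_norm_minus_commute)
    finally show ?thesis using h(3)[of n] by linarith
  qed
  have "(\<lambda>n. L2_norm ?V (\<lambda>x. f x - g n x) + (1/2) ^ n) \<longlonglongrightarrow> 0 + 0"
    by (intro tendsto_add f(2) LIMSEQ_power_zero) simp
  then have "L2_norm ?\<mu> (\<lambda>l. Phi T f l - \<psi> l) \<le> 0"
    using le by (intro LIMSEQ_le_const) auto
  then have "AE l in ?\<mu>. Phi T f l = \<psi> l"
    by (intro L2_norm_small_AE_eq[OF PfL \<psi>L]) linarith
  with fK show ?thesis by (rule that)
qed

section \<open>Existence and uniqueness of U\<close>

lemma is_U_Phi: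
  assumes T: "T > 0"
  shows "is_U H T (Phi T)"
  unfolding is_U_def L2_bounded_linear_def
proof (intro conjI ballI impI allI)
  fix f assume f: "f \<in> K_space H T"
  show "Phi T f \<in> L_space H T" by (rule Phi_K_space(1)[OF T f])
next
  fix f g assume fg: "f \<in> K_space H T" "g \<in> K_space H T" "AE x in V_measure H T. f x = g x"
  then have fgL: "f \<in> L2_space (V_measure H T)" "g \<in> L2_space (V_measure H T)" using K_space_L2 by auto
  have "Phi T f l = Phi T g l" for l
    unfolding Phi_def
  proof (rule integral_cong_AE)
    show "(\<lambda>u. f u * phi H (u * l)) \<in> borel_measurable (V_measure H T)" "(\<lambda>u. g u * phi H (u * l)) \<in> borel_measurable (V_measure H T)"
      by (intro borel_measurable_integrable Phi_integrable[OF T] fgL)+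
    show "AE u in V_measure H T. f u * phi H (u * l) = g u * phi H (u * l)" using fg(3) by eventually_elim simp
  qed
  then show "AE y in spectral_measure H. Phi T f y = Phi T g y" by simp
next
  fix f g a b assume fg: "f \<in> K_space H T" "g \<in> K_space H T"
  then have "f \<in> L2_space (V_measure H T)" "g \<in> L2_space (V_measure H T)" using K_space_L2 by auto
  then show "AE y in spectral_measure H. Phi T (\<lambda>x. a * f x + b * g x) y = a * Phi T f y + b * Phi T g y"
    by (simp add: Phi_lincomb[OF T])
next
  show "\<exists>C. \<forall>f\<in>K_space H T. L2_norm (spectral_measure H) (Phi T f) \<le> C * L2_norm (V_measure H T) f"
    by (intro exI[of _ 1] ballI) (simp add: Phi_K_space(2)[OF T])
next
  fix t assume "t \<in> {0..T}"
  then show "AE l in spectral_measure H. Phi T (x_fun H t) l = e_fun t l" by (simp add: Phi_x_fun)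
qed

text \<open>Agreement on the \<open>x_t\<close> extends to their span because only finitely many
  exceptional null sets are involved, and to the closure because both operators are bounded.\<close>

lemma is_U_eq_Phi:
  assumes T: "T > 0" and U: "is_U H T U" and f: "f \<in> K_space H T"
  shows "AE l in spectral_measure H. U f l = Phi T f l"
proof -
  let ?V = "V_measure H T" and ?\<mu> = "spectral_measure H"
  have UL: "\<And>f. f \<in> K_space H T \<Longrightarrow> U f \<in> L_space H T"
    and Ulin: "\<And>f g a b. f \<in> K_space H T \<Longrightarrow> g \<in> K_space H T \<Longrightarrow> AE y in ?\<mu>. U (\<lambda>x. a * f x + b * g x) y = a * U f y + b * U g y"
    and Ux: "\<And>t. t \<in> {0..T} \<Longrightarrow> AE l in ?\<mu>. U (x_fun H t) l = e_fun t l"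
    using U by (auto simp: is_U_def L2_bounded_linear_def)
  obtain C where C: "\<And>f. f \<in> K_space H T \<Longrightarrow> L2_norm ?\<mu> (U f) \<le> C * L2_norm ?V f"
    using U unfolding is_U_def L2_bounded_linear_def by blast
  have UL2: "\<And>f. f \<in> K_space H T \<Longrightarrow> U f \<in> L2_space ?\<mu>" using UL L_space_L2 by blast
  have PL2: "\<And>f. f \<in> K_space H T \<Longrightarrow> Phi T f \<in> L2_space ?\<mu>" using Phi_K_space(1)[OF T] L_space_L2 by blast
  have span: "AE l in ?\<mu>. U g l = Phi T g l" if "g \<in> x_span T" for g
  proof -
    let ?P = "{g \<in> x_span T. AE l in ?\<mu>. U g l = Phi T g l}"
    have "lin_closed ?P"
      unfolding lin_closed_def
    proof (intro conjI ballI allI)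
      have 0: "(\<lambda>_. 0) \<in> x_span T" by (rule lin_closedD(1)[OF lin_closed_x_span])
      then have "(\<lambda>_. 0) \<in> K_space H T" using x_span_K_space by blast
      \<comment> \<open>\<open>U\<close> acts on representatives, so that \<open>U\<close> maps 0 to
        0 almost everywhere has to be derived, here from linearity with both coefficients 0.\<close>
      from Ulin[OF this this, of 0 0] 0 show "(\<lambda>_. 0) \<in> ?P" by (simp add: Phi_zero)
      fix f g a b assume fg: "f \<in> ?P" "g \<in> ?P"
      then have fgK: "f \<in> K_space H T" "g \<in> K_space H T" using x_span_K_space by auto
      then have fgL: "f \<in> L2_space ?V" "g \<in> L2_space ?V" using K_space_L2 by auto
      have 1: "AE l in ?\<mu>. U f l = Phi T f l" "AE l in ?\<mu>. U g l = Phi T g l" using fg by auto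
      have "AE l in ?\<mu>. U (\<lambda>x. a * f x + b * g x) l = Phi T (\<lambda>x. a * f x + b * g x) l"
        using Ulin[OF fgK, of a b] 1 by eventually_elim (simp add: Phi_lincomb[OF T fgL])
      then show "(\<lambda>x. a * f x + b * g x) \<in> ?P" using fg lin_closedD(2)[OF lin_closed_x_span] by simp
    qed
    moreover have "x_fun H ` {0..T} \<subseteq> ?P" using Ux x_fun_x_span by (auto simp: Phi_x_fun)
    ultimately have "x_span T \<subseteq> ?P" by (subst x_span_def) (rule complex_span_minimal)
    then show ?thesis using that by auto
  qed
  have fL: "f \<in> L2_space ?V" using f K_space_L2 by blast
  obtain g where g: "\<And>n. g n \<in> x_span T" "\<And>n. g n \<in> L2_space ?V" "\<And>n. L2_norm ?V (\<lambda>x. f x - g n x) < (1/2) ^ n"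
    using L2_closure_sequence[of f ?V "x_span T"] f unfolding K_space_eq by blast
  have gK: "g n \<in> K_space H T" for n using g(1) x_span_K_space by blast
  \<comment> \<open>The bound for \<open>U\<close> contributes \<open>C\<close> and the isometry
    \<open>Phi\<close> contributes 1. The modulus is taken because the sign of \<open>C\<close> is
    not specified.\<close>
  have le: "L2_norm ?\<mu> (\<lambda>l. U f l - Phi T f l) \<le> (\<bar>C\<bar> + 1) * (1/2) ^ n" for n
  proof -
    have dK: "(\<lambda>x. f x - g n x) \<in> K_space H T" by (rule lin_closed_diff[OF lin_closed_K_space f gK])
    have "AE l in ?\<mu>. U f l - U (g n) l = U (\<lambda>x. f x - g n x) l"
      using Ulin[OF f gK[of n], of 1 "-1"] by eventually_elim simp
    then have 1: "L2_norm ?\<mu> (\<lambda>l. U f l - U (g n) l) = L2_norm ?\<mu> (U (\<lambda>x. f x - g n x))"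
      by (intro L2_norm_cong_AE borel_measurable_diff L2_space_measurable UL2 f gK dK)
    have "AE l in ?\<mu>. U (g n) l - Phi T f l = Phi T (g n) l - Phi T f l"
      using span[OF g(1)[of n]] by eventually_elim simp
    then have 2: "L2_norm ?\<mu> (\<lambda>l. U (g n) l - Phi T f l) = L2_norm ?\<mu> (\<lambda>l. Phi T (g n) l - Phi T f l)"
      by (intro L2_norm_cong_AE borel_measurable_diff L2_space_measurable UL2 PL2 f gK)
    have "(\<lambda>l. Phi T f l - Phi T (g n) l) = Phi T (\<lambda>x. f x - g n x)" using Phi_diff[OF T fL g(2)] by auto
    then have 3: "L2_norm ?\<mu> (\<lambda>l. Phi T (g n) l - Phi T f l) = L2_norm ?V (\<lambda>x. f x - g n x)"
      by (subst L2_norm_minus_commute) (simp add: Phi_K_space(2)[OF T dK])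
    have "L2_norm ?\<mu> (\<lambda>l. U f l - Phi T f l) \<le> L2_norm ?\<mu> (\<lambda>l. U f l - U (g n) l) + L2_norm ?\<mu> (\<lambda>l. U (g n) l - Phi T f l)"
      by (intro L2_norm_diff_triangle UL2 PL2 f gK)
    also have "\<dots> \<le> C * L2_norm ?V (\<lambda>x. f x - g n x) + L2_norm ?V (\<lambda>x. f x - g n x)"
      unfolding 1 2 3 using C[OF dK] by simp
    also have "\<dots> \<le> (\<bar>C\<bar> + 1) * L2_norm ?V (\<lambda>x. f x - g n x)"
      using mult_right_mono[OF abs_ge_self[of C] L2_norm_nonneg[of ?V "\<lambda>x. f x - g n x"]] by (simp add: algebra_simps)
    also have "\<dots> \<le> (\<bar>C\<bar> + 1) * (1/2) ^ n" using g(3)[of n] by (intro mult_left_mono) auto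
    finally show ?thesis .
  qed
  then have "L2_norm ?\<mu> (\<lambda>l. U f l - Phi T f l) \<le> 0" by (rule half_power_small)
  then show ?thesis by (intro L2_norm_small_AE_eq[OF UL2[OF f] PL2[OF f]]) linarith
qed

section \<open>The class L' is dense\<close>

lemma L'_space_subset: "L'_space H T \<subseteq> L_space H T"
  by (auto simp: L'_space_def)

text \<open>With the linear bound on \<open>phi_norm\<close> and cubic decay, the product is of
  order \<open>1 / l^2\<close>, which is integrable against the spectral density for every
  \<open>H\<close>. A single smoothing factor would leave order \<open>1 / |l|\<close> and the
  integrand \<open>|l| powr (- 2 * H)\<close>, integrable at infinity only for
  \<open>H > 1/2\<close>.\<close>

lemma e_smooth_L':
  assumes T: "T > 0" and \<epsilon>: "0 < \<epsilon>" "2 * \<epsilon> \<le> t" "t \<le> T"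
  shows "e_smooth t \<epsilon> \<in> L'_space H T"
proof -
  let ?\<mu> = "spectral_measure H"
  obtain K where K: "K \<ge> 0" "\<And>l. phi_norm T l \<le> K * (1 + \<bar>l\<bar>)" by (rule phi_norm_bound[OF T]) (rule that)
  define B where "B = K * 2 * (t + 8 / \<epsilon>\<^sup>2)"
  have t: "t > 0" using \<epsilon> by linarith
  have int: "integrable ?\<mu> (\<lambda>l. K * (1 + \<bar>l\<bar>) * cmod (e_smooth t \<epsilon> l))"
  proof (rule integrable_spectralI[OF H, of _ B])
    fix l :: real
    assume l: "\<bar>l\<bar> < 1"
    have "cmod (e_smooth t \<epsilon> l) \<le> \<bar>t - 2 * \<epsilon>\<bar>"
      using e_smooth_bound(1)[OF \<epsilon>(1,2), of l] norm_e_fun_le(1)[of "t - 2 * \<epsilon>" l] by linarith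
    also have "\<dots> \<le> t + 8 / \<epsilon>\<^sup>2"
    proof -
      have "0 \<le> 8 / \<epsilon>\<^sup>2" by simp
      then show ?thesis using \<epsilon> by linarith
    qed
    finally have "K * (1 + \<bar>l\<bar>) * cmod (e_smooth t \<epsilon> l) \<le> K * 2 * (t + 8 / \<epsilon>\<^sup>2)"
      using l K by (intro mult_mono) auto
    then show "\<bar>K * (1 + \<bar>l\<bar>) * cmod (e_smooth t \<epsilon> l)\<bar> \<le> B" using K by (simp add: B_def abs_mult)
  next
    fix l :: real
    assume l: "1 \<le> \<bar>l\<bar>"
    have "K * (1 + \<bar>l\<bar>) * cmod (e_smooth t \<epsilon> l) \<le> K * (2 * \<bar>l\<bar>) * (8 / \<epsilon>\<^sup>2 / \<bar>l\<bar> ^ 3)"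
      using l K e_smooth_bound(2)[OF \<epsilon>(1,2), of l] by (intro mult_mono) auto
    also have "\<dots> = K * 2 * (8 / \<epsilon>\<^sup>2) / l\<^sup>2"
    proof -
      have "\<bar>l\<bar> ^ 3 = \<bar>l\<bar> * l\<^sup>2" by (simp add: power3_eq_cube power2_eq_square)
      moreover have "\<bar>l\<bar> \<noteq> 0" using l by linarith
      ultimately show ?thesis by simp
    qed
    also have "\<dots> \<le> B / l\<^sup>2"
      unfolding B_def using K t by (intro divide_right_mono mult_left_mono) auto
    finally show "\<bar>K * (1 + \<bar>l\<bar>) * cmod (e_smooth t \<epsilon> l)\<bar> \<le> B / l\<^sup>2" using K by (simp add: abs_mult)
  qed measurable
  have "(\<integral>\<^sup>+l. ennreal (phi_norm T l * cmod (e_smooth t \<epsilon> l)) \<partial>?\<mu>) \<le> (\<integral>\<^sup>+l. ennreal (K * (1 + \<bar>l\<bar>) * cmod (e_smooth t \<epsilon> l)) \<partial>?\<mu>)"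
    by (intro nn_integral_mono ennreal_leI mult_right_mono K) auto
  also have "\<dots> < \<infinity>"
    using int K by (subst nn_integral_eq_integral) auto
  finally show ?thesis
    using e_smooth_L_space[OF H \<epsilon>] by (simp add: L'_space_def phi_norm_def)
qed

lemma lin_closed_L'_space:
  assumes T: "T > 0"
  shows "lin_closed (L'_space H T)"
  unfolding lin_closed_def
proof (intro conjI ballI allI)
  let ?\<mu> = "spectral_measure H"
  show "(\<lambda>_. 0) \<in> L'_space H T" using lin_closedD(1)[OF lin_closed_L_space] by (simp add: L'_space_def)
  fix f g a b assume fg: "f \<in> L'_space H T" "g \<in> L'_space H T"
  then have L: "f \<in> L_space H T" "g \<in> L_space H T" using L'_space_subset by auto
  have fm: "f \<in> borel_measurable ?\<mu>" "g \<in> borel_measurable ?\<mu>" using L L_space_L2 L2_space_measurable by blast+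
  note [measurable] = phi_norm_measurable[OF T] fm
  have "(\<integral>\<^sup>+l. ennreal (phi_norm T l * cmod (a * f l + b * g l)) \<partial>?\<mu>) \<le>
      (\<integral>\<^sup>+l. ennreal (cmod a) * ennreal (phi_norm T l * cmod (f l)) + ennreal (cmod b) * ennreal (phi_norm T l * cmod (g l)) \<partial>?\<mu>)"
  proof (rule nn_integral_mono)
    fix l
    have "phi_norm T l * cmod (a * f l + b * g l) \<le> phi_norm T l * (cmod a * cmod (f l) + cmod b * cmod (g l))"
      using norm_triangle_ineq[of "a * f l" "b * g l"] by (intro mult_left_mono phi_norm_nonneg) (simp add: norm_mult)
    also have "\<dots> = cmod a * (phi_norm T l * cmod (f l)) + cmod b * (phi_norm T l * cmod (g l))" by (simp add: algebra_simps)
    finally show "ennreal (phi_norm T l * cmod (a * f l + b * g l)) \<le> ennreal (cmod a) * ennreal (phi_norm T l * cmod (f l)) + ennreal (cmod b) * ennreal (phi_norm T l * cmod (g l))"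
      using phi_norm_nonneg by (simp add: ennreal_mult'[symmetric] ennreal_leI flip: ennreal_plus)
  qed
  also have "\<dots> = ennreal (cmod a) * (\<integral>\<^sup>+l. ennreal (phi_norm T l * cmod (f l)) \<partial>?\<mu>) + ennreal (cmod b) * (\<integral>\<^sup>+l. ennreal (phi_norm T l * cmod (g l)) \<partial>?\<mu>)"
    by (subst nn_integral_add, measurable) (simp add: nn_integral_cmult)
  also have "\<dots> < \<infinity>"
    using fg by (simp add: L'_space_def phi_norm_def ennreal_mult_less_top)
  finally show "(\<lambda>x. a * f x + b * g x) \<in> L'_space H T"
    using lin_closedD(2)[OF lin_closed_L_space L] by (simp add: L'_space_def phi_norm_def)
qed

text \<open>The closure of a subspace is a closed subspace, so it suffices that it contains the
  generators \<open>e_t\<close>. The case \<open>t = 0\<close> is separate because it admits no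
  positive \<open>epsilon\<close> with \<open>2 * epsilon <= t\<close>; there \<open>e_t\<close> is
  the zero function.\<close>

lemma L'_space_dense:
  assumes T: "T > 0"
  shows "L2_closure (spectral_measure H) (L'_space H T) = L_space H T"
proof
  let ?\<mu> = "spectral_measure H"
  have "L2_closure ?\<mu> (L'_space H T) \<subseteq> L2_closure ?\<mu> (L_space H T)" by (rule L2_closure_mono[OF L'_space_subset])
  then show "L2_closure ?\<mu> (L'_space H T) \<subseteq> L_space H T" using L_space_closed by blast
  have "e_span T \<subseteq> L2_closure ?\<mu> (L'_space H T)"
    unfolding e_span_def
  proof (rule complex_span_minimal[OF lin_closed_L2_closure[OF lin_closed_L'_space[OF T]]], rule subsetI)
    fix f assume "f \<in> e_fun ` {0..T}"
    then obtain t where t: "0 \<le> t" "t \<le> T" "f = e_fun t" by auto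
    show "f \<in> L2_closure ?\<mu> (L'_space H T)"
    proof (cases "t = 0")
      case True
      then have "f = (\<lambda>_. 0)" using t by (auto simp: fun_eq_iff)
      then show ?thesis using lin_closedD(1)[OF lin_closed_L2_closure[OF lin_closed_L'_space[OF T]]] by simp
    next
      case False
      then show ?thesis unfolding t(3) using t by (intro e_fun_closure[OF H] e_smooth_L' T) auto
    qed
  qed
  then have "L_space H T \<subseteq> L2_closure ?\<mu> (L2_closure ?\<mu> (L'_space H T))"
    unfolding L_space_eq by (rule L2_closure_mono)
  then show "L_space H T \<subseteq> L2_closure ?\<mu> (L'_space H T)" using L2_closure_idem by blast
qed

text \<open>The adjoint formula only needs that the kernels \<open>x\<^sub>t\<close> are total, in a form that also covers functions
  not yet known to be square integrable.\<close>

lemma V_orthogonal_AE: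
  assumes T: "T > 0" and h: "integrable (V_measure H T) h"
    and bound: "\<And>t. 0 < t \<Longrightarrow> t \<le> T \<Longrightarrow> (\<integral>\<^sup>+u. ennreal (cmod (h u) * cmod (x_fun H t u)) \<partial>V_measure H T) \<le> ennreal (C * t powr H)"
    and C: "C \<ge> 0"
    and orth: "\<And>t. 0 < t \<Longrightarrow> t \<le> T \<Longrightarrow> (\<integral>u. h u * x_fun H t u \<partial>V_measure H T) = 0"
  shows "AE u in V_measure H T. h u = 0"
proof -
  define g where "g u = (indicator {0..T} u * Vdens u) *\<^sub>R h u" for u
  have hm: "h \<in> borel_measurable (V_measure H T)" using h by simp
  have g: "integrable lborel g" unfolding g_def using has_bochner_integral_V_lborel(1)[OF hm] h by simp
  have [measurable]: "g \<in> borel_measurable borel" using g by simp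
  have g0: "g u = 0" if "u \<notin> {0<..T}" for u using that by (auto simp: g_def indicator_def Vdens_def)
  have hx: "(\<lambda>u. h u * x_fun H t u) \<in> borel_measurable (V_measure H T)" for t
    by (intro borel_measurable_times hm borel_measurable_V) simp
  have "AE u in lborel. g u = 0"
  proof (rule orthogonal_kernels_AE[OF T g g0 _ C])
    fix t assume t: "0 < t" "t \<le> T"
    define r where "r u = complex_of_real (cmod (h u) * cmod (x_fun H t u))" for u
    have "integrable (V_measure H T) (\<lambda>u. norm (h u * x_fun H t u))"
    proof (rule integrableI_bounded)
      show "(\<lambda>u. norm (h u * x_fun H t u)) \<in> borel_measurable (V_measure H T)" using hx by simp
      show "(\<integral>\<^sup>+u. ennreal (norm (norm (h u * x_fun H t u))) \<partial>V_measure H T) < \<infinity>"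
        using bound[OF t] by (simp add: norm_mult le_less_trans)
    qed
    then have int: "integrable (V_measure H T) (\<lambda>u. h u * x_fun H t u)" using hx by (rule integrable_norm_cancel)
    have eq: "(indicator {0..T} u * Vdens u) *\<^sub>R (h u * x_fun H t u) = g u * of_real (xr t u)" for u
      by (simp add: g_def x_fun_eq)
    show "(\<integral>u. g u * of_real (xr t u) \<partial>lborel) = 0"
      using orth[OF t] has_bochner_integral_V_lborel(2)[OF hx, of t] unfolding eq by simp
    have int': "integrable lborel (\<lambda>u. g u * of_real (xr t u))"
      using int has_bochner_integral_V_lborel(1)[OF hx, of t] unfolding eq by simp
    have hxn: "(\<lambda>u. norm (h u * x_fun H t u)) \<in> borel_measurable (V_measure H T)" using hx by simp
    have eqn: "(indicator {0..T} u * Vdens u) *\<^sub>R norm (h u * x_fun H t u) = cmod (g u) * xr t u" for u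
      using Vdens_nonneg[of u] xr_nonneg[of t u] by (simp add: g_def x_fun_eq norm_mult)
    have "(\<integral>\<^sup>+u. ennreal (norm (h u * x_fun H t u)) \<partial>V_measure H T) \<le> ennreal (C * t powr H)"
      using bound[OF t] by (simp add: norm_mult)
    then have "ennreal (\<integral>u. norm (h u * x_fun H t u) \<partial>V_measure H T) \<le> ennreal (C * t powr H)"
      by (simp only: nn_integral_eq_integral[OF integrable_norm[OF int] always_eventually[OF allI[OF norm_ge_zero]]])
    then have "ennreal (\<integral>u. cmod (g u) * xr t u \<partial>lborel) \<le> ennreal (C * t powr H)"
      using has_bochner_integral_V_lborel(2)[OF hxn] unfolding eqn by simp
    moreover have "integrable lborel (\<lambda>u. cmod (g u) * xr t u)"
      using integrable_norm[OF int'] xr_nonneg[of t] by (simp add: norm_mult)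
    ultimately show "(\<integral>\<^sup>+u. ennreal (cmod (g u) * xr t u) \<partial>lborel) \<le> ennreal (C * t powr H)"
      using xr_nonneg[of t] by (subst nn_integral_eq_integral) auto
  qed
  then have "AE u in density lborel (\<lambda>u. ennreal (Vdens u)). u \<in> {0..T} \<longrightarrow> h u = 0"
    by (subst AE_density) (auto simp: g_def elim!: eventually_mono)
  then show ?thesis unfolding V_measure_eq by (subst AE_restrict_space_iff) auto
qed

section \<open>The adjoint formula\<close>

lemma adjoint_kernel:
  assumes T: "T > 0" and \<psi>: "\<psi> \<in> L'_space H T"
  obtains C where "C \<ge> 0"
    "\<And>f. f \<in> L2_space (V_measure H T) \<Longrightarrow>
      integrable (V_measure H T \<Otimes>\<^sub>M spectral_measure H) (\<lambda>(u, l). f u * phi H (u * l) * cnj (\<psi> l))"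
    "\<And>f. f \<in> L2_space (V_measure H T) \<Longrightarrow>
      (\<integral>\<^sup>+u. \<integral>\<^sup>+l. ennreal (cmod (f u) * cmod (phi H (u * l)) * cmod (\<psi> l)) \<partial>spectral_measure H \<partial>V_measure H T)
        \<le> ennreal (C * L2_norm (V_measure H T) f)"
proof -
  let ?V = "V_measure H T" and ?\<mu> = "spectral_measure H"
  interpret V: finite_measure ?V by (rule finite_measure_V[OF T])
  interpret S: sigma_finite_measure ?\<mu> by (rule sigma_finite_spectral)
  interpret VS: pair_sigma_finite ?V ?\<mu> ..
  have \<psi>L: "\<psi> \<in> L2_space ?\<mu>" using \<psi> L'_space_subset L_space_L2 by blast
  have \<psi>m [measurable]: "\<psi> \<in> borel_measurable ?\<mu>" by (rule L2_space_measurable[OF \<psi>L])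
  have fin: "(\<integral>\<^sup>+l. ennreal (phi_norm T l * cmod (\<psi> l)) \<partial>?\<mu>) < \<infinity>" using \<psi> by (simp add: L'_space_def phi_norm_def)
  define C where "C = enn2real (\<integral>\<^sup>+l. ennreal (phi_norm T l * cmod (\<psi> l)) \<partial>?\<mu>)"
  have Ceq: "(\<integral>\<^sup>+l. ennreal (phi_norm T l * cmod (\<psi> l)) \<partial>?\<mu>) = ennreal C" using fin by (simp add: C_def)
  have pm: "(\<lambda>(u, l). f u * phi H (u * l) * cnj (\<psi> l)) \<in> borel_measurable (?V \<Otimes>\<^sub>M ?\<mu>)" if "f \<in> L2_space ?V" for f
  proof -
    have [measurable]: "f \<in> borel_measurable ?V" by (rule L2_space_measurable[OF that])
    have "(\<lambda>p. f (fst p)) \<in> borel_measurable (?V \<Otimes>\<^sub>M ?\<mu>)" "(\<lambda>p. cnj (\<psi> (snd p))) \<in> borel_measurable (?V \<Otimes>\<^sub>M ?\<mu>)"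
      by (rule measurable_compose[OF measurable_fst], simp, rule measurable_compose[OF measurable_snd], simp)
    then show ?thesis
      unfolding case_prod_beta by (intro borel_measurable_times phi_pair_measurable[unfolded case_prod_beta])
  qed
  have nm: "(\<lambda>(u, l). ennreal (cmod (f u) * cmod (phi H (u * l)) * cmod (\<psi> l))) \<in> borel_measurable (?V \<Otimes>\<^sub>M ?\<mu>)" if "f \<in> L2_space ?V" for f
  proof -
    have "(\<lambda>p. ennreal (norm (case p of (u, l) \<Rightarrow> f u * phi H (u * l) * cnj (\<psi> l)))) \<in> borel_measurable (?V \<Otimes>\<^sub>M ?\<mu>)"
      by (intro measurable_compose[OF _ measurable_ennreal] measurable_compose[OF _ borel_measurable_norm] pm[OF that])
    then show ?thesis by (simp add: case_prod_beta norm_mult)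
  qed
  have bd: "(\<integral>\<^sup>+u. \<integral>\<^sup>+l. ennreal (cmod (f u) * cmod (phi H (u * l)) * cmod (\<psi> l)) \<partial>?\<mu> \<partial>?V) \<le> ennreal (C * L2_norm ?V f)" if f: "f \<in> L2_space ?V" for f
  proof -
    have [measurable]: "f \<in> borel_measurable ?V" by (rule L2_space_measurable[OF f])
    have "(\<integral>\<^sup>+u. \<integral>\<^sup>+l. ennreal (cmod (f u) * cmod (phi H (u * l)) * cmod (\<psi> l)) \<partial>?\<mu> \<partial>?V) =
        (\<integral>\<^sup>+l. \<integral>\<^sup>+u. ennreal (cmod (f u) * cmod (phi H (u * l)) * cmod (\<psi> l)) \<partial>?V \<partial>?\<mu>)"
      by (rule VS.Fubini'[symmetric]) (rule nm[OF f])
    \<comment> \<open>With \<open>u\<close> innermost, Cauchy-Schwarz at fixed \<open>l\<close>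
      splits off the norm of \<open>f\<close> and leaves exactly the integral that defines
      \<open>L'\<close>.\<close>
    also have "\<dots> \<le> (\<integral>\<^sup>+l. ennreal (L2_norm ?V f) * ennreal (phi_norm T l * cmod (\<psi> l)) \<partial>?\<mu>)"
    proof (rule nn_integral_mono)
      fix l
      have i: "integrable ?V (\<lambda>u. cmod (f u) * cmod (phi H (u * l)))"
        by (rule L2_mult_integrable[OF f phi_slice_L2[OF T]])
      have "(\<integral>\<^sup>+u. ennreal (cmod (f u) * cmod (phi H (u * l)) * cmod (\<psi> l)) \<partial>?V) = ennreal (\<integral>u. cmod (f u) * cmod (phi H (u * l)) * cmod (\<psi> l) \<partial>?V)"
        using i by (intro nn_integral_eq_integral integrable_mult_left) auto
      also have "(\<integral>u. cmod (f u) * cmod (phi H (u * l)) * cmod (\<psi> l) \<partial>?V) = (\<integral>u. cmod (f u) * cmod (phi H (u * l)) \<partial>?V) * cmod (\<psi> l)"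
        by (rule integral_mult_left_zero)
      also have "ennreal \<dots> \<le> ennreal (L2_norm ?V f * phi_norm T l * cmod (\<psi> l))"
        by (intro ennreal_leI mult_right_mono Phi_bound(1)[OF T f]) auto
      also have "\<dots> = ennreal (L2_norm ?V f) * ennreal (phi_norm T l * cmod (\<psi> l))"
        by (simp add: ennreal_mult'[symmetric] mult.assoc)
      finally show "(\<integral>\<^sup>+u. ennreal (cmod (f u) * cmod (phi H (u * l)) * cmod (\<psi> l)) \<partial>?V) \<le> ennreal (L2_norm ?V f) * ennreal (phi_norm T l * cmod (\<psi> l))" .
    qed
    also have "\<dots> = ennreal (L2_norm ?V f) * ennreal C"
      unfolding Ceq[symmetric]
    proof (rule nn_integral_cmult)
      note [measurable] = phi_norm_measurable[OF T]
      show "(\<lambda>l. ennreal (phi_norm T l * cmod (\<psi> l))) \<in> borel_measurable ?\<mu>" by measurable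
    qed
    also have "\<dots> = ennreal (C * L2_norm ?V f)" by (simp add: ennreal_mult'[symmetric] mult.commute C_def)
    finally show ?thesis .
  qed
  show ?thesis
  proof (rule that[of C])
    show "C \<ge> 0" by (simp add: C_def)
    show "integrable (?V \<Otimes>\<^sub>M ?\<mu>) (\<lambda>(u, l). f u * phi H (u * l) * cnj (\<psi> l))" if f: "f \<in> L2_space ?V" for f
    proof (rule integrableI_bounded[OF pm[OF f]])
      have "(\<integral>\<^sup>+p. ennreal (norm (case p of (u, l) \<Rightarrow> f u * phi H (u * l) * cnj (\<psi> l))) \<partial>(?V \<Otimes>\<^sub>M ?\<mu>)) =
          (\<integral>\<^sup>+p. (case p of (u, l) \<Rightarrow> ennreal (cmod (f u) * cmod (phi H (u * l)) * cmod (\<psi> l))) \<partial>(?V \<Otimes>\<^sub>M ?\<mu>))"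
        by (simp add: case_prod_beta norm_mult)
      also have "\<dots> = (\<integral>\<^sup>+u. \<integral>\<^sup>+l. ennreal (cmod (f u) * cmod (phi H (u * l)) * cmod (\<psi> l)) \<partial>?\<mu> \<partial>?V)"
        using S.nn_integral_fst[OF nm[OF f]] by simp
      also have "\<dots> < \<infinity>" using bd[OF f] by (simp add: le_less_trans)
      finally show "(\<integral>\<^sup>+p. ennreal (norm (case p of (u, l) \<Rightarrow> f u * phi H (u * l) * cnj (\<psi> l))) \<partial>(?V \<Otimes>\<^sub>M ?\<mu>)) < \<infinity>" .
    qed
  qed (rule bd)
qed

text \<open>By Fubini's theorem \<open>cnj w\<close> and the kernel integral \<open>k\<close> pair
  equally with every \<open>x_t\<close>. The kernel bound, with \<open>t powr H\<close> as the norm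
  of \<open>x_t\<close>, supplies the estimate that the orthogonality criterion asks for.
  Integrability of almost every slice belongs to the conclusion, since otherwise the integral could
  be a mere default value.\<close>

lemma adjoint_formula:
  assumes T: "T > 0" and \<psi>: "\<psi> \<in> L'_space H T" and w: "w \<in> K_space H T"
    and adj: "\<And>f. f \<in> K_space H T \<Longrightarrow> L2_inner (spectral_measure H) (Phi T f) \<psi> = L2_inner (V_measure H T) f w"
  shows "AE u in V_measure H T. integrable (spectral_measure H) (\<lambda>l. \<psi> l * cnj (phi H (u * l))) \<and>
    w u = (\<integral>l. \<psi> l * cnj (phi H (u * l)) \<partial>spectral_measure H)"
proof -
  let ?V = "V_measure H T" and ?\<mu> = "spectral_measure H"
  interpret V: finite_measure ?V by (rule finite_measure_V[OF T])
  interpret S: sigma_finite_measure ?\<mu> by (rule sigma_finite_spectral)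
  interpret VS: pair_sigma_finite ?V ?\<mu> ..
  obtain C where C: "C \<ge> 0"
    and int: "\<And>f. f \<in> L2_space ?V \<Longrightarrow> integrable (?V \<Otimes>\<^sub>M ?\<mu>) (\<lambda>(u, l). f u * phi H (u * l) * cnj (\<psi> l))"
    and bd: "\<And>f. f \<in> L2_space ?V \<Longrightarrow>
      (\<integral>\<^sup>+u. \<integral>\<^sup>+l. ennreal (cmod (f u) * cmod (phi H (u * l)) * cmod (\<psi> l)) \<partial>?\<mu> \<partial>?V) \<le> ennreal (C * L2_norm ?V f)"
    by (rule adjoint_kernel[OF T \<psi>]) blast
  have one: "(\<lambda>u. 1) \<in> L2_space ?V" by (simp add: L2_space_def)
  have wL: "w \<in> L2_space ?V" using w K_space_L2 by blast
  have wm [measurable]: "w \<in> borel_measurable ?V" by (rule L2_space_measurable[OF wL])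
  define k where "k u = (\<integral>l. phi H (u * l) * cnj (\<psi> l) \<partial>?\<mu>)" for u
  \<comment> \<open>The choice \<open>f = 1\<close>, square integrable because \<open>dV\<close> is
    finite, yields integrability of \<open>k\<close> and of almost every slice.\<close>
  have int1: "integrable (?V \<Otimes>\<^sub>M ?\<mu>) (\<lambda>(u, l). phi H (u * l) * cnj (\<psi> l))" using int[OF one] by simp
  have AEint: "AE u in ?V. integrable ?\<mu> (\<lambda>l. phi H (u * l) * cnj (\<psi> l))"
    using VS.AE_integrable_fst[OF int1] by simp
  have ki: "integrable ?V k" unfolding k_def using VS.integrable_fst[OF int1] by simp
  have km [measurable]: "k \<in> borel_measurable ?V" using ki by simp
  have kb: "(\<integral>\<^sup>+u. ennreal (cmod (k u) * cmod (f u)) \<partial>?V) \<le> ennreal (C * L2_norm ?V f)" if f: "f \<in> L2_space ?V" for f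
  proof -
    have "(\<integral>\<^sup>+u. ennreal (cmod (k u) * cmod (f u)) \<partial>?V) \<le> (\<integral>\<^sup>+u. \<integral>\<^sup>+l. ennreal (cmod (f u) * cmod (phi H (u * l)) * cmod (\<psi> l)) \<partial>?\<mu> \<partial>?V)"
    proof (rule nn_integral_mono_AE)
      show "AE u in ?V. ennreal (cmod (k u) * cmod (f u)) \<le> (\<integral>\<^sup>+l. ennreal (cmod (f u) * cmod (phi H (u * l)) * cmod (\<psi> l)) \<partial>?\<mu>)"
        using AEint
      proof eventually_elim
        case (elim u)
        then have i: "integrable ?\<mu> (\<lambda>l. cmod (f u) * cmod (phi H (u * l) * cnj (\<psi> l)))" by simp
        have "cmod (k u) * cmod (f u) \<le> cmod (f u) * (\<integral>l. cmod (phi H (u * l) * cnj (\<psi> l)) \<partial>?\<mu>)"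
          unfolding k_def by (subst mult.commute) (intro mult_left_mono integral_norm_bound, simp)
        also have "\<dots> = (\<integral>l. cmod (f u) * cmod (phi H (u * l) * cnj (\<psi> l)) \<partial>?\<mu>)" by simp
        finally have "ennreal (cmod (k u) * cmod (f u)) \<le> ennreal (\<integral>l. cmod (f u) * cmod (phi H (u * l) * cnj (\<psi> l)) \<partial>?\<mu>)"
          by (rule ennreal_leI)
        also have "\<dots> = (\<integral>\<^sup>+l. ennreal (cmod (f u) * cmod (phi H (u * l) * cnj (\<psi> l))) \<partial>?\<mu>)"
          by (rule nn_integral_eq_integral[OF i, symmetric]) simp
        finally show ?case by (simp add: norm_mult mult.assoc)
      qed
    qed
    then show ?thesis using bd[OF f] by (rule order_trans)
  qed
  have fub: "L2_inner ?\<mu> (Phi T f) \<psi> = (\<integral>u. f u * k u \<partial>?V)" if f: "f \<in> L2_space ?V" for f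
  proof -
    have "L2_inner ?\<mu> (Phi T f) \<psi> = (\<integral>l. (\<integral>u. f u * phi H (u * l) * cnj (\<psi> l) \<partial>?V) \<partial>?\<mu>)"
      unfolding L2_inner_def Phi_def by simp
    also have "\<dots> = (\<integral>u. (\<integral>l. f u * phi H (u * l) * cnj (\<psi> l) \<partial>?\<mu>) \<partial>?V)"
      by (rule VS.Fubini_integral[OF int[OF f]])
    also have "\<dots> = (\<integral>u. f u * k u \<partial>?V)" unfolding k_def by (simp add: mult.assoc)
    finally show ?thesis .
  qed
  \<comment> \<open>The inner product conjugates \<open>w\<close>, while \<open>k\<close> enters
    linearly, so \<open>cnj (w u)\<close> is what has to be compared with
    \<open>k u\<close>.\<close>
  define h where "h u = cnj (w u) - k u" for u
  have hi: "integrable ?V h"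
  proof -
    have "integrable ?V (\<lambda>u. 1 * cnj (w u))" by (rule L2_inner_integrable[OF one wL])
    then show ?thesis unfolding h_def using ki by simp
  qed
  have "AE u in ?V. h u = 0"
  proof (rule V_orthogonal_AE[OF T hi])
    show "L2_norm ?V w + C \<ge> 0" using C by simp
    fix t assume t: "0 < t" "t \<le> T"
    then have xK: "x_fun H t \<in> K_space H T" using x_fun_x_span[of t T] x_span_K_space by auto
    have xL: "x_fun H t \<in> L2_space ?V" and xn: "L2_norm ?V (x_fun H t) = t powr H" using x_fun_L2[of t T] t by auto
    have [measurable]: "x_fun H t \<in> borel_measurable ?V" by (rule L2_space_measurable[OF xL])
    have "(\<integral>\<^sup>+u. ennreal (cmod (h u) * cmod (x_fun H t u)) \<partial>?V) \<le> (\<integral>\<^sup>+u. ennreal (cmod (w u) * cmod (x_fun H t u)) + ennreal (cmod (k u) * cmod (x_fun H t u)) \<partial>?V)"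
    proof (rule nn_integral_mono)
      fix u
      have "cmod (h u) \<le> cmod (w u) + cmod (k u)" unfolding h_def using norm_triangle_ineq4[of "cnj (w u)" "k u"] by simp
      then have "cmod (h u) * cmod (x_fun H t u) \<le> (cmod (w u) + cmod (k u)) * cmod (x_fun H t u)" by (rule mult_right_mono) simp
      then show "ennreal (cmod (h u) * cmod (x_fun H t u)) \<le> ennreal (cmod (w u) * cmod (x_fun H t u)) + ennreal (cmod (k u) * cmod (x_fun H t u))"
        by (simp add: ennreal_leI distrib_right flip: ennreal_plus)
    qed
    also have "\<dots> = (\<integral>\<^sup>+u. ennreal (cmod (w u) * cmod (x_fun H t u)) \<partial>?V) + (\<integral>\<^sup>+u. ennreal (cmod (k u) * cmod (x_fun H t u)) \<partial>?V)"
      by (rule nn_integral_add) measurable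
    also have "\<dots> \<le> ennreal (L2_norm ?V w * t powr H) + ennreal (C * t powr H)"
    proof (rule add_mono)
      show "(\<integral>\<^sup>+u. ennreal (cmod (w u) * cmod (x_fun H t u)) \<partial>?V) \<le> ennreal (L2_norm ?V w * t powr H)"
        using L2_Cauchy_Schwarz[OF wL xL] L2_mult_integrable[OF wL xL] xn
        by (subst nn_integral_eq_integral) (auto intro: ennreal_leI)
      show "(\<integral>\<^sup>+u. ennreal (cmod (k u) * cmod (x_fun H t u)) \<partial>?V) \<le> ennreal (C * t powr H)"
        using kb[OF xL] xn by simp
    qed
    also have "\<dots> = ennreal ((L2_norm ?V w + C) * t powr H)"
      using C by (simp add: distrib_right)
    finally show "(\<integral>\<^sup>+u. ennreal (cmod (h u) * cmod (x_fun H t u)) \<partial>?V) \<le> ennreal ((L2_norm ?V w + C) * t powr H)" .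
    have kx: "integrable ?V (\<lambda>u. x_fun H t u * k u)"
    proof (rule integrableI_bounded)
      show "(\<integral>\<^sup>+u. ennreal (norm (x_fun H t u * k u)) \<partial>?V) < \<infinity>"
        using kb[OF xL] by (simp add: norm_mult mult.commute le_less_trans)
    qed measurable
    have "(\<integral>u. h u * x_fun H t u \<partial>?V) = (\<integral>u. x_fun H t u * cnj (w u) - x_fun H t u * k u \<partial>?V)"
      by (simp add: h_def algebra_simps)
    also have "\<dots> = (\<integral>u. x_fun H t u * cnj (w u) \<partial>?V) - (\<integral>u. x_fun H t u * k u \<partial>?V)"
      by (rule Bochner_Integration.integral_diff[OF L2_inner_integrable[OF xL wL] kx])
    also have "\<dots> = 0" using fub[OF xL] adj[OF xK] by (simp add: L2_inner_def)
    finally show "(\<integral>u. h u * x_fun H t u \<partial>?V) = 0" .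
  qed
  with AEint show ?thesis
  proof eventually_elim
    case (elim u)
    have c: "(\<lambda>l. \<psi> l * cnj (phi H (u * l))) = (\<lambda>l. cnj (phi H (u * l) * cnj (\<psi> l)))" by (simp add: mult.commute)
    have "integrable ?\<mu> (\<lambda>l. cnj (phi H (u * l) * cnj (\<psi> l)))" using elim(1) by (rule integrable_cnj)
    moreover have "w u = (\<integral>l. cnj (phi H (u * l) * cnj (\<psi> l)) \<partial>?\<mu>)"
    proof -
      have "(\<integral>l. cnj (phi H (u * l) * cnj (\<psi> l)) \<partial>?\<mu>) = cnj (k u)"
        unfolding k_def by (rule Bochner_Integration.integral_cnj)
      moreover have "cnj (w u) = k u" using elim(2) by (simp add: h_def)
      ultimately show ?thesis by (metis complex_cnj_cnj)
    qed
    ultimately show ?case unfolding c by simp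
  qed
qed

end

text \<open>\<open>U\<close> is determined only up to null sets, so the claims are made for every
  \<open>U\<close> with \<open>is_U\<close>; existence is asserted separately to keep them from
  being vacuous. Likewise the inversion formula is claimed for every \<open>W\<close> that is an
  adjoint or an inverse, and one \<open>W\<close> that is both is shown to exist. The integrability
  clauses ensure that the integrals are genuine.\<close>

theorem theorem3p2:
  fixes H T :: real
  assumes "0 < H" and "H < 1" and "0 < T"
  shows
    "(\<exists>U. is_U H T U) \<and>
     (\<forall>U U'. is_U H T U \<longrightarrow> is_U H T U' \<longrightarrow>
        (\<forall>f\<in>K_space H T. AE l in spectral_measure H. U f l = U' f l)) \<and>
     L2_closure (spectral_measure H) (L'_space H T) = L_space H T \<and>
     (\<forall>U. is_U H T U \<longrightarrow>
        L2_isometry_onto (V_measure H T) (K_space H T) (spectral_measure H) (L_space H T) U \<and>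
        (\<forall>f\<in>K_space H T. AE l in spectral_measure H.
           integrable (V_measure H T) (\<lambda>u. f u * phi H (u * l)) \<and>
           U f l = (\<integral>u. f u * phi H (u * l) \<partial>V_measure H T)) \<and>
        (\<exists>W. L2_adjoint (V_measure H T) (K_space H T) (spectral_measure H) (L_space H T) U W \<and>
             L2_inverse (V_measure H T) (K_space H T) (spectral_measure H) (L_space H T) U W) \<and>
        (\<forall>W. L2_adjoint (V_measure H T) (K_space H T) (spectral_measure H) (L_space H T) U W \<or>
             L2_inverse (V_measure H T) (K_space H T) (spectral_measure H) (L_space H T) U W \<longrightarrow>
           (\<forall>\<psi>\<in>L'_space H T. AE u in V_measure H T.
              integrable (spectral_measure H) (\<lambda>l. \<psi> l * cnj (phi H (u * l))) \<and>
              W \<psi> u = (\<integral>l. \<psi> l * cnj (phi H (u * l)) \<partial>spectral_measure H))))"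
proof -
  interpret hurst H "H - 1/2" by unfold_locales (use assms in auto)
  let ?V = "V_measure H T" and ?\<mu> = "spectral_measure H" and ?K = "K_space H T" and ?L = "L_space H T"
  note T = assms(3)
  have KL: "f \<in> L2_space ?V" if "f \<in> ?K" for f using that K_space_L2 by blast
  have LL: "f \<in> L2_space ?\<mu>" if "f \<in> ?L" for f using that L_space_L2 by blast
  have PL: "Phi T f \<in> ?L" if "f \<in> ?K" for f by (rule Phi_K_space(1)[OF T that])
  have main: "L2_isometry_onto ?V ?K ?\<mu> ?L U \<and>
        (\<forall>f\<in>?K. AE l in ?\<mu>. integrable ?V (\<lambda>u. f u * phi H (u * l)) \<and> U f l = (\<integral>u. f u * phi H (u * l) \<partial>?V)) \<and>
        (\<exists>W. L2_adjoint ?V ?K ?\<mu> ?L U W \<and> L2_inverse ?V ?K ?\<mu> ?L U W) \<and>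
        (\<forall>W. L2_adjoint ?V ?K ?\<mu> ?L U W \<or> L2_inverse ?V ?K ?\<mu> ?L U W \<longrightarrow>
           (\<forall>\<psi>\<in>L'_space H T. AE u in ?V.
              integrable ?\<mu> (\<lambda>l. \<psi> l * cnj (phi H (u * l))) \<and>
              W \<psi> u = (\<integral>l. \<psi> l * cnj (phi H (u * l)) \<partial>?\<mu>)))" if U: "is_U H T U" for U
  proof -
    have bl: "L2_bounded_linear ?V ?K ?\<mu> ?L U" using U by (simp add: is_U_def)
    have UL: "U f \<in> ?L" if "f \<in> ?K" for f using bl that by (auto simp: L2_bounded_linear_def)
    have UP: "AE l in ?\<mu>. U f l = Phi T f l" if "f \<in> ?K" for f by (rule is_U_eq_Phi[OF T U that])
    have Um: "U f \<in> borel_measurable ?\<mu>" "Phi T f \<in> borel_measurable ?\<mu>" if "f \<in> ?K" for f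
      using UL[OF that] PL[OF that] LL L2_space_measurable by blast+
    have inner: "L2_inner ?\<mu> (U f) (U g) = L2_inner ?V f g" if "f \<in> ?K" "g \<in> ?K" for f g
      using L2_inner_cong_AE[OF Um(1,2)[OF that(1)] Um(1,2)[OF that(2)] UP[OF that(1)] UP[OF that(2)]]
        Phi_K_space_inner[OF T that] by simp
    have onto: "\<exists>f\<in>?K. AE y in ?\<mu>. U f y = \<psi> y" if "\<psi> \<in> ?L" for \<psi>
    proof -
      obtain f where f: "f \<in> ?K" "AE l in ?\<mu>. Phi T f l = \<psi> l" by (rule Phi_onto[OF T \<open>\<psi> \<in> ?L\<close>])
      have "AE y in ?\<mu>. U f y = \<psi> y" using UP[OF f(1)] f(2) by eventually_elim simp
      with f(1) show ?thesis by blast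
    qed
    \<comment> \<open>If \<open>U w = psi\<close> almost everywhere, the isometry turns pairing with
      \<open>psi\<close> into pairing with \<open>w\<close>; any choice of preimages therefore acts
      as an adjoint.\<close>
    have inv_adj: "L2_inner ?\<mu> (U f) \<psi> = L2_inner ?V f w" if "f \<in> ?K" "\<psi> \<in> ?L" "w \<in> ?K" "AE y in ?\<mu>. U w y = \<psi> y" for f \<psi> w
    proof -
      have "L2_inner ?\<mu> (U f) \<psi> = L2_inner ?\<mu> (U f) (U w)"
        using that(4) Um(1)[OF that(1)] Um(1)[OF that(3)] L2_space_measurable[OF LL[OF that(2)]]
        by (intro L2_inner_cong_AE) (auto elim: eventually_mono)
      also have "\<dots> = L2_inner ?V f w" by (rule inner[OF that(1,3)])
      finally show ?thesis .
    qed
    have iso: "L2_isometry_onto ?V ?K ?\<mu> ?L U"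
      unfolding L2_isometry_onto_def using bl inner onto by blast
    have formula: "\<forall>f\<in>?K. AE l in ?\<mu>. integrable ?V (\<lambda>u. f u * phi H (u * l)) \<and> U f l = (\<integral>u. f u * phi H (u * l) \<partial>?V)"
    proof
      fix f assume f: "f \<in> ?K"
      show "AE l in ?\<mu>. integrable ?V (\<lambda>u. f u * phi H (u * l)) \<and> U f l = (\<integral>u. f u * phi H (u * l) \<partial>?V)"
        using UP[OF f] by eventually_elim (simp add: Phi_integrable[OF T KL[OF f]] Phi_def)
    qed
    have "\<forall>\<psi>\<in>?L. \<exists>f. f \<in> ?K \<and> (AE y in ?\<mu>. U f y = \<psi> y)" using onto by blast
    then obtain W where W: "\<And>\<psi>. \<psi> \<in> ?L \<Longrightarrow> W \<psi> \<in> ?K" "\<And>\<psi>. \<psi> \<in> ?L \<Longrightarrow> AE y in ?\<mu>. U (W \<psi>) y = \<psi> y"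
      by metis
    have "L2_adjoint ?V ?K ?\<mu> ?L U W"
      unfolding L2_adjoint_def using W inv_adj by blast
    moreover have "L2_inverse ?V ?K ?\<mu> ?L U W"
      unfolding L2_inverse_def
    proof (intro conjI ballI)
      fix f assume f: "f \<in> ?K"
      let ?w = "W (U f)"
      have w: "?w \<in> ?K" by (rule W(1)[OF UL[OF f]])
      have d: "(\<lambda>x. ?w x - f x) \<in> ?K" by (rule lin_closed_diff[OF lin_closed_K_space w f])
      \<comment> \<open>Injectivity: the transform of the difference vanishes almost everywhere, and
        \<open>Phi\<close> preserves norms.\<close>
      have "AE l in ?\<mu>. Phi T (\<lambda>x. ?w x - f x) l = 0"
        using UP[OF f] UP[OF w] W(2)[OF UL[OF f]]
        by eventually_elim (simp add: Phi_diff[OF T KL[OF w] KL[OF f]])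
      then have "L2_norm ?\<mu> (Phi T (\<lambda>x. ?w x - f x)) = L2_norm ?\<mu> (\<lambda>_. 0)"
        using L2_space_measurable[OF LL[OF PL[OF d]]] by (intro L2_norm_cong_AE) auto
      then have "L2_norm ?V (\<lambda>x. ?w x - f x) = 0" using Phi_K_space(2)[OF T d] by simp
      from L2_norm_eq_0D[OF KL[OF d] this] show "AE x in ?V. ?w x = f x" by simp
    qed (use W in auto)
    ultimately have ex: "\<exists>W. L2_adjoint ?V ?K ?\<mu> ?L U W \<and> L2_inverse ?V ?K ?\<mu> ?L U W" by blast
    have adj: "\<forall>\<psi>\<in>L'_space H T. AE u in ?V. integrable ?\<mu> (\<lambda>l. \<psi> l * cnj (phi H (u * l))) \<and>
        W \<psi> u = (\<integral>l. \<psi> l * cnj (phi H (u * l)) \<partial>?\<mu>)"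
      if W: "L2_adjoint ?V ?K ?\<mu> ?L U W \<or> L2_inverse ?V ?K ?\<mu> ?L U W" for W
    proof
      fix \<psi> assume \<psi>: "\<psi> \<in> L'_space H T"
      then have \<psi>L: "\<psi> \<in> ?L" using L'_space_subset by blast
      have w: "W \<psi> \<in> ?K" using W \<psi>L by (auto simp: L2_adjoint_def L2_inverse_def)
      have Uadj: "L2_inner ?\<mu> (U f) \<psi> = L2_inner ?V f (W \<psi>)" if f: "f \<in> ?K" for f
        using W
      proof
        assume "L2_adjoint ?V ?K ?\<mu> ?L U W"
        then show ?thesis using f \<psi>L by (auto simp: L2_adjoint_def)
      next
        assume "L2_inverse ?V ?K ?\<mu> ?L U W"
        then have "AE y in ?\<mu>. U (W \<psi>) y = \<psi> y" using \<psi>L by (auto simp: L2_inverse_def)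
        then show ?thesis by (rule inv_adj[OF f \<psi>L w])
      qed
      have "L2_inner ?\<mu> (Phi T f) \<psi> = L2_inner ?V f (W \<psi>)" if f: "f \<in> ?K" for f
      proof -
        have "L2_inner ?\<mu> (Phi T f) \<psi> = L2_inner ?\<mu> (U f) \<psi>"
          using UP[OF f] Um[OF f] L2_space_measurable[OF LL[OF \<psi>L]]
          by (intro L2_inner_cong_AE) (auto elim: eventually_mono)
        then show ?thesis using Uadj[OF f] by simp
      qed
      from adjoint_formula[OF T \<psi> w this]
      show "AE u in ?V. integrable ?\<mu> (\<lambda>l. \<psi> l * cnj (phi H (u * l))) \<and> W \<psi> u = (\<integral>l. \<psi> l * cnj (phi H (u * l)) \<partial>?\<mu>)" .
    qed
    show ?thesis using iso formula ex adj by blast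
  qed
  have uniq: "AE l in ?\<mu>. U f l = U' f l" if "is_U H T U" "is_U H T U'" "f \<in> ?K" for U U' f
    using is_U_eq_Phi[OF T that(1,3)] is_U_eq_Phi[OF T that(2,3)] by eventually_elim simp
  show ?thesis
    using is_U_Phi[OF T] uniq L'_space_dense[OF T] main by blast
qed

end
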